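(* Let $(M,g)$ be a connected Riemannian manifold of dimension $n\ge3$ with $g\in C^0(M)$, and suppose that $M$ has a weakly asymptotically flat end $\widetilde M$. Let $E$ be a real vector bundle with inner product over $M$ and suppose that the connection $\nabla_i=\partial_i-\Gamma_i$ on $E$ satisfies $\Gamma\in L^{n}_{\rm loc}(M)$ and the decay conditions $$\|r^{-1}\Gamma^S\|_{L^{n/2}(\widetilde M)}+\|\Gamma^S\|_{L^n(\widetilde M)}<\infty ,$$ where $\Gamma^S$ is the symmetric, inner product incompatible, part of $\nabla$. Then $M$ admits a weighted Poincar\'e inequality: there is a function $w\in L^1_{\rm loc}(M)$, with $\mathrm{ess\,inf}_\Omega w>0$ for every relatively compact $\Omega\subset M$, such that $$\int_M|u|^2\,w\,dv_M\le\int_M|\nabla u|^2\,dv_M\qquad\text{for all }u\in C^1_c(M).$$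
   Context: A weakly asymptotically flat end $\widetilde M\subset M$ is a connected component of $M\setminus\mathcal{C}$ for some compact set $\mathcal{C}$, such that $\widetilde M\simeq\mathbb{R}^n\setminus B(0,1)$ and there is $\eta>0$ with $\eta\,\delta_{ij}\xi^i\xi^j\le g_{ij}(x)\xi^i\xi^j\le\eta^{-1}\delta_{ij}\xi^i\xi^j$ for all $x\in\mathbb{R}^n\setminus B(0,1)$ and $\xi\in\mathbb{R}^n$. On $\widetilde M$, $r=(\sum_i(x^i)^2)^{1/2}$. The connection $\nabla$ need not be compatible with the inner product $\langle\cdot,\cdot\rangle$ on $E$; its symmetric part $\Gamma^S$ is the tensor (one-form with values in symmetric endomorphisms of $E$) defined by $\langle\phi,\Gamma^S(X)\psi\rangle=\frac12\big(X\langle\phi,\psi\rangle-\langle\phi,\nabla_X\psi\rangle-\langle\nabla_X\phi,\psi\rangle\big)$; equivalently $\Gamma^S=\frac12(\Gamma+{}^t\Gamma)$ in orthonormal frames. $M$ may have a compact boundary; $C^1_c(M)$ denotes compactly supported $C^1$ sections of $E$. $|\nabla u|^2$ and $dv_M$ are taken with respect to $g$ and the inner product of $E$. *)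

theory Defs
  imports "HOL-Analysis.Analysis"
begin

section \<open>Smooth manifolds with boundary\<close>

text \<open>
  Classes of differentiability on a set \<open>S\<close>. They are only used for \<open>S\<close> relatively open in a
  Euclidean space or in a closed half-space. There the derivative within \<open>S\<close> is unique, so that
  this is the usual notion, one-sided at boundary points.
\<close>

fun Ck_on :: "nat \<Rightarrow> ('x::euclidean_space \<Rightarrow> 'y::real_normed_vector) \<Rightarrow> 'x set \<Rightarrow> bool" where
  "Ck_on 0 f S \<longleftrightarrow> continuous_on S f"
| "Ck_on (Suc k) f S \<longleftrightarrow>
     (\<exists>f'. (\<forall>x\<in>S. (f has_derivative f' x) (at x within S)) \<and> (\<forall>v. Ck_on k (\<lambda>x. f' x v) S))"

text \<open>
  A chart is a pair of an open domain and a coordinate map, whose values outside the domain are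
  irrelevant. The manifold is the whole type \<open>'a\<close>.
\<close>

type_synonym ('a, 'n) chart = "'a set \<times> ('a \<Rightarrow> real^'n)"

definition chart_inv :: "('a, 'n) chart \<Rightarrow> real^'n \<Rightarrow> 'a" where
  "chart_inv c = inv_into (fst c) (snd c)"

text \<open>For \<open>v = 0\<close> the half-space below is all of \<open>real^'n\<close>: this gives the interior charts.\<close>

definition is_chart :: "('a::topological_space, 'n::finite) chart \<Rightarrow> bool" where
  "is_chart c \<longleftrightarrow> open (fst c) \<and>
     (\<exists>v. openin (top_of_set {x. 0 \<le> v \<bullet> x}) (snd c ` fst c)) \<and>
     homeomorphism (fst c) (snd c ` fst c) (snd c) (chart_inv c)"

definition Ck_in_chart ::
  "nat \<Rightarrow> ('a, 'n::finite) chart \<Rightarrow> 'a set \<Rightarrow> ('a \<Rightarrow> 'y::real_normed_vector) \<Rightarrow> bool" where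
  "Ck_in_chart k c W f \<longleftrightarrow> Ck_on k (\<lambda>x. f (chart_inv c x)) (snd c ` W)"

definition smooth_in_chart ::
  "('a, 'n::finite) chart \<Rightarrow> 'a set \<Rightarrow> ('a \<Rightarrow> 'y::real_normed_vector) \<Rightarrow> bool" where
  "smooth_in_chart c W f \<longleftrightarrow> (\<forall>k. Ck_in_chart k c W f)"

text \<open>
  The derivative of \<open>f\<close> at \<open>p\<close> along the tangent vector with components \<open>X\<close> in the chart \<open>c\<close>.
  It only depends on \<open>f\<close> near \<open>p\<close>. The tangent vector has components
  \<open>chart_deriv c (snd d) p X\<close> in another chart \<open>d\<close>.
\<close>

definition chart_deriv ::
  "('a, 'n::finite) chart \<Rightarrow> ('a \<Rightarrow> 'y::real_normed_vector) \<Rightarrow> 'a \<Rightarrow> real^'n \<Rightarrow> 'y" where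
  "chart_deriv c f p X =
     frechet_derivative (\<lambda>x. f (chart_inv c x)) (at (snd c p) within snd c ` fst c) X"

definition compatible_charts :: "('a, 'n::finite) chart \<Rightarrow> ('a, 'n) chart \<Rightarrow> bool" where
  "compatible_charts c d \<longleftrightarrow>
     smooth_in_chart c (fst c \<inter> fst d) (snd d) \<and> smooth_in_chart d (fst c \<inter> fst d) (snd c)"

text \<open>A smooth structure is given by its maximal atlas.\<close>

definition smooth_structure :: "('a::topological_space, 'n::finite) chart set \<Rightarrow> bool" where
  "smooth_structure A \<longleftrightarrow>
     (\<forall>c\<in>A. is_chart c) \<and> (\<Union>c\<in>A. fst c) = UNIV \<and>
     (\<forall>c\<in>A. \<forall>d\<in>A. compatible_charts c d) \<and>
     (\<forall>c. is_chart c \<and> (\<forall>d\<in>A. compatible_charts c d) \<longrightarrow> c \<in> A)"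

definition manifold_boundary :: "('a::topological_space, 'n::finite) chart set \<Rightarrow> 'a set" where
  "manifold_boundary A = {p. \<exists>c\<in>A. p \<in> fst c \<and> snd c p \<notin> interior (snd c ` fst c)}"


section \<open>Continuous Riemannian metrics\<close>

text \<open>\<open>g c p\<close> is the matrix \<open>g\<^sub>i\<^sub>j(p)\<close> of the metric in the chart \<open>c\<close>.\<close>

definition C0_riemannian_metric ::
  "('a::topological_space, 'n::finite) chart set \<Rightarrow> (('a, 'n) chart \<Rightarrow> 'a \<Rightarrow> real^'n^'n) \<Rightarrow> bool" where
  "C0_riemannian_metric A g \<longleftrightarrow>
     (\<forall>c\<in>A. continuous_on (fst c) (g c) \<and>
        (\<forall>p\<in>fst c. transpose (g c p) = g c p \<and> (\<forall>X. X \<noteq> 0 \<longrightarrow> 0 < X \<bullet> (g c p *v X)))) \<and>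
     (\<forall>c\<in>A. \<forall>d\<in>A. \<forall>p\<in>fst c \<inter> fst d. \<forall>X Y.
        X \<bullet> (g c p *v Y) =
        chart_deriv c (snd d) p X \<bullet> (g d p *v chart_deriv c (snd d) p Y))"

text \<open>
  The Riemannian measure is the unique Borel measure with density \<open>sqrt (det g)\<close> in every chart.
\<close>

definition riemannian_measure ::
  "('a::topological_space, 'n::finite) chart set \<Rightarrow> (('a, 'n) chart \<Rightarrow> 'a \<Rightarrow> real^'n^'n) \<Rightarrow>
   'a measure \<Rightarrow> bool" where
  "riemannian_measure A g vol \<longleftrightarrow> sets vol = sets borel \<and>
     (\<forall>c\<in>A. \<forall>S\<in>sets borel. S \<subseteq> fst c \<longrightarrow>
        emeasure vol S =
        (\<integral>\<^sup>+x\<in>snd c ` S. ennreal (sqrt (det (g c (chart_inv c x)))) \<partial>lborel))"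

text \<open>
  A component of the complement of a compact set is open in the manifold, so the ball removed
  from Euclidean space is the closed one. The end is a coordinate chart \<open>e\<close>, that is, its
  identification with the exterior of the ball is a diffeomorphism.
\<close>

definition weakly_af_end ::
  "('a::topological_space, 'n::finite) chart set \<Rightarrow> (('a, 'n) chart \<Rightarrow> 'a \<Rightarrow> real^'n^'n) \<Rightarrow>
   ('a, 'n) chart \<Rightarrow> bool" where
  "weakly_af_end A g e \<longleftrightarrow> e \<in> A \<and>
     (\<exists>C. compact C \<and> fst e \<in> components (- C)) \<and>
     snd e ` fst e = - cball 0 1 \<and>
     (\<exists>\<eta>>0. \<forall>p\<in>fst e. \<forall>\<xi>.
        \<eta> * (\<xi> \<bullet> \<xi>) \<le> \<xi> \<bullet> (g e p *v \<xi>) \<and> \<xi> \<bullet> (g e p *v \<xi>) \<le> inverse \<eta> * (\<xi> \<bullet> \<xi>))"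

definition end_radius :: "('a, 'n::finite) chart \<Rightarrow> 'a \<Rightarrow> real" where
  "end_radius e p = norm (snd e p)"


section \<open>Vector bundles with inner product\<close>

text \<open>
  The fibre over \<open>p\<close> is a subspace \<open>E p\<close> of a real vector space \<open>'e\<close>. The latter only serves
  to carry the fibres and has no topology: the bundle structure is given by local trivializations
  \<open>t\<close>, where \<open>snd t p\<close> maps \<open>real^'k\<close> isomorphically onto \<open>E p\<close> for \<open>p \<in> fst t\<close>.
\<close>

type_synonym ('a, 'k, 'e) triv = "'a set \<times> ('a \<Rightarrow> real^'k \<Rightarrow> 'e)"

text \<open>The components of a section in a local trivialization.\<close>

definition components_in ::
  "('a, 'k::finite, 'e) triv \<Rightarrow> ('a \<Rightarrow> 'e) \<Rightarrow> 'a \<Rightarrow> real^'k" where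
  "components_in t u p = inv (snd t p) (u p)"

definition frame_section :: "('a, 'k::finite, 'e) triv \<Rightarrow> real^'k \<Rightarrow> 'a \<Rightarrow> 'e" where
  "frame_section t v p = snd t p v"

definition vector_bundle ::
  "('a::topological_space, 'n::finite) chart set \<Rightarrow> ('a, 'k::finite, 'e::real_vector) triv set \<Rightarrow>
   ('a \<Rightarrow> 'e set) \<Rightarrow> bool" where
  "vector_bundle A T E \<longleftrightarrow>
     (\<forall>p. subspace (E p)) \<and> (\<Union>t\<in>T. fst t) = UNIV \<and>
     (\<forall>t\<in>T. open (fst t) \<and> (\<forall>p\<in>fst t. linear (snd t p) \<and> bij_betw (snd t p) UNIV (E p))) \<and>
     (\<forall>c\<in>A. \<forall>s\<in>T. \<forall>t\<in>T. \<forall>v.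
        smooth_in_chart c (fst c \<inter> fst s \<inter> fst t) (components_in t (frame_section s v)))"

definition C1_section ::
  "('a::topological_space, 'n::finite) chart set \<Rightarrow> ('a, 'k::finite, 'e::real_vector) triv set \<Rightarrow>
   ('a \<Rightarrow> 'e set) \<Rightarrow> ('a \<Rightarrow> 'e) \<Rightarrow> bool" where
  "C1_section A T E u \<longleftrightarrow> (\<forall>p. u p \<in> E p) \<and>
     (\<forall>c\<in>A. \<forall>t\<in>T. Ck_in_chart 1 c (fst c \<inter> fst t) (components_in t u))"

definition C1c_section ::
  "('a::topological_space, 'n::finite) chart set \<Rightarrow> ('a, 'k::finite, 'e::real_vector) triv set \<Rightarrow>
   ('a \<Rightarrow> 'e set) \<Rightarrow> ('a \<Rightarrow> 'e) \<Rightarrow> bool" where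
  "C1c_section A T E u \<longleftrightarrow> C1_section A T E u \<and> compact (closure {p. u p \<noteq> 0})"

definition bundle_inner_product ::
  "('a::topological_space, 'n::finite) chart set \<Rightarrow> ('a, 'k::finite, 'e::real_vector) triv set \<Rightarrow>
   ('a \<Rightarrow> 'e set) \<Rightarrow> ('a \<Rightarrow> 'e \<Rightarrow> 'e \<Rightarrow> real) \<Rightarrow> bool" where
  "bundle_inner_product A T E ip \<longleftrightarrow>
     (\<forall>p. \<forall>x\<in>E p. \<forall>y\<in>E p. \<forall>z\<in>E p. \<forall>a.
        ip p x y = ip p y x \<and>
        ip p (x + y) z = ip p x z + ip p y z \<and>
        ip p (a *\<^sub>R x) y = a * ip p x y \<and>
        (x \<noteq> 0 \<longrightarrow> 0 < ip p x x)) \<and>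
     (\<forall>c\<in>A. \<forall>t\<in>T. \<forall>v w.
        smooth_in_chart c (fst c \<inter> fst t)
          (\<lambda>p. ip p (frame_section t v p) (frame_section t w p)))"


section \<open>Connections\<close>

text \<open>
  \<open>\<Gamma> c t p $ i\<close> is the matrix of \<open>\<Gamma>\<^sub>i\<close> at \<open>p\<close> with respect to the chart \<open>c\<close> and the
  trivialization \<open>t\<close>.
\<close>

type_synonym ('a, 'n, 'k, 'e) conn =
  "('a, 'n) chart \<Rightarrow> ('a, 'k, 'e) triv \<Rightarrow> 'a \<Rightarrow> real^'k^'k^'n"

text \<open>
  The derivative \<open>\<nabla>\<^sub>X u\<close> at \<open>p\<close>, computed in \<open>c\<close> and \<open>t\<close> by \<open>\<nabla>\<^sub>i = \<partial>\<^sub>i - \<Gamma>\<^sub>i\<close>, for the tangent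
  vector with components \<open>X\<close> in \<open>c\<close>.
\<close>

definition nabla_in ::
  "('a, 'n::finite, 'k::finite, 'e) conn \<Rightarrow> ('a, 'n) chart \<Rightarrow> ('a, 'k, 'e) triv \<Rightarrow>
   ('a \<Rightarrow> 'e) \<Rightarrow> 'a \<Rightarrow> real^'n \<Rightarrow> 'e" where
  "nabla_in \<Gamma> c t u p X =
     snd t p (chart_deriv c (components_in t u) p X
              - (\<Sum>i\<in>UNIV. X $ i *\<^sub>R (\<Gamma> c t p $ i *v components_in t u p)))"

text \<open>
  The local coefficients define one connection if \<open>\<nabla>\<close> computed in any two pairs of a chart and a
  trivialization agrees on the frame sections, hence by the Leibniz rule on all sections. This is
  the transformation law \<open>\<Gamma>' = S\<^sup>-\<^sup>1 \<Gamma> S - S\<^sup>-\<^sup>1 dS\<close>. The coefficients are only locally integrable;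
  a representative is used for which the law holds at every point.
\<close>

definition bundle_connection ::
  "('a, 'n::finite) chart set \<Rightarrow> ('a, 'k::finite, 'e) triv set \<Rightarrow> ('a, 'n, 'k, 'e) conn \<Rightarrow> bool" where
  "bundle_connection A T \<Gamma> \<longleftrightarrow>
     (\<forall>c\<in>A. \<forall>d\<in>A. \<forall>s\<in>T. \<forall>t\<in>T. \<forall>p\<in>fst c \<inter> fst d \<inter> fst s \<inter> fst t. \<forall>v X.
        nabla_in \<Gamma> c s (frame_section s v) p X =
        nabla_in \<Gamma> d t (frame_section s v) p (chart_deriv c (snd d) p X))"

text \<open>
  The tensor \<open>\<Gamma>\<^sup>S\<close> is defined by
  \<open>\<langle>\<phi>, \<Gamma>\<^sup>S(X) \<psi>\<rangle> = (X\<langle>\<phi>, \<psi>\<rangle> - \<langle>\<phi>, \<nabla>\<^sub>X \<psi>\<rangle> - \<langle>\<nabla>\<^sub>X \<phi>, \<psi>\<rangle>) / 2\<close>. Here the right hand side is taken on frame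
  sections, and \<open>Gamma_sym\<close> is the matrix of the endomorphism in the trivialization.
\<close>

definition Gamma_sym_form ::
  "('a \<Rightarrow> 'e \<Rightarrow> 'e \<Rightarrow> real) \<Rightarrow> ('a, 'n::finite, 'k::finite, 'e) conn \<Rightarrow> ('a, 'n) chart \<Rightarrow>
   ('a, 'k, 'e) triv \<Rightarrow> 'a \<Rightarrow> real^'n \<Rightarrow> real^'k \<Rightarrow> real^'k \<Rightarrow> real" where
  "Gamma_sym_form ip \<Gamma> c t p X v w =
     (let \<phi> = frame_section t v; \<psi> = frame_section t w in
      (chart_deriv c (\<lambda>q. ip q (\<phi> q) (\<psi> q)) p X
       - ip p (\<phi> p) (nabla_in \<Gamma> c t \<psi> p X)
       - ip p (nabla_in \<Gamma> c t \<phi> p X) (\<psi> p)) / 2)"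

definition gram_matrix ::
  "('a \<Rightarrow> 'e \<Rightarrow> 'e \<Rightarrow> real) \<Rightarrow> ('a, 'k::finite, 'e) triv \<Rightarrow> 'a \<Rightarrow> real^'k^'k" where
  "gram_matrix ip t p = (\<chi> a b. ip p (snd t p (axis a 1)) (snd t p (axis b 1)))"

definition Gamma_sym ::
  "('a \<Rightarrow> 'e \<Rightarrow> 'e \<Rightarrow> real) \<Rightarrow> ('a, 'n::finite, 'k::finite, 'e) conn \<Rightarrow> ('a, 'n) chart \<Rightarrow>
   ('a, 'k, 'e) triv \<Rightarrow> 'a \<Rightarrow> real^'n \<Rightarrow> real^'k^'k" where
  "Gamma_sym ip \<Gamma> c t p X =
     matrix_inv (gram_matrix ip t p) **
     (\<chi> a b. Gamma_sym_form ip \<Gamma> c t p X (axis a 1) (axis b 1))"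

text \<open>
  The pointwise norms do not depend on the chart and the trivialization, so these can be chosen
  separately at each point. The endomorphisms \<open>\<Gamma>\<^sup>S(X)\<close> are symmetric, so \<open>trace (S ** S')\<close> is their
  Hilbert-Schmidt product and the norm below is
  \<open>(g\<^sup>i\<^sup>j \<langle>\<Gamma>\<^sup>S\<^sub>i, \<Gamma>\<^sup>S\<^sub>j\<rangle>)\<^sup>1\<^sup>/\<^sup>2\<close>.
\<close>

definition chart_at :: "('a, 'n) chart set \<Rightarrow> 'a \<Rightarrow> ('a, 'n) chart" where
  "chart_at A p = (SOME c. c \<in> A \<and> p \<in> fst c)"

definition triv_at :: "('a, 'k, 'e) triv set \<Rightarrow> 'a \<Rightarrow> ('a, 'k, 'e) triv" where
  "triv_at T p = (SOME t. t \<in> T \<and> p \<in> fst t)"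

definition Gamma_sym_norm ::
  "('a, 'n::finite) chart set \<Rightarrow> (('a, 'n) chart \<Rightarrow> 'a \<Rightarrow> real^'n^'n) \<Rightarrow>
   ('a, 'k::finite, 'e) triv set \<Rightarrow> ('a \<Rightarrow> 'e \<Rightarrow> 'e \<Rightarrow> real) \<Rightarrow> ('a, 'n, 'k, 'e) conn \<Rightarrow>
   'a \<Rightarrow> real" where
  "Gamma_sym_norm A g T ip \<Gamma> p =
     (let c = chart_at A p; t = triv_at T p in
      sqrt (\<Sum>i\<in>UNIV. \<Sum>j\<in>UNIV. matrix_inv (g c p) $ i $ j *
        trace (Gamma_sym ip \<Gamma> c t p (axis i 1) ** Gamma_sym ip \<Gamma> c t p (axis j 1))))"

definition nabla_norm_sq ::
  "('a, 'n::finite) chart set \<Rightarrow> (('a, 'n) chart \<Rightarrow> 'a \<Rightarrow> real^'n^'n) \<Rightarrow>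
   ('a, 'k::finite, 'e) triv set \<Rightarrow> ('a \<Rightarrow> 'e \<Rightarrow> 'e \<Rightarrow> real) \<Rightarrow> ('a, 'n, 'k, 'e) conn \<Rightarrow>
   ('a \<Rightarrow> 'e) \<Rightarrow> 'a \<Rightarrow> real" where
  "nabla_norm_sq A g T ip \<Gamma> u p =
     (let c = chart_at A p; t = triv_at T p in
      \<Sum>i\<in>UNIV. \<Sum>j\<in>UNIV. matrix_inv (g c p) $ i $ j *
        ip p (nabla_in \<Gamma> c t u p (axis i 1)) (nabla_in \<Gamma> c t u p (axis j 1)))"


section \<open>Integrability\<close>

text \<open>\<open>f \<in> L\<^sup>q(S)\<close>, that is, the \<open>L\<^sup>q\<close> norm of \<open>f\<close> over \<open>S\<close> is finite.\<close>

definition in_Lp ::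
  "real \<Rightarrow> 'a measure \<Rightarrow> 'a set \<Rightarrow> ('a \<Rightarrow> 'y::{real_normed_vector, second_countable_topology}) \<Rightarrow> bool"
  where
  "in_Lp q \<mu> S f \<longleftrightarrow> f \<in> borel_measurable (restrict_space \<mu> S) \<and>
     (\<integral>\<^sup>+x\<in>S. ennreal (norm (f x) powr q) \<partial>\<mu>) < \<infinity>"

definition in_L1_loc :: "'a::topological_space measure \<Rightarrow> ('a \<Rightarrow> real) \<Rightarrow> bool" where
  "in_L1_loc \<mu> w \<longleftrightarrow> w \<in> borel_measurable \<mu> \<and> (\<forall>K. compact K \<longrightarrow> set_integrable \<mu> K w)"

definition connection_in_Lp_loc ::
  "real \<Rightarrow> 'a::topological_space measure \<Rightarrow> ('a, 'n::finite) chart set \<Rightarrow>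
   ('a, 'k::finite, 'e) triv set \<Rightarrow> ('a, 'n, 'k, 'e) conn \<Rightarrow> bool" where
  "connection_in_Lp_loc q \<mu> A T \<Gamma> \<longleftrightarrow>
     (\<forall>c\<in>A. \<forall>t\<in>T. \<forall>K. compact K \<and> K \<subseteq> fst c \<inter> fst t \<longrightarrow> in_Lp q \<mu> K (\<Gamma> c t))"

definition ess_inf :: "'a measure \<Rightarrow> 'a set \<Rightarrow> ('a \<Rightarrow> real) \<Rightarrow> ereal" where
  "ess_inf \<mu> \<Omega> w = Sup {a. AE p in \<mu>. p \<in> \<Omega> \<longrightarrow> a \<le> ereal (w p)}"

definition relatively_compact :: "'a::topological_space set \<Rightarrow> bool" where
  "relatively_compact \<Omega> \<longleftrightarrow> compact (closure \<Omega>)"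

end

theory Submission
  imports Defs "HOL-Analysis.Analysis"
begin

text \<open>
  Let \<open>s = |u|\<^sup>2\<close>. Since \<open>X\<langle>u, u\<rangle> = 2\<langle>u, \<nabla>\<^sub>X u\<rangle> + 2\<langle>u, \<Gamma>\<^sup>S(X) u\<rangle>\<close>, the derivative of \<open>s\<close> is bounded by
  \<open>2 sqrt s (H + \<kappa> sqrt s)\<close>, where \<open>H\<close> is a multiple of \<open>|\<nabla>u|\<close> and \<open>\<kappa>\<close> of \<open>|\<Gamma>\<^sup>S|\<close> (lemma \<open>kato\<close>). This is
  Kato's inequality for \<open>|u|\<close>, written for \<open>|u|\<^sup>2\<close> in order to remain differentiable at the zeros of \<open>u\<close>.
  What has to be shown is a statement about functions \<open>s\<close> of this kind. The term with \<open>\<kappa>\<close> is critical: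
  \<open>\<kappa>\<close> is in \<open>L\<^sup>n\<close>, so by Hoelder's inequality \<open>\<kappa> |u|\<close> is controlled in \<open>L\<^sup>2\<close> by the norm of \<open>u\<close> in
  \<open>L\<^sup>2\<^sup>n\<^sup>/\<^sup>(\<^sup>n\<^sup>-\<^sup>2\<^sup>)\<close>, and the Sobolev inequality absorbs it where \<open>\<kappa>\<close> is small in \<open>L\<^sup>n\<close>. The Sobolev inequality is
  derived from the Gagliardo--Nirenberg inequality along coordinate lines, because this proof adapts to
  domains on which nothing is assumed about \<open>u\<close> at the boundary.

  The argument starts in the end. Outside a large cube \<open>\<kappa>\<close> is small. Half-lines in coordinate directions that
  lead away from the cube do not meet it, and \<open>u\<close> vanishes somewhere on almost all of them. So the Sobolev
  inequality holds there without a boundary term (\<open>exterior_estimate\<close>), and the integral of \<open>|u|\<^sup>2\<close> over a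
  ball in the end is bounded by the integral of \<open>|\<nabla>u|\<^sup>2\<close> (\<open>energy_bounded_end\<close>).

  Such a bound propagates. In a coordinate cube on which \<open>\<kappa>\<close> is small, it extends from any open part of the
  cube to the whole cube (\<open>cube_control\<close>): one doubles boxes in one coordinate direction at a time, using the
  Poincare inequality in that direction together with the Sobolev inequality on the box. The smallness
  required in each step is invariant under scaling, so the number of steps does not matter. Every point,
  including those of the boundary, has cubes of this kind as neighbourhoods, if the charts are rotated
  suitably. Since the manifold is connected, every point has a neighbourhood over which the integral of
  \<open>|u|\<^sup>2\<close> is bounded by a constant times the energy, and a weighted sum of the indicator functions of
  countably many of these neighbourhoods is the required weight.
\<close>

section \<open>Powers of extended reals and Hoelder's inequality\<close>

text \<open>
  The power function on \<open>[0, \<infinity>]\<close>. Here \<open>x\<^sup>0 = 1\<close> also for \<open>x = 0\<close>, unlike for \<open>powr\<close>, so that factors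
  with exponent zero drop out of products.
\<close>

definition epow :: "ennreal \<Rightarrow> real \<Rightarrow> ennreal" where
  "epow x a = (if a = 0 then 1 else if x = top then top else ennreal (enn2real x powr a))"

lemma epow_0 [simp]: "epow x 0 = 1"
  by (simp add: epow_def)

lemma epow_1 [simp]: "epow x 1 = x"
  by (cases x) (auto simp: epow_def)

lemma epow_zero [simp]: "a \<noteq> 0 \<Longrightarrow> epow 0 a = 0"
  by (simp add: epow_def)

lemma epow_top [simp]: "a \<noteq> 0 \<Longrightarrow> epow top a = top"
  by (simp add: epow_def)

lemma epow_ennreal: "a \<noteq> 0 \<Longrightarrow> 0 \<le> x \<Longrightarrow> epow (ennreal x) a = ennreal (x powr a)"
  by (simp add: epow_def)

lemma epow_ennreal_pos: "0 < x \<Longrightarrow> epow (ennreal x) a = ennreal (x powr a)"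
  by (simp add: epow_def)

lemma measurable_epow [measurable]:
  assumes [measurable]: "f \<in> borel_measurable M"
  shows "(\<lambda>x. epow (f x) a) \<in> borel_measurable M"
  unfolding epow_def by measurable

lemma epow_add:
  assumes "0 \<le> a" "0 \<le> b"
  shows "epow x (a + b) = epow x a * epow x b"
proof (cases x)
  case (real r)
  then show ?thesis
    using assms by (auto simp: epow_def powr_add ennreal_mult)
next
  case top
  then show ?thesis
    using assms by (auto simp: epow_def add_nonneg_eq_0_iff ennreal_top_mult)
qed

lemma epow_mult:
  assumes "0 \<le> a"
  shows "epow (x * y) a = epow x a * epow y a"
proof (cases "a = 0 \<or> x = 0 \<or> y = 0")
  case False
  then show ?thesis
    using assms
    by (cases x; cases y)
       (auto simp: epow_ennreal powr_mult ennreal_top_mult ennreal_mult_top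
             simp flip: ennreal_mult)
qed (cases "a = 0"; auto)

lemma epow_mono:
  assumes "0 \<le> a" "x \<le> y"
  shows "epow x a \<le> epow y a"
  using assms
  by (cases x; cases y) (auto simp: epow_def powr_mono2 top_unique)

lemma epow_eq_0_iff: "epow x a = 0 \<longleftrightarrow> x = 0 \<and> a \<noteq> 0"
  by (cases x) (auto simp: epow_def)

text \<open>
  Convexity of the exponential function, after taking logarithms.
\<close>

lemma weighted_arith_geom_mean_real:
  fixes x a :: "'i \<Rightarrow> real"
  assumes "finite I" "\<And>i. i \<in> I \<Longrightarrow> 0 < a i" "(\<Sum>i\<in>I. a i) = 1" "\<And>i. i \<in> I \<Longrightarrow> 0 \<le> x i"
  shows "(\<Prod>i\<in>I. x i powr a i) \<le> (\<Sum>i\<in>I. a i * x i)"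
proof (cases "\<exists>i\<in>I. x i = 0")
  case True
  then have "(\<Prod>i\<in>I. x i powr a i) = 0" using assms(1) by auto
  moreover have "0 \<le> (\<Sum>i\<in>I. a i * x i)"
    using assms by (intro sum_nonneg mult_nonneg_nonneg) (auto intro: less_imp_le)
  ultimately show ?thesis by simp
next
  case False
  then have pos: "0 < x i" if "i \<in> I" for i using assms(4)[of i] that by force
  have ne: "I \<noteq> {}" using assms(3) by auto
  have "(\<Prod>i\<in>I. x i powr a i) = (\<Prod>i\<in>I. exp (a i * ln (x i)))"
    using pos by (intro prod.cong) (force simp: powr_def)+
  also have "\<dots> = exp (\<Sum>i\<in>I. a i *\<^sub>R ln (x i))"
    using assms(1) by (simp add: exp_sum)
  also have "\<dots> \<le> (\<Sum>i\<in>I. a i * exp (ln (x i)))"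
    using assms ne by (intro convex_on_sum[OF _ _ exp_convex]) (auto intro: less_imp_le)
  also have "\<dots> = (\<Sum>i\<in>I. a i * x i)"
    using pos by (intro sum.cong) auto
  finally show ?thesis .
qed

lemma weighted_arith_geom_mean:
  fixes x :: "'i \<Rightarrow> ennreal"
  assumes "finite I" "\<And>i. i \<in> I \<Longrightarrow> 0 < a i" "(\<Sum>i\<in>I. a i) = 1"
  shows "(\<Prod>i\<in>I. epow (x i) (a i)) \<le> (\<Sum>i\<in>I. ennreal (a i) * x i)"
proof (cases "\<exists>i\<in>I. x i = top")
  case True
  then obtain j where j: "j \<in> I" "x j = top" by auto
  have "ennreal (a j) * x j \<le> (\<Sum>i\<in>I. ennreal (a i) * x i)"
    using assms(1) j by (intro member_le_sum) auto
  moreover have "ennreal (a j) * x j = top" using j assms(2)[of j] by (simp add: ennreal_mult_top)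
  ultimately show ?thesis by (simp add: top_unique)
next
  case False
  define r where "r i = enn2real (x i)" for i
  have r: "x i = ennreal (r i)" "0 \<le> r i" if "i \<in> I" for i
    using False that by (auto simp: r_def less_top)
  have "(\<Prod>i\<in>I. epow (x i) (a i)) = (\<Prod>i\<in>I. ennreal (r i powr a i))"
    using r assms(2) by (intro prod.cong) (auto simp: epow_ennreal less_imp_neq[THEN not_sym] )
  also have "\<dots> = ennreal (\<Prod>i\<in>I. r i powr a i)"
    by (simp add: prod_ennreal)
  also have "\<dots> \<le> ennreal (\<Sum>i\<in>I. a i * r i)"
    using assms r by (intro ennreal_leI weighted_arith_geom_mean_real) auto
  also have "\<dots> = (\<Sum>i\<in>I. ennreal (a i * r i))"
    using assms(2) r by (intro sum_ennreal[symmetric] mult_nonneg_nonneg) (auto intro: less_imp_le)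
  also have "\<dots> = (\<Sum>i\<in>I. ennreal (a i) * x i)"
    using assms(2) r by (intro sum.cong) (auto simp: ennreal_mult less_imp_le)
  finally show ?thesis .
qed

text \<open>
  When every factor is normalized to have integral one, this is the weighted arithmetic-geometric
  mean inequality, integrated.
\<close>

lemma Hoelder_nn_integral_pos:
  assumes "finite I" "\<And>i. i \<in> I \<Longrightarrow> 0 < a i" "(\<Sum>i\<in>I. a i) = 1"
    and [measurable]: "\<And>i. i \<in> I \<Longrightarrow> f i \<in> borel_measurable M"
  shows "(\<integral>\<^sup>+x. (\<Prod>i\<in>I. epow (f i x) (a i)) \<partial>M) \<le> (\<Prod>i\<in>I. epow (\<integral>\<^sup>+x. f i x \<partial>M) (a i))"
proof -
  define c where "c i = (\<integral>\<^sup>+x. f i x \<partial>M)" for i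
  have ane: "a i \<noteq> 0" if "i \<in> I" for i using assms(2)[OF that] by simp
  consider "\<exists>i\<in>I. c i = 0" | "\<forall>i\<in>I. c i \<noteq> 0" "\<exists>i\<in>I. c i = top" | "\<forall>i\<in>I. c i \<noteq> 0 \<and> c i \<noteq> top"
    by blast
  then show ?thesis
  proof cases
    case 1
    then obtain j where j: "j \<in> I" "c j = 0" by auto
    then have "AE x in M. f j x = 0"
      unfolding c_def by (subst (asm) nn_integral_0_iff_AE) (auto intro: assms)
    then have "AE x in M. (\<Prod>i\<in>I. epow (f i x) (a i)) = 0"
      by eventually_elim (use j ane assms(1) in \<open>auto intro!: bexI[of _ j]\<close>)
    then have "(\<integral>\<^sup>+x. (\<Prod>i\<in>I. epow (f i x) (a i)) \<partial>M) = (\<integral>\<^sup>+x. 0 \<partial>M)"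
      by (intro nn_integral_cong_AE)
    then show ?thesis by simp
  next
    case 2
    then obtain j where j: "j \<in> I" "c j = top" by auto
    have "(\<Prod>i\<in>I. epow (c i) (a i)) = epow (c j) (a j) * (\<Prod>i\<in>I-{j}. epow (c i) (a i))"
      using assms(1) j by (simp add: prod.remove)
    also have "\<dots> = top"
      using 2 j ane assms(1) by (auto simp: ennreal_top_mult epow_eq_0_iff)
    finally show ?thesis by (simp add: c_def)
  next
    case 3
    define r where "r i = enn2real (c i)" for i
    have r: "c i = ennreal (r i)" "0 < r i" if "i \<in> I" for i
      using 3 that by (auto simp: r_def less_top enn2real_positive_iff zero_less_iff_neq_zero)
    define P where "P = (\<Prod>i\<in>I. r i powr a i)"
    have P: "0 < P" unfolding P_def using r(2) by (intro prod_pos) (force simp: less_le)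
    have Pc: "(\<Prod>i\<in>I. epow (c i) (a i)) = ennreal P"
      unfolding P_def using r by (subst prod_ennreal[symmetric]) (auto simp: epow_ennreal_pos intro!: prod.cong)
    have split: "(\<Prod>i\<in>I. epow (f i x) (a i)) = ennreal P * (\<Prod>i\<in>I. epow (f i x / ennreal (r i)) (a i))" for x
    proof -
      have "epow (f i x) (a i) = ennreal (r i powr a i) * epow (f i x / ennreal (r i)) (a i)" if "i \<in> I" for i
      proof -
        have "f i x = ennreal (r i) * (f i x / ennreal (r i))"
          using r[OF that] by (simp add: ennreal_times_divide ennreal_mult_divide_eq mult.commute[of "ennreal (r i)"])
        then have "epow (f i x) (a i) = epow (ennreal (r i) * (f i x / ennreal (r i))) (a i)" by simp
        then show ?thesis using r[OF that] assms(2)[OF that] by (simp add: epow_mult epow_ennreal_pos)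
      qed
      then show ?thesis
        unfolding P_def using assms(1)
        by (subst prod_ennreal[symmetric]) (auto simp flip: prod.distrib intro!: prod.cong)
    qed
    have "(\<integral>\<^sup>+x. (\<Prod>i\<in>I. epow (f i x) (a i)) \<partial>M) \<le> (\<integral>\<^sup>+x. ennreal P * (\<Sum>i\<in>I. ennreal (a i) * (f i x / ennreal (r i))) \<partial>M)"
      unfolding split using assms by (intro nn_integral_mono mult_left_mono weighted_arith_geom_mean) auto
    also have "\<dots> = ennreal P * (\<Sum>i\<in>I. ennreal (a i) * (c i / ennreal (r i)))"
      unfolding c_def by (simp add: nn_integral_cmult nn_integral_sum nn_integral_divide)
    also have "(\<Sum>i\<in>I. ennreal (a i) * (c i / ennreal (r i))) = (\<Sum>i\<in>I. ennreal (a i))"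
    proof (intro sum.cong refl)
      fix i assume "i \<in> I"
      then have "c i / ennreal (r i) = 1"
        using r[of i] by (simp add: divide_ennreal)
      then show "ennreal (a i) * (c i / ennreal (r i)) = ennreal (a i)" by simp
    qed
    also have "\<dots> = 1" using assms by (simp add: sum_ennreal less_imp_le)
    finally show ?thesis using Pc by (simp add: c_def)
  qed
qed

lemma Hoelder_nn_integral:
  assumes "finite I" "\<And>i. i \<in> I \<Longrightarrow> 0 \<le> a i" "(\<Sum>i\<in>I. a i) = 1"
    and [measurable]: "\<And>i. i \<in> I \<Longrightarrow> f i \<in> borel_measurable M"
  shows "(\<integral>\<^sup>+x. (\<Prod>i\<in>I. epow (f i x) (a i)) \<partial>M) \<le> (\<Prod>i\<in>I. epow (\<integral>\<^sup>+x. f i x \<partial>M) (a i))"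
proof -
  let ?J = "{i\<in>I. a i \<noteq> 0}"
  have eq: "(\<Prod>i\<in>I. epow (g i) (a i)) = (\<Prod>i\<in>?J. epow (g i) (a i))" for g :: "_ \<Rightarrow> ennreal"
    using assms(1) by (intro prod.mono_neutral_right) auto
  have "(\<Sum>i\<in>?J. a i) = (\<Sum>i\<in>I. a i)"
    using assms(1) by (intro sum.mono_neutral_left) auto
  then show ?thesis
    unfolding eq using assms by (intro Hoelder_nn_integral_pos) (auto simp: less_le)
qed

lemma Hoelder_nn_integral2:
  assumes "0 \<le> a" "0 \<le> b" "a + b = 1"
    and [measurable]: "f \<in> borel_measurable M" "g \<in> borel_measurable M"
  shows "(\<integral>\<^sup>+x. epow (f x) a * epow (g x) b \<partial>M) \<le> epow (\<integral>\<^sup>+x. f x \<partial>M) a * epow (\<integral>\<^sup>+x. g x \<partial>M) b"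
  using Hoelder_nn_integral[of "UNIV::bool set" "\<lambda>i. if i then a else b" "\<lambda>i. if i then f else g" M] assms
  by (simp add: UNIV_bool mult.commute add.commute split: if_splits)

section \<open>The Gagliardo--Nirenberg inequality along coordinate lines\<close>

text \<open>
  The general exponent \<open>p\<close> makes an induction on the set of coordinates possible. Integrate first
  over the new coordinate \<open>i\<close>. The line integral in the direction \<open>i\<close> does not depend on it, and
  Hoelder's inequality applies to the other factors, whose exponents \<open>1 - |I| p\<close> and \<open>p\<close>
  (\<open>|I|\<close> times) add up to one. The result is the same expression for the function \<open>F\<close> of one
  variable less that arises by integrating \<open>f\<close> over the coordinate \<open>i\<close>; the exponent of \<open>F\<close> itself
  is again the right one.
\<close>

lemma grid_lines_PiM:
  fixes f :: "('i \<Rightarrow> real) \<Rightarrow> ennreal"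
  assumes "finite I" "0 \<le> p" "(real (card I) - 1) * p \<le> 1"
    and "f \<in> borel_measurable (PiM I (\<lambda>_. lborel))"
  shows "(\<integral>\<^sup>+x. epow (f x) (1 - (real (card I) - 1) * p) *
            (\<Prod>i\<in>I. epow (\<integral>\<^sup>+t. f (x(i := t)) \<partial>lborel) p) \<partial>PiM I (\<lambda>_. lborel))
         \<le> epow (\<integral>\<^sup>+x. f x \<partial>PiM I (\<lambda>_. lborel)) (1 + p)"
  using assms
proof (induction I arbitrary: f rule: finite_induct)
  case empty
  interpret product_sigma_finite "\<lambda>_::'i. lborel :: real measure" by standard
  show ?case by (simp add: nn_integral_empty)
next
  case (insert i I)
  interpret product_sigma_finite "\<lambda>_::'i. lborel :: real measure" by standard
  note fin = insert.hyps(1) and [simp] = insert.hyps(2)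
  note [measurable] = insert.prems(3)
  let ?M = "\<lambda>I. PiM I (\<lambda>_::'i. lborel :: real measure)"
  define m where "m = real (card I)"
  have card: "real (card (insert i I)) = m + 1" using insert.hyps by (simp add: m_def)
  have mp: "m * p \<le> 1" using insert.prems by (simp add: card)
  define F where "F x = (\<integral>\<^sup>+t. f (x(i := t)) \<partial>lborel)" for x
  have upd[measurable]: "(\<lambda>(x, t). x(i := t)) \<in> measurable (?M I \<Otimes>\<^sub>M lborel) (?M (insert i I))"
    by (rule measurable_add_dim)
  have F[measurable]: "F \<in> borel_measurable (?M I)"
    unfolding F_def by measurable
  have Fint: "(\<integral>\<^sup>+x. F x \<partial>?M I) = (\<integral>\<^sup>+x. f x \<partial>?M (insert i I))"
    unfolding F_def using fin by (subst product_nn_integral_insert) auto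
  let ?G = "\<lambda>x. epow (f x) (1 - m * p) * (\<Prod>j\<in>insert i I. epow (\<integral>\<^sup>+t. f (x(j := t)) \<partial>lborel) p)"
  have line[measurable]: "(\<lambda>x. \<integral>\<^sup>+t. f (x(j := t)) \<partial>lborel) \<in> borel_measurable (?M (insert i I))"
    if "j \<in> insert i I" for j
  proof -
    have "(\<lambda>(x, t). x(j := t)) \<in> measurable (?M (insert i I) \<Otimes>\<^sub>M lborel) (?M (insert j (insert i I)))"
      by (rule measurable_add_dim)
    moreover have "insert j (insert i I) = insert i I" using that by auto
    ultimately have [measurable]: "(\<lambda>(x, t). x(j := t)) \<in> measurable (?M (insert i I) \<Otimes>\<^sub>M lborel) (?M (insert i I))"
      by simp
    show ?thesis by measurable
  qed
  have "(\<integral>\<^sup>+x. ?G x \<partial>?M (insert i I)) = (\<integral>\<^sup>+x. (\<integral>\<^sup>+y. ?G (x(i := y)) \<partial>lborel) \<partial>?M I)"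
    using fin by (subst product_nn_integral_insert) (auto intro!: borel_measurable_times_ennreal borel_measurable_prod_ennreal)
  also have "\<dots> \<le> (\<integral>\<^sup>+x. epow (F x) (1 - (m - 1) * p) * (\<Prod>j\<in>I. epow (\<integral>\<^sup>+t. F (x(j := t)) \<partial>lborel) p) \<partial>?M I)"
  proof (rule nn_integral_mono)
    fix x assume x: "x \<in> space (?M I)"
    define g where "g j y = (if j = i then f (x(i := y)) else \<integral>\<^sup>+t. f (x(i := y, j := t)) \<partial>lborel)" for j y
    define a where "a j = (if j = i then 1 - m * p else p)" for j
    have cu[measurable]: "(\<lambda>y. x(i := y)) \<in> measurable lborel (?M (insert i I))"
      using x by (intro measurable_component_update) auto
    have g[measurable]: "g j \<in> borel_measurable lborel" if "j \<in> insert i I" for j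
    proof (cases "j = i")
      case True
      then show ?thesis unfolding g_def by simp
    next
      case False
      with that have "j \<in> I" by simp
      have "(\<lambda>y. (\<lambda>x. \<integral>\<^sup>+t. f (x(j := t)) \<partial>lborel) (x(i := y))) \<in> borel_measurable lborel"
        by (rule measurable_compose[OF cu line[OF that]])
      then show ?thesis unfolding g_def using False by simp
    qed
    have G: "?G (x(i := y)) = epow (F x) p * (\<Prod>j\<in>insert i I. epow (g j y) (a j))" for y
    proof -
      have "(\<Prod>j\<in>I. epow (\<integral>\<^sup>+t. f (x(i := y, j := t)) \<partial>lborel) p) = (\<Prod>j\<in>I. epow (g j y) (a j))"
        using insert.hyps(2) by (intro prod.cong) (auto simp: g_def a_def)
      then show ?thesis
        using fin by (simp add: F_def g_def a_def mult_ac)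
    qed
    have "(\<integral>\<^sup>+y. ?G (x(i := y)) \<partial>lborel) = epow (F x) p * (\<integral>\<^sup>+y. (\<Prod>j\<in>insert i I. epow (g j y) (a j)) \<partial>lborel)"
      unfolding G using fin by (intro nn_integral_cmult) measurable
    also have "\<dots> \<le> epow (F x) p * (\<Prod>j\<in>insert i I. epow (\<integral>\<^sup>+y. g j y \<partial>lborel) (a j))"
    proof (intro mult_left_mono Hoelder_nn_integral)
      have "(\<Sum>j\<in>I. a j) = m * p" using insert.hyps(2)
        by (subst sum.cong[of I I a "\<lambda>_. p"]) (auto simp: a_def m_def)
      then show "(\<Sum>j\<in>insert i I. a j) = 1"
        using fin by (simp add: a_def)
    qed (use fin mp insert.prems in \<open>auto simp: a_def\<close>)
    also have "(\<Prod>j\<in>insert i I. epow (\<integral>\<^sup>+y. g j y \<partial>lborel) (a j)) =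
       epow (F x) (1 - m * p) * (\<Prod>j\<in>I. epow (\<integral>\<^sup>+y. g j y \<partial>lborel) p)"
    proof -
      have "(\<Prod>j\<in>I. epow (\<integral>\<^sup>+y. g j y \<partial>lborel) (a j)) = (\<Prod>j\<in>I. epow (\<integral>\<^sup>+y. g j y \<partial>lborel) p)"
        using insert.hyps(2) by (intro prod.cong) (auto simp: a_def)
      then show ?thesis using fin by (simp add: g_def a_def F_def)
    qed
    also have "(\<Prod>j\<in>I. epow (\<integral>\<^sup>+y. g j y \<partial>lborel) p) = (\<Prod>j\<in>I. epow (\<integral>\<^sup>+t. F (x(j := t)) \<partial>lborel) p)"
    proof (intro prod.cong refl arg_cong2[where f=epow])
      fix j assume j: "j \<in> I"
      then have ji: "j \<noteq> i" by auto
      have [measurable]: "(\<lambda>(y, t). x(j := t, i := y)) \<in> measurable (lborel \<Otimes>\<^sub>M lborel) (?M (insert i I))"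
      proof -
        have "(\<lambda>y. x(j := y)) \<in> measurable lborel (?M I)"
        proof -
          have "x(j := y) = (x(j := undefined))(j := y)" for y by simp
          moreover have "x(j := undefined) \<in> space (?M (I - {j}))"
            using x by (auto simp: space_PiM PiE_def extensional_def Pi_def)
          ultimately show ?thesis
            using measurable_component_update[of "x(j := undefined)" "I - {j}" "\<lambda>_. lborel" j] j
            by (simp add: insert_absorb)
        qed
        then have "(\<lambda>(y, t). (x(j := t), y)) \<in> measurable (lborel \<Otimes>\<^sub>M lborel) (?M I \<Otimes>\<^sub>M lborel)"
          by measurable
        from measurable_compose[OF this upd] show ?thesis by (simp add: case_prod_beta)
      qed
      have "(\<integral>\<^sup>+y. g j y \<partial>lborel) = (\<integral>\<^sup>+y. \<integral>\<^sup>+t. f (x(j := t, i := y)) \<partial>lborel \<partial>lborel)"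
        using ji by (simp add: g_def fun_upd_twist)
      also have "\<dots> = (\<integral>\<^sup>+t. \<integral>\<^sup>+y. f (x(j := t, i := y)) \<partial>lborel \<partial>lborel)"
        by (rule lborel_pair.Fubini') measurable
      finally show "(\<integral>\<^sup>+y. g j y \<partial>lborel) = (\<integral>\<^sup>+t. F (x(j := t)) \<partial>lborel)"
        by (simp add: F_def)
    qed
    also have "epow (F x) p * (epow (F x) (1 - m * p) * (\<Prod>j\<in>I. epow (\<integral>\<^sup>+t. F (x(j := t)) \<partial>lborel) p)) =
      epow (F x) (1 - (m - 1) * p) * (\<Prod>j\<in>I. epow (\<integral>\<^sup>+t. F (x(j := t)) \<partial>lborel) p)"
    proof -
      have "1 - (m - 1) * p = p + (1 - m * p)" by (simp add: algebra_simps)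
      then have "epow (F x) (1 - (m - 1) * p) = epow (F x) p * epow (F x) (1 - m * p)"
        using mp insert.prems(1) by (simp only: epow_add)
      then show ?thesis by (simp only: mult.assoc)
    qed
    finally show "(\<integral>\<^sup>+y. ?G (x(i := y)) \<partial>lborel) \<le>
      epow (F x) (1 - (m - 1) * p) * (\<Prod>j\<in>I. epow (\<integral>\<^sup>+t. F (x(j := t)) \<partial>lborel) p)" .
  qed
  also have "\<dots> \<le> epow (\<integral>\<^sup>+x. F x \<partial>?M I) (1 + p)"
  proof -
    have "(m - 1) * p \<le> 1" using mp insert.prems(1) by (simp add: algebra_simps)
    then show ?thesis
      using insert.IH[OF insert.prems(1) _ F] unfolding m_def by blast
  qed
  finally show ?case unfolding Fint card by (simp only: add_diff_cancel_right')
qed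

text \<open>
  For \<open>p = 1 / (n - 1)\<close> the first factor in the grid-lines inequality disappears.
\<close>

lemma gagliardo_nirenberg:
  fixes h :: "'b::euclidean_space \<Rightarrow> ennreal"
  assumes n: "2 \<le> DIM('b)" and [measurable]: "h \<in> borel_measurable borel"
  shows "(\<integral>\<^sup>+x. (\<Prod>b\<in>Basis. epow (\<integral>\<^sup>+t. h (x + (t - x \<bullet> b) *\<^sub>R b) \<partial>lborel) (1 / (real DIM('b) - 1))) \<partial>lborel)
      \<le> epow (\<integral>\<^sup>+x. h x \<partial>lborel) (real DIM('b) / (real DIM('b) - 1))"
proof -
  define S where "S x = (\<Sum>b\<in>Basis. x b *\<^sub>R b)" for x :: "'b \<Rightarrow> real"
  have S[measurable]: "S \<in> measurable (PiM Basis (\<lambda>_. lborel)) borel"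
    unfolding S_def by measurable
  have lb: "(lborel :: 'b measure) = distr (PiM Basis (\<lambda>_. lborel)) borel S"
    unfolding S_def by (rule lborel_eq)
  define p where "p = 1 / (real DIM('b) - 1)"
  have p: "0 \<le> p" "(real DIM('b) - 1) * p = 1" "1 + p = real DIM('b) / (real DIM('b) - 1)"
    using n by (auto simp: p_def field_simps)
  have upd: "S x + (t - S x \<bullet> b) *\<^sub>R b = S (x(b := t))" if b: "b \<in> Basis" for x t b
  proof -
    have "S x \<bullet> b = x b"
      using b by (simp add: S_def inner_sum_left inner_Basis sum.delta' if_distrib cong: if_cong)
    moreover have "S x = x b *\<^sub>R b + (\<Sum>c\<in>Basis-{b}. x c *\<^sub>R c)"
      unfolding S_def using b by (simp add: sum.remove)
    moreover have "S (x(b := t)) = t *\<^sub>R b + (\<Sum>c\<in>Basis-{b}. x c *\<^sub>R c)"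
      unfolding S_def using b by (simp add: sum.remove)
    ultimately show ?thesis by (simp add: algebra_simps)
  qed
  have "(\<integral>\<^sup>+x. (\<Prod>b\<in>Basis. epow (\<integral>\<^sup>+t. h (x + (t - x \<bullet> b) *\<^sub>R b) \<partial>lborel) p) \<partial>lborel)
     = (\<integral>\<^sup>+x. (\<Prod>b\<in>Basis. epow (\<integral>\<^sup>+t. h (S x + (t - S x \<bullet> b) *\<^sub>R b) \<partial>lborel) p) \<partial>PiM Basis (\<lambda>_. lborel))"
    unfolding lb[symmetric] by (subst lb, subst nn_integral_distr) auto
  also have "\<dots> = (\<integral>\<^sup>+x. (\<Prod>b\<in>Basis. epow (\<integral>\<^sup>+t. h (S (x(b := t))) \<partial>lborel) p) \<partial>PiM Basis (\<lambda>_. lborel))"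
    using upd by (intro nn_integral_cong prod.cong) auto
  also have "\<dots> \<le> epow (\<integral>\<^sup>+x. h (S x) \<partial>PiM Basis (\<lambda>_. lborel)) (1 + p)"
    using grid_lines_PiM[of "Basis :: 'b set" p "\<lambda>x. h (S x)"] p by simp
  also have "(\<integral>\<^sup>+x. h (S x) \<partial>PiM Basis (\<lambda>_. lborel)) = (\<integral>\<^sup>+x. h x \<partial>lborel)"
    by (subst lb, subst nn_integral_distr) auto
  finally show ?thesis using p by (simp add: p_def)
qed

section \<open>Sobolev inequalities with a critical zeroth-order term\<close>

text \<open>
  The power is differentiable at the zeros of \<open>s\<close> too, since there \<open>s powr (q - 1)\<close> tends to zero.
  This is why the squared length of a section can be used without regularizing it near the zeros
  of the section.
\<close>

lemma has_derivative_powr_nonneg: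
  fixes s :: "'b::real_normed_vector \<Rightarrow> real"
  assumes q: "1 < q" and x: "x \<in> S" and nn: "\<And>y. y \<in> S \<Longrightarrow> 0 \<le> s y"
    and D: "(s has_derivative D) (at x within S)"
  shows "((\<lambda>y. s y powr q) has_derivative (\<lambda>v. q * s x powr (q - 1) * D v)) (at x within S)"
proof -
  let ?\<phi> = "\<lambda>t::real. \<bar>t\<bar> powr q"
  have \<phi>: "(?\<phi> has_real_derivative q * t powr (q - 1)) (at t)" if "0 \<le> t" for t
  proof (cases "t = 0")
    case True
    have "((\<lambda>h. \<bar>h\<bar> powr (q - 1)) \<longlongrightarrow> 0) (at (0::real))"
      by (rule tendsto_zero_powrI[where b="q - 1"]) (use q in \<open>auto intro!: tendsto_rabs_zero\<close>)
    then have "((\<lambda>h. \<bar>h\<bar> powr q / h) \<longlongrightarrow> 0) (at (0::real))"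
    proof (rule Lim_null_comparison[rotated])
      show "\<forall>\<^sub>F h in at 0. norm (\<bar>h\<bar> powr q / h) \<le> \<bar>h\<bar> powr (q - 1)"
        unfolding eventually_at
        by (rule exI[of _ 1]) (auto simp: powr_diff)
    qed
    then show ?thesis using True q by (simp add: DERIV_def)
  next
    case False
    with that have t: "0 < t" by simp
    have "((\<lambda>t. t powr q) has_real_derivative q * t powr (q - 1)) (at t)"
      using t by (auto intro!: derivative_eq_intros simp: powr_diff)
    moreover have "eventually (\<lambda>u. u powr q = ?\<phi> u) (nhds t)"
      using eventually_nhds_in_open[of "{0<..}" t] t
      by (auto elim!: eventually_mono)
    ultimately show ?thesis by (subst (asm) DERIV_cong_ev[OF refl _ refl])
  qed
  have "(?\<phi> has_derivative (\<lambda>h. q * s x powr (q - 1) * h)) (at (s x))"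
    using \<phi>[OF nn[OF x]] by (simp add: has_field_derivative_def)
  from has_derivative_compose[OF D this]
  have "((\<lambda>y. \<bar>s y\<bar> powr q) has_derivative (\<lambda>v. q * s x powr (q - 1) * D v)) (at x within S)" .
  then show ?thesis
    by (rule has_derivative_transform[OF x, rotated]) (simp add: nn)
qed

lemma line_increment_le:
  fixes f :: "'b::euclidean_space \<Rightarrow> real"
  assumes seg: "\<And>t. t \<in> {t0..t1} \<Longrightarrow> z + t *\<^sub>R b \<in> S" and "t0 \<le> t1"
    and D: "\<And>x. x \<in> S \<Longrightarrow> (f has_derivative f' x) (at x within S)"
    and C: "continuous_on S (\<lambda>x. f' x b)"
  shows "ennreal \<bar>f (z + t1 *\<^sub>R b) - f (z + t0 *\<^sub>R b)\<bar>
     \<le> (\<integral>\<^sup>+t\<in>{t0..t1}. ennreal \<bar>f' (z + t *\<^sub>R b) b\<bar> \<partial>lborel)"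
proof -
  let ?y = "\<lambda>t. z + t *\<^sub>R b"
  have vd: "((\<lambda>t. f (?y t)) has_vector_derivative f' (?y t) b) (at t within {t0..t1})"
    if "t0 \<le> t" "t \<le> t1" for t
  proof -
    have 1: "(?y has_derivative (\<lambda>h. h *\<^sub>R b)) (at t within {t0..t1})"
      by (auto intro!: derivative_eq_intros)
    have 2: "(f has_derivative f' (?y t)) (at (?y t) within ?y ` {t0..t1})"
      using D[of "?y t"] seg that by (intro has_derivative_subset[where t="?y ` {t0..t1}" and s=S]) auto
    have lin: "linear (f' (?y t))"
      using D[of "?y t"] seg that has_derivative_linear by auto
    show ?thesis
      using diff_chain_within[OF 1 2]
      by (simp add: has_vector_derivative_def comp_def linear_cmul[OF lin])
  qed
  have cont: "continuous_on {t0..t1} (\<lambda>t. f' (?y t) b)"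
    by (rule continuous_on_compose2[OF C]) (auto intro!: continuous_intros seg)
  have eq: "(\<integral>t. indicator {t0..t1} t *\<^sub>R f' (?y t) b \<partial>lborel) = f (?y t1) - f (?y t0)"
    by (rule integral_FTC_Icc[OF assms(2) vd cont])
  have int: "integrable lborel (\<lambda>t. indicator {t0..t1} t *\<^sub>R f' (?y t) b)"
    using borel_integrable_atLeastAtMost'[OF cont] by (simp add: set_integrable_def)
  have "ennreal (norm (f (?y t1) - f (?y t0))) \<le> (\<integral>\<^sup>+t. norm (indicator {t0..t1} t *\<^sub>R f' (?y t) b) \<partial>lborel)"
    unfolding eq[symmetric] by (rule integral_norm_bound_ennreal[OF int])
  also have "\<dots> = (\<integral>\<^sup>+t\<in>{t0..t1}. ennreal \<bar>f' (?y t) b\<bar> \<partial>lborel)"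
    by (intro nn_integral_cong) (auto simp: indicator_def)
  finally show ?thesis by simp
qed

text \<open>
  The function \<open>s\<close> stands for the squared length \<open>|u|\<^sup>2\<close> of a section. The condition on its derivative
  is the inequality \<open>|\<partial>\<^sub>b |u|| \<le> H + \<kappa> |u|\<close>, multiplied by \<open>2 |u|\<close> so that it makes sense at the zeros
  of \<open>u\<close>.
\<close>

definition admissible ::
  "'b::euclidean_space set \<Rightarrow> ('b \<Rightarrow> real) \<Rightarrow> ('b \<Rightarrow> real) \<Rightarrow> ('b \<Rightarrow> 'b \<Rightarrow> real) \<Rightarrow> ('b \<Rightarrow> real) \<Rightarrow> bool" where
  "admissible S \<kappa> s s' H \<longleftrightarrow>
     (\<forall>x\<in>S. 0 \<le> s x \<and> 0 \<le> H x \<and> (s has_derivative s' x) (at x within S) \<and>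
        (\<forall>b\<in>Basis. \<bar>s' x b\<bar> \<le> 2 * sqrt (s x) * (H x + \<kappa> x * sqrt (s x)))) \<and>
     (\<forall>b\<in>Basis. continuous_on S (\<lambda>x. s' x b)) \<and>
     set_borel_measurable borel S H"

text \<open>
  The power for which the Gagliardo--Nirenberg exponent \<open>n / (n - 1)\<close>, applied to \<open>s powr q\<close>,
  produces the Sobolev exponent \<open>n / (n - 2)\<close> of \<open>s\<close>, that is, \<open>2 n / (n - 2)\<close> of \<open>|u|\<close>.
\<close>

definition sob_q :: "'b::euclidean_space itself \<Rightarrow> real" where
  "sob_q _ = (real DIM('b) - 1) / (real DIM('b) - 2)"

text \<open>
  The sum of the constants in front of the zeroth-order term in the Sobolev and the Poincare
  inequality on a box.
\<close>

definition sob_const :: "'b::euclidean_space itself \<Rightarrow> real" where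
  "sob_const _ = 12 * (sob_q TYPE('b))\<^sup>2 + 24"

text \<open>
  The square of the norm of \<open>\<kappa>\<close> in \<open>L\<^sup>n\<close>, where \<open>n\<close> is the dimension. It is invariant under the
  scaling of first-order terms.
\<close>

definition critical_norm :: "'b::euclidean_space set \<Rightarrow> ('b \<Rightarrow> real) \<Rightarrow> ennreal" where
  "critical_norm S \<kappa> = epow (\<integral>\<^sup>+x\<in>S. ennreal (\<kappa> x powr real DIM('b)) \<partial>lborel) (2 / real DIM('b))"

definition small_on :: "'b::euclidean_space set \<Rightarrow> ('b \<Rightarrow> real) \<Rightarrow> bool" where
  "small_on S \<kappa> \<longleftrightarrow> ennreal (sob_const TYPE('b)) * critical_norm S \<kappa> \<le> ennreal (1/2)"

text \<open>
  The Gagliardo--Nirenberg inequality for \<open>s powr q\<close> bounds the integral \<open>A\<close> on the left by a power of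
  the integral of \<open>s powr (\<theta>/2) * k\<close>, which is at most \<open>sqrt A\<close> times the norm of \<open>k\<close>. The total power
  of \<open>A\<close> on the right is less than one, so it can be divided out; this needs \<open>A\<close> to be finite.
\<close>

lemma sobolev_core:
  fixes s k :: "'b::euclidean_space \<Rightarrow> real"
  defines "n \<equiv> real DIM('b)" and "q \<equiv> sob_q TYPE('b)"
  defines "\<theta> \<equiv> n / (n - 2)"
  assumes dim: "3 \<le> DIM('b)"
    and [measurable]: "s \<in> borel_measurable borel" "k \<in> borel_measurable borel" "S \<in> sets borel"
    and nn: "\<And>x. 0 \<le> s x" "\<And>x. 0 \<le> k x"
    and fin: "(\<integral>\<^sup>+x\<in>S. ennreal (s x powr \<theta>) \<partial>lborel) < top"
    and line: "AE x in lborel. x \<in> S \<longrightarrow> (\<forall>b\<in>Basis. ennreal (s x powr q) \<le>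
        (\<integral>\<^sup>+t. ennreal (s (x + (t - x \<bullet> b) *\<^sub>R b) powr (\<theta> / 2) * k (x + (t - x \<bullet> b) *\<^sub>R b)) *
            indicator S (x + (t - x \<bullet> b) *\<^sub>R b) \<partial>lborel))"
  shows "epow (\<integral>\<^sup>+x\<in>S. ennreal (s x powr \<theta>) \<partial>lborel) ((n - 2) / n) \<le> (\<integral>\<^sup>+x\<in>S. ennreal ((k x)\<^sup>2) \<partial>lborel)"
proof -
  have n: "3 \<le> n" using dim by (simp add: n_def)
  define p where "p = 1 / (n - 1)"
  have p: "0 < p" using n by (simp add: p_def)
  define h where "h x = ennreal (s x powr (\<theta> / 2) * k x) * indicator S x" for x
  have [measurable]: "h \<in> borel_measurable borel" unfolding h_def by measurable
  define A where "A = (\<integral>\<^sup>+x\<in>S. ennreal (s x powr \<theta>) \<partial>lborel)"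
  define B where "B = (\<integral>\<^sup>+x\<in>S. ennreal ((k x)\<^sup>2) \<partial>lborel)"
  have "A \<le> (\<integral>\<^sup>+x. (\<Prod>b\<in>Basis. epow (\<integral>\<^sup>+t. h (x + (t - x \<bullet> b) *\<^sub>R b) \<partial>lborel) p) \<partial>lborel)"
    unfolding A_def
  proof (rule nn_integral_mono_AE)
    show "AE x in lborel. ennreal (s x powr \<theta>) * indicator S x
       \<le> (\<Prod>b\<in>Basis. epow (\<integral>\<^sup>+t. h (x + (t - x \<bullet> b) *\<^sub>R b) \<partial>lborel) p)"
      using line
    proof eventually_elim
      case (elim x)
      show ?case
      proof (cases "x \<in> S")
        case True
        have "q * p * n = \<theta>" using n by (simp add: q_def sob_q_def p_def \<theta>_def n_def[symmetric])
        then have "ennreal (s x powr \<theta>) = (\<Prod>b\<in>(Basis::'b set). ennreal (s x powr (q * p)))"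
          by (simp add: ennreal_power powr_realpow'[symmetric] powr_powr n_def)
        also have "\<dots> = (\<Prod>b\<in>(Basis::'b set). epow (ennreal (s x powr q)) p)"
          using p by (simp add: epow_ennreal powr_powr)
        also have "\<dots> \<le> (\<Prod>b\<in>(Basis::'b set). epow (\<integral>\<^sup>+t. h (x + (t - x \<bullet> b) *\<^sub>R b) \<partial>lborel) p)"
          using elim True p by (intro prod_mono_ennreal epow_mono) (auto simp: h_def)
        finally show ?thesis using True by simp
      qed auto
    qed
  qed
  also have "\<dots> \<le> epow (\<integral>\<^sup>+x. h x \<partial>lborel) (n / (n - 1))"
    unfolding p_def n_def using dim by (intro gagliardo_nirenberg) auto
  also have "(\<integral>\<^sup>+x. h x \<partial>lborel) \<le> epow A (1/2) * epow B (1/2)"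
  proof -
    have "h x = epow (ennreal (s x powr \<theta>) * indicator S x) (1/2) * epow (ennreal ((k x)\<^sup>2) * indicator S x) (1/2)" for x
      using nn[of x] by (auto simp: h_def epow_ennreal powr_powr powr_half_sqrt ennreal_mult indicator_def)
    then have "(\<integral>\<^sup>+x. h x \<partial>lborel) = (\<integral>\<^sup>+x. epow (ennreal (s x powr \<theta>) * indicator S x) (1/2) *
        epow (ennreal ((k x)\<^sup>2) * indicator S x) (1/2) \<partial>lborel)"
      by (intro nn_integral_cong)
    also have "\<dots> \<le> epow A (1/2) * epow B (1/2)"
      unfolding A_def B_def by (rule Hoelder_nn_integral2) auto
    finally show ?thesis .
  qed
  finally have le: "A \<le> epow (epow A (1/2) * epow B (1/2)) (n / (n - 1))"
    using n by (simp add: epow_mono)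
  show ?thesis
  proof (cases "B = top \<or> A = 0")
    case True
    then show ?thesis using n by (auto simp: A_def B_def)
  next
    case False
    obtain a where a: "A = ennreal a" "0 < a"
      using False fin unfolding A_def[symmetric] by (cases A) (auto simp: ennreal_eq_0_iff)
    obtain b where b: "B = ennreal b" "0 \<le> b" using False by (cases B) auto
    define e where "e = n / (n - 1)"
    have e: "1 < e" "e < 2" using n by (auto simp: e_def field_simps)
    have "ennreal a \<le> ennreal ((sqrt a * sqrt b) powr e)"
      using le a b n by (simp add: epow_ennreal powr_half_sqrt e_def flip: ennreal_mult)
    then have "a \<le> (a powr (1/2) * b powr (1/2)) powr e"
      using a b by (simp add: powr_half_sqrt)
    then have *: "a \<le> a powr (e/2) * b powr (e/2)"
      using a b by (simp add: powr_mult powr_powr)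
    have "a powr (1 - e/2) = a / a powr (e/2)" using a by (simp add: powr_diff)
    also have "\<dots> \<le> b powr (e/2)" using * a by (simp add: field_simps)
    finally have "(a powr (1 - e/2)) powr (2/e) \<le> (b powr (e/2)) powr (2/e)"
      using e by (intro powr_mono2) auto
    moreover have "(1 - e/2) * (2/e) = (n - 2) / n" using n by (simp add: e_def field_simps)
    ultimately have "a powr ((n - 2) / n) \<le> b"
      using e b by (simp add: powr_powr)
    then show ?thesis using a b n by (simp add: A_def[symmetric] B_def[symmetric] epow_ennreal)
  qed
qed

lemma admissible_subset:
  assumes "admissible S \<kappa> s s' H" "T \<subseteq> S" "T \<in> sets borel"
  shows "admissible T \<kappa> s s' H"
proof -
  have [measurable]: "T \<in> sets borel" "(\<lambda>x. indicator S x *\<^sub>R H x) \<in> borel_measurable borel"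
    using assms by (auto simp: admissible_def set_borel_measurable_def)
  have "(\<lambda>x. indicator T x *\<^sub>R (indicator S x *\<^sub>R H x)) \<in> borel_measurable borel"
    by measurable
  moreover have "indicator T x *\<^sub>R (indicator S x *\<^sub>R H x) = indicator T x *\<^sub>R H x" for x
    using assms(2) by (auto simp: indicator_def)
  ultimately have "set_borel_measurable borel T H"
    unfolding set_borel_measurable_def by (simp only:)
  then show ?thesis
    using assms unfolding admissible_def
    by (auto intro: has_derivative_subset continuous_on_subset)
qed

lemma admissible_continuous:
  assumes "admissible S \<kappa> s s' H"
  shows "continuous_on S s"
  using assms unfolding admissible_def
  by (auto intro!: has_derivative_continuous_on)

lemma sob_facts:
  assumes "3 \<le> DIM('b::euclidean_space)"
  shows "1 < sob_q TYPE('b)" "sob_const TYPE('b) = 12 * (sob_q TYPE('b))\<^sup>2 + 24"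
    "(sob_q TYPE('b) - 1) + 1/2 = real DIM('b) / (real DIM('b) - 2) / 2"
  using assms by (auto simp: sob_q_def sob_const_def field_simps)

text \<open>
  The derivative of \<open>s powr q\<close> contains \<open>s powr (q - 1) * sqrt s\<close>, which is exactly
  \<open>s powr (\<theta>/2)\<close>. The term with \<open>\<mu>\<close> covers domains on which \<open>s\<close> need not vanish at the end of a line and
  has to be averaged over it instead.
\<close>

lemma sobolev_admissible:
  fixes s :: "'b::euclidean_space \<Rightarrow> real"
  defines "n \<equiv> real DIM('b)" and "q \<equiv> sob_q TYPE('b)"
  defines "\<theta> \<equiv> n / (n - 2)"
  assumes dim: "3 \<le> DIM('b)"
    and [measurable]: "S \<in> sets borel" "\<kappa> \<in> borel_measurable borel" and \<kappa>: "\<And>x. 0 \<le> \<kappa> x" and lam: "0 \<le> \<mu>"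
    and adm: "admissible S \<kappa> s s' H"
    and fin: "(\<integral>\<^sup>+x\<in>S. ennreal (s x powr \<theta>) \<partial>lborel) < top"
    and line: "AE x in lborel. x \<in> S \<longrightarrow> (\<forall>b\<in>Basis. ennreal (s x powr q) \<le>
        (\<integral>\<^sup>+t. ennreal (q * s (x + (t - x \<bullet> b) *\<^sub>R b) powr (q - 1) * \<bar>s' (x + (t - x \<bullet> b) *\<^sub>R b) b\<bar>
               + \<mu> * s (x + (t - x \<bullet> b) *\<^sub>R b) powr q) *
            indicator S (x + (t - x \<bullet> b) *\<^sub>R b) \<partial>lborel))"
  shows "epow (\<integral>\<^sup>+x\<in>S. ennreal (s x powr \<theta>) \<partial>lborel) ((n - 2) / n)
     \<le> ennreal (12 * q\<^sup>2) * ((\<integral>\<^sup>+x\<in>S. ennreal ((H x)\<^sup>2) \<partial>lborel) + (\<integral>\<^sup>+x\<in>S. ennreal ((\<kappa> x)\<^sup>2 * s x) \<partial>lborel))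
       + ennreal (3 * \<mu>\<^sup>2) * (\<integral>\<^sup>+x\<in>S. ennreal (s x) \<partial>lborel)"
proof -
  have q: "1 < q" "q - 1 + 1/2 = \<theta> / 2"
    using sob_facts[OF dim] unfolding q_def n_def \<theta>_def by auto
  have q': "q = \<theta> / 2 + 1/2" using q(2) by simp
  define s1 where "s1 x = indicator S x * s x" for x
  define H1 where "H1 x = indicator S x * H x" for x
  have [measurable]: "s1 \<in> borel_measurable borel"
    using borel_measurable_continuous_on_indicator[OF _ admissible_continuous[OF adm]]
    by (simp add: s1_def[abs_def])
  have [measurable]: "H1 \<in> borel_measurable borel"
    using adm by (simp add: H1_def[abs_def] admissible_def set_borel_measurable_def)
  have s1: "s1 x = s x" "H1 x = H x" if "x \<in> S" for x using that by (auto simp: s1_def H1_def)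
  have nn: "0 \<le> s1 x" "0 \<le> H1 x" for x
    using adm by (auto simp: s1_def H1_def admissible_def indicator_def)
  define k where "k x = 2 * q * (H1 x + \<kappa> x * sqrt (s1 x)) + \<mu> * sqrt (s1 x)" for x
  have [measurable]: "k \<in> borel_measurable borel" unfolding k_def by measurable
  have knn: "0 \<le> k x" for x using nn \<kappa> lam q by (auto simp: k_def intro!: add_nonneg_nonneg mult_nonneg_nonneg)
  have eq: "(\<integral>\<^sup>+x\<in>S. ennreal (s1 x powr \<theta>) \<partial>lborel) = (\<integral>\<^sup>+x\<in>S. ennreal (s x powr \<theta>) \<partial>lborel)"
    by (intro nn_integral_cong) (auto simp: s1_def indicator_def)
  have pt: "q * s y powr (q - 1) * \<bar>s' y b\<bar> + \<mu> * s y powr q \<le> s1 y powr (\<theta>/2) * k y"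
    if y: "y \<in> S" and b: "b \<in> Basis" for y b
  proof -
    have s0: "0 \<le> s y" and sb: "\<bar>s' y b\<bar> \<le> 2 * sqrt (s y) * (H y + \<kappa> y * sqrt (s y))"
      using adm y b by (auto simp: admissible_def)
    have e1: "s y powr (q - 1) * sqrt (s y) = s y powr (\<theta>/2)"
      using s0 unfolding q(2)[symmetric] powr_add by (simp add: powr_half_sqrt)
    have e2: "s y powr q = s y powr (\<theta>/2) * sqrt (s y)"
      using s0 unfolding q' powr_add by (simp add: powr_half_sqrt)
    have "q * s y powr (q - 1) * \<bar>s' y b\<bar> \<le> q * s y powr (q - 1) * (2 * sqrt (s y) * (H y + \<kappa> y * sqrt (s y)))"
      using q sb by (intro mult_left_mono) auto
    also have "\<dots> = (s y powr (q - 1) * sqrt (s y)) * (2 * q * (H y + \<kappa> y * sqrt (s y)))"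
      by (simp add: algebra_simps)
    finally show ?thesis
      unfolding e1 e2 k_def s1[OF y] by (simp add: algebra_simps)
  qed
  have "epow (\<integral>\<^sup>+x\<in>S. ennreal (s x powr \<theta>) \<partial>lborel) ((n - 2) / n) \<le> (\<integral>\<^sup>+x\<in>S. ennreal ((k x)\<^sup>2) \<partial>lborel)"
    unfolding eq[symmetric] unfolding n_def \<theta>_def
  proof (rule sobolev_core[OF dim])
    show "(\<integral>\<^sup>+x\<in>S. ennreal (s1 x powr (real DIM('b) / (real DIM('b) - 2))) \<partial>lborel) < top"
      using fin eq by (simp add: n_def \<theta>_def)
    show "AE x in lborel. x \<in> S \<longrightarrow> (\<forall>b\<in>Basis. ennreal (s1 x powr sob_q TYPE('b)) \<le>
        (\<integral>\<^sup>+t. ennreal (s1 (x + (t - x \<bullet> b) *\<^sub>R b) powr (real DIM('b) / (real DIM('b) - 2) / 2) * k (x + (t - x \<bullet> b) *\<^sub>R b)) *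
            indicator S (x + (t - x \<bullet> b) *\<^sub>R b) \<partial>lborel))"
      using line
    proof eventually_elim
      case (elim x)
      show ?case
      proof (intro impI ballI)
        fix b :: 'b assume x: "x \<in> S" and b: "b \<in> Basis"
        let ?y = "\<lambda>t. x + (t - x \<bullet> b) *\<^sub>R b"
        have "ennreal (s1 x powr q) \<le> (\<integral>\<^sup>+t. ennreal (q * s (?y t) powr (q - 1) * \<bar>s' (?y t) b\<bar> + \<mu> * s (?y t) powr q) * indicator S (?y t) \<partial>lborel)"
          using elim x b by (simp add: s1)
        also have "\<dots> \<le> (\<integral>\<^sup>+t. ennreal (s1 (?y t) powr (\<theta>/2) * k (?y t)) * indicator S (?y t) \<partial>lborel)"
          using pt b by (intro nn_integral_mono) (auto simp: indicator_def intro!: ennreal_leI)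
        finally show "ennreal (s1 x powr sob_q TYPE('b)) \<le>
          (\<integral>\<^sup>+t. ennreal (s1 (?y t) powr (real DIM('b) / (real DIM('b) - 2) / 2) * k (?y t)) * indicator S (?y t) \<partial>lborel)"
          by (simp add: q_def n_def \<theta>_def)
      qed
    qed
  qed (use nn knn in auto)
  also have "\<dots> \<le> (\<integral>\<^sup>+x. ennreal (12 * q\<^sup>2) * (ennreal ((H1 x)\<^sup>2) * indicator S x + ennreal ((\<kappa> x)\<^sup>2 * s1 x) * indicator S x)
       + ennreal (3 * \<mu>\<^sup>2) * (ennreal (s1 x) * indicator S x) \<partial>lborel)"
  proof (rule nn_integral_mono)
    fix x
    have three: "(a + b + c)\<^sup>2 \<le> 3 * (a\<^sup>2 + b\<^sup>2 + c\<^sup>2)" for a b c :: real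
      using sum_squares_ge_zero[of "a - b" "b - c"] zero_le_power2[of "a - c"]
      by (simp add: power2_eq_square algebra_simps)
    have "(k x)\<^sup>2 \<le> 3 * ((2 * q * H1 x)\<^sup>2 + (2 * q * \<kappa> x * sqrt (s1 x))\<^sup>2 + (\<mu> * sqrt (s1 x))\<^sup>2)"
      using three[of "2 * q * H1 x" "2 * q * \<kappa> x * sqrt (s1 x)" "\<mu> * sqrt (s1 x)"]
      by (simp add: k_def algebra_simps)
    also have "\<dots> = 12 * q\<^sup>2 * ((H1 x)\<^sup>2 + (\<kappa> x)\<^sup>2 * s1 x) + 3 * \<mu>\<^sup>2 * s1 x"
      using nn by (simp add: power_mult_distrib algebra_simps)
    finally have "ennreal ((k x)\<^sup>2) \<le> ennreal (12 * q\<^sup>2 * ((H1 x)\<^sup>2 + (\<kappa> x)\<^sup>2 * s1 x) + 3 * \<mu>\<^sup>2 * s1 x)"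
      by (rule ennreal_leI)
    also have "\<dots> = ennreal (12 * q\<^sup>2) * (ennreal ((H1 x)\<^sup>2) + ennreal ((\<kappa> x)\<^sup>2 * s1 x)) + ennreal (3 * \<mu>\<^sup>2) * ennreal (s1 x)"
      using nn by (simp add: ennreal_mult ennreal_plus)
    finally show "ennreal ((k x)\<^sup>2) * indicator S x \<le> ennreal (12 * q\<^sup>2) * (ennreal ((H1 x)\<^sup>2) * indicator S x + ennreal ((\<kappa> x)\<^sup>2 * s1 x) * indicator S x)
       + ennreal (3 * \<mu>\<^sup>2) * (ennreal (s1 x) * indicator S x)"
      by (cases "x \<in> S") auto
  qed
  also have "\<dots> = ennreal (12 * q\<^sup>2) * ((\<integral>\<^sup>+x\<in>S. ennreal ((H1 x)\<^sup>2) \<partial>lborel) + (\<integral>\<^sup>+x\<in>S. ennreal ((\<kappa> x)\<^sup>2 * s1 x) \<partial>lborel))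
       + ennreal (3 * \<mu>\<^sup>2) * (\<integral>\<^sup>+x\<in>S. ennreal (s1 x) \<partial>lborel)"
    by (simp add: nn_integral_add nn_integral_cmult)
  also have "(\<integral>\<^sup>+x\<in>S. ennreal ((H1 x)\<^sup>2) \<partial>lborel) = (\<integral>\<^sup>+x\<in>S. ennreal ((H x)\<^sup>2) \<partial>lborel)"
    by (intro nn_integral_cong) (auto simp: H1_def indicator_def)
  also have "(\<integral>\<^sup>+x\<in>S. ennreal ((\<kappa> x)\<^sup>2 * s1 x) \<partial>lborel) = (\<integral>\<^sup>+x\<in>S. ennreal ((\<kappa> x)\<^sup>2 * s x) \<partial>lborel)"
    by (intro nn_integral_cong) (auto simp: s1_def indicator_def)
  also have "(\<integral>\<^sup>+x\<in>S. ennreal (s1 x) \<partial>lborel) = (\<integral>\<^sup>+x\<in>S. ennreal (s x) \<partial>lborel)"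
    by (intro nn_integral_cong) (auto simp: s1_def indicator_def)
  finally show ?thesis .
qed

text \<open>
  Hoelder's inequality with the exponents \<open>2 / n\<close> and \<open>(n - 2) / n\<close>: the zeroth-order term is bounded
  by the left-hand side of the Sobolev inequality, and can be absorbed when the critical norm is small.
\<close>

lemma hoelder_critical:
  fixes s :: "'b::euclidean_space \<Rightarrow> real"
  defines "n \<equiv> real DIM('b)"
  defines "\<theta> \<equiv> n / (n - 2)"
  assumes dim: "3 \<le> DIM('b)"
    and [measurable]: "S \<in> sets borel" "\<kappa> \<in> borel_measurable borel" and \<kappa>: "\<And>x. 0 \<le> \<kappa> x"
    and adm: "admissible S \<kappa> s s' H"
  shows "(\<integral>\<^sup>+x\<in>S. ennreal ((\<kappa> x)\<^sup>2 * s x) \<partial>lborel)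
      \<le> critical_norm S \<kappa> * epow (\<integral>\<^sup>+x\<in>S. ennreal (s x powr \<theta>) \<partial>lborel) ((n - 2) / n)" (is "?I1")
    and "W \<in> sets borel \<Longrightarrow> W \<subseteq> S \<Longrightarrow> (\<integral>\<^sup>+x\<in>W. ennreal (s x) \<partial>lborel)
      \<le> epow (emeasure lborel W) (2 / n) * epow (\<integral>\<^sup>+x\<in>S. ennreal (s x powr \<theta>) \<partial>lborel) ((n - 2) / n)" (is "_ \<Longrightarrow> _ \<Longrightarrow> ?I2")
proof -
  have n: "3 \<le> n" using dim by (simp add: n_def)
  define s1 where "s1 x = indicator S x * s x" for x
  have [measurable]: "s1 \<in> borel_measurable borel"
    using borel_measurable_continuous_on_indicator[OF _ admissible_continuous[OF adm]]
    by (simp add: s1_def[abs_def])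
  have nn: "0 \<le> s1 x" for x
    using adm by (auto simp: s1_def admissible_def indicator_def)
  have eq: "(\<integral>\<^sup>+x\<in>S. ennreal (s x powr \<theta>) \<partial>lborel) = (\<integral>\<^sup>+x. ennreal (s1 x powr \<theta>) \<partial>lborel)"
    using n by (intro nn_integral_cong) (auto simp: s1_def indicator_def \<theta>_def)
  have es: "epow (ennreal (s1 x powr \<theta>)) ((n - 2) / n) = ennreal (s1 x)" for x
    using n nn[of x] by (simp add: epow_ennreal powr_powr \<theta>_def)
  have H: "(\<integral>\<^sup>+x. epow (f x) (2/n) * epow (ennreal (s1 x powr \<theta>)) ((n - 2) / n) \<partial>lborel)
    \<le> epow (\<integral>\<^sup>+x. f x \<partial>lborel) (2/n) * epow (\<integral>\<^sup>+x. ennreal (s1 x powr \<theta>) \<partial>lborel) ((n - 2) / n)"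
    if "f \<in> borel_measurable borel" for f
    using n that by (intro Hoelder_nn_integral2) (auto simp: field_simps)
  show ?I1
  proof -
    have "(\<integral>\<^sup>+x\<in>S. ennreal ((\<kappa> x)\<^sup>2 * s x) \<partial>lborel) =
      (\<integral>\<^sup>+x. epow (ennreal (\<kappa> x powr n) * indicator S x) (2/n) * epow (ennreal (s1 x powr \<theta>)) ((n - 2) / n) \<partial>lborel)"
    proof (rule nn_integral_cong)
      fix x
      have "epow (ennreal (\<kappa> x powr n)) (2/n) = ennreal ((\<kappa> x)\<^sup>2)"
        using n \<kappa>[of x] by (simp add: epow_ennreal powr_powr)
      moreover have "0 \<le> s x" if "x \<in> S" using adm that by (simp add: admissible_def)
      ultimately show "ennreal ((\<kappa> x)\<^sup>2 * s x) * indicator S x =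
        epow (ennreal (\<kappa> x powr n) * indicator S x) (2/n) * epow (ennreal (s1 x powr \<theta>)) ((n - 2) / n)"
        unfolding es using n by (cases "x \<in> S") (auto simp: s1_def ennreal_mult)
    qed
    also have "\<dots> \<le> epow (\<integral>\<^sup>+x\<in>S. ennreal (\<kappa> x powr n) \<partial>lborel) (2/n) * epow (\<integral>\<^sup>+x. ennreal (s1 x powr \<theta>) \<partial>lborel) ((n - 2) / n)"
      by (rule H) measurable
    finally show ?thesis unfolding critical_norm_def n_def[symmetric] eq .
  qed
  show ?I2 if [measurable]: "W \<in> sets borel" and W: "W \<subseteq> S"
  proof -
    have "(\<integral>\<^sup>+x\<in>W. ennreal (s x) \<partial>lborel) =
      (\<integral>\<^sup>+x. epow (indicator W x) (2/n) * epow (ennreal (s1 x powr \<theta>)) ((n - 2) / n) \<partial>lborel)"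
    proof (rule nn_integral_cong)
      fix x
      have "epow 1 (2/n) = 1" using n epow_ennreal[of "2/n" 1] by simp
      then show "ennreal (s x) * indicator W x =
        epow (indicator W x) (2/n) * epow (ennreal (s1 x powr \<theta>)) ((n - 2) / n)"
        unfolding es using n W by (cases "x \<in> W") (auto simp: s1_def)
    qed
    also have "\<dots> \<le> epow (\<integral>\<^sup>+x. indicator W x \<partial>lborel) (2/n) * epow (\<integral>\<^sup>+x. ennreal (s1 x powr \<theta>) \<partial>lborel) ((n - 2) / n)"
      by (rule H) measurable
    finally show ?thesis by (simp add: eq)
  qed
qed

lemma ennreal_mult_collect: "0 \<le> x \<Longrightarrow> 0 \<le> y \<Longrightarrow> ennreal x * (ennreal y * u) = ennreal (x * y) * u"
  by (simp add: ennreal_mult mult.assoc)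

lemma absorb_half:
  fixes a u :: ennreal
  assumes "a \<le> u + ennreal (1/2) * a" "a < top"
  shows "a \<le> 2 * u"
proof (cases u)
  case (real r)
  obtain x where x: "a = ennreal x" "0 \<le> x" using assms(2) by (cases a) auto
  have "ennreal x \<le> ennreal (r + x / 2)"
  proof -
    have "ennreal (1/2) * ennreal x = ennreal (1/2 * x)" using x by (intro ennreal_mult[symmetric]) auto
    then show ?thesis using assms(1) real x by (simp only: ennreal_plus) simp
  qed
  then have "x \<le> r + x / 2" using real x by (subst (asm) ennreal_le_iff) auto
  then have "x \<le> 2 * r" by simp
  then have "ennreal x \<le> ennreal (2 * r)" by (rule ennreal_leI)
  then show ?thesis using real x by (simp add: ennreal_mult')
qed (simp add: ennreal_mult_top)

lemma nn_integral_lborel_shift: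
  fixes c :: "'b::euclidean_space"
  assumes [measurable]: "f \<in> borel_measurable borel"
  shows "(\<integral>\<^sup>+x. f (x + c) \<partial>lborel) = (\<integral>\<^sup>+x. f x \<partial>lborel)"
proof -
  have "(\<integral>\<^sup>+x. f x \<partial>lborel) = (\<integral>\<^sup>+x. f x \<partial>distr lborel borel ((+) c))"
    by (simp add: lborel_distr_plus)
  also have "\<dots> = (\<integral>\<^sup>+x. f (c + x) \<partial>lborel)" by (subst nn_integral_distr) auto
  finally show ?thesis by (simp add: add.commute)
qed

text \<open>
  By Tonelli's theorem and translation invariance, the time that the ray from \<open>x\<close> spends in \<open>A\<close>, integrated
  over the \<open>x\<close> in a ball of radius \<open>R\<close>, is at most \<open>2 R\<close> times the measure of \<open>A\<close>. Hence it is finite for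
  almost every \<open>x\<close>.
\<close>

lemma AE_ray_escapes:
  fixes A :: "'b::euclidean_space set"
  assumes [measurable]: "A \<in> sets borel" and fin: "emeasure lborel A < top" and v: "norm v = 1"
  shows "AE x in lborel. \<exists>\<tau>\<ge>0. x + \<tau> *\<^sub>R v \<notin> A"
proof -
  have "AE x in lborel. x \<in> {x. norm x < real R} \<longrightarrow> (\<exists>\<tau>\<ge>0. x + \<tau> *\<^sub>R v \<notin> A)" for R :: nat
  proof -
    define G where "G x \<tau> = (indicator A (x + \<tau> *\<^sub>R v) * indicator ({x. norm x < real R}) x * indicator {0..} \<tau> :: ennreal)" for x :: 'b and \<tau> :: real
    have [measurable]: "(\<lambda>(x, \<tau>). G x \<tau>) \<in> borel_measurable (lborel \<Otimes>\<^sub>M lborel)"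
      unfolding G_def by measurable
    have "(\<integral>\<^sup>+x. \<integral>\<^sup>+\<tau>. G x \<tau> \<partial>lborel \<partial>lborel) = (\<integral>\<^sup>+\<tau>. \<integral>\<^sup>+x. G x \<tau> \<partial>lborel \<partial>lborel)"
      by (rule lborel_pair.Fubini'[symmetric]) measurable
    also have "\<dots> = (\<integral>\<^sup>+\<tau>. \<integral>\<^sup>+y. indicator A y * indicator ({x. norm x < real R}) (y - \<tau> *\<^sub>R v) * indicator {0..} \<tau> \<partial>lborel \<partial>lborel)"
    proof (rule nn_integral_cong)
      fix \<tau> :: real
      show "(\<integral>\<^sup>+x. G x \<tau> \<partial>lborel) = (\<integral>\<^sup>+y. indicator A y * indicator ({x. norm x < real R}) (y - \<tau> *\<^sub>R v) * indicator {0..} \<tau> \<partial>lborel)"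
        by (subst nn_integral_lborel_shift[of _ "\<tau> *\<^sub>R v", symmetric]) (auto simp: G_def)
    qed
    also have "\<dots> = (\<integral>\<^sup>+y. \<integral>\<^sup>+\<tau>. indicator A y * indicator ({x. norm x < real R}) (y - \<tau> *\<^sub>R v) * indicator {0..} \<tau> \<partial>lborel \<partial>lborel)"
      by (rule lborel_pair.Fubini') measurable
    also have "\<dots> \<le> (\<integral>\<^sup>+y. ennreal (2 * real R) * indicator A y \<partial>lborel)"
    proof (rule nn_integral_mono)
      fix y :: 'b
      have "(\<integral>\<^sup>+\<tau>. indicator A y * indicator ({x. norm x < real R}) (y - \<tau> *\<^sub>R v) * indicator {0..} \<tau> \<partial>lborel)
        \<le> (\<integral>\<^sup>+\<tau>. indicator A y * indicator {y \<bullet> v - real R .. y \<bullet> v + real R} \<tau> \<partial>lborel)"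
      proof (rule nn_integral_mono)
        fix \<tau> :: real
        have "\<tau> \<in> {y \<bullet> v - real R .. y \<bullet> v + real R}" if "y - \<tau> *\<^sub>R v \<in> {x. norm x < real R}"
        proof -
          have "\<bar>(y - \<tau> *\<^sub>R v) \<bullet> v\<bar> \<le> norm (y - \<tau> *\<^sub>R v) * norm v" by (rule Cauchy_Schwarz_ineq2)
          moreover have "v \<bullet> v = 1" using v by (simp add: dot_square_norm)
          ultimately show ?thesis using that v by (auto simp: inner_diff_left)
        qed
        then show "indicator A y * indicator ({x. norm x < real R}) (y - \<tau> *\<^sub>R v) * indicator {0..} \<tau>
           \<le> (indicator A y * indicator {y \<bullet> v - real R .. y \<bullet> v + real R} \<tau> :: ennreal)"
          by (auto simp: indicator_def)
      qed
      also have "\<dots> = ennreal (2 * real R) * indicator A y"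
        by (subst nn_integral_cmult) (auto simp: mult.commute)
      finally show "(\<integral>\<^sup>+\<tau>. indicator A y * indicator ({x. norm x < real R}) (y - \<tau> *\<^sub>R v) * indicator {0..} \<tau> \<partial>lborel)
        \<le> ennreal (2 * real R) * indicator A y" .
    qed
    also have "\<dots> = ennreal (2 * real R) * emeasure lborel A"
      by (simp add: nn_integral_cmult)
    also have "\<dots> < top" using fin by (simp add: ennreal_mult_less_top)
    finally have "AE x in lborel. (\<integral>\<^sup>+\<tau>. G x \<tau> \<partial>lborel) \<noteq> \<infinity>"
      by (intro nn_integral_PInf_AE) auto
    then show ?thesis
    proof eventually_elim
      case (elim x)
      show ?case
      proof (rule impI, rule ccontr)
        assume x: "x \<in> {x. norm x < real R}" and "\<not> (\<exists>\<tau>\<ge>0. x + \<tau> *\<^sub>R v \<notin> A)"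
        then have all: "x + \<tau> *\<^sub>R v \<in> A" if "0 \<le> \<tau>" for \<tau> using that by auto
        have "of_nat k \<le> (\<integral>\<^sup>+\<tau>. G x \<tau> \<partial>lborel)" for k :: nat
        proof -
          have "of_nat k = (\<integral>\<^sup>+\<tau>. indicator {0..real k} \<tau> \<partial>lborel)" by (simp add: ennreal_of_nat_eq_real_of_nat)
          also have "\<dots> \<le> (\<integral>\<^sup>+\<tau>. G x \<tau> \<partial>lborel)"
            using x all by (intro nn_integral_mono) (auto simp: G_def indicator_def)
          finally show ?thesis .
        qed
        then have "(\<integral>\<^sup>+\<tau>. G x \<tau> \<partial>lborel) = top"
          by (metis ennreal_Ex_less_of_nat leD top.not_eq_extremum)
        with elim show False by simp
      qed
    qed
  qed
  then have "AE x in lborel. \<forall>R::nat. x \<in> {x. norm x < real R} \<longrightarrow> (\<exists>\<tau>\<ge>0. x + \<tau> *\<^sub>R v \<notin> A)"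
    unfolding AE_all_countable by blast
  then show ?thesis
  proof eventually_elim
    case (elim x)
    obtain R :: nat where "norm x < real R" using reals_Archimedean2 by blast
    then show ?case using elim by auto
  qed
qed

section \<open>Exterior domains\<close>

text \<open>
  The exterior of a cube rather than of a ball: from each of its points one can move away from the origin
  in every coordinate direction without leaving it.
\<close>

definition cube_exterior :: "real \<Rightarrow> 'b::euclidean_space set" where
  "cube_exterior R = {x. \<exists>b\<in>Basis. R < \<bar>x \<bullet> b\<bar>}"

lemma open_cube_exterior: "open (cube_exterior R :: 'b::euclidean_space set)"
proof -
  have "(cube_exterior R :: 'b set) = (\<Union>b\<in>Basis. {x. R < \<bar>x \<bullet> b\<bar>})" by (auto simp: cube_exterior_def)
  then show ?thesis by (simp only:) (intro open_UN ballI open_Collect_less continuous_intros)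
qed

lemma cube_exterior_ray:
  assumes "x \<in> cube_exterior R" "b \<in> Basis" "(0 \<le> x \<bullet> b \<and> 0 \<le> r) \<or> (x \<bullet> b \<le> 0 \<and> r \<le> 0)"
  shows "x + r *\<^sub>R b \<in> cube_exterior R"
proof -
  obtain b' where b': "b' \<in> Basis" "R < \<bar>x \<bullet> b'\<bar>" using assms(1) by (auto simp: cube_exterior_def)
  have "\<bar>x \<bullet> b'\<bar> \<le> \<bar>(x + r *\<^sub>R b) \<bullet> b'\<bar>"
    using assms(2,3) b' by (cases "b = b'") (auto simp: inner_add_left inner_Basis)
  then show ?thesis using b' by (force simp: cube_exterior_def)
qed

text \<open>
  A Sobolev inequality without any boundary condition on the cube, because only half-lines that lead away
  from it are used. Along almost all of them \<open>s\<close> has a zero far out, since its support has finite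
  measure. The zeroth-order term is absorbed.
\<close>

lemma exterior_estimate:
  fixes s :: "'b::euclidean_space \<Rightarrow> real"
  assumes dim: "3 \<le> DIM('b)"
    and [measurable]: "\<kappa> \<in> borel_measurable borel" and \<kappa>: "\<And>x. 0 \<le> \<kappa> x"
    and small: "small_on (cube_exterior R) \<kappa>"
    and adm: "admissible (cube_exterior R) \<kappa> s s' H"
    and bdd: "\<And>x. x \<in> cube_exterior R \<Longrightarrow> s x \<le> M"
    and supp: "emeasure lborel {x \<in> cube_exterior R. s x \<noteq> 0} < top"
    and W: "W \<in> sets borel" "W \<subseteq> cube_exterior R"
  shows "(\<integral>\<^sup>+x\<in>W. ennreal (s x) \<partial>lborel) \<le> epow (emeasure lborel W) (2 / real DIM('b)) *
     (ennreal (24 * (sob_q TYPE('b))\<^sup>2) * (\<integral>\<^sup>+x\<in>cube_exterior R. ennreal ((H x)\<^sup>2) \<partial>lborel))"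
proof -
  define n where "n = real DIM('b)"
  define q where "q = sob_q TYPE('b)"
  define \<theta> where "\<theta> = n / (n - 2)"
  define S where "S = (cube_exterior R :: 'b set)"
  have n: "3 \<le> n" using dim by (simp add: n_def)
  have q: "1 < q" using sob_facts(1)[OF dim] by (simp add: q_def)
  have [measurable]: "S \<in> sets borel" by (simp add: S_def open_cube_exterior)
  note adm = adm[folded S_def]
  have cs: "continuous_on S s" by (rule admissible_continuous[OF adm])
  have s0: "0 \<le> s x" if "x \<in> S" for x using adm that by (simp add: admissible_def)
  define Z where "Z = {x \<in> S. s x \<noteq> 0}"
  have Z[measurable]: "Z \<in> sets borel"
  proof -
    have "openin (top_of_set S) (S \<inter> s -` (- {0}))"
      by (rule continuous_openin_preimage_gen[OF cs]) auto
    then have "open (S \<inter> s -` (- {0}))"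
      using openin_open_trans open_cube_exterior S_def by blast
    moreover have "S \<inter> s -` (- {0}) = Z" by (auto simp: Z_def)
    ultimately show ?thesis by simp
  qed
  have Zfin: "emeasure lborel Z < top" using supp by (simp add: Z_def S_def)
  let ?A = "\<integral>\<^sup>+x\<in>S. ennreal (s x powr \<theta>) \<partial>lborel"
  have fin: "?A < top"
  proof -
    have "?A \<le> (\<integral>\<^sup>+x. ennreal (M powr \<theta>) * indicator Z x \<partial>lborel)"
      using s0 bdd n by (intro nn_integral_mono)
        (auto simp: indicator_def Z_def S_def \<theta>_def intro!: ennreal_leI powr_mono2)
    also have "\<dots> = ennreal (M powr \<theta>) * emeasure lborel Z" by (simp add: nn_integral_cmult)
    also have "\<dots> < top" using Zfin by (simp add: ennreal_mult_less_top)
    finally show ?thesis .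
  qed
  have "AE x in lborel. \<forall>b\<in>Basis. (\<exists>\<tau>\<ge>0. x + \<tau> *\<^sub>R b \<notin> Z) \<and> (\<exists>\<tau>\<ge>0. x + \<tau> *\<^sub>R (- b) \<notin> Z)"
  proof -
    have "AE x in lborel. (\<exists>\<tau>\<ge>0. x + \<tau> *\<^sub>R b \<notin> Z) \<and> (\<exists>\<tau>\<ge>0. x + \<tau> *\<^sub>R (- b) \<notin> Z)" if "b \<in> Basis" for b
      using AE_ray_escapes[OF Z Zfin, of b] AE_ray_escapes[OF Z Zfin, of "- b"] that by auto
    then show ?thesis by (subst AE_ball_countable) (auto intro: countable_finite)
  qed
  then have line: "AE x in lborel. x \<in> S \<longrightarrow> (\<forall>b\<in>Basis. ennreal (s x powr q) \<le>
        (\<integral>\<^sup>+t. ennreal (q * s (x + (t - x \<bullet> b) *\<^sub>R b) powr (q - 1) * \<bar>s' (x + (t - x \<bullet> b) *\<^sub>R b) b\<bar>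
               + 0 * s (x + (t - x \<bullet> b) *\<^sub>R b) powr q) *
            indicator S (x + (t - x \<bullet> b) *\<^sub>R b) \<partial>lborel))"
  proof eventually_elim
    case (elim x)
    show ?case
    proof (intro impI ballI)
      fix b :: 'b assume x: "x \<in> S" and b: "b \<in> Basis"
      define z where "z = x - (x \<bullet> b) *\<^sub>R b"
      have y: "x + (t - x \<bullet> b) *\<^sub>R b = z + t *\<^sub>R b" for t by (simp add: z_def algebra_simps)
      obtain t0 t1 where t: "t0 \<le> t1" "\<And>t. t \<in> {t0..t1} \<Longrightarrow> z + t *\<^sub>R b \<in> S"
        and e: "(t0 = x \<bullet> b \<and> s (z + t1 *\<^sub>R b) = 0) \<or> (t1 = x \<bullet> b \<and> s (z + t0 *\<^sub>R b) = 0)"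
      proof (cases "0 \<le> x \<bullet> b")
        case True
        obtain \<tau> where \<tau>: "0 \<le> \<tau>" "x + \<tau> *\<^sub>R b \<notin> Z" using elim b by auto
        have *: "z + t *\<^sub>R b \<in> S" if "t \<in> {x \<bullet> b .. x \<bullet> b + \<tau>}" for t
          unfolding y[symmetric] using x b that True unfolding S_def by (intro cube_exterior_ray) auto
        moreover have eq: "z + (x \<bullet> b + \<tau>) *\<^sub>R b = x + \<tau> *\<^sub>R b" by (simp add: z_def algebra_simps)
        ultimately have "s (z + (x \<bullet> b + \<tau>) *\<^sub>R b) = 0"
          using \<tau> by (force simp: Z_def simp flip: eq)
        then show ?thesis
          using that[of "x \<bullet> b" "x \<bullet> b + \<tau>"] \<tau>(1) * by auto
      next
        case False
        obtain \<tau> where \<tau>: "0 \<le> \<tau>" "x + \<tau> *\<^sub>R (- b) \<notin> Z" using elim b by auto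
        have *: "z + t *\<^sub>R b \<in> S" if "t \<in> {x \<bullet> b - \<tau> .. x \<bullet> b}" for t
          unfolding y[symmetric] using x b that False unfolding S_def by (intro cube_exterior_ray) auto
        moreover have eq: "z + (x \<bullet> b - \<tau>) *\<^sub>R b = x + \<tau> *\<^sub>R (- b)" by (simp add: z_def algebra_simps)
        ultimately have "s (z + (x \<bullet> b - \<tau>) *\<^sub>R b) = 0"
          using \<tau> by (force simp: Z_def simp flip: eq)
        then show ?thesis
          using that[of "x \<bullet> b - \<tau>" "x \<bullet> b"] \<tau>(1) * by auto
      qed
      have x_eq: "z + (x \<bullet> b) *\<^sub>R b = x" by (simp add: z_def)
      have "ennreal (s x powr q) = ennreal \<bar>s (z + t1 *\<^sub>R b) powr q - s (z + t0 *\<^sub>R b) powr q\<bar>"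
        using e x_eq q by auto
      also have "\<dots> \<le> (\<integral>\<^sup>+t\<in>{t0..t1}. ennreal \<bar>q * s (z + t *\<^sub>R b) powr (q - 1) * s' (z + t *\<^sub>R b) b\<bar> \<partial>lborel)"
      proof (rule line_increment_le[OF t(2) t(1), where f="\<lambda>x. s x powr q" and f'="\<lambda>x v. q * s x powr (q - 1) * s' x v"])
        show "((\<lambda>x. s x powr q) has_derivative (\<lambda>v. q * s x powr (q - 1) * s' x v)) (at x within S)" if "x \<in> S" for x
          using adm that q by (intro has_derivative_powr_nonneg) (auto simp: admissible_def)
        show "continuous_on S (\<lambda>x. q * s x powr (q - 1) * s' x b)"
          using adm b q s0 cs by (auto simp: admissible_def intro!: continuous_intros continuous_on_powr')
      qed
      also have "\<dots> \<le> (\<integral>\<^sup>+t. ennreal (q * s (x + (t - x \<bullet> b) *\<^sub>R b) powr (q - 1) * \<bar>s' (x + (t - x \<bullet> b) *\<^sub>R b) b\<bar>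
               + 0 * s (x + (t - x \<bullet> b) *\<^sub>R b) powr q) * indicator S (x + (t - x \<bullet> b) *\<^sub>R b) \<partial>lborel)"
        unfolding y using t(2) q by (intro nn_integral_mono) (auto simp: indicator_def abs_mult)
      finally show "ennreal (s x powr q) \<le> (\<integral>\<^sup>+t. ennreal (q * s (x + (t - x \<bullet> b) *\<^sub>R b) powr (q - 1) * \<bar>s' (x + (t - x \<bullet> b) *\<^sub>R b) b\<bar>
               + 0 * s (x + (t - x \<bullet> b) *\<^sub>R b) powr q) * indicator S (x + (t - x \<bullet> b) *\<^sub>R b) \<partial>lborel)" .
    qed
  qed
  define A' where "A' = epow ?A ((n - 2) / n)"
  define h where "h = (\<integral>\<^sup>+x\<in>S. ennreal ((H x)\<^sup>2) \<partial>lborel)"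
  have A'fin: "A' < top" using fin by (cases ?A) (auto simp: A'_def epow_def)
  have "A' \<le> ennreal (12 * q\<^sup>2) * (h + (\<integral>\<^sup>+x\<in>S. ennreal ((\<kappa> x)\<^sup>2 * s x) \<partial>lborel))"
    using sobolev_admissible[OF dim, of S \<kappa> 0 s s' H] adm \<kappa> fin line
    by (simp add: A'_def h_def n_def \<theta>_def q_def)
  also have "\<dots> \<le> ennreal (12 * q\<^sup>2) * (h + critical_norm S \<kappa> * A')"
    unfolding A'_def \<theta>_def n_def using \<kappa> adm dim
    by (intro mult_left_mono add_left_mono hoelder_critical) auto
  also have "\<dots> = ennreal (12 * q\<^sup>2) * h + (ennreal (12 * q\<^sup>2) * critical_norm S \<kappa>) * A'"
    by (simp add: algebra_simps)
  also have "\<dots> \<le> ennreal (12 * q\<^sup>2) * h + ennreal (1/2) * A'"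
  proof (intro add_left_mono mult_right_mono)
    have "ennreal (12 * q\<^sup>2) * critical_norm S \<kappa> \<le> ennreal (sob_const TYPE('b)) * critical_norm S \<kappa>"
      by (intro mult_right_mono ennreal_leI) (auto simp: sob_const_def q_def)
    also have "\<dots> \<le> ennreal (1/2)" using small by (simp add: small_on_def S_def)
    finally show "ennreal (12 * q\<^sup>2) * critical_norm S \<kappa> \<le> ennreal (1/2)" .
  qed auto
  finally have "A' \<le> 2 * (ennreal (12 * q\<^sup>2) * h)" by (rule absorb_half[OF _ A'fin])
  also have "\<dots> = ennreal (24 * q\<^sup>2) * h"
    by (simp add: mult.assoc[symmetric] flip: ennreal_mult' ennreal_numeral)
  finally have A': "A' \<le> ennreal (24 * q\<^sup>2) * h" .
  have "(\<integral>\<^sup>+x\<in>W. ennreal (s x) \<partial>lborel) \<le> epow (emeasure lborel W) (2 / n) * A'"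
    unfolding A'_def \<theta>_def n_def using W \<kappa> adm dim by (intro hoelder_critical(2)[where \<kappa>=\<kappa>]) (auto simp: S_def open_cube_exterior)
  also have "\<dots> \<le> epow (emeasure lborel W) (2 / n) * (ennreal (24 * q\<^sup>2) * h)"
    using A' by (rule mult_left_mono) simp
  finally show ?thesis by (simp add: n_def q_def h_def S_def)
qed

section \<open>Propagation of bounds through cubes\<close>

lemma ennreal_le_plus_diff:
  assumes "0 \<le> b"
  shows "ennreal a \<le> ennreal b + ennreal \<bar>a - b\<bar>"
proof -
  have "ennreal a \<le> ennreal (b + \<bar>a - b\<bar>)" by (rule ennreal_leI) simp
  also have "\<dots> = ennreal b + ennreal \<bar>a - b\<bar>" using assms by (intro ennreal_plus) auto
  finally show ?thesis .
qed

text \<open>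
  The fundamental theorem of calculus on the coordinate line through \<open>x\<close>, averaged over the starting
  point.
\<close>

lemma box_line_bound:
  fixes f :: "'b::euclidean_space \<Rightarrow> real"
  assumes l: "0 < l" "l \<le> c \<bullet> b - a \<bullet> b" and b: "b \<in> Basis" and x: "x \<in> cbox a c"
    and D: "\<And>x. x \<in> cbox a c \<Longrightarrow> (f has_derivative f' x) (at x within cbox a c)"
    and C: "continuous_on (cbox a c) (\<lambda>x. f' x b)"
    and nn: "\<And>x. x \<in> cbox a c \<Longrightarrow> 0 \<le> f x"
  shows "ennreal (f x) \<le> (\<integral>\<^sup>+t. ennreal (\<bar>f' (x + (t - x \<bullet> b) *\<^sub>R b) b\<bar> + 1 / l * f (x + (t - x \<bullet> b) *\<^sub>R b)) *
      indicator (cbox a c) (x + (t - x \<bullet> b) *\<^sub>R b) \<partial>lborel)"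
proof -
  define z where "z = x - (x \<bullet> b) *\<^sub>R b"
  have y: "x + (t - x \<bullet> b) *\<^sub>R b = z + t *\<^sub>R b" for t by (simp add: z_def algebra_simps)
  define I where "I = {a \<bullet> b .. c \<bullet> b}"
  have zI: "z + t *\<^sub>R b \<in> cbox a c \<longleftrightarrow> t \<in> I" for t
  proof -
    have "(z + t *\<^sub>R b) \<bullet> i = (if i = b then t else x \<bullet> i)" if "i \<in> Basis" for i
      using b that by (auto simp: z_def inner_diff_left inner_add_left inner_Basis)
    then show ?thesis using x b by (auto simp: mem_box I_def split: if_splits)
  qed
  have x_eq: "z + (x \<bullet> b) *\<^sub>R b = x" by (simp add: z_def)
  have xI: "x \<bullet> b \<in> I" using x b by (auto simp: mem_box I_def)
  have cf: "continuous_on (cbox a c) f" using D by (rule has_derivative_continuous_on)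
  have aff: "continuous_on I (\<lambda>t. z + t *\<^sub>R b)" by (intro continuous_intros)
  have cl: "continuous_on I (\<lambda>t. f (z + t *\<^sub>R b))" "continuous_on I (\<lambda>t. f' (z + t *\<^sub>R b) b)"
    by (rule continuous_on_compose2[OF cf aff] continuous_on_compose2[OF C aff]; auto simp: zI)+
  have [measurable]: "I \<in> sets borel" by (simp add: I_def)
  define F where "F t = indicator I t *\<^sub>R f (z + t *\<^sub>R b)" for t
  define G where "G t = indicator I t *\<^sub>R f' (z + t *\<^sub>R b) b" for t
  have [measurable]: "F \<in> borel_measurable borel" "G \<in> borel_measurable borel"
    using cl unfolding F_def[abs_def] G_def[abs_def]
    by (auto intro!: borel_measurable_continuous_on_indicator simp del: real_scaleR_def)
  define J where "J = (\<integral>\<^sup>+t\<in>I. ennreal \<bar>G t\<bar> \<partial>lborel)"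
  define L where "L = c \<bullet> b - a \<bullet> b"
  have L: "0 < L" "l \<le> L" using l by (auto simp: L_def)
  have emI: "emeasure lborel I = ennreal L" using L by (simp add: I_def L_def)
  have step: "ennreal (f x) \<le> ennreal (F t) + J" if t: "t \<in> I" for t
  proof -
    define t0 where "t0 = min t (x \<bullet> b)"
    define t1 where "t1 = max t (x \<bullet> b)"
    have sub: "{t0..t1} \<subseteq> I" using t xI by (auto simp: t0_def t1_def I_def)
    have "ennreal \<bar>f (z + t1 *\<^sub>R b) - f (z + t0 *\<^sub>R b)\<bar> \<le> (\<integral>\<^sup>+t\<in>{t0..t1}. ennreal \<bar>f' (z + t *\<^sub>R b) b\<bar> \<partial>lborel)"
      by (rule line_increment_le[OF _ _ D C]) (use sub zI in \<open>auto simp: t0_def t1_def\<close>)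
    also have "\<dots> \<le> J"
      unfolding J_def using sub by (intro nn_integral_mono) (auto simp: G_def indicator_def)
    finally have "ennreal \<bar>f x - f (z + t *\<^sub>R b)\<bar> \<le> J"
      using x_eq by (auto simp: t0_def t1_def min_def max_def abs_minus_commute split: if_splits)
    moreover have "ennreal (f x) \<le> ennreal (f (z + t *\<^sub>R b)) + ennreal \<bar>f x - f (z + t *\<^sub>R b)\<bar>"
      using nn[of "z + t *\<^sub>R b"] t by (intro ennreal_le_plus_diff) (simp add: zI)
    ultimately show ?thesis using t by (auto simp: F_def intro: order_trans add_left_mono)
  qed
  have "ennreal L * ennreal (f x) = (\<integral>\<^sup>+t\<in>I. ennreal (f x) \<partial>lborel)"
    by (simp add: nn_integral_cmult emI mult.commute)
  also have "\<dots> \<le> (\<integral>\<^sup>+t\<in>I. (ennreal (F t) + J) \<partial>lborel)"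
    using step by (intro nn_integral_mono) (auto simp: indicator_def)
  also have "\<dots> = (\<integral>\<^sup>+t. ennreal (F t) * indicator I t + J * indicator I t \<partial>lborel)"
    by (intro nn_integral_cong) (simp add: algebra_simps)
  also have "\<dots> = (\<integral>\<^sup>+t\<in>I. ennreal (F t) \<partial>lborel) + ennreal L * J"
    by (simp add: nn_integral_add nn_integral_cmult emI mult.commute)
  finally have "ennreal (1/L) * (ennreal L * ennreal (f x)) \<le> ennreal (1/L) * ((\<integral>\<^sup>+t\<in>I. ennreal (F t) \<partial>lborel) + ennreal L * J)"
    by (rule mult_left_mono) simp
  moreover have "ennreal (1/L) * (ennreal L * u) = u" for u
    using L by (simp add: mult.assoc[symmetric] flip: ennreal_mult)
  ultimately have "ennreal (f x) \<le> ennreal (1/L) * (\<integral>\<^sup>+t\<in>I. ennreal (F t) \<partial>lborel) + J"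
    by (simp add: distrib_left)
  also have "\<dots> \<le> ennreal (1/l) * (\<integral>\<^sup>+t\<in>I. ennreal (F t) \<partial>lborel) + J"
    using L l by (intro add_right_mono mult_right_mono ennreal_leI) (auto simp: field_simps)
  also have "\<dots> = (\<integral>\<^sup>+t. ennreal (1/l) * (ennreal (F t) * indicator I t) + ennreal \<bar>G t\<bar> * indicator I t \<partial>lborel)"
    unfolding J_def by (simp add: nn_integral_add nn_integral_cmult)
  also have "\<dots> = (\<integral>\<^sup>+t. ennreal (\<bar>f' (z + t *\<^sub>R b) b\<bar> + 1 / l * f (z + t *\<^sub>R b)) * indicator (cbox a c) (z + t *\<^sub>R b) \<partial>lborel)"
  proof (rule nn_integral_cong)
    fix t
    show "ennreal (1/l) * (ennreal (F t) * indicator I t) + ennreal \<bar>G t\<bar> * indicator I t =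
       ennreal (\<bar>f' (z + t *\<^sub>R b) b\<bar> + 1 / l * f (z + t *\<^sub>R b)) * indicator (cbox a c) (z + t *\<^sub>R b)"
    proof (cases "t \<in> I")
      case True
      then have m: "z + t *\<^sub>R b \<in> cbox a c" by (simp add: zI)
      have "ennreal (1/l) * ennreal (f (z + t *\<^sub>R b)) = ennreal (1 / l * f (z + t *\<^sub>R b))"
        using l nn[OF m] by (intro ennreal_mult[symmetric]) auto
      then have "ennreal (1/l) * ennreal (f (z + t *\<^sub>R b)) + ennreal \<bar>f' (z + t *\<^sub>R b) b\<bar> =
         ennreal (\<bar>f' (z + t *\<^sub>R b) b\<bar> + 1 / l * f (z + t *\<^sub>R b))"
        using l nn[OF m] by (simp add: add.commute flip: ennreal_plus)
      then show ?thesis using True m by (simp add: F_def G_def)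
    qed (simp add: zI)
  qed
  finally show ?thesis unfolding y .
qed

text \<open>
  A Poincare inequality in one coordinate direction: a point of \<open>D\<close> outside \<open>U\<close> is reached from a point
  of \<open>U\<close> along a segment in the direction \<open>b\<close>.
\<close>

lemma doubling_translate:
  fixes s :: "'b::euclidean_space \<Rightarrow> real"
  assumes conv: "convex D" and [measurable]: "D \<in> sets borel" "U \<in> sets borel" and U: "U \<subseteq> D"
    and cov: "D \<subseteq> U \<union> (\<lambda>x. x + \<tau> *\<^sub>R b) ` U"
    and Dv: "\<And>x. x \<in> D \<Longrightarrow> (s has_derivative s' x) (at x within D)"
    and C: "continuous_on D (\<lambda>x. s' x b)"
    and nn: "\<And>x. x \<in> D \<Longrightarrow> 0 \<le> s x"
  shows "(\<integral>\<^sup>+x\<in>D. ennreal (s x) \<partial>lborel) \<le> 2 * (\<integral>\<^sup>+x\<in>U. ennreal (s x) \<partial>lborel)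
      + ennreal \<bar>\<tau>\<bar> * (\<integral>\<^sup>+x\<in>D. ennreal \<bar>s' x b\<bar> \<partial>lborel)"
proof -
  define s1 where "s1 x = indicator D x *\<^sub>R s x" for x
  define g where "g x = indicator D x *\<^sub>R s' x b" for x
  have cs: "continuous_on D s" using Dv by (rule has_derivative_continuous_on)
  have [measurable]: "s1 \<in> borel_measurable borel" "g \<in> borel_measurable borel"
    using cs C unfolding s1_def[abs_def] g_def[abs_def]
    by (auto intro!: borel_measurable_continuous_on_indicator simp del: real_scaleR_def)
  define I where "I = {min 0 \<tau>..max 0 \<tau>}"
  have [measurable]: "I \<in> sets borel" by (simp add: I_def)
  have emI: "emeasure lborel I = ennreal \<bar>\<tau>\<bar>" by (auto simp: I_def min_def max_def)
  have pt: "ennreal (s1 (x + \<tau> *\<^sub>R b)) \<le> ennreal (s1 x) + (\<integral>\<^sup>+t\<in>I. ennreal \<bar>g (x + t *\<^sub>R b)\<bar> \<partial>lborel)" if x: "x \<in> D" for x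
  proof (cases "x + \<tau> *\<^sub>R b \<in> D")
    case True
    have seg: "x + t *\<^sub>R b \<in> D" if t: "t \<in> I" for t
    proof (cases "\<tau> = 0")
      case False
      have "0 \<le> t / \<tau>" "t / \<tau> \<le> 1" using t False by (auto simp: I_def min_def max_def divide_simps split: if_splits)
      then have "(1 - t / \<tau>) *\<^sub>R x + (t / \<tau>) *\<^sub>R (x + \<tau> *\<^sub>R b) \<in> D"
        using x True by (intro convexD_alt[OF conv]) auto
      then show ?thesis using False by (simp add: algebra_simps)
    qed (use t x in \<open>auto simp: I_def\<close>)
    have "ennreal \<bar>s (x + max 0 \<tau> *\<^sub>R b) - s (x + min 0 \<tau> *\<^sub>R b)\<bar> \<le> (\<integral>\<^sup>+t\<in>I. ennreal \<bar>s' (x + t *\<^sub>R b) b\<bar> \<partial>lborel)"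
      unfolding I_def by (rule line_increment_le[OF seg[unfolded I_def] _ Dv C]) auto
    also have "\<dots> = (\<integral>\<^sup>+t\<in>I. ennreal \<bar>g (x + t *\<^sub>R b)\<bar> \<partial>lborel)"
      using seg by (intro nn_integral_cong) (auto simp: g_def indicator_def)
    finally have "ennreal \<bar>s (x + \<tau> *\<^sub>R b) - s x\<bar> \<le> (\<integral>\<^sup>+t\<in>I. ennreal \<bar>g (x + t *\<^sub>R b)\<bar> \<partial>lborel)"
      by (auto simp: min_def max_def abs_minus_commute split: if_splits)
    moreover have "ennreal (s (x + \<tau> *\<^sub>R b)) \<le> ennreal (s x) + ennreal \<bar>s (x + \<tau> *\<^sub>R b) - s x\<bar>"
      using nn[OF x] by (rule ennreal_le_plus_diff)
    ultimately show ?thesis using x True by (auto simp: s1_def intro: order_trans add_left_mono)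
  qed (simp add: s1_def)
  have "(\<integral>\<^sup>+x\<in>D. ennreal (s x) \<partial>lborel) \<le> (\<integral>\<^sup>+x. ennreal (s1 x) * indicator U x + ennreal (s1 x) * indicator U (x - \<tau> *\<^sub>R b) \<partial>lborel)"
  proof (rule nn_integral_mono)
    fix x
    have "x \<in> U \<or> x - \<tau> *\<^sub>R b \<in> U" if "x \<in> D" using cov that by auto
    then show "ennreal (s x) * indicator D x \<le> ennreal (s1 x) * indicator U x + ennreal (s1 x) * indicator U (x - \<tau> *\<^sub>R b)"
      by (auto simp: s1_def indicator_def)
  qed
  also have "\<dots> = (\<integral>\<^sup>+x\<in>U. ennreal (s1 x) \<partial>lborel) + (\<integral>\<^sup>+x. ennreal (s1 x) * indicator U (x - \<tau> *\<^sub>R b) \<partial>lborel)"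
    by (rule nn_integral_add) measurable
  also have "(\<integral>\<^sup>+x. ennreal (s1 x) * indicator U (x - \<tau> *\<^sub>R b) \<partial>lborel) = (\<integral>\<^sup>+x. ennreal (s1 (x + \<tau> *\<^sub>R b)) * indicator U x \<partial>lborel)"
    by (subst nn_integral_lborel_shift[of _ "\<tau> *\<^sub>R b", symmetric]) auto
  also have "\<dots> \<le> (\<integral>\<^sup>+x. ennreal (s1 x) * indicator U x + (\<integral>\<^sup>+t\<in>I. ennreal \<bar>g (x + t *\<^sub>R b)\<bar> \<partial>lborel) \<partial>lborel)"
    using pt U by (intro nn_integral_mono) (auto simp: indicator_def)
  also have "\<dots> = (\<integral>\<^sup>+x\<in>U. ennreal (s1 x) \<partial>lborel) + (\<integral>\<^sup>+x. (\<integral>\<^sup>+t\<in>I. ennreal \<bar>g (x + t *\<^sub>R b)\<bar> \<partial>lborel) \<partial>lborel)"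
    by (rule nn_integral_add) measurable
  also have "(\<integral>\<^sup>+x. (\<integral>\<^sup>+t\<in>I. ennreal \<bar>g (x + t *\<^sub>R b)\<bar> \<partial>lborel) \<partial>lborel) = (\<integral>\<^sup>+t. \<integral>\<^sup>+x. ennreal \<bar>g (x + t *\<^sub>R b)\<bar> * indicator I t \<partial>lborel \<partial>lborel)"
    by (rule lborel_pair.Fubini'[symmetric]) measurable
  also have "\<dots> = (\<integral>\<^sup>+t. (\<integral>\<^sup>+x. ennreal \<bar>g x\<bar> \<partial>lborel) * indicator I t \<partial>lborel)"
  proof (rule nn_integral_cong)
    fix t
    have "(\<integral>\<^sup>+x. ennreal \<bar>g (x + t *\<^sub>R b)\<bar> * indicator I t \<partial>lborel) = (\<integral>\<^sup>+x. ennreal \<bar>g (x + t *\<^sub>R b)\<bar> \<partial>lborel) * indicator I t"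
      by (rule nn_integral_multc) measurable
    then show "(\<integral>\<^sup>+x. ennreal \<bar>g (x + t *\<^sub>R b)\<bar> * indicator I t \<partial>lborel) = (\<integral>\<^sup>+x. ennreal \<bar>g x\<bar> \<partial>lborel) * indicator I t"
      by (simp add: nn_integral_lborel_shift[of "\<lambda>x. ennreal \<bar>g x\<bar>"])
  qed
  also have "\<dots> = ennreal \<bar>\<tau>\<bar> * (\<integral>\<^sup>+x. ennreal \<bar>g x\<bar> \<partial>lborel)"
    by (subst nn_integral_cmult_indicator) (auto simp: emI mult.commute)
  also have "(\<integral>\<^sup>+x. ennreal \<bar>g x\<bar> \<partial>lborel) = (\<integral>\<^sup>+x\<in>D. ennreal \<bar>s' x b\<bar> \<partial>lborel)"
    by (intro nn_integral_cong) (auto simp: g_def indicator_def)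
  also have "(\<integral>\<^sup>+x\<in>U. ennreal (s1 x) \<partial>lborel) = (\<integral>\<^sup>+x\<in>U. ennreal (s x) \<partial>lborel)"
    using U by (intro nn_integral_cong) (auto simp: s1_def indicator_def)
  finally show ?thesis by (simp add: mult_2 add.assoc)
qed

text \<open>
  The Sobolev inequality bounds the critical norm \<open>A'\<close> of \<open>s\<close> by the integral of \<open>s\<close> over the box, with a
  factor \<open>1 / l\<^sup>2\<close>, and the Poincare inequality bounds this integral by the one over \<open>U\<close>, with a
  factor \<open>l\<^sup>2\<close> in front of the derivative terms. When they are combined, these factors cancel in front
  of the zeroth-order term, so the smallness that is needed to absorb it does not depend on the size of
  the box.
\<close>

lemma box_doubling:
  fixes s :: "'b::euclidean_space \<Rightarrow> real"
  assumes dim: "3 \<le> DIM('b)"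
    and [measurable]: "\<kappa> \<in> borel_measurable borel" and \<kappa>: "\<And>x. 0 \<le> \<kappa> x"
    and small: "small_on (cbox a c) \<kappa>"
    and adm: "admissible (cbox a c) \<kappa> s s' H"
    and l: "0 < l" "\<And>b. b \<in> Basis \<Longrightarrow> l \<le> c \<bullet> b - a \<bullet> b"
    and [measurable]: "U \<in> sets borel" and U: "U \<subseteq> cbox a c"
    and b: "b \<in> Basis" and \<tau>: "\<bar>\<tau>\<bar> \<le> l"
    and cov: "cbox a c \<subseteq> U \<union> (\<lambda>x. x + \<tau> *\<^sub>R b) ` U"
  shows "(\<integral>\<^sup>+x\<in>cbox a c. ennreal (s x) \<partial>lborel) \<le> ennreal (8 + 16 * l\<^sup>2) *
     ((\<integral>\<^sup>+x\<in>U. ennreal (s x) \<partial>lborel) + (\<integral>\<^sup>+x\<in>cbox a c. ennreal ((H x)\<^sup>2) \<partial>lborel))"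
proof -
  define n where "n = real DIM('b)"
  define q where "q = sob_q TYPE('b)"
  define \<theta> where "\<theta> = n / (n - 2)"
  define D where "D = cbox a c"
  have [measurable]: "D \<in> sets borel" by (simp add: D_def)
  note adm = adm[folded D_def] and cov = cov[folded D_def] and U = U[folded D_def]
  have n: "3 \<le> n" using dim by (simp add: n_def)
  have q: "1 < q" using sob_facts(1)[OF dim] by (simp add: q_def)
  have cs: "continuous_on D s" by (rule admissible_continuous[OF adm])
  have s0: "0 \<le> s x" if "x \<in> D" for x using adm that by (simp add: admissible_def)
  have "bounded (s ` D)"
    by (intro compact_imp_bounded compact_continuous_image cs) (simp add: D_def)
  then obtain M where M: "\<And>x. x \<in> D \<Longrightarrow> s x \<le> M"
    unfolding bounded_iff real_norm_def by (meson abs_le_D1 imageI)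
  have Dfin: "emeasure lborel D < top" using emeasure_lborel_cbox_finite[of a c] by (simp add: D_def)
  define A where "A = (\<integral>\<^sup>+x\<in>D. ennreal (s x powr \<theta>) \<partial>lborel)"
  define A' where "A' = epow A ((n - 2) / n)"
  define h where "h = (\<integral>\<^sup>+x\<in>D. ennreal ((H x)\<^sup>2) \<partial>lborel)"
  define P where "P = (\<integral>\<^sup>+x\<in>D. ennreal ((\<kappa> x)\<^sup>2 * s x) \<partial>lborel)"
  define X where "X = (\<integral>\<^sup>+x\<in>D. ennreal (s x) \<partial>lborel)"
  define Y where "Y = (\<integral>\<^sup>+x\<in>U. ennreal (s x) \<partial>lborel)"
  define N where "N = critical_norm D \<kappa>"
  define C where "C = 12 * q\<^sup>2 + 24"
  have finI: "(\<integral>\<^sup>+x\<in>D. ennreal (f x) \<partial>lborel) < top" if "\<And>x. x \<in> D \<Longrightarrow> f x \<le> K" for f K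
  proof -
    have "(\<integral>\<^sup>+x\<in>D. ennreal (f x) \<partial>lborel) \<le> (\<integral>\<^sup>+x. ennreal K * indicator D x \<partial>lborel)"
      using that by (intro nn_integral_mono) (auto simp: indicator_def intro: ennreal_leI)
    also have "\<dots> = ennreal K * emeasure lborel D" by (simp add: nn_integral_cmult)
    also have "\<dots> < top" using Dfin by (simp add: ennreal_mult_less_top)
    finally show ?thesis .
  qed
  have Xfin: "X < top" unfolding X_def using M by (rule finI)
  have Afin: "A < top" unfolding A_def
    by (rule finI[of _ "M powr \<theta>"]) (use s0 M n in \<open>auto simp: \<theta>_def intro!: powr_mono2\<close>)
  have A'fin: "A' < top" using Afin by (cases A) (auto simp: A'_def epow_def)
  have YX: "Y \<le> X" unfolding Y_def X_def using U by (intro nn_integral_mono) (auto simp: indicator_def)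
  have line: "ennreal (s x powr q) \<le>
        (\<integral>\<^sup>+t. ennreal (q * s (x + (t - x \<bullet> b) *\<^sub>R b) powr (q - 1) * \<bar>s' (x + (t - x \<bullet> b) *\<^sub>R b) b\<bar>
               + 1 / l * s (x + (t - x \<bullet> b) *\<^sub>R b) powr q) *
            indicator D (x + (t - x \<bullet> b) *\<^sub>R b) \<partial>lborel)" if x: "x \<in> D" and b: "b \<in> Basis" for x b
  proof -
    have "ennreal (s x powr q) \<le> (\<integral>\<^sup>+t. ennreal (\<bar>q * s (x + (t - x \<bullet> b) *\<^sub>R b) powr (q - 1) * s' (x + (t - x \<bullet> b) *\<^sub>R b) b\<bar>
               + 1 / l * s (x + (t - x \<bullet> b) *\<^sub>R b) powr q) * indicator (cbox a c) (x + (t - x \<bullet> b) *\<^sub>R b) \<partial>lborel)"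
    proof (rule box_line_bound[where f="\<lambda>x. s x powr q" and f'="\<lambda>x v. q * s x powr (q - 1) * s' x v"])
      show "((\<lambda>x. s x powr q) has_derivative (\<lambda>v. q * s x powr (q - 1) * s' x v)) (at x within cbox a c)" if "x \<in> cbox a c" for x
        using adm that q by (intro has_derivative_powr_nonneg) (auto simp: admissible_def D_def)
      show "continuous_on (cbox a c) (\<lambda>x. q * s x powr (q - 1) * s' x b)"
        using adm b q s0 cs by (auto simp: admissible_def D_def intro!: continuous_intros continuous_on_powr')
    qed (use l b x in \<open>auto simp: D_def\<close>)
    also have "\<dots> = (\<integral>\<^sup>+t. ennreal (q * s (x + (t - x \<bullet> b) *\<^sub>R b) powr (q - 1) * \<bar>s' (x + (t - x \<bullet> b) *\<^sub>R b) b\<bar>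
               + 1 / l * s (x + (t - x \<bullet> b) *\<^sub>R b) powr q) * indicator D (x + (t - x \<bullet> b) *\<^sub>R b) \<partial>lborel)"
      using q by (intro nn_integral_cong) (simp add: abs_mult D_def)
    finally show ?thesis .
  qed
  have sob: "A' \<le> ennreal (12 * q\<^sup>2) * (h + P) + ennreal (3 * (1/l)\<^sup>2) * X"
    unfolding A'_def A_def h_def P_def X_def n_def q_def \<theta>_def
    by (rule sobolev_admissible[OF dim, where s'=s'])
       (use adm \<kappa> l Afin line in \<open>auto simp: A_def n_def q_def \<theta>_def\<close>)
  have PN: "P \<le> N * A'"
    unfolding P_def N_def A'_def A_def n_def \<theta>_def using adm \<kappa> dim by (intro hoelder_critical) auto
  have poin: "X \<le> 2 * Y + (ennreal (1/2) * X + ennreal (4 * l\<^sup>2) * (h + P))"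
  proof -
    define s1 where "s1 x = indicator D x * s x" for x
    define H1 where "H1 x = indicator D x * H x" for x
    have [measurable]: "s1 \<in> borel_measurable borel"
      using borel_measurable_continuous_on_indicator[OF _ cs]
      by (simp add: s1_def[abs_def])
    have [measurable]: "H1 \<in> borel_measurable borel"
      using adm by (simp add: H1_def[abs_def] admissible_def set_borel_measurable_def)
    have eqs: "h = (\<integral>\<^sup>+x\<in>D. ennreal ((H1 x)\<^sup>2) \<partial>lborel)" "P = (\<integral>\<^sup>+x\<in>D. ennreal ((\<kappa> x)\<^sup>2 * s1 x) \<partial>lborel)"
      "X = (\<integral>\<^sup>+x\<in>D. ennreal (s1 x) \<partial>lborel)"
      unfolding h_def P_def X_def by (intro nn_integral_cong; simp add: s1_def H1_def indicator_def)+
    have "X \<le> 2 * Y + ennreal \<bar>\<tau>\<bar> * (\<integral>\<^sup>+x\<in>D. ennreal \<bar>s' x b\<bar> \<partial>lborel)"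
      unfolding X_def Y_def using adm U cov b
      by (intro doubling_translate) (auto simp: D_def admissible_def convex_box)
    also have "\<dots> \<le> 2 * Y + ennreal l * (\<integral>\<^sup>+x\<in>D. ennreal \<bar>s' x b\<bar> \<partial>lborel)"
      using \<tau> by (intro add_left_mono mult_right_mono ennreal_leI) auto
    also have "ennreal l * (\<integral>\<^sup>+x\<in>D. ennreal \<bar>s' x b\<bar> \<partial>lborel) = (\<integral>\<^sup>+x\<in>D. ennreal (l * \<bar>s' x b\<bar>) \<partial>lborel)"
    proof -
      define g where "g x = indicator D x *\<^sub>R s' x b" for x
      have [measurable]: "g \<in> borel_measurable borel"
        using adm b unfolding g_def[abs_def] admissible_def
        by (auto intro!: borel_measurable_continuous_on_indicator simp del: real_scaleR_def)
      have "(\<integral>\<^sup>+x\<in>D. ennreal \<bar>s' x b\<bar> \<partial>lborel) = (\<integral>\<^sup>+x. ennreal \<bar>g x\<bar> \<partial>lborel)"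
        by (intro nn_integral_cong) (simp add: g_def indicator_def)
      then have "ennreal l * (\<integral>\<^sup>+x\<in>D. ennreal \<bar>s' x b\<bar> \<partial>lborel) = (\<integral>\<^sup>+x. ennreal l * ennreal \<bar>g x\<bar> \<partial>lborel)"
        by (simp add: nn_integral_cmult)
      also have "\<dots> = (\<integral>\<^sup>+x\<in>D. ennreal (l * \<bar>s' x b\<bar>) \<partial>lborel)"
        using l by (intro nn_integral_cong) (simp add: g_def indicator_def ennreal_mult)
      finally show ?thesis .
    qed
    also have "\<dots> \<le> (\<integral>\<^sup>+x. ennreal (1/2) * (ennreal (s1 x) * indicator D x) + ennreal (4 * l\<^sup>2) *
        (ennreal ((H1 x)\<^sup>2) * indicator D x + ennreal ((\<kappa> x)\<^sup>2 * s1 x) * indicator D x) \<partial>lborel)"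
    proof (rule nn_integral_mono)
      fix x
      show "ennreal (l * \<bar>s' x b\<bar>) * indicator D x \<le> ennreal (1/2) * (ennreal (s1 x) * indicator D x) + ennreal (4 * l\<^sup>2) *
        (ennreal ((H1 x)\<^sup>2) * indicator D x + ennreal ((\<kappa> x)\<^sup>2 * s1 x) * indicator D x)"
      proof (cases "x \<in> D")
        case True
        have sx: "0 \<le> s x" by (rule s0[OF True])
        let ?k = "H x + \<kappa> x * sqrt (s x)"
        have "l * \<bar>s' x b\<bar> \<le> l * (2 * sqrt (s x) * ?k)"
          using adm True b l by (intro mult_left_mono) (auto simp: admissible_def)
        also have "\<dots> \<le> s x / 2 + 2 * (l * ?k)\<^sup>2"
        proof -
          have "l * (2 * r * k) \<le> r\<^sup>2 / 2 + 2 * (l * k)\<^sup>2" for r k :: real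
            using zero_le_power2[of "r - 2 * l * k"] by (simp add: power2_eq_square algebra_simps)
          from this[of "sqrt (s x)" ?k] show ?thesis using sx by simp
        qed
        also have "\<dots> = s x / 2 + 2 * l\<^sup>2 * ?k\<^sup>2" by (simp add: power_mult_distrib)
        also have "2 * l\<^sup>2 * ?k\<^sup>2 \<le> 2 * l\<^sup>2 * (2 * ((H x)\<^sup>2 + (\<kappa> x)\<^sup>2 * s x))"
        proof (intro mult_left_mono)
          have "(a + b)\<^sup>2 \<le> 2 * (a\<^sup>2 + b\<^sup>2)" for a b :: real
            using zero_le_power2[of "a - b"] by (simp add: power2_eq_square algebra_simps)
          from this[of "H x" "\<kappa> x * sqrt (s x)"] show "?k\<^sup>2 \<le> 2 * ((H x)\<^sup>2 + (\<kappa> x)\<^sup>2 * s x)"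
            using sx by (simp add: power_mult_distrib)
        qed simp
        finally have "l * \<bar>s' x b\<bar> \<le> 1 / 2 * s x + 4 * l\<^sup>2 * ((H x)\<^sup>2 + (\<kappa> x)\<^sup>2 * s x)"
          by (simp add: algebra_simps)
        then have "ennreal (l * \<bar>s' x b\<bar>) \<le> ennreal (1 / 2 * s x + 4 * l\<^sup>2 * ((H x)\<^sup>2 + (\<kappa> x)\<^sup>2 * s x))"
          by (rule ennreal_leI)
        also have "\<dots> = ennreal (1/2 * s x) + ennreal (4 * l\<^sup>2 * ((H x)\<^sup>2 + (\<kappa> x)\<^sup>2 * s x))"
          using sx by (intro ennreal_plus) auto
        also have "ennreal (1/2 * s x) = ennreal (1/2) * ennreal (s x)" using sx by (intro ennreal_mult) auto
        also have "ennreal (4 * l\<^sup>2 * ((H x)\<^sup>2 + (\<kappa> x)\<^sup>2 * s x)) = ennreal (4 * l\<^sup>2) * ennreal ((H x)\<^sup>2 + (\<kappa> x)\<^sup>2 * s x)"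
          using sx by (intro ennreal_mult) auto
        also have "ennreal ((H x)\<^sup>2 + (\<kappa> x)\<^sup>2 * s x) = ennreal ((H x)\<^sup>2) + ennreal ((\<kappa> x)\<^sup>2 * s x)"
          using sx by (intro ennreal_plus) auto
        finally show ?thesis using True by (simp only: s1_def H1_def indicator_simps mult_1 mult_1_right)
      qed simp
    qed
    also have "\<dots> = ennreal (1/2) * X + ennreal (4 * l\<^sup>2) * (h + P)"
      unfolding eqs by (simp add: nn_integral_add nn_integral_cmult del: ennreal_half)
    finally show ?thesis by (simp add: add_left_mono)
  qed
  have cN: "ennreal C * N \<le> ennreal (1/2)"
    using small by (simp add: small_on_def N_def C_def D_def sob_facts(2)[OF dim] q_def)
  show ?thesis
  proof (cases "h = top")
    case True
    have "ennreal (8 + 16 * l\<^sup>2) \<noteq> 0" by (simp add: ennreal_eq_0_iff not_le add_pos_nonneg)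
    then show ?thesis using True unfolding h_def D_def by (simp add: ennreal_mult_top)
  next
    case False
    have C: "24 \<le> C" by (simp add: C_def)
    have "N \<noteq> top" using cN C by (auto simp: ennreal_mult_top top_unique)
    then obtain \<nu> where \<nu>: "N = ennreal \<nu>" "0 \<le> \<nu>" by (cases N) auto
    obtain a' where a': "A' = ennreal a'" "0 \<le> a'" using A'fin by (cases A') auto
    obtain x where x: "X = ennreal x" "0 \<le> x" using Xfin by (cases X) auto
    have "Y < top" using YX Xfin by simp
    then obtain y where y: "Y = ennreal y" "0 \<le> y" by (cases Y) auto
    obtain k where k: "h = ennreal k" "0 \<le> k" using False by (cases h) auto
    have "P < top" using PN \<nu> a' by (simp flip: ennreal_mult add: le_less_trans)
    then obtain p where p: "P = ennreal p" "0 \<le> p" by (cases P) auto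
    have 1: "a' \<le> 12 * q\<^sup>2 * (k + p) + 3 * (1/l)\<^sup>2 * x"
    proof -
      have "ennreal a' \<le> ennreal (12 * q\<^sup>2 * (k + p) + 3 * (1/l)\<^sup>2 * x)"
        using sob a' x k p by (simp only: ennreal_plus ennreal_mult mult_nonneg_nonneg zero_le_power2 add_nonneg_nonneg zero_le_numeral)
      then show ?thesis using x k p by (subst (asm) ennreal_le_iff) auto
    qed
    have 2: "p \<le> \<nu> * a'"
      using PN p \<nu> a' by (simp flip: ennreal_mult add: ennreal_le_iff)
    have 3: "C * \<nu> \<le> 1/2"
    proof -
      have "ennreal (C * \<nu>) \<le> ennreal (1/2)" using cN \<nu> C by (simp only: ennreal_mult)
      then show ?thesis by (subst (asm) ennreal_le_iff) simp
    qed
    have 4: "x \<le> 2 * y + (1/2 * x + 4 * l\<^sup>2 * (k + p))"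
    proof -
      have "ennreal x \<le> ennreal (2 * y + (1/2 * x + 4 * l\<^sup>2 * (k + p)))"
      proof -
        have "ennreal (2 * y + (1/2 * x + 4 * l\<^sup>2 * (k + p))) = 2 * Y + (ennreal (1/2) * X + ennreal (4 * l\<^sup>2) * (h + P))"
          using x k p y by (simp only: ennreal_plus ennreal_mult mult_nonneg_nonneg zero_le_power2 add_nonneg_nonneg
            zero_le_numeral divide_nonneg_nonneg zero_le_one ennreal_numeral)
        then show ?thesis using poin x by simp
      qed
      then show ?thesis using x k p y by (subst (asm) ennreal_le_iff) auto
    qed
    have x4: "x \<le> 4 * y + 8 * l\<^sup>2 * (k + p)" using 4 by simp
    have l2: "0 < l\<^sup>2" using l by simp
    have "3 * (1/l)\<^sup>2 * x \<le> 3 * (1/l)\<^sup>2 * (4 * y + 8 * l\<^sup>2 * (k + p))"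
      using x4 by (intro mult_left_mono) auto
    also have "\<dots> = 12 * y / l\<^sup>2 + 24 * (k + p)" using l by (simp add: field_simps power2_eq_square)
    finally have a5: "a' \<le> C * (k + p) + 12 * y / l\<^sup>2" using 1 by (simp add: C_def algebra_simps)
    have "C * p \<le> C * (\<nu> * a')" using 2 C by (intro mult_left_mono) auto
    also have "\<dots> = (C * \<nu>) * a'" by simp
    also have "\<dots> \<le> 1/2 * a'" using 3 a' by (intro mult_right_mono) auto
    finally have "C * p \<le> 1/2 * a'" .
    with a5 have "C * p \<le> C * k + 12 * y / l\<^sup>2" by (simp add: algebra_simps)
    then have "l\<^sup>2 * (C * p) \<le> l\<^sup>2 * (C * k + 12 * y / l\<^sup>2)" using l2 by (intro mult_left_mono) auto
    also have "\<dots> = C * (l\<^sup>2 * k) + 12 * y" using l by (simp add: field_simps)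
    also have "\<dots> \<le> C * (l\<^sup>2 * k) + C * (y / 2)" using mult_right_mono[OF C, of "y/2"] y by simp
    finally have "C * (l\<^sup>2 * p) \<le> C * (l\<^sup>2 * k + y / 2)" by (simp add: algebra_simps)
    then have "l\<^sup>2 * p \<le> l\<^sup>2 * k + y / 2" using C by simp
    with x4 have "x \<le> 8 * y + 16 * l\<^sup>2 * k" by (simp add: algebra_simps)
    also have "\<dots> \<le> (8 + 16 * l\<^sup>2) * (y + k)" using y k l by (simp add: algebra_simps)
    finally have "ennreal x \<le> ennreal ((8 + 16 * l\<^sup>2) * (y + k))" by (rule ennreal_leI)
    also have "\<dots> = ennreal (8 + 16 * l\<^sup>2) * (ennreal y + ennreal k)"
      using y k by (simp add: ennreal_mult ennreal_plus)
    finally show ?thesis using x y k by (simp add: X_def Y_def h_def D_def)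
  qed
qed

text \<open>
  The point of this notion is that the constant is the same for all admissible functions.
\<close>

definition controls :: "'b::euclidean_space set \<Rightarrow> ('b \<Rightarrow> real) \<Rightarrow> 'b set \<Rightarrow> 'b set \<Rightarrow> bool" where
  "controls D \<kappa> U V \<longleftrightarrow> (\<exists>C::real. 0 \<le> C \<and> (\<forall>s s' H. admissible D \<kappa> s s' H \<longrightarrow>
     (\<integral>\<^sup>+x\<in>V. ennreal (s x) \<partial>lborel) \<le> ennreal C *
       ((\<integral>\<^sup>+x\<in>U. ennreal (s x) \<partial>lborel) + (\<integral>\<^sup>+x\<in>D. ennreal ((H x)\<^sup>2) \<partial>lborel))))"

lemma controlsE:
  assumes "controls D \<kappa> U V"
  obtains C where "0 \<le> C" "\<And>s s' H. admissible D \<kappa> s s' H \<Longrightarrow>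
     (\<integral>\<^sup>+x\<in>V. ennreal (s x) \<partial>lborel) \<le> ennreal C *
       ((\<integral>\<^sup>+x\<in>U. ennreal (s x) \<partial>lborel) + (\<integral>\<^sup>+x\<in>D. ennreal ((H x)\<^sup>2) \<partial>lborel))"
  using assms unfolding controls_def by blast

lemma controls_mono:
  assumes "V \<subseteq> U"
  shows "controls D \<kappa> U V"
proof -
  have "(\<integral>\<^sup>+x\<in>V. ennreal (s x) \<partial>lborel) \<le> (\<integral>\<^sup>+x\<in>U. ennreal (s x) \<partial>lborel)" for s :: "_ \<Rightarrow> real"
    using assms by (intro nn_integral_mono) (auto simp: indicator_def)
  then show ?thesis
    unfolding controls_def by (intro exI[of _ 1]) (auto intro: add_increasing2)
qed

lemma controls_trans:
  assumes "controls D \<kappa> U V" "controls D \<kappa> V W"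
  shows "controls D \<kappa> U W"
proof -
  obtain C1 where C1: "0 \<le> C1" "\<And>s s' H. admissible D \<kappa> s s' H \<Longrightarrow>
     (\<integral>\<^sup>+x\<in>V. ennreal (s x) \<partial>lborel) \<le> ennreal C1 *
       ((\<integral>\<^sup>+x\<in>U. ennreal (s x) \<partial>lborel) + (\<integral>\<^sup>+x\<in>D. ennreal ((H x)\<^sup>2) \<partial>lborel))"
    using assms(1) by (auto simp: controls_def)
  obtain C2 where C2: "0 \<le> C2" "\<And>s s' H. admissible D \<kappa> s s' H \<Longrightarrow>
     (\<integral>\<^sup>+x\<in>W. ennreal (s x) \<partial>lborel) \<le> ennreal C2 *
       ((\<integral>\<^sup>+x\<in>V. ennreal (s x) \<partial>lborel) + (\<integral>\<^sup>+x\<in>D. ennreal ((H x)\<^sup>2) \<partial>lborel))"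
    using assms(2) by (auto simp: controls_def)
  show ?thesis
    unfolding controls_def
  proof (intro exI[of _ "C2 * (C1 + 1)"] conjI allI impI)
    show "0 \<le> C2 * (C1 + 1)" using C1 C2 by simp
    fix s s' H assume adm: "admissible D \<kappa> s s' H"
    let ?U = "\<integral>\<^sup>+x\<in>U. ennreal (s x) \<partial>lborel" and ?h = "\<integral>\<^sup>+x\<in>D. ennreal ((H x)\<^sup>2) \<partial>lborel"
    have "(\<integral>\<^sup>+x\<in>W. ennreal (s x) \<partial>lborel) \<le> ennreal C2 * ((\<integral>\<^sup>+x\<in>V. ennreal (s x) \<partial>lborel) + ?h)"
      by (rule C2(2)[OF adm])
    also have "\<dots> \<le> ennreal C2 * (ennreal C1 * (?U + ?h) + (?U + ?h))"
      using C1(2)[OF adm] by (intro mult_left_mono add_mono) auto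
    also have "\<dots> = ennreal (C2 * (C1 + 1)) * (?U + ?h)"
      using C1(1) C2(1) by (simp add: ennreal_mult ennreal_plus algebra_simps)
    finally show "(\<integral>\<^sup>+x\<in>W. ennreal (s x) \<partial>lborel) \<le> ennreal (C2 * (C1 + 1)) * (?U + ?h)" .
  qed
qed

lemma small_on_subset:
  assumes "small_on S \<kappa>" "T \<subseteq> S"
  shows "small_on T \<kappa>"
proof -
  have "critical_norm T \<kappa> \<le> critical_norm S \<kappa>"
    unfolding critical_norm_def using assms(2)
    by (intro epow_mono nn_integral_mono) (auto simp: indicator_def)
  then show ?thesis
    using assms(1) unfolding small_on_def by (meson mult_left_mono order_trans zero_le)
qed

lemma controls_box:
  fixes a c :: "'b::euclidean_space"
  assumes dim: "3 \<le> DIM('b)"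
    and "\<kappa> \<in> borel_measurable borel" "\<And>x. 0 \<le> \<kappa> x" "small_on D \<kappa>"
    and sub: "cbox a c \<subseteq> D" and l: "0 < l" "\<And>b. b \<in> Basis \<Longrightarrow> l \<le> c \<bullet> b - a \<bullet> b"
    and "U \<in> sets borel" "U \<subseteq> cbox a c" "b \<in> Basis" "\<bar>\<tau>\<bar> \<le> l"
    and "cbox a c \<subseteq> U \<union> (\<lambda>x. x + \<tau> *\<^sub>R b) ` U"
  shows "controls D \<kappa> U (cbox a c)"
  unfolding controls_def
proof (intro exI[of _ "8 + 16 * l\<^sup>2"] conjI allI impI)
  fix s s' H assume adm: "admissible D \<kappa> s s' H"
  have "(\<integral>\<^sup>+x\<in>cbox a c. ennreal (s x) \<partial>lborel) \<le> ennreal (8 + 16 * l\<^sup>2) *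
     ((\<integral>\<^sup>+x\<in>U. ennreal (s x) \<partial>lborel) + (\<integral>\<^sup>+x\<in>cbox a c. ennreal ((H x)\<^sup>2) \<partial>lborel))"
    using assms adm by (intro box_doubling) (auto intro: small_on_subset admissible_subset)
  also have "\<dots> \<le> ennreal (8 + 16 * l\<^sup>2) *
     ((\<integral>\<^sup>+x\<in>U. ennreal (s x) \<partial>lborel) + (\<integral>\<^sup>+x\<in>D. ennreal ((H x)\<^sup>2) \<partial>lborel))"
    using sub by (intro mult_left_mono add_left_mono nn_integral_mono) (auto simp: indicator_def)
  finally show "(\<integral>\<^sup>+x\<in>cbox a c. ennreal (s x) \<partial>lborel) \<le> ennreal (8 + 16 * l\<^sup>2) *
     ((\<integral>\<^sup>+x\<in>U. ennreal (s x) \<partial>lborel) + (\<integral>\<^sup>+x\<in>D. ennreal ((H x)\<^sup>2) \<partial>lborel))" .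
qed simp

text \<open>
  Start from the small cube and double one side after the other. Every box on the way has its sides
  between \<open>\<delta>\<close> and \<open>2 \<delta>\<close>, so the doubling estimate applies with \<open>l = \<delta>\<close>.
\<close>

lemma cube_halving:
  fixes z x :: "'b::euclidean_space"
  assumes dim: "3 \<le> DIM('b)"
    and \<kappa>: "\<kappa> \<in> borel_measurable borel" "\<And>x. 0 \<le> \<kappa> x" "small_on D \<kappa>"
    and sub: "cbox z (z + (2 * \<delta>) *\<^sub>R One) \<subseteq> D" and \<delta>: "0 < \<delta>"
    and x: "x \<in> cbox z (z + (2 * \<delta>) *\<^sub>R One)"
  shows "\<exists>z'. x \<in> cbox z' (z' + \<delta> *\<^sub>R One) \<and> cbox z' (z' + \<delta> *\<^sub>R One) \<subseteq> cbox z (z + (2 * \<delta>) *\<^sub>R One) \<and>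
     controls D \<kappa> (cbox z' (z' + \<delta> *\<^sub>R One)) (cbox z (z + (2 * \<delta>) *\<^sub>R One))"
proof -
  define w where "w b = (if x \<bullet> b \<le> z \<bullet> b + \<delta> then z \<bullet> b else z \<bullet> b + \<delta>)" for b
  define lo where "lo J = (\<Sum>b\<in>Basis. (if b \<in> J then w b else z \<bullet> b) *\<^sub>R b)" for J
  define hi where "hi J = (\<Sum>b\<in>Basis. (if b \<in> J then w b + \<delta> else z \<bullet> b + 2 * \<delta>) *\<^sub>R b)" for J
  have lo: "lo J \<bullet> b = (if b \<in> J then w b else z \<bullet> b)" if "b \<in> Basis" for J b
    using that by (simp add: lo_def)
  have hi: "hi J \<bullet> b = (if b \<in> J then w b + \<delta> else z \<bullet> b + 2 * \<delta>)" if "b \<in> Basis" for J b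
    using that by (simp add: hi_def)
  have w: "w b = z \<bullet> b \<or> w b = z \<bullet> b + \<delta>" for b by (simp add: w_def)
  have empty: "cbox (lo {}) (hi {}) = cbox z (z + (2 * \<delta>) *\<^sub>R One)"
    by (auto simp: mem_box lo hi inner_add_left)
  have sub_empty: "cbox (lo J) (hi J) \<subseteq> cbox (lo {}) (hi {})" for J
  proof
    fix y assume y: "y \<in> cbox (lo J) (hi J)"
    have "z \<bullet> b \<le> y \<bullet> b \<and> y \<bullet> b \<le> z \<bullet> b + 2 * \<delta>" if "b \<in> Basis" for b
      using y that w[of b] \<delta> lo[OF that, of J] hi[OF that, of J] by (auto simp: mem_box split: if_splits)
    then show "y \<in> cbox (lo {}) (hi {})" by (auto simp: mem_box lo hi)
  qed
  have ctl: "controls D \<kappa> (cbox (lo J) (hi J)) (cbox (lo {}) (hi {}))" if "finite J" "J \<subseteq> Basis" for J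
    using that
  proof (induction J rule: finite_induct)
    case empty
    show ?case by (rule controls_mono) simp
  next
    case (insert b J)
    then have b: "b \<in> Basis" by auto
    define \<tau> where "\<tau> = (if w b = z \<bullet> b then \<delta> else - \<delta>)"
    have "controls D \<kappa> (cbox (lo (insert b J)) (hi (insert b J))) (cbox (lo J) (hi J))"
    proof (rule controls_box[OF dim \<kappa>, where l=\<delta> and b=b and \<tau>=\<tau>])
      show "cbox (lo J) (hi J) \<subseteq> D" using sub_empty[of J] sub by (auto simp: empty)
      show "\<delta> \<le> hi J \<bullet> i - lo J \<bullet> i" if "i \<in> Basis" for i
        using that \<delta> by (simp add: lo hi)
      show "cbox (lo (insert b J)) (hi (insert b J)) \<subseteq> cbox (lo J) (hi J)"
      proof
        fix y assume y: "y \<in> cbox (lo (insert b J)) (hi (insert b J))"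
        have "lo J \<bullet> i \<le> y \<bullet> i \<and> y \<bullet> i \<le> hi J \<bullet> i" if i: "i \<in> Basis" for i
          using y i w[of i] \<delta> insert.hyps lo[OF i, of J] hi[OF i, of J] lo[OF i, of "insert b J"] hi[OF i, of "insert b J"]
          by (auto simp: mem_box split: if_splits)
        then show "y \<in> cbox (lo J) (hi J)" by (simp add: mem_box)
      qed
      show "cbox (lo J) (hi J) \<subseteq> cbox (lo (insert b J)) (hi (insert b J)) \<union>
         (\<lambda>y. y + \<tau> *\<^sub>R b) ` cbox (lo (insert b J)) (hi (insert b J))"
      proof
        fix y assume y: "y \<in> cbox (lo J) (hi J)"
        let ?U = "cbox (lo (insert b J)) (hi (insert b J))"
        have yi: "lo J \<bullet> i \<le> y \<bullet> i \<and> y \<bullet> i \<le> hi J \<bullet> i" if "i \<in> Basis" for i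
          using y that by (simp add: mem_box)
        have yb: "z \<bullet> b \<le> y \<bullet> b" "y \<bullet> b \<le> z \<bullet> b + 2 * \<delta>"
          using yi[OF b] insert.hyps by (auto simp: lo[OF b] hi[OF b])
        show "y \<in> ?U \<union> (\<lambda>y. y + \<tau> *\<^sub>R b) ` ?U"
        proof (cases "w b \<le> y \<bullet> b \<and> y \<bullet> b \<le> w b + \<delta>")
          case True
          have "lo (insert b J) \<bullet> i \<le> y \<bullet> i \<and> y \<bullet> i \<le> hi (insert b J) \<bullet> i" if i: "i \<in> Basis" for i
            using yi[OF i] True by (auto simp: lo[OF i] hi[OF i] split: if_splits)
          then show ?thesis by (simp add: mem_box)
        next
          case False
          have "lo (insert b J) \<bullet> i \<le> (y - \<tau> *\<^sub>R b) \<bullet> i \<and> (y - \<tau> *\<^sub>R b) \<bullet> i \<le> hi (insert b J) \<bullet> i" if i: "i \<in> Basis" for i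
          proof (cases "i = b")
            case True
            then show ?thesis using False yb w[of b] \<delta> b
              by (auto simp: lo hi \<tau>_def inner_diff_left inner_add_left)
          next
            case False
            then show ?thesis using yi[OF i] b i
              by (auto simp: lo[OF i] hi[OF i] inner_diff_left inner_Basis)
          qed
          then have "y - \<tau> *\<^sub>R b \<in> ?U" by (simp add: mem_box)
          then show ?thesis by (auto intro!: image_eqI[of _ _ "y - \<tau> *\<^sub>R b"])
        qed
      qed
    qed (use \<delta> b in \<open>auto simp: \<tau>_def\<close>)
    then show ?case using insert by (auto intro: controls_trans)
  qed
  have full: "cbox (lo Basis) (hi Basis) = cbox (lo Basis) (lo Basis + \<delta> *\<^sub>R One)"
    by (auto simp: mem_box lo hi inner_add_left)
  have "x \<in> cbox (lo Basis) (hi Basis)"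
    using x \<delta> by (auto simp: mem_box lo hi w_def inner_add_left)
  then show ?thesis
    using ctl[of Basis] sub_empty[of Basis] unfolding empty full by (intro exI[of _ "lo Basis"]) auto
qed

text \<open>
  Repeated halving towards \<open>x\<close> leads to a cube inside \<open>U\<close>. The constant depends on the number of steps,
  but the smallness of \<open>\<kappa>\<close> that is assumed depends only on the dimension.
\<close>

proposition cube_control:
  fixes z x :: "'b::euclidean_space"
  assumes dim: "3 \<le> DIM('b)"
    and \<kappa>: "\<kappa> \<in> borel_measurable borel" "\<And>x. 0 \<le> \<kappa> x"
    and small: "small_on (cbox z (z + r *\<^sub>R One)) \<kappa>" and r: "0 < r"
    and x: "x \<in> cbox z (z + r *\<^sub>R One)" and U: "0 < \<rho>" "ball x \<rho> \<inter> cbox z (z + r *\<^sub>R One) \<subseteq> U"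
  shows "controls (cbox z (z + r *\<^sub>R One)) \<kappa> U (cbox z (z + r *\<^sub>R One))"
proof -
  define D where "D = cbox z (z + r *\<^sub>R One)"
  have "\<exists>y. x \<in> cbox y (y + (r / 2 ^ m) *\<^sub>R One) \<and> cbox y (y + (r / 2 ^ m) *\<^sub>R One) \<subseteq> D \<and>
      controls D \<kappa> (cbox y (y + (r / 2 ^ m) *\<^sub>R One)) D" for m
  proof (induction m)
    case 0
    then show ?case using x by (intro exI[of _ z]) (auto simp: D_def controls_mono)
  next
    case (Suc m)
    then obtain y where y: "x \<in> cbox y (y + (r / 2 ^ m) *\<^sub>R One)" "cbox y (y + (r / 2 ^ m) *\<^sub>R One) \<subseteq> D"
      "controls D \<kappa> (cbox y (y + (r / 2 ^ m) *\<^sub>R One)) D" by blast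
    have e: "2 * (r / 2 ^ Suc m) = r / 2 ^ m" by simp
    obtain y' where "x \<in> cbox y' (y' + (r / 2 ^ Suc m) *\<^sub>R One)"
       "cbox y' (y' + (r / 2 ^ Suc m) *\<^sub>R One) \<subseteq> cbox y (y + (r / 2 ^ m) *\<^sub>R One)"
       "controls D \<kappa> (cbox y' (y' + (r / 2 ^ Suc m) *\<^sub>R One)) (cbox y (y + (r / 2 ^ m) *\<^sub>R One))"
      using cube_halving[OF dim \<kappa> small[folded D_def], of y "r / 2 ^ Suc m" x] y r unfolding e by auto
    then show ?case using y by (intro exI[of _ y']) (auto intro: controls_trans)
  qed
  moreover obtain m :: nat where m: "r * real DIM('b) / \<rho> < 2 ^ m"
    using real_arch_pow[of 2] by auto
  ultimately obtain y where y: "x \<in> cbox y (y + (r / 2 ^ m) *\<^sub>R One)" "cbox y (y + (r / 2 ^ m) *\<^sub>R One) \<subseteq> D"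
      "controls D \<kappa> (cbox y (y + (r / 2 ^ m) *\<^sub>R One)) D" by blast
  have "cbox y (y + (r / 2 ^ m) *\<^sub>R One) \<subseteq> ball x \<rho>"
  proof
    fix v assume v: "v \<in> cbox y (y + (r / 2 ^ m) *\<^sub>R One)"
    have "dist x v \<le> (\<Sum>b\<in>(Basis::'b set). \<bar>(x - v) \<bullet> b\<bar>)" unfolding dist_norm by (rule norm_le_l1)
    also have "\<dots> \<le> (\<Sum>b\<in>(Basis::'b set). r / 2 ^ m)"
    proof (rule sum_mono)
      fix b :: 'b assume "b \<in> Basis"
      then have "y \<bullet> b \<le> x \<bullet> b \<and> x \<bullet> b \<le> y \<bullet> b + r / 2 ^ m" "y \<bullet> b \<le> v \<bullet> b \<and> v \<bullet> b \<le> y \<bullet> b + r / 2 ^ m"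
        using v y(1) by (auto simp: mem_box inner_add_left)
      then show "\<bar>(x - v) \<bullet> b\<bar> \<le> r / 2 ^ m" by (auto simp: inner_diff_left abs_le_iff)
    qed
    also have "\<dots> = r * real DIM('b) / 2 ^ m" by simp
    also have "\<dots> < \<rho>" using m U(1) by (simp add: field_simps)
    finally show "v \<in> ball x \<rho>" by simp
  qed
  then have "controls D \<kappa> U (cbox y (y + (r / 2 ^ m) *\<^sub>R One))"
    using y(2) U(2) by (intro controls_mono) (auto simp: D_def)
  then show ?thesis using y(3) unfolding D_def by (rule controls_trans)
qed

text \<open>
  Continuity from above of the finite measure with density \<open>\<kappa> powr n\<close>.
\<close>

lemma eventually_small_on:
  fixes S :: "nat \<Rightarrow> 'b::euclidean_space set"
  assumes dim: "3 \<le> DIM('b)" and [measurable]: "\<kappa> \<in> borel_measurable borel"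
    and dec: "decseq S" and [measurable]: "\<And>i. S i \<in> sets borel"
    and null: "emeasure lborel (\<Inter>i. S i) = 0"
    and fin: "(\<integral>\<^sup>+x\<in>S 0. ennreal (\<kappa> x powr real DIM('b)) \<partial>lborel) < top"
  shows "\<exists>i. small_on (S i) \<kappa>"
proof -
  define n where "n = real DIM('b)"
  have n: "3 \<le> n" using dim by (simp add: n_def)
  define C where "C = sob_const TYPE('b)"
  have C: "24 \<le> C" by (simp add: C_def sob_const_def)
  define \<nu> where "\<nu> = density lborel (\<lambda>x. ennreal (\<kappa> x powr n))"
  have em: "emeasure \<nu> B = (\<integral>\<^sup>+x\<in>B. ennreal (\<kappa> x powr n) \<partial>lborel)" if "B \<in> sets borel" for B
    using that by (simp add: \<nu>_def emeasure_density)
  have le0: "emeasure \<nu> (S i) \<noteq> \<infinity>" for i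
  proof -
    have "emeasure \<nu> (S i) \<le> emeasure \<nu> (S 0)"
      using dec by (intro emeasure_mono) (auto simp: decseq_def \<nu>_def)
    also have "\<dots> < top" using fin by (simp add: em n_def)
    finally show ?thesis by simp
  qed
  have "(\<lambda>i. emeasure \<nu> (S i)) \<longlonglongrightarrow> emeasure \<nu> (\<Inter>i. S i)"
    using dec le0 by (intro Lim_emeasure_decseq) (auto simp: \<nu>_def)
  also have "emeasure \<nu> (\<Inter>i. S i) = 0"
  proof -
    have "AE x in lborel. x \<notin> (\<Inter>i. S i)" using null by (intro AE_not_in) auto
    then have "AE x in lborel. ennreal (\<kappa> x powr n) * indicator (\<Inter>i. S i) x = 0" by eventually_elim auto
    then show ?thesis by (subst em) (auto simp: nn_integral_0_iff_AE)
  qed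
  finally have "eventually (\<lambda>i. emeasure \<nu> (S i) < ennreal ((1 / (2 * C)) powr (n / 2))) sequentially"
    using C by (intro order_tendstoD) (auto simp: ennreal_less_zero_iff)
  then obtain i where "emeasure \<nu> (S i) < ennreal ((1 / (2 * C)) powr (n / 2))"
    by (auto dest!: eventually_happens)
  then have i: "emeasure \<nu> (S i) \<le> ennreal ((1 / (2 * C)) powr (n / 2))" by simp
  have "critical_norm (S i) \<kappa> \<le> epow (ennreal ((1 / (2 * C)) powr (n / 2))) (2 / n)"
    unfolding critical_norm_def n_def[symmetric] using i n by (intro epow_mono) (auto simp: em)
  also have "\<dots> = ennreal (1 / (2 * C))" using n C by (simp add: epow_ennreal powr_powr)
  finally have "ennreal C * critical_norm (S i) \<kappa> \<le> ennreal C * ennreal (1 / (2 * C))"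
    by (rule mult_left_mono) simp
  also have "\<dots> = ennreal (1/2)" using C by (subst ennreal_mult[symmetric]) auto
  finally show ?thesis unfolding small_on_def C_def by blast
qed

section \<open>Charts\<close>

lemma chart_inv_left [simp]: "is_chart c \<Longrightarrow> p \<in> fst c \<Longrightarrow> chart_inv c (snd c p) = p"
  unfolding is_chart_def homeomorphism_def by blast

lemma chart_inv_right: "is_chart c \<Longrightarrow> x \<in> snd c ` fst c \<Longrightarrow> snd c (chart_inv c x) = x"
  unfolding is_chart_def homeomorphism_def by blast

lemma chart_inv_mem: "is_chart c \<Longrightarrow> x \<in> snd c ` fst c \<Longrightarrow> chart_inv c x \<in> fst c"
  unfolding is_chart_def homeomorphism_def by blast

lemma chart_open: "is_chart c \<Longrightarrow> open (fst c)"
  by (simp add: is_chart_def)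

lemma chart_continuous: "is_chart c \<Longrightarrow> continuous_on (fst c) (snd c)"
  "is_chart c \<Longrightarrow> continuous_on (snd c ` fst c) (chart_inv c)"
  unfolding is_chart_def homeomorphism_def by blast+

lemma chart_image_inv: "is_chart c \<Longrightarrow> D \<subseteq> snd c ` fst c \<Longrightarrow> snd c ` chart_inv c ` D = D"
  unfolding image_image by (subst image_cong[OF refl, of D _ "\<lambda>x. x"]) (auto simp: chart_inv_right)

lemma chart_openin:
  assumes "is_chart c" "open W" "W \<subseteq> fst c"
  shows "openin (top_of_set (snd c ` fst c)) (snd c ` W)"
proof -
  have "homeomorphism (fst c) (snd c ` fst c) (snd c) (chart_inv c)"
    using assms(1) by (simp add: is_chart_def)
  moreover have "openin (top_of_set (fst c)) W"
    using assms by (simp add: openin_open_eq chart_open)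
  ultimately show ?thesis by (rule homeomorphism_imp_open_map)
qed

lemma chart_at_within:
  fixes c :: "('a::topological_space, 'n::finite) chart"
  assumes "is_chart c" "open W" "W \<subseteq> fst c" "p \<in> W"
  shows "at (snd c p) within (snd c ` W) = at (snd c p) within (snd c ` fst c)"
proof -
  obtain Q where Q: "open Q" "snd c ` W = snd c ` fst c \<inter> Q"
    using chart_openin[OF assms(1-3)] by (auto simp: openin_open)
  show ?thesis
    by (rule at_within_nhd[of _ Q]) (use Q assms(4) in auto)
qed

lemma chart_image_borel:
  fixes c :: "('a::topological_space, 'n::finite) chart"
  assumes "is_chart c" "open W" "W \<subseteq> fst c"
  shows "snd c ` W \<in> sets borel"
proof -
  obtain v where v: "openin (top_of_set {x. 0 \<le> v \<bullet> x}) (snd c ` fst c)"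
    using assms(1) by (auto simp: is_chart_def)
  have "openin (top_of_set {x. 0 \<le> v \<bullet> x}) (snd c ` W)"
    using chart_openin[OF assms] v by (rule openin_trans)
  then obtain Q where "open Q" "snd c ` W = {x. 0 \<le> v \<bullet> x} \<inter> Q" by (auto simp: openin_open)
  moreover have "closed {x. 0 \<le> v \<bullet> x}" by (simp add: closed_halfspace_ge)
  ultimately show ?thesis by auto
qed

text \<open>
  The image of a chart is relatively open in a half-space, so for each coordinate direction it contains
  a short segment from the given point in at least one of the two senses.
\<close>

lemma chart_has_derivative_unique:
  fixes c :: "('a::topological_space, 'n::finite) chart" and f :: "real^'n \<Rightarrow> 'y::real_normed_vector"
  assumes c: "is_chart c" "p \<in> fst c"
    and "(f has_derivative D) (at (snd c p) within (snd c ` fst c))"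
    and "(f has_derivative D') (at (snd c p) within (snd c ` fst c))"
  shows "D = D'"
proof (rule frechet_derivative_unique_within[OF assms(3,4)])
  fix i :: "real^'n" and \<epsilon> :: real assume i: "i \<in> Basis" and \<epsilon>: "0 < \<epsilon>"
  obtain v where v: "openin (top_of_set {x. 0 \<le> v \<bullet> x}) (snd c ` fst c)"
    using c by (auto simp: is_chart_def)
  then obtain Q where Q: "open Q" "snd c ` fst c = {x. 0 \<le> v \<bullet> x} \<inter> Q" by (auto simp: openin_open)
  let ?x = "snd c p"
  have x: "?x \<in> Q" "0 \<le> v \<bullet> ?x" using Q(2) c by auto
  then obtain r where r: "0 < r" "ball ?x r \<subseteq> Q" using Q(1) open_contains_ball by blast
  define d where "d = (if 0 \<le> v \<bullet> i then 1 else -1) * min (\<epsilon> / 2) (r / 2)"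
  have d: "0 < \<bar>d\<bar>" "\<bar>d\<bar> < \<epsilon>" "\<bar>d\<bar> < r" using \<epsilon> r by (auto simp: d_def)
  have "0 \<le> d * (v \<bullet> i)" using \<epsilon> r by (auto simp: d_def mult_le_0_iff min_def)
  then have "0 \<le> v \<bullet> (?x + d *\<^sub>R i)" using x by (simp add: inner_add_right)
  moreover have "?x + d *\<^sub>R i \<in> Q" using r d i by (intro subsetD[OF r(2)]) (simp add: dist_norm)
  ultimately show "\<exists>d. 0 < \<bar>d\<bar> \<and> \<bar>d\<bar> < \<epsilon> \<and> ?x + d *\<^sub>R i \<in> snd c ` fst c"
    using d Q(2) by (intro exI[of _ d]) auto
qed

definition has_chart_deriv ::
  "('a, 'n::finite) chart \<Rightarrow> ('a \<Rightarrow> 'y::real_normed_vector) \<Rightarrow> 'a \<Rightarrow> (real^'n \<Rightarrow> 'y) \<Rightarrow> bool" where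
  "has_chart_deriv c f p D \<longleftrightarrow>
     ((\<lambda>x. f (chart_inv c x)) has_derivative D) (at (snd c p) within snd c ` fst c)"

lemma chart_deriv_eq:
  fixes c :: "('a::topological_space, 'n::finite) chart"
  assumes "is_chart c" "p \<in> fst c" "has_chart_deriv c f p D"
  shows "chart_deriv c f p = D"
proof
  fix X
  have "((\<lambda>x. f (chart_inv c x)) has_derivative
     frechet_derivative (\<lambda>x. f (chart_inv c x)) (at (snd c p) within snd c ` fst c)) (at (snd c p) within snd c ` fst c)"
    using assms(3) unfolding has_chart_deriv_def frechet_derivative_works[symmetric]
    by (rule differentiableI)
  from chart_has_derivative_unique[OF assms(1,2) this assms(3)[unfolded has_chart_deriv_def]]
  show "chart_deriv c f p X = D X" by (simp add: chart_deriv_def)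
qed

lemma has_chart_deriv_chart_deriv:
  fixes c :: "('a::topological_space, 'n::finite) chart"
  assumes "is_chart c" "p \<in> fst c" "has_chart_deriv c f p D"
  shows "has_chart_deriv c f p (chart_deriv c f p)"
  using chart_deriv_eq[OF assms] assms(3) by simp

lemma has_chart_deriv_linear:
  "has_chart_deriv c f p D \<Longrightarrow> linear D"
  unfolding has_chart_deriv_def by (rule has_derivative_linear)

lemma has_chart_deriv_local:
  fixes c :: "('a::topological_space, 'n::finite) chart"
  assumes "is_chart c" "open W" "W \<subseteq> fst c" "p \<in> W" "\<And>q. q \<in> W \<Longrightarrow> f q = f' q"
    and "has_chart_deriv c f p D"
  shows "has_chart_deriv c f' p D"
proof -
  note eq = chart_at_within[OF assms(1-4)]
  have "((\<lambda>x. f (chart_inv c x)) has_derivative D) (at (snd c p) within snd c ` W)"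
    using assms(6) by (simp add: has_chart_deriv_def eq)
  then have "((\<lambda>x. f' (chart_inv c x)) has_derivative D) (at (snd c p) within snd c ` W)"
    by (rule has_derivative_transform[rotated 2]) (use assms in \<open>auto simp: subset_iff\<close>)
  then show ?thesis by (simp add: has_chart_deriv_def eq)
qed

lemma Ck_on_continuous: "Ck_on k f S \<Longrightarrow> continuous_on S f"
  by (cases k) (auto intro: has_derivative_continuous_on)

lemma C1_in_chart:
  fixes c :: "('a::topological_space, 'n::finite) chart"
  assumes c: "is_chart c" "open W" "W \<subseteq> fst c" and C1: "Ck_in_chart (Suc k) c W f"
  shows "p \<in> W \<Longrightarrow> has_chart_deriv c f p (chart_deriv c f p)"
    and "continuous_on (snd c ` W) (\<lambda>x. chart_deriv c f (chart_inv c x) v)"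
    and "continuous_on (snd c ` W) (\<lambda>x. f (chart_inv c x))"
proof -
  obtain f' where f': "\<And>x. x \<in> snd c ` W \<Longrightarrow> ((\<lambda>x. f (chart_inv c x)) has_derivative f' x) (at x within snd c ` W)"
     "\<And>v. Ck_on k (\<lambda>x. f' x v) (snd c ` W)"
    using C1 by (auto simp: Ck_in_chart_def)
  have D: "has_chart_deriv c f p (f' (snd c p))" if "p \<in> W" for p
    using f'(1)[of "snd c p"] that by (simp add: has_chart_deriv_def chart_at_within[OF c that])
  have eq: "chart_deriv c f p = f' (snd c p)" if "p \<in> W" for p
    using D[OF that] that c by (intro chart_deriv_eq) auto
  show "has_chart_deriv c f p (chart_deriv c f p)" if "p \<in> W"
    using D[OF that] eq[OF that] by simp
  have "continuous_on (snd c ` W) (\<lambda>x. f' x v)"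
    using f'(2) by (rule Ck_on_continuous)
  then show "continuous_on (snd c ` W) (\<lambda>x. chart_deriv c f (chart_inv c x) v)"
    by (rule continuous_on_cong[THEN iffD1, rotated 2, OF _ refl])
       (use c eq in \<open>auto simp: subset_iff\<close>)
  show "continuous_on (snd c ` W) (\<lambda>x. f (chart_inv c x))"
    using f'(1) by (rule has_derivative_continuous_on)
qed

lemma smooth_in_chart_C1: "smooth_in_chart c W f \<Longrightarrow> Ck_in_chart (Suc 0) c W f"
  by (auto simp: smooth_in_chart_def)

lemma chart_chain_rule:
  fixes c d :: "('a::topological_space, 'n::finite) chart"
  assumes c: "is_chart c" and d: "is_chart d" and cd: "compatible_charts c d"
    and p: "p \<in> fst c" "p \<in> fst d" and f: "has_chart_deriv d f p D"
  shows "has_chart_deriv c f p (\<lambda>X. D (chart_deriv c (snd d) p X))"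
proof -
  let ?W = "fst c \<inter> fst d"
  have W: "open ?W" "?W \<subseteq> fst c" "p \<in> ?W" using c d p by (auto simp: chart_open)
  note eq = chart_at_within[OF c W]
  let ?T = "\<lambda>x. snd d (chart_inv c x)"
  have "has_chart_deriv c (snd d) p (chart_deriv c (snd d) p)"
    using C1_in_chart(1)[OF c W(1,2) smooth_in_chart_C1 W(3)] cd unfolding compatible_charts_def by blast
  then have 1: "(?T has_derivative chart_deriv c (snd d) p) (at (snd c p) within snd c ` ?W)"
    by (simp add: has_chart_deriv_def eq)
  have Tp: "?T (snd c p) = snd d p" using c p by simp
  have "((\<lambda>y. f (chart_inv d y)) has_derivative D) (at (?T (snd c p)) within ?T ` snd c ` ?W)"
    using f unfolding Tp has_chart_deriv_def
    by (rule has_derivative_subset) (use c in \<open>auto simp: subset_iff\<close>)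
  from diff_chain_within[OF 1 this]
  have "((\<lambda>x. f (chart_inv d (?T x))) has_derivative (\<lambda>X. D (chart_deriv c (snd d) p X))) (at (snd c p) within snd c ` ?W)"
    by (simp add: comp_def)
  then have "((\<lambda>x. f (chart_inv c x)) has_derivative (\<lambda>X. D (chart_deriv c (snd d) p X))) (at (snd c p) within snd c ` ?W)"
    by (rule has_derivative_transform[rotated 2]) (use c d p in auto)
  then show ?thesis by (simp add: has_chart_deriv_def eq)
qed

lemma chart_deriv_self:
  fixes c :: "('a::topological_space, 'n::finite) chart"
  assumes "is_chart c" "p \<in> fst c"
  shows "chart_deriv c (snd c) p = (\<lambda>X. X)"
proof (rule chart_deriv_eq[OF assms])
  have "((\<lambda>x. x) has_derivative (\<lambda>X. X)) (at (snd c p) within snd c ` fst c)" by (rule has_derivative_ident)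
  then show "has_chart_deriv c (snd c) p (\<lambda>X. X)"
    unfolding has_chart_deriv_def
    by (rule has_derivative_transform[rotated 2]) (use assms in \<open>auto simp: chart_inv_right\<close>)
qed

section \<open>Rotated charts\<close>

lemma Ck_on_cong:
  assumes "\<And>x. x \<in> S \<Longrightarrow> f x = g x" "Ck_on k f S"
  shows "Ck_on k g S"
  using assms
proof (cases k)
  case 0
  then show ?thesis using assms by (auto cong: continuous_on_cong)
next
  case (Suc m)
  then obtain f' where f': "\<And>x. x \<in> S \<Longrightarrow> (f has_derivative f' x) (at x within S)" "\<And>v. Ck_on m (\<lambda>x. f' x v) S"
    using assms(2) by auto
  have "(g has_derivative f' x) (at x within S)" if "x \<in> S" for x
    by (rule has_derivative_transform[OF that _ f'(1)[OF that]]) (simp add: assms(1))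
  then show ?thesis using Suc f'(2) by auto
qed

lemma Ck_on_linear_left:
  assumes L: "bounded_linear L" and "Ck_on k f S"
  shows "Ck_on k (\<lambda>x. L (f x)) S"
  using assms(2)
proof (induction k arbitrary: f)
  case 0
  then show ?case using L by (auto intro: bounded_linear.continuous_on)
next
  case (Suc k)
  then obtain f' where f': "\<And>x. x \<in> S \<Longrightarrow> (f has_derivative f' x) (at x within S)" "\<And>v. Ck_on k (\<lambda>x. f' x v) S"
    by auto
  show ?case
    using f' Suc.IH by (auto intro!: exI[of _ "\<lambda>x v. L (f' x v)"] bounded_linear.has_derivative[OF L])
qed

lemma Ck_on_linear_right:
  fixes L :: "'x::euclidean_space \<Rightarrow> 'x"
  assumes L: "bounded_linear L" and "L ` S' \<subseteq> S" and "Ck_on k f S"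
  shows "Ck_on k (\<lambda>x. f (L x)) S'"
  using assms(3)
proof (induction k arbitrary: f)
  case 0
  then have "continuous_on S f" by simp
  then show ?case
    unfolding Ck_on.simps(1) by (rule continuous_on_compose2[OF _ linear_continuous_on[OF L] assms(2)])
next
  case (Suc k)
  then obtain f' where f': "\<And>x. x \<in> S \<Longrightarrow> (f has_derivative f' x) (at x within S)" "\<And>v. Ck_on k (\<lambda>x. f' x v) S"
    by auto
  have "((\<lambda>x. f (L x)) has_derivative (\<lambda>v. f' (L x) (L v))) (at x within S')" if x: "x \<in> S'" for x
  proof -
    have 1: "(L has_derivative L) (at x within S')" by (rule bounded_linear_imp_has_derivative[OF L])
    have 2: "(f has_derivative f' (L x)) (at (L x) within L ` S')"
    proof (rule has_derivative_subset[OF _ assms(2)])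
      have "L x \<in> S" using x assms(2) by blast
      then show "(f has_derivative f' (L x)) (at (L x) within S)" by (rule f'(1))
    qed
    show ?thesis using diff_chain_within[OF 1 2] by (simp add: comp_def)
  qed
  moreover have "Ck_on k (\<lambda>x. f' (L x) (L v)) S'" for v
    using Suc.IH[OF f'(2)[of "L v"]] .
  ultimately show ?case
    unfolding Ck_on.simps(2) by (intro exI[of _ "\<lambda>x v. f' (L x) (L v)"] conjI ballI allI)
qed

text \<open>
  The atlas is maximal, hence closed under rotations of the coordinates. They are needed to turn the
  boundary into a coordinate hyperplane, so that cubes can have a face on it.
\<close>

lemma rotated_chart:
  fixes A :: "('a::topological_space, 'n::finite) chart set"
  assumes A: "smooth_structure A" and c: "c \<in> A" and f: "orthogonal_transformation f"
  shows "(fst c, \<lambda>p. f (snd c p)) \<in> A"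
proof -
  define h where "h = inv f"
  have bij: "bij f" using f by (rule orthogonal_transformation_bij)
  have hf: "h (f x) = x" "f (h x) = x" for x
    using bij by (auto simp: h_def bij_is_inj bij_is_surj surj_f_inv_f)
  have oh: "orthogonal_transformation h" unfolding h_def using f by (rule orthogonal_transformation_inv)
  have bl: "bounded_linear f" "bounded_linear h"
    using f oh by (auto simp: orthogonal_transformation_linear linear_conv_bounded_linear[symmetric])
  let ?c = "(fst c, \<lambda>p. f (snd c p)) :: ('a, 'n) chart"
  have cc: "is_chart c" using A c by (auto simp: smooth_structure_def)
  have inj: "inj_on (snd c) (fst c)"
    using cc by (metis chart_inv_left inj_onI)
  have im: "snd ?c ` fst ?c = f ` snd c ` fst c" by (simp add: image_image)
  have inv: "chart_inv ?c x = chart_inv c (h x)" if x: "x \<in> f ` snd c ` fst c" for x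
  proof -
    obtain p where p: "p \<in> fst c" "x = f (snd c p)" using x by auto
    have "inj_on (\<lambda>p. f (snd c p)) (fst c)"
      by (rule inj_onI) (metis hf(1) inj inj_onD)
    then have "chart_inv ?c x = p" using p inv_into_f_f[of "\<lambda>p. f (snd c p)" "fst c" p] by (simp add: chart_inv_def)
    then show ?thesis using p cc by (simp add: hf)
  qed
  obtain v where v: "openin (top_of_set {x. 0 \<le> v \<bullet> x}) (snd c ` fst c)"
    using cc by (auto simp: is_chart_def)
  have "is_chart ?c"
    unfolding is_chart_def im
  proof (intro conjI exI)
    show "open (fst ?c)" using cc by (simp add: chart_open)
    have "{x. 0 \<le> f v \<bullet> x} = f ` {x. 0 \<le> v \<bullet> x}"
    proof -
      have "f v \<bullet> x = v \<bullet> h x" for x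
        using f hf(2)[of x] unfolding orthogonal_transformation_def by metis
      then show ?thesis by (auto simp: hf intro!: image_eqI[of _ f "h _"])
    qed
    moreover have "openin (top_of_set (f ` {x. 0 \<le> v \<bullet> x})) (f ` snd c ` fst c)"
    proof -
      have "homeomorphism {x. 0 \<le> v \<bullet> x} (f ` {x. 0 \<le> v \<bullet> x}) f h"
        using bl by (auto simp: homeomorphism_def hf image_image linear_continuous_on)
      then show ?thesis using v by (rule homeomorphism_imp_open_map)
    qed
    ultimately show "openin (top_of_set {x. 0 \<le> f v \<bullet> x}) (f ` snd c ` fst c)" by simp
    have "homeomorphism (fst c) (f ` snd c ` fst c) (f \<circ> snd c) (chart_inv c \<circ> h)"
    proof (rule homeomorphism_compose)
      show "homeomorphism (fst c) (snd c ` fst c) (snd c) (chart_inv c)" using cc by (simp add: is_chart_def)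
      show "homeomorphism (snd c ` fst c) (f ` snd c ` fst c) f h"
        using bl by (auto simp: homeomorphism_def hf image_image linear_continuous_on)
    qed
    then show "homeomorphism (fst ?c) (f ` snd c ` fst c) (snd ?c) (chart_inv ?c)"
      by (rule homeomorphism_cong) (auto simp: inv[OF imageI[OF imageI]] hf)
  qed
  moreover have "compatible_charts ?c d" if d: "d \<in> A" for d
  proof -
    have cd: "compatible_charts c d" using A c d by (auto simp: smooth_structure_def)
    have "Ck_in_chart k ?c (fst c \<inter> fst d) (snd d)" for k
    proof -
      let ?S = "snd c ` (fst c \<inter> fst d)"
      have "Ck_on k (\<lambda>x. snd d (chart_inv c x)) ?S"
        using cd by (simp add: compatible_charts_def smooth_in_chart_def Ck_in_chart_def)
      then have "Ck_on k (\<lambda>x. snd d (chart_inv c (h x))) (f ` ?S)"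
        by (rule Ck_on_linear_right[OF bl(2), rotated]) (auto simp: hf)
      then have "Ck_on k (\<lambda>x. snd d (chart_inv ?c x)) (f ` ?S)"
        by (rule Ck_on_cong[rotated]) (use inv in force)
      then show ?thesis by (simp add: Ck_in_chart_def image_image)
    qed
    moreover have "Ck_in_chart k d (fst c \<inter> fst d) (\<lambda>p. f (snd c p))" for k
      using cd bl(1) by (auto simp: compatible_charts_def smooth_in_chart_def Ck_in_chart_def intro: Ck_on_linear_left)
    ultimately show ?thesis by (simp add: compatible_charts_def smooth_in_chart_def)
  qed
  ultimately show ?thesis using A unfolding smooth_structure_def by blast
qed

text \<open>
  The vector \<open>m\<close> fixes the position of \<open>x\<close> in the cube relative to the side length, so that \<open>x\<close> does not move
  within the cube as \<open>r\<close> shrinks.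
\<close>

definition corner_cube :: "'b::euclidean_space \<Rightarrow> 'b \<Rightarrow> real \<Rightarrow> 'b set" where
  "corner_cube x m r = cbox (x - r *\<^sub>R m) (x - r *\<^sub>R m + r *\<^sub>R One)"

definition cube_family :: "('a::topological_space, 'n::finite) chart \<Rightarrow> 'a \<Rightarrow> real^'n \<Rightarrow> real \<Rightarrow> bool" where
  "cube_family c p m r0 \<longleftrightarrow> 0 < r0 \<and>
     (\<forall>r. 0 < r \<and> r \<le> r0 \<longrightarrow>
        snd c p \<in> corner_cube (snd c p) m r \<and>
        corner_cube (snd c p) m r \<subseteq> snd c ` fst c \<and>
        corner_cube (snd c p) m r \<subseteq> cball (snd c p) (r * real CARD('n)) \<and>
        (\<exists>Q. open Q \<and> p \<in> Q \<and> Q \<subseteq> fst c \<and> snd c ` Q \<subseteq> corner_cube (snd c p) m r) \<and>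
        (\<forall>r'\<ge>r. r' \<le> r0 \<longrightarrow> corner_cube (snd c p) m r \<subseteq> corner_cube (snd c p) m r'))"

lemma cube_familyD:
  fixes c :: "('a::topological_space, 'n::finite) chart"
  assumes "cube_family c p m r0" "0 < r" "r \<le> r0"
  shows "snd c p \<in> corner_cube (snd c p) m r"
    and "corner_cube (snd c p) m r \<subseteq> snd c ` fst c"
    and "corner_cube (snd c p) m r \<subseteq> cball (snd c p) (r * real CARD('n))"
    and "\<exists>Q. open Q \<and> p \<in> Q \<and> Q \<subseteq> fst c \<and> snd c ` Q \<subseteq> corner_cube (snd c p) m r"
    and "r \<le> r' \<Longrightarrow> r' \<le> r0 \<Longrightarrow> corner_cube (snd c p) m r \<subseteq> corner_cube (snd c p) m r'"
  using conjunct2[OF assms(1)[unfolded cube_family_def], rule_format, of r] assms(2,3) by simp_all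

lemma cube_family_pos: "cube_family c p m r0 \<Longrightarrow> 0 < r0"
  unfolding cube_family_def by (rule conjunct1)

text \<open>
  In the directions \<open>K\<close> the image of the chart lies on one side of the point, and the cube starts at the
  point; in the other directions it is centred there.
\<close>

lemma chart_cubes:
  fixes c :: "('a::topological_space, 'n::finite) chart"
  assumes c: "is_chart c" "p \<in> fst c" and K: "K \<subseteq> Basis" and \<rho>: "0 < \<rho>"
    and in_U: "\<And>y. dist (snd c p) y < \<rho> \<Longrightarrow> (\<And>k. k \<in> K \<Longrightarrow> snd c p \<bullet> k \<le> y \<bullet> k) \<Longrightarrow> y \<in> snd c ` fst c"
    and of_U: "\<And>y k. y \<in> snd c ` fst c \<Longrightarrow> k \<in> K \<Longrightarrow> snd c p \<bullet> k \<le> y \<bullet> k"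
  obtains m r0 where "cube_family c p m r0"
proof -
  let ?x = "snd c p"
  define m :: "real^'n" where "m = (\<Sum>b\<in>Basis. (if b \<in> K then 0 else 1/2) *\<^sub>R b)"
  have m: "m \<bullet> b = (if b \<in> K then 0 else 1/2)" if "b \<in> Basis" for b
    using that by (simp add: m_def)
  let ?D = "\<lambda>r. cbox (?x - r *\<^sub>R m) (?x - r *\<^sub>R m + r *\<^sub>R One)"
  have D: "y \<in> ?D r \<longleftrightarrow> (\<forall>b\<in>Basis. ?x \<bullet> b - r * (m \<bullet> b) \<le> y \<bullet> b \<and> y \<bullet> b \<le> ?x \<bullet> b + r * (1 - m \<bullet> b))" for y r
    by (auto simp: mem_box inner_diff_left inner_add_left algebra_simps)
  have dist_D: "dist ?x y \<le> r * real CARD('n)" if y: "y \<in> ?D r" and r: "0 < r" for y r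
  proof -
    have "dist ?x y \<le> (\<Sum>b\<in>Basis. \<bar>(?x - y) \<bullet> b\<bar>)" unfolding dist_norm by (rule norm_le_l1)
    also have "\<dots> \<le> (\<Sum>b\<in>(Basis :: (real^'n) set). r)"
    proof (rule sum_mono)
      fix b :: "real^'n" assume b: "b \<in> Basis"
      have "?x \<bullet> b - r * (m \<bullet> b) \<le> y \<bullet> b" "y \<bullet> b \<le> ?x \<bullet> b + r * (1 - m \<bullet> b)"
        using y b unfolding D by auto
      then show "\<bar>(?x - y) \<bullet> b\<bar> \<le> r"
        using r by (auto simp: m[OF b] inner_diff_left abs_le_iff split: if_splits)
    qed
    also have "\<dots> = r * real CARD('n)" by simp
    finally show ?thesis .
  qed
  define r0 where "r0 = \<rho> / (2 * real CARD('n))"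
  have r0: "0 < r0" using \<rho> by (simp add: r0_def)
  have near: "dist ?x y < \<rho>" if "y \<in> ?D r" "0 < r" "r \<le> r0" for y r
  proof -
    have "r * real CARD('n) \<le> r0 * real CARD('n)" using that by (intro mult_right_mono) auto
    also have "\<dots> < \<rho>" using \<rho> by (simp add: r0_def)
    finally show ?thesis using dist_D[OF that(1,2)] by simp
  qed
  have sub: "?D r \<subseteq> snd c ` fst c" if r: "0 < r" "r \<le> r0" for r
  proof
    fix y assume y: "y \<in> ?D r"
    show "y \<in> snd c ` fst c"
    proof (rule in_U[OF near[OF y r]])
      fix k assume k: "k \<in> K"
      then show "?x \<bullet> k \<le> y \<bullet> k" using y K m[of k] unfolding D by force
    qed
  qed
  have nbh: "\<exists>Q. open Q \<and> p \<in> Q \<and> Q \<subseteq> fst c \<and> snd c ` Q \<subseteq> ?D r" if r: "0 < r" "r \<le> r0" for r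
  proof (intro exI conjI)
    let ?Q = "fst c \<inter> snd c -` ball ?x (r / 2)"
    show "open ?Q"
      using continuous_open_preimage[OF chart_continuous(1)[OF c(1)] chart_open[OF c(1)] open_ball] .
    show "p \<in> ?Q" using c r by simp
    show "snd c ` ?Q \<subseteq> ?D r"
    proof
      fix y assume "y \<in> snd c ` ?Q"
      then have y: "y \<in> snd c ` fst c" "dist ?x y < r / 2" by auto
      show "y \<in> ?D r"
        unfolding D
      proof
        fix b :: "real^'n" assume b: "b \<in> Basis"
        have "\<bar>(y - ?x) \<bullet> b\<bar> \<le> norm (y - ?x)" using b by (rule Basis_le_norm)
        also have "\<dots> < r / 2" using y by (simp add: dist_norm norm_minus_commute)
        finally have "y \<bullet> b - ?x \<bullet> b < r / 2" "?x \<bullet> b - y \<bullet> b < r / 2"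
          unfolding inner_diff_left abs_less_iff by linarith+
        then show "?x \<bullet> b - r * (m \<bullet> b) \<le> y \<bullet> b \<and> y \<bullet> b \<le> ?x \<bullet> b + r * (1 - m \<bullet> b)"
          using of_U[OF y(1), of b] r by (auto simp: m[OF b])
      qed
    qed
  qed auto
  have mono: "?D r \<subseteq> ?D r'" if "0 < r" "r \<le> r'" for r r'
  proof
    fix y assume y: "y \<in> ?D r"
    show "y \<in> ?D r'"
      unfolding D
    proof
      fix b :: "real^'n" assume b: "b \<in> Basis"
      have "?x \<bullet> b - r * (m \<bullet> b) \<le> y \<bullet> b" "y \<bullet> b \<le> ?x \<bullet> b + r * (1 - m \<bullet> b)"
        using y b unfolding D by auto
      then show "?x \<bullet> b - r' * (m \<bullet> b) \<le> y \<bullet> b \<and> y \<bullet> b \<le> ?x \<bullet> b + r' * (1 - m \<bullet> b)"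
        using that by (auto simp: m[OF b] split: if_splits)
    qed
  qed
  have mem: "?x \<in> ?D r" if "0 < r" for r
    unfolding D using that m by (auto simp: zero_le_mult_iff)
  have cb: "?D r \<subseteq> cball ?x (r * real CARD('n))" if "0 < r" for r
  proof
    fix y assume "y \<in> ?D r"
    then show "y \<in> cball ?x (r * real CARD('n))" using dist_D[of y r] that unfolding mem_cball by blast
  qed
  have "cube_family c p m r0"
    unfolding cube_family_def corner_cube_def
  proof (intro conjI allI impI)
    show "0 < r0" by (rule r0)
  next
    fix r assume "0 < r \<and> r \<le> r0"
    then have r: "0 < r" "r \<le> r0" by blast+
    show "?x \<in> ?D r" by (rule mem[OF r(1)])
    show "?D r \<subseteq> snd c ` fst c" by (rule sub[OF r])
    show "?D r \<subseteq> cball ?x (r * real CARD('n))" by (rule cb[OF r(1)])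
    show "\<exists>Q. open Q \<and> p \<in> Q \<and> Q \<subseteq> fst c \<and> snd c ` Q \<subseteq> ?D r" by (rule nbh[OF r])
    fix r' assume "r \<le> r'"
    then show "?D r \<subseteq> ?D r'" by (rule mono[OF r(1)])
  qed
  then show thesis by (rule that)
qed

lemma cube_charts:
  fixes A :: "('a::topological_space, 'n::finite) chart set" and p :: 'a
  assumes A: "smooth_structure A"
  obtains c m r0 where "c \<in> A" "p \<in> fst c" "cube_family c p m r0"
proof -
  have "p \<in> (\<Union>c\<in>A. fst c)" using A by (simp add: smooth_structure_def)
  then obtain c where c: "c \<in> A" "p \<in> fst c" by auto
  have cc: "is_chart c" using A c by (simp add: smooth_structure_def)
  obtain v where v: "openin (top_of_set {x. 0 \<le> v \<bullet> x}) (snd c ` fst c)"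
    using cc by (auto simp: is_chart_def)
  then obtain Q where Q: "open Q" "snd c ` fst c = {x. 0 \<le> v \<bullet> x} \<inter> Q" by (auto simp: openin_open)
  have x: "snd c p \<in> Q" "0 \<le> v \<bullet> snd c p" using Q(2) c by auto
  show thesis
  proof (cases "v = 0 \<or> 0 < v \<bullet> snd c p")
    case True
    have "open (Q \<inter> {y. v = 0 \<or> 0 < v \<bullet> y})"
    proof (cases "v = 0")
      case False
      then show ?thesis using open_Int[OF Q(1) open_halfspace_gt[of 0 v]] by simp
    qed (use Q(1) in simp)
    moreover have "snd c p \<in> Q \<inter> {y. v = 0 \<or> 0 < v \<bullet> y}" using x True by auto
    ultimately obtain \<rho> where \<rho>: "0 < \<rho>" "ball (snd c p) \<rho> \<subseteq> Q \<inter> {y. v = 0 \<or> 0 < v \<bullet> y}"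
      unfolding open_contains_ball by blast
    have in_U: "y \<in> snd c ` fst c" if "dist (snd c p) y < \<rho>" for y
    proof -
      have "y \<in> Q \<inter> {y. v = 0 \<or> 0 < v \<bullet> y}" using \<rho>(2) that by (meson mem_ball subsetD)
      then have "0 \<le> v \<bullet> y" "y \<in> Q" by auto
      then show ?thesis unfolding Q(2) by blast
    qed
    show thesis
    proof (rule chart_cubes[OF cc c(2), of "{}" \<rho>])
      show "0 < \<rho>" by (rule \<rho>(1))
      show "y \<in> snd c ` fst c" if "dist (snd c p) y < \<rho>" for y using that by (rule in_U)
      show "snd c p \<bullet> k \<le> y \<bullet> k" if "k \<in> {}" for y k :: "real^'n" using that by simp
      show "{} \<subseteq> (Basis :: (real^'n) set)" by simp
    qed (rule that[OF c])
  next
    case False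
    then have v0: "v \<noteq> 0" "v \<bullet> snd c p = 0" using x by auto
    obtain k :: 'n where True by simp
    have nv_eq: "norm v = norm (norm v *\<^sub>R axis k 1 :: real^'n)" by simp
    obtain f :: "real^'n \<Rightarrow> real^'n" where f: "orthogonal_transformation f" "f v = norm v *\<^sub>R axis k 1"
      by (rule orthogonal_transformation_exists[OF nv_eq]) (rule that)
    define d where "d = (fst c, \<lambda>p. f (snd c p))"
    have dA: "d \<in> A" unfolding d_def by (rule rotated_chart[OF A c(1) f(1)])
    have dc: "is_chart d" using A dA by (simp add: smooth_structure_def)
    have pd: "p \<in> fst d" using c by (simp add: d_def)
    have im: "snd d ` fst d = f ` (snd c ` fst c)" by (simp add: d_def image_image)
    have fk: "norm v * (f y \<bullet> axis k 1) = v \<bullet> y" for y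
    proof -
      have "f v \<bullet> f y = v \<bullet> y" using f(1) by (simp add: orthogonal_transformation_def)
      then show ?thesis by (simp add: f(2) inner_commute)
    qed
    have nv: "0 < norm v" using v0 by simp
    have sgn: "0 \<le> f y \<bullet> axis k 1 \<longleftrightarrow> 0 \<le> v \<bullet> y" for y
      unfolding fk[symmetric] using nv by (simp add: zero_le_mult_iff)
    have xk: "snd d p \<bullet> axis k 1 = 0" using fk[of "snd c p"] nv v0 by (simp add: d_def)
    obtain \<rho> where \<rho>: "0 < \<rho>" "ball (snd c p) \<rho> \<subseteq> Q" using Q(1) x(1) open_contains_ball by blast
    show thesis
    proof (rule chart_cubes[OF dc pd, of "{axis k 1}" \<rho>])
      show "0 < \<rho>" by (rule \<rho>(1))
      show "{axis k 1} \<subseteq> (Basis :: (real^'n) set)" by (simp add: axis_in_Basis_iff)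
    next
      fix y assume y: "dist (snd d p) y < \<rho>" and "\<And>b. b \<in> {axis k 1} \<Longrightarrow> snd d p \<bullet> b \<le> y \<bullet> b"
      then have yk: "0 \<le> y \<bullet> axis k 1" by (simp add: xk)
      obtain w where w: "y = f w"
        using orthogonal_transformation_surj[OF f(1)] surjD[of f y] by blast
      have "dist (snd c p) w = dist (snd d p) y"
        using f(1) by (simp add: d_def w orthogonal_transformation_isometry)
      then have "w \<in> ball (snd c p) \<rho>" using y by simp
      then have "w \<in> Q" using \<rho>(2) by blast
      moreover have "0 \<le> v \<bullet> w" using yk sgn[of w] unfolding w by blast
      ultimately show "y \<in> snd d ` fst d" unfolding im Q(2) w by blast
    next
      fix y b assume y: "y \<in> snd d ` fst d" and b: "b \<in> {axis k (1::real)}"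
      then obtain w where "y = f w" "0 \<le> v \<bullet> w" unfolding im Q(2) by blast
      then have "0 \<le> y \<bullet> axis k 1" using sgn[of w] by blast
      then show "snd d p \<bullet> b \<le> y \<bullet> b" using b xk by simp
    qed (rule that[OF dA pd])
  qed
qed

section \<open>The Riemannian measure in a chart\<close>

lemma continuous_on_det:
  fixes M :: "'a::topological_space \<Rightarrow> real^'n^'n"
  assumes "continuous_on S M"
  shows "continuous_on S (\<lambda>x. det (M x))"
  unfolding det_def by (intro continuous_intros assms)

text \<open>
  The segment from the unit matrix to \<open>G\<close> consists of matrices with trivial kernel.
\<close>

lemma det_pos:
  fixes G :: "real^'n^'n"
  assumes pos: "\<And>X. X \<noteq> 0 \<Longrightarrow> 0 < X \<bullet> (G *v X)"
  shows "0 < det G"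
proof -
  define M where "M t = (1 - t) *\<^sub>R mat 1 + t *\<^sub>R G" for t :: real
  have ne: "det (M t) \<noteq> 0" if t: "0 \<le> t" "t \<le> 1" for t
  proof
    assume "det (M t) = 0"
    then have "\<not> invertible (M t)" by (simp add: invertible_det_nz)
    then obtain X where X: "M t *v X = 0" "X \<noteq> 0"
      unfolding invertible_left_inverse matrix_left_invertible_ker by auto
    have "0 = X \<bullet> (M t *v X)" using X by simp
    also have "\<dots> = (1 - t) * (X \<bullet> X) + t * (X \<bullet> (G *v X))"
      by (simp add: M_def matrix_vector_mult_add_rdistrib scaleR_matrix_vector_assoc[symmetric] inner_add_right)
    also have "\<dots> > 0"
    proof (cases "t = 0")
      case False
      then have "0 < t * (X \<bullet> (G *v X))" using pos[OF X(2)] t by simp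
      then show ?thesis using t by (intro add_nonneg_pos) auto
    qed (use X in simp)
    finally show False by simp
  qed
  have "continuous_on {0..1} (\<lambda>t. det (M t))"
    unfolding M_def by (intro continuous_on_det continuous_intros)
  then have "det (M 1) > 0"
  proof (rule_tac ccontr)
    assume cont: "continuous_on {0..1} (\<lambda>t. det (M t))" and "\<not> det (M 1) > 0"
    then have "det (M 1) \<le> 0" "0 \<le> det (M 0)" by (auto simp: M_def)
    then have "\<exists>t. 0 \<le> t \<and> t \<le> 1 \<and> det (M t) = 0"
      using cont by (intro IVT2') auto
    then show False using ne by auto
  qed
  then show ?thesis by (simp add: M_def)
qed

lemma chart_mem_image_iff:
  assumes "is_chart c" "S \<subseteq> fst c"
  shows "x \<in> snd c ` S \<longleftrightarrow> x \<in> snd c ` fst c \<and> chart_inv c x \<in> S"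
proof
  assume "x \<in> snd c ` S"
  then obtain p where p: "p \<in> S" "x = snd c p" by blast
  then show "x \<in> snd c ` fst c \<and> chart_inv c x \<in> S"
    using assms chart_inv_left[of c p] by (metis imageI subsetD)
next
  assume "x \<in> snd c ` fst c \<and> chart_inv c x \<in> S"
  then show "x \<in> snd c ` S"
    using chart_inv_right[OF assms(1), of x] by (metis imageI)
qed

definition posdef :: "real^'n^'n \<Rightarrow> bool" where
  "posdef G \<longleftrightarrow> transpose G = G \<and> (\<forall>X. X \<noteq> 0 \<longrightarrow> 0 < X \<bullet> (G *v X))"

lemma metric_continuous: "C0_riemannian_metric A g \<Longrightarrow> c \<in> A \<Longrightarrow> continuous_on (fst c) (g c)"
  unfolding C0_riemannian_metric_def by blast

lemma metric_posdef: "C0_riemannian_metric A g \<Longrightarrow> c \<in> A \<Longrightarrow> p \<in> fst c \<Longrightarrow> posdef (g c p)"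
  unfolding C0_riemannian_metric_def posdef_def by blast

lemma metric_change:
  "C0_riemannian_metric A g \<Longrightarrow> c \<in> A \<Longrightarrow> d \<in> A \<Longrightarrow> p \<in> fst c \<Longrightarrow> p \<in> fst d \<Longrightarrow>
    chart_deriv c (snd d) p X \<bullet> (g d p *v chart_deriv c (snd d) p Y) = X \<bullet> (g c p *v Y)"
  unfolding C0_riemannian_metric_def by (metis Int_iff)

lemma metric_matrix_continuous:
  fixes A :: "('a::topological_space, 'n::finite) chart set"
  assumes A: "smooth_structure A" and g: "C0_riemannian_metric A g" and c: "c \<in> A"
  shows "continuous_on (snd c ` fst c) (\<lambda>x. g c (chart_inv c x))"
    and "continuous_on (snd c ` fst c) (\<lambda>x. sqrt (det (g c (chart_inv c x))))"
    and "x \<in> snd c ` fst c \<Longrightarrow> 0 < det (g c (chart_inv c x))"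
proof -
  have cc: "is_chart c" using A c by (simp add: smooth_structure_def)
  from metric_continuous[OF g c] show 1: "continuous_on (snd c ` fst c) (\<lambda>x. g c (chart_inv c x))"
    by (rule continuous_on_compose2[OF _ chart_continuous(2)[OF cc]]) (use chart_inv_mem[OF cc] in blast)
  then show "continuous_on (snd c ` fst c) (\<lambda>x. sqrt (det (g c (chart_inv c x))))"
    by (intro continuous_intros continuous_on_det)
  show "0 < det (g c (chart_inv c x))" if "x \<in> snd c ` fst c"
    using metric_posdef[OF g c chart_inv_mem[OF cc that]] unfolding posdef_def by (intro det_pos) blast
qed

text \<open>
  The defining property of the Riemannian measure says that, restricted to the domain of the chart, it
  is the image of the measure with density \<open>sqrt (det g)\<close> under the inverse of the chart.
\<close>

lemma nn_integral_chart:
  fixes A :: "('a::topological_space, 'n::finite) chart set"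
  assumes A: "smooth_structure A" and g: "C0_riemannian_metric A g" and vol: "riemannian_measure A g vol"
    and c: "c \<in> A" and h: "h \<in> borel_measurable borel"
  shows "(\<integral>\<^sup>+p\<in>fst c. h p \<partial>vol) =
     (\<integral>\<^sup>+x\<in>snd c ` fst c. (h (chart_inv c x) * ennreal (sqrt (det (g c (chart_inv c x))))) \<partial>lborel)"
proof -
  have cc: "is_chart c" using A c by (simp add: smooth_structure_def)
  have sv: "sets vol = sets borel" using vol by (simp add: riemannian_measure_def)
  note [measurable_cong] = sv
  let ?U = "snd c ` fst c"
  have [measurable]: "?U \<in> sets borel" using cc by (intro chart_image_borel) (auto simp: chart_open)
  have fc[measurable]: "fst c \<in> sets borel" using chart_open[OF cc] by simp
  define J where "J x = indicator ?U x *\<^sub>R sqrt (det (g c (chart_inv c x)))" for x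
  have [measurable]: "J \<in> borel_measurable borel"
    unfolding J_def[abs_def] using metric_matrix_continuous(2)[OF A g c]
    by (intro borel_measurable_continuous_on_indicator) auto
  show ?thesis
  proof (cases "fst c = {}")
    case True
    then show ?thesis by simp
  next
    case False
    then obtain p0 where p0: "p0 \<in> fst c" by auto
    define \<phi> where "\<phi> x = (if x \<in> ?U then chart_inv c x else p0)" for x
    have \<phi>: "\<phi> \<in> measurable borel borel"
    proof -
      have "chart_inv c \<in> borel_measurable (restrict_space borel ?U)"
        using chart_continuous(2)[OF cc] by (rule borel_measurable_continuous_on_restrict)
      then have "(\<lambda>x. if x \<in> ?U then chart_inv c x else p0) \<in> borel_measurable borel"
        by (subst (asm) measurable_restrict_space_iff[where c=p0]) auto
      then show ?thesis by (simp add: \<phi>_def[abs_def])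
    qed
    have \<phi>'[measurable]: "\<phi> \<in> measurable lborel vol"
      using \<phi> sv by (simp add: measurable_def space_borel sets_eq_imp_space_eq[OF sv])
    define \<nu> where "\<nu> = density lborel (\<lambda>x. ennreal (J x))"
    have "density vol (indicator (fst c)) = distr \<nu> vol \<phi>"
    proof (rule measure_eqI)
      show "sets (density vol (indicator (fst c))) = sets (distr \<nu> vol \<phi>)" by simp
    next
      fix S assume "S \<in> sets (density vol (indicator (fst c)))"
      then have S[measurable]: "S \<in> sets borel" by (simp add: sv)
      have pm[measurable]: "\<phi> -` S \<in> sets borel"
        using measurable_sets[OF \<phi> S] by simp
      have Sc: "S \<inter> fst c \<in> sets borel" by simp
      have "emeasure (density vol (indicator (fst c))) S = emeasure vol (S \<inter> fst c)"
        using S fc by (subst emeasure_density) (auto simp: sv indicator_inter_arith[symmetric] Int_commute)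
      also have "\<dots> = (\<integral>\<^sup>+x\<in>snd c ` (S \<inter> fst c). ennreal (sqrt (det (g c (chart_inv c x)))) \<partial>lborel)"
        using vol c Sc by (simp add: riemannian_measure_def)
      also have "\<dots> = (\<integral>\<^sup>+x. ennreal (J x) * indicator (\<phi> -` S) x \<partial>lborel)"
      proof (rule nn_integral_cong)
        fix x
        have "x \<in> snd c ` (S \<inter> fst c) \<longleftrightarrow> x \<in> ?U \<and> chart_inv c x \<in> S"
          using chart_mem_image_iff[OF cc, of "S \<inter> fst c" x] chart_inv_mem[OF cc, of x] by blast
        then show "ennreal (sqrt (det (g c (chart_inv c x)))) * indicator (snd c ` (S \<inter> fst c)) x
           = ennreal (J x) * indicator (\<phi> -` S) x"
          by (auto simp: J_def \<phi>_def indicator_def)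
      qed
      also have "\<dots> = emeasure \<nu> (\<phi> -` S)" unfolding \<nu>_def by (subst emeasure_density) auto
      also have "\<dots> = emeasure (distr \<nu> vol \<phi>) S"
        using S \<phi>' by (subst emeasure_distr) (auto simp: \<nu>_def sv)
      finally show "emeasure (density vol (indicator (fst c))) S = emeasure (distr \<nu> vol \<phi>) S" .
    qed
    note eq = this
    have hv[measurable]: "h \<in> borel_measurable vol"
      using h sv by (simp cong: measurable_cong_sets)
    have "(\<integral>\<^sup>+p\<in>fst c. h p \<partial>vol) = (\<integral>\<^sup>+p. h p \<partial>density vol (indicator (fst c)))"
      using fc by (subst nn_integral_density) (auto simp: sv mult.commute)
    also have "\<dots> = (\<integral>\<^sup>+x. h (\<phi> x) \<partial>\<nu>)"
      unfolding eq by (subst nn_integral_distr) (auto simp: \<nu>_def)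
    also have "\<dots> = (\<integral>\<^sup>+x. ennreal (J x) * h (\<phi> x) \<partial>lborel)"
    proof -
      have [measurable]: "(\<lambda>x. h (\<phi> x)) \<in> borel_measurable lborel"
        by (rule measurable_compose[OF \<phi>' hv])
      show ?thesis unfolding \<nu>_def by (subst nn_integral_density) auto
    qed
    also have "\<dots> = (\<integral>\<^sup>+x\<in>?U. (h (chart_inv c x) * ennreal (sqrt (det (g c (chart_inv c x))))) \<partial>lborel)"
      by (intro nn_integral_cong) (auto simp: J_def \<phi>_def indicator_def mult.commute)
    finally show ?thesis .
  qed
qed

lemma nn_integral_chart_le:
  fixes A :: "('a::topological_space, 'n::finite) chart set"
  assumes A: "smooth_structure A" and g: "C0_riemannian_metric A g" and vol: "riemannian_measure A g vol"
    and c: "c \<in> A" and h: "h \<in> borel_measurable borel"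
    and S: "S \<subseteq> fst c" "S \<in> sets borel" and M: "\<And>x. x \<in> snd c ` S \<Longrightarrow> sqrt (det (g c (chart_inv c x))) \<le> M"
  shows "(\<integral>\<^sup>+p\<in>S. h p \<partial>vol) \<le> ennreal M * (\<integral>\<^sup>+x\<in>snd c ` S. h (chart_inv c x) \<partial>lborel)"
proof -
  have cc: "is_chart c" using A c by (simp add: smooth_structure_def)
  have mem: "x \<in> snd c ` S \<longleftrightarrow> x \<in> snd c ` fst c \<and> chart_inv c x \<in> S" for x
    using chart_mem_image_iff[OF cc S(1)] .
  have [measurable]: "h \<in> borel_measurable borel" "S \<in> sets borel" by fact+
  have m: "(\<lambda>x. h (chart_inv c x) * indicator (snd c ` S) x) \<in> borel_measurable borel"
  proof -
    have U: "snd c ` fst c \<in> sets borel" using cc by (intro chart_image_borel) (auto simp: chart_open)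
    have "chart_inv c \<in> borel_measurable (restrict_space borel (snd c ` fst c))"
      using chart_continuous(2)[OF cc] by (rule borel_measurable_continuous_on_restrict)
    moreover have "(\<lambda>p. h p * indicator S p) \<in> borel_measurable borel" by measurable
    ultimately have "(\<lambda>x. h (chart_inv c x) * indicator S (chart_inv c x)) \<in> borel_measurable (restrict_space borel (snd c ` fst c))"
      by (rule measurable_compose)
    then have "(\<lambda>x. h (chart_inv c x) * indicator S (chart_inv c x) * indicator (snd c ` fst c) x) \<in> borel_measurable borel"
      using U by (subst (asm) borel_measurable_restrict_space_iff_ennreal) auto
    moreover have "h (chart_inv c x) * indicator S (chart_inv c x) * indicator (snd c ` fst c) x = h (chart_inv c x) * indicator (snd c ` S) x" for x
      using mem[of x] by (auto simp: indicator_def)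
    ultimately show ?thesis by simp
  qed
  have "(\<integral>\<^sup>+p\<in>S. h p \<partial>vol) = (\<integral>\<^sup>+p\<in>fst c. (h p * indicator S p) \<partial>vol)"
    using S by (intro nn_integral_cong) (auto simp: indicator_def)
  also have "\<dots> = (\<integral>\<^sup>+x\<in>snd c ` fst c. (h (chart_inv c x) * indicator S (chart_inv c x) * ennreal (sqrt (det (g c (chart_inv c x))))) \<partial>lborel)"
    by (rule nn_integral_chart[OF A g vol c]) measurable
  also have "\<dots> \<le> (\<integral>\<^sup>+x. ennreal M * (h (chart_inv c x) * indicator (snd c ` S) x) \<partial>lborel)"
  proof (rule nn_integral_mono)
    fix x
    show "h (chart_inv c x) * indicator S (chart_inv c x) * ennreal (sqrt (det (g c (chart_inv c x)))) * indicator (snd c ` fst c) x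
       \<le> ennreal M * (h (chart_inv c x) * indicator (snd c ` S) x)"
    proof (cases "x \<in> snd c ` S")
      case True
      have "h (chart_inv c x) * ennreal (sqrt (det (g c (chart_inv c x)))) \<le> h (chart_inv c x) * ennreal M"
        using M[OF True] by (intro mult_left_mono ennreal_leI) auto
      then show ?thesis using True mem[of x] by (simp add: mult.commute)
    next
      case False
      then have "x \<notin> snd c ` fst c \<or> chart_inv c x \<notin> S" unfolding mem by blast
      then show ?thesis by (metis indicator_simps(2) mult_zero_left mult_zero_right zero_le)
    qed
  qed
  also have "\<dots> = ennreal M * (\<integral>\<^sup>+x\<in>snd c ` S. h (chart_inv c x) \<partial>lborel)"
    using m by (intro nn_integral_cmult) simp
  finally show ?thesis .
qed

lemma nn_integral_chart_ge:
  fixes A :: "('a::topological_space, 'n::finite) chart set"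
  assumes A: "smooth_structure A" and g: "C0_riemannian_metric A g" and vol: "riemannian_measure A g vol"
    and c: "c \<in> A" and h: "h \<in> borel_measurable borel"
    and S: "S \<subseteq> fst c" "S \<in> sets borel" and M: "0 < M" "\<And>x. x \<in> snd c ` S \<Longrightarrow> M \<le> sqrt (det (g c (chart_inv c x)))"
  shows "(\<integral>\<^sup>+x\<in>snd c ` S. h (chart_inv c x) \<partial>lborel) \<le> ennreal (1/M) * (\<integral>\<^sup>+p\<in>S. h p \<partial>vol)"
proof -
  have cc: "is_chart c" using A c by (simp add: smooth_structure_def)
  have mem: "x \<in> snd c ` S \<longleftrightarrow> x \<in> snd c ` fst c \<and> chart_inv c x \<in> S" for x
    using chart_mem_image_iff[OF cc S(1)] .
  have [measurable]: "h \<in> borel_measurable borel" "S \<in> sets borel" by fact+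
  let ?J = "\<lambda>x. sqrt (det (g c (chart_inv c x)))"
  have sv: "sets vol = sets borel" using vol by (simp add: riemannian_measure_def)
  have "(\<integral>\<^sup>+x\<in>snd c ` S. h (chart_inv c x) \<partial>lborel) \<le>
    (\<integral>\<^sup>+x\<in>snd c ` fst c. ((ennreal (1/M) * (h (chart_inv c x) * indicator S (chart_inv c x))) * ennreal (?J x)) \<partial>lborel)"
  proof (rule nn_integral_mono)
    fix x
    show "h (chart_inv c x) * indicator (snd c ` S) x \<le>
      (ennreal (1/M) * (h (chart_inv c x) * indicator S (chart_inv c x))) * ennreal (?J x) * indicator (snd c ` fst c) x"
    proof (cases "x \<in> snd c ` S")
      case True
      then have J: "M \<le> ?J x" using M by simp
      have "1 = ennreal (1/M) * ennreal M" using M(1) by (subst ennreal_mult[symmetric]) auto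
      also have "\<dots> \<le> ennreal (1/M) * ennreal (?J x)" using J by (intro mult_left_mono ennreal_leI) auto
      finally have "h (chart_inv c x) * 1 \<le> h (chart_inv c x) * (ennreal (1/M) * ennreal (?J x))"
        by (rule mult_left_mono) simp
      then show ?thesis using True mem[of x] by (simp add: mult_ac)
    qed simp
  qed
  also have "\<dots> = (\<integral>\<^sup>+p\<in>fst c. (ennreal (1/M) * (h p * indicator S p)) \<partial>vol)"
    by (rule nn_integral_chart[OF A g vol c, symmetric]) measurable
  also have "\<dots> = (\<integral>\<^sup>+p. ennreal (1/M) * (h p * indicator S p) \<partial>vol)"
    using S by (intro nn_integral_cong) (auto simp: indicator_def)
  also have "\<dots> = ennreal (1/M) * (\<integral>\<^sup>+p\<in>S. h p \<partial>vol)"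
  proof (rule nn_integral_cmult)
    show "(\<lambda>p. h p * indicator S p) \<in> borel_measurable vol"
      using sv by (simp cong: measurable_cong_sets)
  qed
  finally show ?thesis .
qed

section \<open>Orthonormal frames of positive definite matrices\<close>

lemma posdef_sym: "posdef G \<Longrightarrow> X \<bullet> (G *v Y) = Y \<bullet> (G *v X)"
proof -
  assume "posdef G"
  then have t: "transpose G = G" by (simp add: posdef_def)
  have "X \<bullet> (G *v Y) = (X v* G) \<bullet> Y" by (rule dot_lmul_matrix[symmetric])
  also have "X v* G = transpose G *v X" by (rule transpose_matrix_vector[symmetric])
  finally show ?thesis unfolding t by (simp only: inner_commute)
qed

text \<open>
  The Gram--Schmidt process, as an induction on the set of indices.
\<close>

lemma orthonormal_family_exists:
  fixes G :: "real^'n^'n"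
  assumes G: "posdef G"
  shows "\<exists>f :: 'n \<Rightarrow> real^'n. \<forall>i j. f i \<bullet> (G *v f j) = (if i = j then 1 else 0)"
proof -
  have "\<exists>f :: 'n \<Rightarrow> real^'n. \<forall>i\<in>I. \<forall>j\<in>I. f i \<bullet> (G *v f j) = (if i = j then 1 else 0)" for I :: "'n set"
  proof (induction I rule: finite_induct[OF finite])
    case 1
    then show ?case by simp
  next
    case (2 k I)
    then obtain f where f: "\<And>i j. i \<in> I \<Longrightarrow> j \<in> I \<Longrightarrow> f i \<bullet> (G *v f j) = (if i = j then 1 else 0)" by blast
    have "dim (span (f ` I)) \<le> card (f ` I)" by (simp add: dim_le_card')
    also have "\<dots> \<le> card I" by (rule card_image_le) simp
    also have "\<dots> < card (insert k I)" using 2 by simp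
    also have "\<dots> \<le> CARD('n)" by (rule card_mono) auto
    finally have lt: "dim (span (f ` I)) < CARD('n)" .
    have "span (f ` I) \<noteq> UNIV"
    proof
      assume eq: "span (f ` I) = UNIV"
      have "dim (span (f ` I)) = CARD('n)" unfolding eq by simp
      with lt show False by simp
    qed
    then obtain x where x: "x \<notin> span (f ` I)" by auto
    define y where "y = x - (\<Sum>i\<in>I. (f i \<bullet> (G *v x)) *\<^sub>R f i)"
    have y0: "y \<noteq> 0"
    proof
      assume "y = 0"
      then have "x = (\<Sum>i\<in>I. (f i \<bullet> (G *v x)) *\<^sub>R f i)" by (simp add: y_def)
      moreover have "(\<Sum>i\<in>I. (f i \<bullet> (G *v x)) *\<^sub>R f i) \<in> span (f ` I)"
        by (intro span_sum span_scale span_base) auto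
      ultimately show False using x by simp
    qed
    have orth: "f j \<bullet> (G *v y) = 0" if j: "j \<in> I" for j
    proof -
      have "f j \<bullet> (G *v y) = f j \<bullet> (G *v x) - (\<Sum>i\<in>I. (f i \<bullet> (G *v x)) * (f j \<bullet> (G *v f i)))"
        by (simp add: y_def matrix_vector_mult_diff_distrib inner_diff_right linear_sum[OF matrix_vector_mul_linear]
            inner_sum_right matrix_vector_mult_scaleR)
      also have "(\<Sum>i\<in>I. (f i \<bullet> (G *v x)) * (f j \<bullet> (G *v f i))) = (\<Sum>i\<in>I. if i = j then f j \<bullet> (G *v x) else 0)"
        using f j by (intro sum.cong) auto
      also have "\<dots> = f j \<bullet> (G *v x)" using j by simp
      finally show ?thesis by simp
    qed
    define r where "r = sqrt (y \<bullet> (G *v y))"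
    have r: "0 < r" "r * r = y \<bullet> (G *v y)" using G y0 by (auto simp: r_def posdef_def less_imp_le)
    define f' where "f' = f(k := (1 / r) *\<^sub>R y)"
    have "f' i \<bullet> (G *v f' j) = (if i = j then 1 else 0)" if "i \<in> insert k I" "j \<in> insert k I" for i j
    proof -
      have ky: "((1 / r) *\<^sub>R y) \<bullet> (G *v ((1 / r) *\<^sub>R y)) = 1"
        using r(1) by (simp add: matrix_vector_mult_scaleR r(2)[symmetric])
      have jy: "f j \<bullet> (G *v ((1 / r) *\<^sub>R y)) = 0" "((1 / r) *\<^sub>R y) \<bullet> (G *v f j) = 0" if "j \<in> I" for j
        using orth[OF that] posdef_sym[OF G, of y "f j"] by (auto simp: matrix_vector_mult_scaleR)
      show ?thesis
        using that f[of i j] ky jy 2 by (auto simp: f'_def)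
    qed
    then show ?case by blast
  qed
  from this[of UNIV] show ?thesis by simp
qed

text \<open>
  If the columns of \<open>P\<close> form an orthonormal family, then \<open>transpose P ** G ** P\<close> is the unit matrix, and
  therefore \<open>P ** transpose P\<close> is the inverse of \<open>G\<close>.
\<close>

lemma orthonormal_frame:
  fixes G :: "real^'n^'n"
  assumes G: "posdef G"
  obtains f :: "'n \<Rightarrow> real^'n" where
    "\<And>i j. f i \<bullet> (G *v f j) = (if i = j then 1 else 0)"
    "\<And>Y. Y = (\<Sum>k\<in>UNIV. (Y \<bullet> (G *v f k)) *\<^sub>R f k)"
    "\<And>Y Z. Y \<bullet> (G *v Z) = (\<Sum>k\<in>UNIV. (Y \<bullet> (G *v f k)) * (Z \<bullet> (G *v f k)))"
    "matrix_inv G = (\<chi> i j. \<Sum>k\<in>UNIV. f k $ i * f k $ j)"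
proof -
  obtain f :: "'n \<Rightarrow> real^'n" where f: "\<And>i j. f i \<bullet> (G *v f j) = (if i = j then 1 else 0)"
    using orthonormal_family_exists[OF G] by blast
  define P :: "real^'n^'n" where "P = (\<chi> i k. f k $ i)"
  have Pc: "column k P = f k" for k by (simp add: P_def column_def vec_eq_iff)
  have "(transpose P ** (G ** P)) $ i $ j = f i \<bullet> (G *v f j)" for i j
  proof -
    have "(transpose P ** (G ** P)) $ i $ j = row i (transpose P) \<bullet> column j (G ** P)"
      by (simp add: matrix_matrix_mult_def row_def column_def inner_vec_def)
    also have "row i (transpose P) = f i" by (simp add: row_transpose Pc)
    also have "column j (G ** P) = G *v f j"
      by (simp add: P_def vec_eq_iff matrix_matrix_mult_def matrix_vector_mult_def column_def)
    finally show ?thesis .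
  qed
  then have 1: "transpose P ** (G ** P) = mat 1"
    by (simp add: f vec_eq_iff mat_def)
  then have 2: "(G ** P) ** transpose P = mat 1"
    by (simp add: matrix_left_right_inverse)
  then have 3: "G ** (P ** transpose P) = mat 1" by (simp add: matrix_mul_assoc)
  then have 4: "(P ** transpose P) ** G = mat 1" by (simp add: matrix_left_right_inverse)
  have inv: "matrix_inv G = P ** transpose P"
  proof -
    have "\<exists>B. G ** B = mat 1 \<and> B ** G = mat 1" using 3 4 by blast
    then have "G ** matrix_inv G = mat 1 \<and> matrix_inv G ** G = mat 1"
      unfolding matrix_inv_def by (rule someI_ex)
    then have "matrix_inv G = matrix_inv G ** (G ** (P ** transpose P))" using 3 by simp
    also have "\<dots> = (matrix_inv G ** G) ** (P ** transpose P)" by (simp only: matrix_mul_assoc)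
    also have "\<dots> = P ** transpose P"
      using \<open>G ** matrix_inv G = mat 1 \<and> matrix_inv G ** G = mat 1\<close> by simp
    finally show ?thesis .
  qed
  have PP: "P ** transpose P = (\<chi> i j. \<Sum>k\<in>UNIV. f k $ i * f k $ j)"
    by (simp add: P_def vec_eq_iff matrix_matrix_mult_def transpose_def)
  have exp: "Y = (\<Sum>k\<in>UNIV. (Y \<bullet> (G *v f k)) *\<^sub>R f k)" for Y
  proof -
    have "Y = (P ** transpose P) *v (G *v Y)" using 4 by (simp add: matrix_vector_mul_assoc)
    also have "\<dots> = (\<Sum>k\<in>UNIV. (f k \<bullet> (G *v Y)) *\<^sub>R f k)"
      unfolding PP
      by (simp add: vec_eq_iff matrix_vector_mult_def inner_vec_def sum_distrib_left sum_distrib_right mult_ac)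
         (subst sum.swap, simp)
    also have "\<dots> = (\<Sum>k\<in>UNIV. (Y \<bullet> (G *v f k)) *\<^sub>R f k)"
      by (intro sum.cong refl arg_cong2[where f=scaleR] posdef_sym[OF G])
    finally show ?thesis .
  qed
  have ip: "Y \<bullet> (G *v Z) = (\<Sum>k\<in>UNIV. (Y \<bullet> (G *v f k)) * (Z \<bullet> (G *v f k)))" for Y Z
  proof -
    have "Y \<bullet> (G *v Z) = Z \<bullet> (G *v Y)" by (rule posdef_sym[OF G])
    also have "\<dots> = (\<Sum>k\<in>UNIV. (Z \<bullet> (G *v f k)) *\<^sub>R f k) \<bullet> (G *v Y)" using exp[of Z] by simp
    also have "\<dots> = (\<Sum>k\<in>UNIV. (Z \<bullet> (G *v f k)) * (f k \<bullet> (G *v Y)))" by (simp add: inner_sum_left)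
    also have "\<dots> = (\<Sum>k\<in>UNIV. (Y \<bullet> (G *v f k)) * (Z \<bullet> (G *v f k)))"
      unfolding posdef_sym[OF G, of "f _" Y] by (intro sum.cong refl mult.commute)
    finally show ?thesis .
  qed
  show thesis
    by (rule that[of f, OF f exp ip inv[unfolded PP]])
qed

text \<open>
  Take the coordinates with respect to an orthonormal frame.
\<close>

lemma posdef_square_root:
  fixes G :: "real^'n^'n"
  assumes "posdef G"
  obtains L :: "real^'n \<Rightarrow> real^'n" where "linear L" "\<And>v w. v \<bullet> (G *v w) = L v \<bullet> L w"
proof -
  obtain f :: "'n \<Rightarrow> real^'n" where f: "\<And>Y Z. Y \<bullet> (G *v Z) = (\<Sum>k\<in>UNIV. (Y \<bullet> (G *v f k)) * (Z \<bullet> (G *v f k)))"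
    by (rule orthonormal_frame[OF assms]) (rule that)
  have "linear (\<lambda>Y. (\<chi> k. Y \<bullet> (G *v f k)) :: real^'n)"
    by (rule linearI) (auto simp: vec_eq_iff inner_add_left)
  moreover have "Y \<bullet> (G *v Z) = (\<chi> k. Y \<bullet> (G *v f k)) \<bullet> (\<chi> k. Z \<bullet> (G *v f k))" for Y Z
    by (subst f) (simp add: inner_vec_def)
  ultimately show thesis by (rule that)
qed

lemma posdef_cauchy_schwarz:
  fixes G :: "real^'n^'n"
  assumes "posdef G"
  shows "\<bar>v \<bullet> (G *v w)\<bar> \<le> sqrt (v \<bullet> (G *v v)) * sqrt (w \<bullet> (G *v w))"
proof -
  obtain L :: "real^'n \<Rightarrow> real^'n" where L: "\<And>v w. v \<bullet> (G *v w) = L v \<bullet> L w"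
    by (rule posdef_square_root[OF assms]) (rule that)
  show ?thesis unfolding L norm_eq_sqrt_inner[symmetric] by (rule Cauchy_Schwarz_ineq2)
qed

lemma norm_sum_scaleR_le:
  fixes w :: "'i \<Rightarrow> 'v::real_normed_vector"
  shows "(norm (\<Sum>k\<in>I. y k *\<^sub>R w k))\<^sup>2 \<le> (\<Sum>k\<in>I. (y k)\<^sup>2) * (\<Sum>k\<in>I. (norm (w k))\<^sup>2)"
proof -
  have "norm (\<Sum>k\<in>I. y k *\<^sub>R w k) \<le> (\<Sum>k\<in>I. \<bar>y k\<bar> * norm (w k))"
    by (rule order_trans[OF norm_sum]) simp
  then have "(norm (\<Sum>k\<in>I. y k *\<^sub>R w k))\<^sup>2 \<le> (\<Sum>k\<in>I. \<bar>y k\<bar> * norm (w k))\<^sup>2"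
    by (rule power_mono) simp
  also have "\<dots> \<le> (\<Sum>k\<in>I. \<bar>y k\<bar>\<^sup>2) * (\<Sum>k\<in>I. (norm (w k))\<^sup>2)"
    by (rule Cauchy_Schwarz_ineq_sum)
  finally show ?thesis by simp
qed

text \<open>
  The contraction with the inverse metric is the square of the Hilbert--Schmidt norm, and it bounds
  the operator norm.
\<close>

lemma contraction_bound:
  fixes G :: "real^'n^'n" and N :: "real^'n \<Rightarrow> 'v::real_inner"
  assumes G: "posdef G" and N: "linear N"
  shows "(norm (N Y))\<^sup>2 \<le> (Y \<bullet> (G *v Y)) *
      (\<Sum>i\<in>UNIV. \<Sum>j\<in>UNIV. matrix_inv G $ i $ j * (N (axis i 1) \<bullet> N (axis j 1)))"
    and "0 \<le> (\<Sum>i\<in>UNIV. \<Sum>j\<in>UNIV. matrix_inv G $ i $ j * (N (axis i 1) \<bullet> N (axis j 1)))"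
proof -
  obtain f :: "'n \<Rightarrow> real^'n" where
    f: "\<And>Y. Y = (\<Sum>k\<in>UNIV. (Y \<bullet> (G *v f k)) *\<^sub>R f k)"
    "\<And>Y Z. Y \<bullet> (G *v Z) = (\<Sum>k\<in>UNIV. (Y \<bullet> (G *v f k)) * (Z \<bullet> (G *v f k)))"
    "matrix_inv G = (\<chi> i j. \<Sum>k\<in>UNIV. f k $ i * f k $ j)"
    by (rule orthonormal_frame[OF G]) (rule that)
  have Nx: "N X = (\<Sum>i\<in>UNIV. X $ i *\<^sub>R N (axis i 1))" for X
  proof -
    have "N X = N (\<Sum>i\<in>UNIV. X $ i *\<^sub>R axis i 1)"
      using basis_expansion[of X] by (simp add: scalar_mult_eq_scaleR)
    then show ?thesis using N by (simp add: linear_sum linear_cmul)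
  qed
  have eq: "(\<Sum>i\<in>UNIV. \<Sum>j\<in>UNIV. matrix_inv G $ i $ j * (N (axis i 1) \<bullet> N (axis j 1))) = (\<Sum>k\<in>UNIV. (norm (N (f k)))\<^sup>2)"
  proof -
    have "(\<Sum>k\<in>UNIV. (norm (N (f k)))\<^sup>2) = (\<Sum>k\<in>UNIV. \<Sum>i\<in>UNIV. \<Sum>j\<in>UNIV. f k $ i * f k $ j * (N (axis i 1) \<bullet> N (axis j 1)))"
      unfolding power2_norm_eq_inner by (subst (1 2) Nx) (simp add: inner_sum_left inner_sum_right sum_distrib_left mult_ac inner_commute)
    also have "\<dots> = (\<Sum>i\<in>UNIV. \<Sum>k\<in>UNIV. \<Sum>j\<in>UNIV. f k $ i * f k $ j * (N (axis i 1) \<bullet> N (axis j 1)))"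
      by (rule sum.swap)
    also have "\<dots> = (\<Sum>i\<in>UNIV. \<Sum>j\<in>UNIV. \<Sum>k\<in>UNIV. f k $ i * f k $ j * (N (axis i 1) \<bullet> N (axis j 1)))"
      by (rule sum.cong[OF refl], rule sum.swap)
    also have "\<dots> = (\<Sum>i\<in>UNIV. \<Sum>j\<in>UNIV. matrix_inv G $ i $ j * (N (axis i 1) \<bullet> N (axis j 1)))"
      by (simp add: f(3) sum_distrib_right)
    finally show ?thesis by simp
  qed
  show "0 \<le> (\<Sum>i\<in>UNIV. \<Sum>j\<in>UNIV. matrix_inv G $ i $ j * (N (axis i 1) \<bullet> N (axis j 1)))"
    unfolding eq by (simp add: sum_nonneg)
  have "N Y = N (\<Sum>k\<in>UNIV. (Y \<bullet> (G *v f k)) *\<^sub>R f k)" using f(1)[of Y] by simp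
  also have "\<dots> = (\<Sum>k\<in>UNIV. (Y \<bullet> (G *v f k)) *\<^sub>R N (f k))"
    using N by (simp add: linear_sum linear_cmul)
  finally have "(norm (N Y))\<^sup>2 \<le> (\<Sum>k\<in>UNIV. (Y \<bullet> (G *v f k))\<^sup>2) * (\<Sum>k\<in>UNIV. (norm (N (f k)))\<^sup>2)"
    by (simp only: norm_sum_scaleR_le)
  then show "(norm (N Y))\<^sup>2 \<le> (Y \<bullet> (G *v Y)) *
      (\<Sum>i\<in>UNIV. \<Sum>j\<in>UNIV. matrix_inv G $ i $ j * (N (axis i 1) \<bullet> N (axis j 1)))"
    unfolding eq by (subst f(2)) (simp add: power2_eq_square)
qed

section \<open>Sections in local trivializations\<close>

locale inner_product_bundle =
  fixes A :: "('a::topological_space, 'n::finite) chart set"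
    and T :: "('a, 'k::finite, 'e::real_vector) triv set"
    and E :: "'a \<Rightarrow> 'e set"
    and ip :: "'a \<Rightarrow> 'e \<Rightarrow> 'e \<Rightarrow> real"
  assumes manifold: "smooth_structure A"
    and vbundle: "vector_bundle A T E"
    and inner_product: "bundle_inner_product A T E ip"
begin

lemma chart: "c \<in> A \<Longrightarrow> is_chart c"
  using manifold unfolding smooth_structure_def by blast

lemma charts_compatible: "c \<in> A \<Longrightarrow> d \<in> A \<Longrightarrow> compatible_charts c d"
  using manifold unfolding smooth_structure_def by blast

lemma chart_at: "chart_at A p \<in> A" "p \<in> fst (chart_at A p)"
proof -
  have "p \<in> (\<Union>c\<in>A. fst c)" using manifold unfolding smooth_structure_def by blast
  then have "\<exists>c. c \<in> A \<and> p \<in> fst c" by blast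
  then have "chart_at A p \<in> A \<and> p \<in> fst (chart_at A p)" unfolding chart_at_def by (rule someI_ex)
  then show "chart_at A p \<in> A" "p \<in> fst (chart_at A p)" by blast+
qed

lemma triv_at: "triv_at T p \<in> T" "p \<in> fst (triv_at T p)"
proof -
  have "p \<in> (\<Union>t\<in>T. fst t)" using vbundle unfolding vector_bundle_def by blast
  then have "\<exists>t. t \<in> T \<and> p \<in> fst t" by blast
  then have "triv_at T p \<in> T \<and> p \<in> fst (triv_at T p)" unfolding triv_at_def by (rule someI_ex)
  then show "triv_at T p \<in> T" "p \<in> fst (triv_at T p)" by blast+
qed

lemma triv_open: "t \<in> T \<Longrightarrow> open (fst t)"
  using vbundle unfolding vector_bundle_def by blast

lemma triv_linear: "t \<in> T \<Longrightarrow> p \<in> fst t \<Longrightarrow> linear (snd t p)"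
  using vbundle unfolding vector_bundle_def by blast

lemma triv_bij: "t \<in> T \<Longrightarrow> p \<in> fst t \<Longrightarrow> bij_betw (snd t p) UNIV (E p)"
  using vbundle unfolding vector_bundle_def by blast

lemma triv_in_fibre: "t \<in> T \<Longrightarrow> p \<in> fst t \<Longrightarrow> snd t p v \<in> E p"
  using triv_bij[of t p] by (auto simp: bij_betw_def)

lemma inv_triv: "t \<in> T \<Longrightarrow> p \<in> fst t \<Longrightarrow> inv (snd t p) (snd t p v) = v"
  using triv_bij[of t p] by (auto simp: bij_betw_def intro: inv_f_f)

lemma triv_inv: "t \<in> T \<Longrightarrow> p \<in> fst t \<Longrightarrow> x \<in> E p \<Longrightarrow> snd t p (inv (snd t p) x) = x"
  using triv_bij[of t p] by (auto simp: bij_betw_def intro: f_inv_into_f)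

lemma section_eq: "t \<in> T \<Longrightarrow> p \<in> fst t \<Longrightarrow> u p \<in> E p \<Longrightarrow> u p = snd t p (components_in t u p)"
  by (simp add: components_in_def triv_inv)

lemma components_frame: "t \<in> T \<Longrightarrow> p \<in> fst t \<Longrightarrow> components_in t (frame_section t v) p = v"
  by (simp add: components_in_def frame_section_def inv_triv)

lemma ip_rules:
  assumes "x \<in> E p" "y \<in> E p"
  shows "ip p x y = ip p y x" "z \<in> E p \<Longrightarrow> ip p (x + y) z = ip p x z + ip p y z"
    "ip p (a *\<^sub>R x) y = a * ip p x y" "x \<noteq> 0 \<Longrightarrow> 0 < ip p x x"
  using inner_product assms unfolding bundle_inner_product_def by blast+

lemma ip_triv_bilinear:
  assumes t: "t \<in> T" "p \<in> fst t"
  shows "ip p (snd t p v) (snd t p w) = v \<bullet> (gram_matrix ip t p *v w)"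
proof -
  note lin = triv_linear[OF t] and mem = triv_in_fibre[OF t]
  define \<beta> where "\<beta> v w = ip p (snd t p v) (snd t p w)" for v w
  have sym: "\<beta> v w = \<beta> w v" for v w unfolding \<beta>_def by (rule ip_rules(1)[OF mem mem])
  have l1: "linear (\<lambda>v. \<beta> v w)" for w
    by (rule linearI) (simp_all add: \<beta>_def linear_add[OF lin] linear_scale[OF lin] ip_rules[OF mem mem] mem)
  then have l2: "linear (\<lambda>w. \<beta> v w)" for v using sym by (subst sym)
  have exp: "x = (\<Sum>i\<in>UNIV. x $ i *\<^sub>R axis i 1)" for x :: "real^'k"
    using basis_expansion[of x] by (simp add: scalar_mult_eq_scaleR)
  have "\<beta> v w = \<beta> (\<Sum>i\<in>UNIV. v $ i *\<^sub>R axis i 1) w" using exp[of v] by simp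
  also have "\<dots> = (\<Sum>i\<in>UNIV. v $ i * \<beta> (axis i 1) w)"
    unfolding linear_sum[OF l1] linear_scale[OF l1] by simp
  also have "\<dots> = (\<Sum>i\<in>UNIV. v $ i * \<beta> (axis i 1) (\<Sum>j\<in>UNIV. w $ j *\<^sub>R axis j 1))" using exp[of w] by simp
  also have "\<dots> = (\<Sum>i\<in>UNIV. v $ i * (\<Sum>j\<in>UNIV. w $ j * \<beta> (axis i 1) (axis j 1)))"
    unfolding linear_sum[OF l2] linear_scale[OF l2] by simp
  also have "\<dots> = v \<bullet> (gram_matrix ip t p *v w)"
    by (simp add: inner_vec_def matrix_vector_mult_def gram_matrix_def \<beta>_def mult.commute)
  finally show ?thesis by (simp add: \<beta>_def)
qed

lemma gram_posdef:
  assumes t: "t \<in> T" "p \<in> fst t"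
  shows "posdef (gram_matrix ip t p)"
  unfolding posdef_def
proof (intro conjI allI impI)
  show "transpose (gram_matrix ip t p) = gram_matrix ip t p"
    using ip_rules(1)[OF triv_in_fibre[OF t] triv_in_fibre[OF t]]
    by (simp add: transpose_def gram_matrix_def vec_eq_iff)
  fix X :: "real^'k" assume "X \<noteq> 0"
  moreover have "snd t p 0 = 0" by (rule linear_0[OF triv_linear[OF t]])
  ultimately have "snd t p X \<noteq> 0" using inv_triv[OF t, of X] inv_triv[OF t, of 0] by metis
  then show "0 < X \<bullet> (gram_matrix ip t p *v X)"
    unfolding ip_triv_bilinear[OF t, symmetric] by (intro ip_rules(4)[OF triv_in_fibre[OF t] triv_in_fibre[OF t]])
qed

lemma norm_sq_section:
  assumes t: "t \<in> T" "p \<in> fst t" and u: "u p \<in> E p"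
  shows "ip p (u p) (u p) = components_in t u p \<bullet> (gram_matrix ip t p *v components_in t u p)"
  using ip_triv_bilinear[OF t, of "components_in t u p" "components_in t u p"]
  unfolding section_eq[of t p u, OF t u, symmetric] .

lemma norm_sq_nonneg:
  assumes "u p \<in> E p"
  shows "0 \<le> ip p (u p) (u p)"
proof (cases "u p = 0")
  case True
  have "ip p (0 *\<^sub>R u p) (u p) = 0 * ip p (u p) (u p)" by (rule ip_rules(3)[OF assms assms])
  then show ?thesis using True by simp
qed (use ip_rules(4)[OF assms assms] in \<open>simp add: less_imp_le\<close>)

lemma components_C1:
  assumes "C1_section A T E u" "c \<in> A" "t \<in> T"
  shows "Ck_in_chart (Suc 0) c (fst c \<inter> fst t) (components_in t u)"
  using assms unfolding C1_section_def by (simp add: One_nat_def)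

lemma chart_triv_open: "c \<in> A \<Longrightarrow> t \<in> T \<Longrightarrow> open (fst c \<inter> fst t)"
  using chart_open[OF chart] triv_open by blast

lemma gram_C1:
  assumes "c \<in> A" "t \<in> T"
  shows "Ck_in_chart (Suc 0) c (fst c \<inter> fst t) (\<lambda>q. gram_matrix ip t q $ a $ b)"
proof -
  have "smooth_in_chart c (fst c \<inter> fst t) (\<lambda>p. ip p (frame_section t (axis a 1) p) (frame_section t (axis b 1) p))"
    using inner_product assms unfolding bundle_inner_product_def by blast
  then have "Ck_in_chart (Suc 0) c (fst c \<inter> fst t) (\<lambda>p. ip p (frame_section t (axis a 1) p) (frame_section t (axis b 1) p))"
    by (rule smooth_in_chart_C1)
  then show ?thesis by (simp add: gram_matrix_def frame_section_def)
qed

text \<open>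
  In a trivialization the squared length is the quadratic form of the Gram matrix, evaluated on the components.
\<close>

lemma norm_sq_deriv:
  assumes u: "C1_section A T E u" and c: "c \<in> A" "p \<in> fst c" and t: "t \<in> T" "p \<in> fst t"
  defines "U \<equiv> components_in t u"
  shows "has_chart_deriv c (\<lambda>q. ip q (u q) (u q)) p
    (\<lambda>X. (\<Sum>a\<in>UNIV. \<Sum>b\<in>UNIV. U p $ a * U p $ b * chart_deriv c (\<lambda>q. gram_matrix ip t q $ a $ b) p X)
        + 2 * (U p \<bullet> (gram_matrix ip t p *v chart_deriv c U p X)))"
proof -
  let ?W = "fst c \<inter> fst t"
  let ?G = "gram_matrix ip t"
  have W: "open ?W" "?W \<subseteq> fst c" "p \<in> ?W" using c t chart_triv_open by auto
  note cc = chart[OF c(1)]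
  have dU: "has_chart_deriv c U p (chart_deriv c U p)"
    unfolding U_def using components_C1[OF u c(1) t(1)] W by (intro C1_in_chart(1)[OF cc])
  have dUa: "((\<lambda>x. U (chart_inv c x) $ a) has_derivative (\<lambda>X. chart_deriv c U p X $ a)) (at (snd c p) within snd c ` fst c)" for a
    using dU unfolding has_chart_deriv_def by (rule bounded_linear.has_derivative[OF bounded_linear_vec_nth])
  have dG: "((\<lambda>x. ?G (chart_inv c x) $ a $ b) has_derivative chart_deriv c (\<lambda>q. ?G q $ a $ b) p) (at (snd c p) within snd c ` fst c)" for a b
    using C1_in_chart(1)[OF cc W(1,2) gram_C1[OF c(1) t(1)] W(3)] unfolding has_chart_deriv_def .
  let ?s = "\<lambda>q. \<Sum>a\<in>UNIV. \<Sum>b\<in>UNIV. U q $ a * U q $ b * ?G q $ a $ b"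
  have p: "chart_inv c (snd c p) = p" using cc c(2) by simp
  have product: "((\<lambda>x. U (chart_inv c x) $ a * U (chart_inv c x) $ b * ?G (chart_inv c x) $ a $ b) has_derivative
     (\<lambda>X. U p $ a * U p $ b * chart_deriv c (\<lambda>q. ?G q $ a $ b) p X +
        (U p $ a * chart_deriv c U p X $ b + chart_deriv c U p X $ a * U p $ b) * ?G p $ a $ b)) (at (snd c p) within snd c ` fst c)" for a b
    using has_derivative_mult[OF has_derivative_mult[OF dUa[of a] dUa[of b]] dG[of a b]] unfolding p .
  have "((\<lambda>x. ?s (chart_inv c x)) has_derivative
     (\<lambda>X. \<Sum>a\<in>UNIV. \<Sum>b\<in>UNIV. U p $ a * U p $ b * chart_deriv c (\<lambda>q. ?G q $ a $ b) p X +
        (U p $ a * chart_deriv c U p X $ b + chart_deriv c U p X $ a * U p $ b) * ?G p $ a $ b)) (at (snd c p) within snd c ` fst c)"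
    by (intro has_derivative_sum product)
  moreover have "(\<lambda>X. \<Sum>a\<in>UNIV. \<Sum>b\<in>UNIV. U p $ a * U p $ b * chart_deriv c (\<lambda>q. ?G q $ a $ b) p X +
        (U p $ a * chart_deriv c U p X $ b + chart_deriv c U p X $ a * U p $ b) * ?G p $ a $ b) =
     (\<lambda>X. (\<Sum>a\<in>UNIV. \<Sum>b\<in>UNIV. U p $ a * U p $ b * chart_deriv c (\<lambda>q. ?G q $ a $ b) p X)
        + 2 * (U p \<bullet> (?G p *v chart_deriv c U p X)))"
  proof
    fix X
    let ?V = "chart_deriv c U p X"
    have 1: "(\<Sum>a\<in>UNIV. \<Sum>b\<in>UNIV. U p $ a * ?V $ b * ?G p $ a $ b) = U p \<bullet> (?G p *v ?V)"
      by (simp add: inner_vec_def matrix_vector_mult_def sum_distrib_left mult_ac)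
    have "(\<Sum>a\<in>UNIV. \<Sum>b\<in>UNIV. ?V $ a * U p $ b * ?G p $ a $ b) = ?V \<bullet> (?G p *v U p)"
      by (simp add: inner_vec_def matrix_vector_mult_def sum_distrib_left mult_ac)
    also have "\<dots> = U p \<bullet> (?G p *v ?V)" by (rule posdef_sym[OF gram_posdef[OF t]])
    finally have 2: "(\<Sum>a\<in>UNIV. \<Sum>b\<in>UNIV. ?V $ a * U p $ b * ?G p $ a $ b) = U p \<bullet> (?G p *v ?V)" .
    show "(\<Sum>a\<in>UNIV. \<Sum>b\<in>UNIV. U p $ a * U p $ b * chart_deriv c (\<lambda>q. ?G q $ a $ b) p X +
        (U p $ a * ?V $ b + ?V $ a * U p $ b) * ?G p $ a $ b) =
       (\<Sum>a\<in>UNIV. \<Sum>b\<in>UNIV. U p $ a * U p $ b * chart_deriv c (\<lambda>q. ?G q $ a $ b) p X) + 2 * (U p \<bullet> (?G p *v ?V))"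
      by (simp only: distrib_right sum.distrib 1 2)
  qed
  ultimately have *: "has_chart_deriv c ?s p
    (\<lambda>X. (\<Sum>a\<in>UNIV. \<Sum>b\<in>UNIV. U p $ a * U p $ b * chart_deriv c (\<lambda>q. ?G q $ a $ b) p X)
        + 2 * (U p \<bullet> (?G p *v chart_deriv c U p X)))"
    by (simp only: has_chart_deriv_def)
  show ?thesis
  proof (rule has_chart_deriv_local[OF cc W _ *])
    fix q assume q: "q \<in> ?W"
    have "u q \<in> E q" using u unfolding C1_section_def by blast
    then have "ip q (u q) (u q) = U q \<bullet> (?G q *v U q)"
      unfolding U_def using q t by (intro norm_sq_section) auto
    then show "?s q = ip q (u q) (u q)"
      by (simp add: inner_vec_def matrix_vector_mult_def sum_distrib_left mult_ac)
  qed
qed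

text \<open>
  Continuity is local, so it can be read off from the formula for the derivative in a trivialization near
  each point.
\<close>

lemma norm_sq_continuous_deriv:
  assumes u: "C1_section A T E u" and c: "c \<in> A"
  shows "continuous_on (snd c ` fst c) (\<lambda>x. chart_deriv c (\<lambda>q. ip q (u q) (u q)) (chart_inv c x) X)"
proof -
  note cc = chart[OF c]
  let ?f = "\<lambda>x. chart_deriv c (\<lambda>q. ip q (u q) (u q)) (chart_inv c x) X"
  have "continuous (at x within snd c ` fst c) ?f" if x: "x \<in> snd c ` fst c" for x
  proof -
    define p where "p = chart_inv c x"
    have p: "p \<in> fst c" "snd c p = x" using chart_inv_mem[OF cc x] chart_inv_right[OF cc x] by (simp_all add: p_def)
    define t where "t = triv_at T p"
    have t: "t \<in> T" "p \<in> fst t" using triv_at by (simp_all add: t_def)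
    let ?W = "fst c \<inter> fst t" and ?U = "components_in t u" and ?G = "gram_matrix ip t"
    have W: "open ?W" "?W \<subseteq> fst c" "p \<in> ?W" using c t p chart_triv_open by auto
    let ?F = "\<lambda>q. (\<Sum>a\<in>UNIV. \<Sum>b\<in>UNIV. ?U q $ a * ?U q $ b * chart_deriv c (\<lambda>q. ?G q $ a $ b) q X)
        + 2 * (\<Sum>a\<in>UNIV. ?U q $ a * (\<Sum>b\<in>UNIV. ?G q $ a $ b * chart_deriv c ?U q X $ b))"
    have eq: "chart_deriv c (\<lambda>q. ip q (u q) (u q)) q X = ?F q" if q: "q \<in> ?W" for q
      using chart_deriv_eq[OF cc _ norm_sq_deriv[OF u c _ t(1)], of q] q
      by (simp add: inner_vec_def matrix_vector_mult_def)
    note C = C1_in_chart(2,3)[OF cc W(1,2) components_C1[OF u c t(1)]]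
      C1_in_chart(2,3)[OF cc W(1,2) gram_C1[OF c t(1)]]
    have "continuous_on (snd c ` ?W) (\<lambda>x. ?F (chart_inv c x))"
      by (intro continuous_on_add continuous_on_mult continuous_on_sum continuous_on_const
          C(3,4) continuous_on_component[OF C(1)] continuous_on_component[OF C(2)])
    then have "continuous_on (snd c ` ?W) ?f"
    proof (rule continuous_on_cong[THEN iffD1, rotated 2, OF _ refl])
      fix y assume "y \<in> snd c ` ?W"
      then have "chart_inv c y \<in> ?W" using chart_mem_image_iff[OF cc W(2)] by blast
      then show "?F (chart_inv c y) = ?f y" by (rule eq[symmetric])
    qed
    moreover have "x \<in> snd c ` ?W" unfolding p(2)[symmetric] using W(3) by (rule imageI)
    ultimately have "continuous (at x within snd c ` ?W) ?f"
      unfolding continuous_on_eq_continuous_within by blast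
    then show ?thesis using chart_at_within[OF cc W] p by (simp add: continuous_within)
  qed
  then show ?thesis by (simp add: continuous_on_eq_continuous_within)
qed

end

section \<open>The connection\<close>

lemma norm_matrix_vector_le:
  fixes M :: "real^'k^'m"
  shows "norm (M *v w) \<le> norm M * norm w"
proof -
  have "norm (M *v w) = L2_set (\<lambda>a. norm ((M *v w) $ a)) UNIV" by (simp add: norm_vec_def)
  also have "\<dots> \<le> L2_set (\<lambda>a. norm (M $ a) * norm w) UNIV"
  proof (rule L2_set_mono)
    fix a
    have "(M *v w) $ a = M $ a \<bullet> w" by (simp add: matrix_vector_mult_def inner_vec_def)
    then show "norm ((M *v w) $ a) \<le> norm (M $ a) * norm w"
      using Cauchy_Schwarz_ineq2[of "M $ a" w] by simp
  qed simp
  also have "\<dots> = norm M * norm w" by (simp add: L2_set_left_distrib norm_vec_def)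
  finally show ?thesis .
qed

lemma linear_axis_expansion:
  fixes N :: "real^'m \<Rightarrow> 'v::real_vector"
  assumes "linear N"
  shows "N X = (\<Sum>i\<in>UNIV. X $ i *\<^sub>R N (axis i 1))"
proof -
  have "X = (\<Sum>i\<in>UNIV. X $ i *\<^sub>R axis i 1)"
    using basis_expansion[of X] by (simp add: scalar_mult_eq_scaleR)
  then have "N X = N (\<Sum>i\<in>UNIV. X $ i *\<^sub>R axis i 1)" by simp
  also have "\<dots> = (\<Sum>i\<in>UNIV. X $ i *\<^sub>R N (axis i 1))"
    unfolding linear_sum[OF assms] linear_scale[OF assms] ..
  finally show ?thesis .
qed

lemma double_axis_expansion:
  fixes \<beta> :: "real^'m \<Rightarrow> real^'m \<Rightarrow> real"
  assumes l1: "\<And>w. linear (\<lambda>v. \<beta> v w)" and l2: "\<And>v. linear (\<lambda>w. \<beta> v w)"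
  shows "\<beta> v w = (\<Sum>a\<in>UNIV. \<Sum>b\<in>UNIV. v $ a * w $ b * \<beta> (axis a 1) (axis b 1))"
proof -
  have "\<beta> v w = (\<Sum>a\<in>UNIV. v $ a *\<^sub>R \<beta> (axis a 1) w)" by (rule linear_axis_expansion[OF l1])
  also have "\<dots> = (\<Sum>a\<in>UNIV. v $ a *\<^sub>R (\<Sum>b\<in>UNIV. w $ b *\<^sub>R \<beta> (axis a 1) (axis b 1)))"
    by (intro sum.cong refl arg_cong2[where f=scaleR] linear_axis_expansion[OF l2])
  finally show ?thesis by (simp add: sum_distrib_left mult.assoc)
qed

locale riemannian_bundle = inner_product_bundle A T E ip
  for A :: "('a::topological_space, 'n::finite) chart set"
    and T :: "('a, 'k::finite, 'e::real_vector) triv set"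
    and E :: "'a \<Rightarrow> 'e set"
    and ip :: "'a \<Rightarrow> 'e \<Rightarrow> 'e \<Rightarrow> real" +
  fixes g :: "('a, 'n) chart \<Rightarrow> 'a \<Rightarrow> real^'n^'n"
    and \<Gamma> :: "('a, 'n, 'k, 'e) conn"
  assumes metric: "C0_riemannian_metric A g"
    and connection: "bundle_connection A T \<Gamma>"
begin

definition conn_term :: "('a, 'n) chart \<Rightarrow> ('a, 'k, 'e) triv \<Rightarrow> 'a \<Rightarrow> real^'n \<Rightarrow> real^'k \<Rightarrow> real^'k" where
  "conn_term c t p X v = (\<Sum>i\<in>UNIV. X $ i *\<^sub>R (\<Gamma> c t p $ i *v v))"

text \<open>
  The components of \<open>\<nabla>\<^sub>X u\<close> in the trivialization \<open>t\<close>.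
\<close>

definition cov_deriv :: "('a, 'n) chart \<Rightarrow> ('a, 'k, 'e) triv \<Rightarrow> ('a \<Rightarrow> 'e) \<Rightarrow> 'a \<Rightarrow> real^'n \<Rightarrow> real^'k" where
  "cov_deriv c t u p X = chart_deriv c (components_in t u) p X - conn_term c t p X (components_in t u p)"

lemma nabla_cov_deriv: "nabla_in \<Gamma> c t u p X = snd t p (cov_deriv c t u p X)"
  by (simp add: nabla_in_def cov_deriv_def conn_term_def)

lemma conn_term_linear1: "linear (\<lambda>X. conn_term c t p X v)"
  unfolding conn_term_def by (rule linearI) (auto simp: scaleR_add_left sum.distrib scaleR_sum_right)

lemma conn_term_linear2: "linear (conn_term c t p X)"
  unfolding conn_term_def
  by (rule linearI) (auto simp: matrix_vector_right_distrib scaleR_add_right sum.distrib scaleR_sum_right matrix_vector_mult_scaleR mult.commute)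

lemma components_deriv:
  assumes "C1_section A T E u" "c \<in> A" "t \<in> T" "p \<in> fst c" "p \<in> fst t"
  shows "has_chart_deriv c (components_in t u) p (chart_deriv c (components_in t u) p)"
  using assms by (intro C1_in_chart(1)[OF chart chart_triv_open _ components_C1]) auto

lemma cov_deriv_linear:
  assumes "C1_section A T E u" "c \<in> A" "t \<in> T" "p \<in> fst c" "p \<in> fst t"
  shows "linear (cov_deriv c t u p)"
  unfolding cov_deriv_def
  by (intro linear_compose_sub has_chart_deriv_linear[OF components_deriv[OF assms]] conn_term_linear1)

lemma frame_components_deriv:
  assumes c: "c \<in> A" "p \<in> fst c" and t: "t \<in> T" "p \<in> fst t"
  shows "chart_deriv c (components_in t (frame_section t v)) p = (\<lambda>X. 0)"
proof (rule chart_deriv_eq[OF chart[OF c(1)] c(2)])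
  have "has_chart_deriv c (\<lambda>q. v) p (\<lambda>X. 0)" by (simp add: has_chart_deriv_def)
  then show "has_chart_deriv c (components_in t (frame_section t v)) p (\<lambda>X. 0)"
    by (rule has_chart_deriv_local[OF chart[OF c(1)] chart_triv_open[OF c(1) t(1)], rotated 3])
       (use c t in \<open>auto simp: components_frame\<close>)
qed

lemma nabla_frame:
  assumes "c \<in> A" "p \<in> fst c" "t \<in> T" "p \<in> fst t"
  shows "nabla_in \<Gamma> c t (frame_section t v) p X = snd t p (- conn_term c t p X v)"
  using assms by (simp add: nabla_cov_deriv cov_deriv_def frame_components_deriv components_frame)

lemma gram_sqrt:
  assumes "t \<in> T" "p \<in> fst t"
  obtains L where "linear L" "\<And>v w. ip p (snd t p v) (snd t p w) = L v \<bullet> (L w :: real^'k)"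
proof -
  obtain L :: "real^'k \<Rightarrow> real^'k" where "linear L" "\<And>v w. v \<bullet> (gram_matrix ip t p *v w) = L v \<bullet> L w"
    by (rule posdef_square_root[OF gram_posdef[OF assms]]) (rule that)
  then show thesis using that ip_triv_bilinear[OF assms] by simp
qed

abbreviation nabla_sq :: "('a \<Rightarrow> 'e) \<Rightarrow> 'a \<Rightarrow> real" where
  "nabla_sq u p \<equiv> nabla_norm_sq A g T ip \<Gamma> u p"

text \<open>
  The expression \<open>|\<nabla>u|\<^sup>2\<close> is a contraction with the inverse metric in the sense of the previous section.
\<close>

lemma nabla_norm_bound:
  assumes u: "C1_section A T E u"
  shows "0 \<le> nabla_sq u p"
    and "ip p (nabla_in \<Gamma> (chart_at A p) (triv_at T p) u p Y) (nabla_in \<Gamma> (chart_at A p) (triv_at T p) u p Y)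
      \<le> (Y \<bullet> (g (chart_at A p) p *v Y)) * nabla_sq u p"
proof -
  let ?c = "chart_at A p" and ?t = "triv_at T p"
  \<comment> \<open>in the coordinates \<open>L\<close> the fibre is a Euclidean space\<close>
  obtain L :: "real^'k \<Rightarrow> real^'k" where L: "linear L" "\<And>v w. ip p (snd ?t p v) (snd ?t p w) = L v \<bullet> L w"
    by (rule gram_sqrt[OF triv_at]) (rule that)
  have lin: "linear (\<lambda>X. L (cov_deriv ?c ?t u p X))"
    using linear_compose[OF cov_deriv_linear[OF u chart_at(1) triv_at(1) chart_at(2) triv_at(2)] L(1)] by (simp add: comp_def)
  have F: "nabla_sq u p = (\<Sum>i\<in>UNIV. \<Sum>j\<in>UNIV. matrix_inv (g ?c p) $ i $ j *
        (L (cov_deriv ?c ?t u p (axis i 1)) \<bullet> L (cov_deriv ?c ?t u p (axis j 1))))"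
    by (simp add: nabla_norm_sq_def Let_def nabla_cov_deriv L(2))
  have pd: "posdef (g ?c p)" by (rule metric_posdef[OF metric chart_at])
  show "0 \<le> nabla_sq u p" unfolding F by (rule contraction_bound(2)[OF pd lin])
  show "ip p (nabla_in \<Gamma> ?c ?t u p Y) (nabla_in \<Gamma> ?c ?t u p Y) \<le> (Y \<bullet> (g ?c p *v Y)) * nabla_sq u p"
    unfolding F nabla_cov_deriv L(2) power2_norm_eq_inner[symmetric] by (rule contraction_bound(1)[OF pd lin])
qed

abbreviation Gamma_S :: "'a \<Rightarrow> real" where
  "Gamma_S p \<equiv> Gamma_sym_norm A g T ip \<Gamma> p"

lemma gram_entry_deriv:
  assumes "c \<in> A" "t \<in> T" "p \<in> fst c" "p \<in> fst t"
  shows "has_chart_deriv c (\<lambda>q. gram_matrix ip t q $ a $ b) p (chart_deriv c (\<lambda>q. gram_matrix ip t q $ a $ b) p)"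
  using assms by (intro C1_in_chart(1)[OF chart chart_triv_open _ gram_C1]) auto

lemma sym_form_eq:
  assumes c: "c \<in> A" "p \<in> fst c" and t: "t \<in> T" "p \<in> fst t"
  shows "Gamma_sym_form ip \<Gamma> c t p X (axis a 1) (axis b 1) =
    (chart_deriv c (\<lambda>q. gram_matrix ip t q $ a $ b) p X
      + axis a 1 \<bullet> (gram_matrix ip t p *v conn_term c t p X (axis b 1))
      + conn_term c t p X (axis a 1) \<bullet> (gram_matrix ip t p *v axis b 1)) / 2"
proof -
  let ?G = "gram_matrix ip t p"
  have "linear (snd t p)" by (rule triv_linear[OF t])
  note neg = linear_neg[OF this]
  have 1: "(\<lambda>q. ip q (frame_section t (axis a 1) q) (frame_section t (axis b 1) q)) = (\<lambda>q. gram_matrix ip t q $ a $ b)"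
    by (simp add: gram_matrix_def frame_section_def)
  have 2: "ip p (frame_section t (axis a 1) p) (nabla_in \<Gamma> c t (frame_section t (axis b 1)) p X) =
      - (axis a 1 \<bullet> (?G *v conn_term c t p X (axis b 1)))"
    unfolding nabla_frame[OF c t] frame_section_def ip_triv_bilinear[OF t]
    by (simp add: linear_neg[OF matrix_vector_mul_linear])
  have 3: "ip p (nabla_in \<Gamma> c t (frame_section t (axis a 1)) p X) (frame_section t (axis b 1) p) =
      - (conn_term c t p X (axis a 1) \<bullet> (?G *v axis b 1))"
    unfolding nabla_frame[OF c t] frame_section_def ip_triv_bilinear[OF t] by simp
  show ?thesis unfolding Gamma_sym_form_def Let_def 1 2 3 by simp
qed

text \<open>
  With respect to a frame \<open>h\<close> that is orthonormal for the Gram matrix, \<open>\<Gamma>\<^sup>S(X)\<close> has a symmetric matrix \<open>M X\<close>.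
  The trace in the definition of \<open>|\<Gamma>\<^sup>S|\<close> is the inner product of two such matrices, and the norm bounds the
  quadratic form.
\<close>

lemma sym_form_bound:
  fixes p :: 'a and Y :: "real^'n" and U :: "real^'k"
  defines "c \<equiv> chart_at A p" and "t \<equiv> triv_at T p"
  shows "\<bar>\<Sum>a\<in>UNIV. \<Sum>b\<in>UNIV. U $ a * U $ b * Gamma_sym_form ip \<Gamma> c t p Y (axis a 1) (axis b 1)\<bar>
     \<le> sqrt (Y \<bullet> (g c p *v Y)) * Gamma_S p * (U \<bullet> (gram_matrix ip t p *v U))"
    and "0 \<le> Gamma_S p"
proof -
  have c: "c \<in> A" "p \<in> fst c" and t: "t \<in> T" "p \<in> fst t"
    using chart_at triv_at by (simp_all add: c_def t_def)
  let ?G = "gram_matrix ip t p"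
  define B where "B X = (\<chi> a b. Gamma_sym_form ip \<Gamma> c t p X (axis a 1) (axis b 1) :: real^'k^'k)" for X
  have linB: "linear (\<lambda>X. B X $ a $ b)" for a b
  proof -
    have l1: "linear (chart_deriv c (\<lambda>q. gram_matrix ip t q $ a $ b) p)"
      by (rule has_chart_deriv_linear[OF gram_entry_deriv[OF c(1) t(1) c(2) t(2)]])
    have l2: "linear (\<lambda>X. v \<bullet> (?G *v conn_term c t p X w))" for v w
      using linear_compose[OF linear_compose[OF conn_term_linear1 matrix_vector_mul_linear] bounded_linear.linear[OF bounded_linear_inner_right]]
      by (simp add: comp_def)
    have l3: "linear (\<lambda>X. conn_term c t p X w \<bullet> v)" for v w
      using linear_compose[OF conn_term_linear1 bounded_linear.linear[OF bounded_linear_inner_left]]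
      by (simp add: comp_def)
    have "linear (\<lambda>X. (1/2) *\<^sub>R (chart_deriv c (\<lambda>q. gram_matrix ip t q $ a $ b) p X
      + axis a 1 \<bullet> (?G *v conn_term c t p X (axis b 1)) + conn_term c t p X (axis a 1) \<bullet> (?G *v axis b 1)))"
      by (intro linear_compose_scale_right linear_compose_add l1 l2 l3)
    then show ?thesis by (simp add: B_def sym_form_eq[OF c t])
  qed
  have linB': "linear B"
    using linear_add[OF linB] linear_scale[OF linB] by (intro linearI) (simp_all add: vec_eq_iff)
  have Bsym: "transpose (B X) = B X" for X
  proof -
    have s: "Gamma_sym_form ip \<Gamma> c t p X (axis b 1) (axis a 1) = Gamma_sym_form ip \<Gamma> c t p X (axis a 1) (axis b 1)" for a b
    proof -
      have eq: "chart_deriv c (\<lambda>q. gram_matrix ip t q $ b $ a) p = chart_deriv c (\<lambda>q. gram_matrix ip t q $ a $ b) p"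
      proof (rule chart_deriv_eq[OF chart[OF c(1)] c(2)])
        show "has_chart_deriv c (\<lambda>q. gram_matrix ip t q $ b $ a) p (chart_deriv c (\<lambda>q. gram_matrix ip t q $ a $ b) p)"
        proof (rule has_chart_deriv_local[OF chart[OF c(1)] chart_triv_open[OF c(1) t(1)] _ _ _ gram_entry_deriv[OF c(1) t(1) c(2) t(2)]])
          fix q assume "q \<in> fst c \<inter> fst t"
          then have q: "q \<in> fst t" by blast
          show "gram_matrix ip t q $ a $ b = gram_matrix ip t q $ b $ a"
            using arg_cong[of _ _ "\<lambda>M. M $ b $ a", OF conjunct1[OF gram_posdef[OF t(1) q, unfolded posdef_def]]]
            by (simp add: transpose_def)
        qed (use c t in auto)
      qed
      show ?thesis
        unfolding sym_form_eq[OF c t] eq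
        unfolding posdef_sym[OF gram_posdef[OF t], of "axis b 1"] posdef_sym[OF gram_posdef[OF t], of "conn_term c t p X (axis b 1)"]
        by simp
    qed
    show ?thesis by (simp add: B_def transpose_def vec_eq_iff s)
  qed
  obtain h :: "'k \<Rightarrow> real^'k" where
    h: "\<And>Y. Y = (\<Sum>k\<in>UNIV. (Y \<bullet> (?G *v h k)) *\<^sub>R h k)"
    "\<And>Y Z. Y \<bullet> (?G *v Z) = (\<Sum>k\<in>UNIV. (Y \<bullet> (?G *v h k)) * (Z \<bullet> (?G *v h k)))"
    "matrix_inv ?G = (\<chi> i j. \<Sum>k\<in>UNIV. h k $ i * h k $ j)"
    by (rule orthonormal_frame[OF gram_posdef[OF t]]) (rule that)
  define H :: "real^'k^'k" where "H = (\<chi> i k. h k $ i)"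
  have Ginv: "matrix_inv ?G = H ** transpose H"
    unfolding h(3) by (simp add: H_def vec_eq_iff matrix_matrix_mult_def transpose_def)
  define M where "M X = transpose H ** (B X ** H)" for X
  have Mlin: "linear M"
  proof -
    have "linear (\<lambda>Z. transpose H ** (Z ** H))"
      by (rule linearI) (simp_all add: vec_eq_iff matrix_matrix_mult_def sum_distrib_left algebra_simps sum.distrib)
    from linear_compose[OF linB' this] show ?thesis by (simp add: comp_def M_def[abs_def])
  qed
  have Msym: "transpose (M X) = M X" for X
    by (simp add: M_def matrix_transpose_mul Bsym matrix_mul_assoc)
  have tr: "trace (Gamma_sym ip \<Gamma> c t p X ** Gamma_sym ip \<Gamma> c t p Z) = M X \<bullet> M Z" for X Z
  proof -
    have S: "Gamma_sym ip \<Gamma> c t p X = H ** (transpose H ** B X)" for X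
      by (simp add: Gamma_sym_def Ginv B_def matrix_mul_assoc)
    have "trace (Gamma_sym ip \<Gamma> c t p X ** Gamma_sym ip \<Gamma> c t p Z) =
       trace (H ** ((transpose H ** B X) ** (H ** (transpose H ** B Z))))"
      unfolding S by (simp add: matrix_mul_assoc)
    also have "\<dots> = trace (((transpose H ** B X) ** (H ** (transpose H ** B Z))) ** H)"
      by (rule trace_mul_sym)
    also have "\<dots> = trace (M X ** M Z)" by (simp add: M_def matrix_mul_assoc)
    also have "\<dots> = trace (M X ** transpose (M Z))" by (simp add: Msym)
    also have "\<dots> = M X \<bullet> M Z"
      by (simp add: trace_def matrix_matrix_mult_def transpose_def inner_vec_def)
    finally show ?thesis .
  qed
  have pd: "posdef (g c p)" by (rule metric_posdef[OF metric c])
  have gs: "Gamma_S p = sqrt (\<Sum>i\<in>UNIV. \<Sum>j\<in>UNIV. matrix_inv (g c p) $ i $ j * (M (axis i 1) \<bullet> M (axis j 1)))"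
    by (simp add: Gamma_sym_norm_def Let_def tr flip: c_def t_def)
  show gs0: "0 \<le> Gamma_S p" unfolding gs by (simp add: contraction_bound(2)[OF pd Mlin])
  have "(norm (M Y))\<^sup>2 \<le> (Y \<bullet> (g c p *v Y)) * (Gamma_S p)\<^sup>2"
    unfolding gs using contraction_bound[OF pd Mlin] by simp
  then have "sqrt ((norm (M Y))\<^sup>2) \<le> sqrt ((Y \<bullet> (g c p *v Y)) * (Gamma_S p)\<^sup>2)" by (rule real_sqrt_le_mono)
  then have Mn: "norm (M Y) \<le> sqrt (Y \<bullet> (g c p *v Y)) * Gamma_S p"
    using gs0 by (simp add: real_sqrt_mult)
  define w :: "real^'k" where "w = (\<chi> k. U \<bullet> (?G *v h k))"
  have wU: "H *v w = U"
  proof -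
    have "H *v w = (\<Sum>k\<in>UNIV. (U \<bullet> (?G *v h k)) *\<^sub>R h k)"
      by (simp add: H_def w_def matrix_vector_mult_def vec_eq_iff mult.commute)
    then show ?thesis using h(1)[of U] by simp
  qed
  have ww: "(norm w)\<^sup>2 = U \<bullet> (?G *v U)"
    unfolding power2_norm_eq_inner by (subst h(2)) (simp add: w_def inner_vec_def)
  have "(\<Sum>a\<in>UNIV. \<Sum>b\<in>UNIV. U $ a * U $ b * Gamma_sym_form ip \<Gamma> c t p Y (axis a 1) (axis b 1)) = U \<bullet> (B Y *v U)"
    by (simp add: inner_vec_def matrix_vector_mult_def B_def sum_distrib_left mult_ac)
  also have "\<dots> = (H *v w) \<bullet> (B Y *v (H *v w))" by (simp add: wU)
  also have "\<dots> = w \<bullet> (M Y *v w)"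
  proof -
    have "(H *v w) \<bullet> z = w \<bullet> (transpose H *v z)" for z
    proof -
      have "(H *v w) \<bullet> z = z \<bullet> (H *v w)" by (rule inner_commute)
      also have "\<dots> = (z v* H) \<bullet> w" by (rule dot_lmul_matrix[symmetric])
      also have "\<dots> = w \<bullet> (transpose H *v z)" unfolding transpose_matrix_vector by (rule inner_commute)
      finally show ?thesis .
    qed
    then show ?thesis by (simp only: M_def matrix_vector_mul_assoc[symmetric])
  qed
  finally have "\<bar>\<Sum>a\<in>UNIV. \<Sum>b\<in>UNIV. U $ a * U $ b * Gamma_sym_form ip \<Gamma> c t p Y (axis a 1) (axis b 1)\<bar> \<le> norm w * norm (M Y *v w)"
    using Cauchy_Schwarz_ineq2[of w "M Y *v w"] by simp
  also have "\<dots> \<le> norm w * (norm (M Y) * norm w)"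
    by (intro mult_left_mono norm_matrix_vector_le) simp
  also have "\<dots> = norm (M Y) * (norm w)\<^sup>2" by (simp add: power2_eq_square)
  also have "\<dots> \<le> (sqrt (Y \<bullet> (g c p *v Y)) * Gamma_S p) * (norm w)\<^sup>2"
    by (intro mult_right_mono Mn) simp
  finally show "\<bar>\<Sum>a\<in>UNIV. \<Sum>b\<in>UNIV. U $ a * U $ b * Gamma_sym_form ip \<Gamma> c t p Y (axis a 1) (axis b 1)\<bar>
     \<le> sqrt (Y \<bullet> (g c p *v Y)) * Gamma_S p * (U \<bullet> (?G *v U))"
    by (simp add: ww)
qed

text \<open>
  Kato's inequality for the squared length: its derivative is controlled by the covariant derivative
  and by the symmetric part of the connection, since
  \<open>X\<langle>u, u\<rangle> = 2\<langle>u, \<nabla>\<^sub>X u\<rangle> + 2\<langle>u, \<Gamma>\<^sup>S(X) u\<rangle>\<close>.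
\<close>

lemma kato:
  assumes u: "C1_section A T E u" and d: "d \<in> A" "p \<in> fst d"
  shows "\<bar>chart_deriv d (\<lambda>q. ip q (u q) (u q)) p X\<bar> \<le> 2 * sqrt (ip p (u p) (u p)) * sqrt (X \<bullet> (g d p *v X)) *
      (sqrt (nabla_sq u p) + Gamma_S p * sqrt (ip p (u p) (u p)))"
proof -
  define c where "c = chart_at A p"
  define t where "t = triv_at T p"
  have c: "c \<in> A" "p \<in> fst c" and t: "t \<in> T" "p \<in> fst t"
    using chart_at triv_at by (simp_all add: c_def t_def)
  let ?s = "\<lambda>q. ip q (u q) (u q)" and ?G = "gram_matrix ip t p"
  have up: "u p \<in> E p" using u unfolding C1_section_def by blast
  define U where "U = components_in t u p"
  define Y where "Y = chart_deriv d (snd c) p X"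
  let ?D = "\<lambda>X. (\<Sum>a\<in>UNIV. \<Sum>b\<in>UNIV. U $ a * U $ b * chart_deriv c (\<lambda>q. gram_matrix ip t q $ a $ b) p X)
        + 2 * (U \<bullet> (?G *v chart_deriv c (components_in t u) p X))"
  have s: "?s p = U \<bullet> (?G *v U)" unfolding U_def by (rule norm_sq_section[of t p u, OF t up])
  have s0: "0 \<le> ?s p" by (rule norm_sq_nonneg[of u p, OF up])
  have "has_chart_deriv c ?s p ?D" unfolding U_def by (rule norm_sq_deriv[OF u c t])
  from chart_chain_rule[OF chart[OF d(1)] chart[OF c(1)] charts_compatible[OF d(1) c(1)] d(2) c(2) this]
  have "has_chart_deriv d ?s p (\<lambda>X. ?D (chart_deriv d (snd c) p X))" .
  from fun_cong[OF chart_deriv_eq[OF chart[OF d(1)] d(2) this], of X]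
  have D: "chart_deriv d ?s p X = ?D Y" unfolding Y_def .
  have sum: "(\<Sum>a\<in>UNIV. \<Sum>b\<in>UNIV. U $ a * U $ b * Gamma_sym_form ip \<Gamma> c t p Y (axis a 1) (axis b 1)) =
     (\<Sum>a\<in>UNIV. \<Sum>b\<in>UNIV. U $ a * U $ b * chart_deriv c (\<lambda>q. gram_matrix ip t q $ a $ b) p Y) / 2
     + U \<bullet> (?G *v conn_term c t p Y U)"
  proof -
    let ?\<beta> = "\<lambda>v w. v \<bullet> (?G *v conn_term c t p Y w)"
    have l1: "linear (\<lambda>v. ?\<beta> v w)" for w by (rule bounded_linear.linear[OF bounded_linear_inner_left])
    have l2: "linear (\<lambda>w. ?\<beta> v w)" for v
      using linear_compose[OF linear_compose[OF conn_term_linear2 matrix_vector_mul_linear] bounded_linear.linear[OF bounded_linear_inner_right]]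
      by (simp add: comp_def)
    have e: "?\<beta> U U = (\<Sum>a\<in>UNIV. \<Sum>b\<in>UNIV. U $ a * U $ b * ?\<beta> (axis a 1) (axis b 1))"
      by (rule double_axis_expansion[OF l1 l2])
    have e': "?\<beta> U U = (\<Sum>a\<in>UNIV. \<Sum>b\<in>UNIV. U $ a * U $ b * ?\<beta> (axis b 1) (axis a 1))"
      unfolding e by (subst sum.swap) (simp add: mult.commute)
    have f: "Gamma_sym_form ip \<Gamma> c t p Y (axis a 1) (axis b 1) =
      chart_deriv c (\<lambda>q. gram_matrix ip t q $ a $ b) p Y / 2 + ?\<beta> (axis a 1) (axis b 1) / 2 + ?\<beta> (axis b 1) (axis a 1) / 2" for a b
      unfolding sym_form_eq[OF c t] posdef_sym[OF gram_posdef[OF t], of "conn_term c t p Y (axis a 1)"]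
      by (simp add: add_divide_distrib)
    have "(\<Sum>a\<in>UNIV. \<Sum>b\<in>UNIV. U $ a * U $ b * Gamma_sym_form ip \<Gamma> c t p Y (axis a 1) (axis b 1)) =
      (\<Sum>a\<in>UNIV. \<Sum>b\<in>UNIV. U $ a * U $ b * chart_deriv c (\<lambda>q. gram_matrix ip t q $ a $ b) p Y) / 2
      + (\<Sum>a\<in>UNIV. \<Sum>b\<in>UNIV. U $ a * U $ b * ?\<beta> (axis a 1) (axis b 1)) / 2
      + (\<Sum>a\<in>UNIV. \<Sum>b\<in>UNIV. U $ a * U $ b * ?\<beta> (axis b 1) (axis a 1)) / 2"
      unfolding f by (simp add: sum.distrib sum_divide_distrib distrib_left)
    then show ?thesis unfolding e[symmetric] e'[symmetric] by simp
  qed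
  define V where "V = cov_deriv c t u p Y"
  \<comment> \<open>\<open>Y\<langle>u, u\<rangle> = 2\<langle>u, \<nabla>\<^sub>Y u\<rangle> + 2\<langle>u, \<Gamma>\<^sup>S(Y) u\<rangle>\<close>\<close>
  have DY: "?D Y = 2 * (U \<bullet> (?G *v V)) + 2 * (\<Sum>a\<in>UNIV. \<Sum>b\<in>UNIV. U $ a * U $ b * Gamma_sym_form ip \<Gamma> c t p Y (axis a 1) (axis b 1))"
    unfolding sum V_def cov_deriv_def U_def[symmetric]
    by (simp add: matrix_vector_mult_diff_distrib inner_diff_right)
  have gY: "Y \<bullet> (g c p *v Y) = X \<bullet> (g d p *v X)"
    unfolding Y_def by (rule metric_change[OF metric d(1) c(1) d(2) c(2)])
  define y where "y = sqrt (X \<bullet> (g d p *v X))"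
  have V2: "V \<bullet> (?G *v V) \<le> (X \<bullet> (g d p *v X)) * nabla_sq u p"
    using nabla_norm_bound(2)[OF u, of p Y] unfolding c_def[symmetric] t_def[symmetric] nabla_cov_deriv ip_triv_bilinear[OF t] gY V_def .
  have "\<bar>U \<bullet> (?G *v V)\<bar> \<le> sqrt (U \<bullet> (?G *v U)) * sqrt (V \<bullet> (?G *v V))"
    by (rule posdef_cauchy_schwarz[OF gram_posdef[OF t]])
  also have "\<dots> \<le> sqrt (?s p) * (y * sqrt (nabla_sq u p))"
    unfolding s[symmetric] y_def real_sqrt_mult[symmetric]
    using s0 by (intro mult_left_mono real_sqrt_le_mono V2) (auto simp: mult_left_mono[OF V2 s0])
  finally have 1: "\<bar>U \<bullet> (?G *v V)\<bar> \<le> sqrt (?s p) * (y * sqrt (nabla_sq u p))" .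
  have 2: "\<bar>\<Sum>a\<in>UNIV. \<Sum>b\<in>UNIV. U $ a * U $ b * Gamma_sym_form ip \<Gamma> c t p Y (axis a 1) (axis b 1)\<bar> \<le> y * Gamma_S p * ?s p"
    using sym_form_bound(1)[of U p Y] unfolding c_def[symmetric] t_def[symmetric] gY s[symmetric] y_def .
  have sq: "?s p = sqrt (?s p) * sqrt (?s p)" using s0 by simp
  have "\<bar>chart_deriv d ?s p X\<bar> \<le> 2 * \<bar>U \<bullet> (?G *v V)\<bar> +
     2 * \<bar>\<Sum>a\<in>UNIV. \<Sum>b\<in>UNIV. U $ a * U $ b * Gamma_sym_form ip \<Gamma> c t p Y (axis a 1) (axis b 1)\<bar>"
    unfolding D DY by (rule order_trans[OF abs_triangle_ineq]) (simp add: abs_mult)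
  also have "\<dots> \<le> 2 * (sqrt (?s p) * (y * sqrt (nabla_sq u p))) + 2 * (y * Gamma_S p * (sqrt (?s p) * sqrt (?s p)))"
    using 1 2 unfolding sq[symmetric] by (intro add_mono mult_left_mono) auto
  also have "\<dots> = 2 * sqrt (?s p) * y * (sqrt (nabla_sq u p) + Gamma_S p * sqrt (?s p))"
    by (simp add: algebra_simps)
  finally show ?thesis by (simp add: y_def)
qed

text \<open>
  The Leibniz rule for the expansion of \<open>u\<close> in the frame of the trivialization \<open>s\<close>. The derivatives
  of \<open>u\<close> only enter through its components in \<open>s\<close>.
\<close>

lemma nabla_frame_expansion:
  assumes u: "C1_section A T E u" and c: "c \<in> A" "p \<in> fst c"
    and s: "s \<in> T" "p \<in> fst s" and t: "t \<in> T" "p \<in> fst t"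
  shows "nabla_in \<Gamma> c t u p X =
     (\<Sum>b\<in>UNIV. chart_deriv c (components_in s u) p X $ b *\<^sub>R frame_section s (axis b 1) p) +
     (\<Sum>b\<in>UNIV. components_in s u p $ b *\<^sub>R nabla_in \<Gamma> c t (frame_section s (axis b 1)) p X)"
proof -
  let ?W = "fst c \<inter> fst s \<inter> fst t"
  have W: "open ?W" "?W \<subseteq> fst c" "p \<in> ?W"
    using c s t chart_open[OF chart[OF c(1)]] triv_open[OF s(1)] triv_open[OF t(1)] by (auto intro: open_Int)
  let ?U = "components_in s u"
  let ?K = "\<lambda>b. components_in t (frame_section s (axis b 1))"
  have lt: "linear (snd t q)" "linear (snd s q)" if "q \<in> ?W" for q
    using that s t by (auto intro: triv_linear)
  have comp: "components_in t u q = (\<Sum>b\<in>UNIV. ?U q $ b *\<^sub>R ?K b q)" if q: "q \<in> ?W" for q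
  proof -
    have qs: "q \<in> fst s" and qt: "q \<in> fst t" using q by auto
    have uq: "u q \<in> E q" using u unfolding C1_section_def by blast
    have K: "snd t q (?K b q) = snd s q (axis b 1)" for b
      unfolding components_in_def frame_section_def by (rule triv_inv[OF t(1) qt triv_in_fibre[OF s(1) qs]])
    have "u q = snd s q (?U q)" by (rule section_eq[of s q u, OF s(1) qs uq])
    also have "\<dots> = (\<Sum>b\<in>UNIV. ?U q $ b *\<^sub>R snd s q (axis b 1))" by (rule linear_axis_expansion[OF lt(2)[OF q]])
    also have "\<dots> = snd t q (\<Sum>b\<in>UNIV. ?U q $ b *\<^sub>R ?K b q)"
      unfolding linear_sum[OF lt(1)[OF q]] linear_scale[OF lt(1)[OF q]] K ..
    finally have "inv (snd t q) (u q) = (\<Sum>b\<in>UNIV. ?U q $ b *\<^sub>R ?K b q)"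
      by (simp only: inv_triv[OF t(1) qt])
    then show ?thesis by (simp only: components_in_def)
  qed
  have dK: "has_chart_deriv c (?K b) p (chart_deriv c (?K b) p)" for b
  proof (rule C1_in_chart(1)[OF chart[OF c(1)] W(1,2) smooth_in_chart_C1 W(3)])
    show "smooth_in_chart c ?W (?K b)"
      using vbundle c s t unfolding vector_bundle_def by blast
  qed
  have dU: "has_chart_deriv c ?U p (chart_deriv c ?U p)"
    by (rule components_deriv[OF u c(1) s(1) c(2) s(2)])
  have dUb: "((\<lambda>x. ?U (chart_inv c x) $ b) has_derivative (\<lambda>X. chart_deriv c ?U p X $ b)) (at (snd c p) within snd c ` fst c)" for b
    using dU unfolding has_chart_deriv_def by (rule bounded_linear.has_derivative[OF bounded_linear_vec_nth])
  have p: "chart_inv c (snd c p) = p" using chart[OF c(1)] c(2) by simp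
  have "((\<lambda>x. \<Sum>b\<in>UNIV. ?U (chart_inv c x) $ b *\<^sub>R ?K b (chart_inv c x)) has_derivative
      (\<lambda>X. \<Sum>b\<in>UNIV. ?U p $ b *\<^sub>R chart_deriv c (?K b) p X + chart_deriv c ?U p X $ b *\<^sub>R ?K b p)) (at (snd c p) within snd c ` fst c)"
    using has_derivative_scaleR[OF dUb dK[unfolded has_chart_deriv_def]] unfolding p by (intro has_derivative_sum)
  then have "has_chart_deriv c (\<lambda>q. \<Sum>b\<in>UNIV. ?U q $ b *\<^sub>R ?K b q) p
      (\<lambda>X. \<Sum>b\<in>UNIV. ?U p $ b *\<^sub>R chart_deriv c (?K b) p X + chart_deriv c ?U p X $ b *\<^sub>R ?K b p)"
    unfolding has_chart_deriv_def .
  then have "has_chart_deriv c (components_in t u) p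
      (\<lambda>X. \<Sum>b\<in>UNIV. ?U p $ b *\<^sub>R chart_deriv c (?K b) p X + chart_deriv c ?U p X $ b *\<^sub>R ?K b p)"
    by (rule has_chart_deriv_local[OF chart[OF c(1)] W, rotated 1]) (rule comp[symmetric])
  from chart_deriv_eq[OF chart[OF c(1)] c(2) this]
  have dV: "chart_deriv c (components_in t u) p X =
      (\<Sum>b\<in>UNIV. ?U p $ b *\<^sub>R chart_deriv c (?K b) p X + chart_deriv c ?U p X $ b *\<^sub>R ?K b p)" by simp
  have "cov_deriv c t u p X = (\<Sum>b\<in>UNIV. chart_deriv c ?U p X $ b *\<^sub>R ?K b p) +
      (\<Sum>b\<in>UNIV. ?U p $ b *\<^sub>R cov_deriv c t (frame_section s (axis b 1)) p X)"
    unfolding cov_deriv_def dV comp[OF W(3)] linear_sum[OF conn_term_linear2] linear_scale[OF conn_term_linear2]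
    by (simp add: sum.distrib scaleR_diff_right sum_subtractf)
  then have "nabla_in \<Gamma> c t u p X = (\<Sum>b\<in>UNIV. chart_deriv c ?U p X $ b *\<^sub>R snd t p (?K b p)) +
      (\<Sum>b\<in>UNIV. ?U p $ b *\<^sub>R snd t p (cov_deriv c t (frame_section s (axis b 1)) p X))"
    unfolding nabla_cov_deriv
    by (simp only: linear_add[OF lt(1)[OF W(3)]] linear_sum[OF lt(1)[OF W(3)]] linear_scale[OF lt(1)[OF W(3)]])
  moreover have "snd t p (?K b p) = frame_section s (axis b 1) p" for b
    unfolding components_in_def frame_section_def by (rule triv_inv[OF t triv_in_fibre[OF s]])
  ultimately show ?thesis unfolding nabla_cov_deriv by simp
qed

text \<open>
  By the preceding expansion it suffices to consider frame sections, for which this is the transformation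
  law of the connection.
\<close>

lemma nabla_independent:
  assumes u: "C1_section A T E u" and c: "c \<in> A" "p \<in> fst c" and d: "d \<in> A" "p \<in> fst d"
    and s: "s \<in> T" "p \<in> fst s" and t: "t \<in> T" "p \<in> fst t"
  shows "nabla_in \<Gamma> c t u p X = nabla_in \<Gamma> d s u p (chart_deriv c (snd d) p X)"
proof -
  let ?Y = "chart_deriv c (snd d) p X" and ?U = "components_in s u"
  have law: "nabla_in \<Gamma> c s (frame_section s v) p X = nabla_in \<Gamma> d t (frame_section s v) p (chart_deriv c (snd d) p X)"
    if "c \<in> A" "d \<in> A" "s \<in> T" "t \<in> T" "p \<in> fst c" "p \<in> fst d" "p \<in> fst s" "p \<in> fst t" for c d s t v X
    using connection that unfolding bundle_connection_def by blast
  have "nabla_in \<Gamma> c t (frame_section s v) p X = nabla_in \<Gamma> c s (frame_section s v) p X" for v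
    using law[OF c(1) c(1) s(1) t(1) c(2) c(2) s(2) t(2), of v X] chart_deriv_self[OF chart[OF c(1)] c(2)] by simp
  also have "nabla_in \<Gamma> c s (frame_section s v) p X = nabla_in \<Gamma> d s (frame_section s v) p ?Y" for v
    by (rule law[OF c(1) d(1) s(1) s(1) c(2) d(2) s(2) s(2)])
  finally have fr: "nabla_in \<Gamma> c t (frame_section s v) p X = nabla_in \<Gamma> d s (frame_section s v) p ?Y" for v .
  have "has_chart_deriv c ?U p (\<lambda>X. chart_deriv d ?U p (chart_deriv c (snd d) p X))"
    by (rule chart_chain_rule[OF chart[OF c(1)] chart[OF d(1)] charts_compatible[OF c(1) d(1)] c(2) d(2)
        components_deriv[OF u d(1) s(1) d(2) s(2)]])
  from fun_cong[OF chart_deriv_eq[OF chart[OF c(1)] c(2) this], of X]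
  have dU: "chart_deriv c ?U p X = chart_deriv d ?U p ?Y" .
  show ?thesis
    unfolding nabla_frame_expansion[OF u c s t] nabla_frame_expansion[OF u d s s] fr dU ..
qed

lemma cov_deriv_bound:
  assumes u: "C1_section A T E u" and c: "c \<in> A" "p \<in> fst c" and t: "t \<in> T" "p \<in> fst t"
  shows "cov_deriv c t u p X \<bullet> (gram_matrix ip t p *v cov_deriv c t u p X) \<le> (X \<bullet> (g c p *v X)) * nabla_sq u p"
proof -
  let ?d = "chart_at A p" and ?s = "triv_at T p"
  let ?Y = "chart_deriv c (snd ?d) p X"
  have "cov_deriv c t u p X \<bullet> (gram_matrix ip t p *v cov_deriv c t u p X) = ip p (nabla_in \<Gamma> c t u p X) (nabla_in \<Gamma> c t u p X)"
    unfolding nabla_cov_deriv by (rule ip_triv_bilinear[OF t, symmetric])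
  also have "\<dots> = ip p (nabla_in \<Gamma> ?d ?s u p ?Y) (nabla_in \<Gamma> ?d ?s u p ?Y)"
    unfolding nabla_independent[OF u c chart_at triv_at t, of X] ..
  also have "\<dots> \<le> (?Y \<bullet> (g ?d p *v ?Y)) * nabla_sq u p" by (rule nabla_norm_bound(2)[OF u])
  also have "?Y \<bullet> (g ?d p *v ?Y) = X \<bullet> (g c p *v X)"
    by (rule metric_change[OF metric c(1) chart_at(1) c(2) chart_at(2)])
  finally show ?thesis .
qed

end

section \<open>Uniform bounds and measurability in charts\<close>

text \<open>
  The quadratic forms attain their extrema on the product of \<open>K\<close> with the unit sphere.
\<close>

lemma posdef_uniform:
  fixes G :: "'x::topological_space \<Rightarrow> real^'m^'m"
  assumes K: "compact K" and cont: "continuous_on K G" and pd: "\<And>x. x \<in> K \<Longrightarrow> posdef (G x)"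
  obtains a b where "0 < a" "0 < b" "\<And>x v. x \<in> K \<Longrightarrow> a * (v \<bullet> v) \<le> v \<bullet> (G x *v v)"
    "\<And>x v. x \<in> K \<Longrightarrow> v \<bullet> (G x *v v) \<le> b * (v \<bullet> v)"
proof (cases "K = {}")
  case True
  then show ?thesis using that[of 1 1] by simp
next
  case False
  let ?S = "K \<times> sphere (0::real^'m) 1"
  let ?f = "\<lambda>z. snd z \<bullet> (G (fst z) *v snd z)"
  obtain i :: 'm where True by simp
  have "axis i 1 \<in> sphere (0::real^'m) 1" by simp
  then have ne: "?S \<noteq> {}" using False by blast
  have comp: "compact ?S" by (intro compact_Times K compact_sphere)
  have cG: "continuous_on ?S (\<lambda>z. G (fst z))"
    by (rule continuous_on_compose2[OF cont continuous_on_fst[OF continuous_on_id]]) auto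
  have "continuous_on ?S (\<lambda>z. \<Sum>i\<in>UNIV. snd z $ i * (\<Sum>j\<in>UNIV. G (fst z) $ i $ j * snd z $ j))"
    by (intro continuous_intros cG)
  then have cf: "continuous_on ?S ?f" by (simp add: inner_vec_def matrix_vector_mult_def)
  obtain z0 where z0: "z0 \<in> ?S" "\<And>z. z \<in> ?S \<Longrightarrow> ?f z0 \<le> ?f z"
    using continuous_attains_inf[OF comp ne cf] by blast
  obtain z1 where z1: "z1 \<in> ?S" "\<And>z. z \<in> ?S \<Longrightarrow> ?f z \<le> ?f z1"
    using continuous_attains_sup[OF comp ne cf] by blast
  have pos: "0 < ?f z" if "z \<in> ?S" for z
  proof -
    have "snd z \<noteq> 0" using that by auto
    then show ?thesis using pd[of "fst z"] that unfolding posdef_def by (auto simp: mem_Times_iff)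
  qed
  have scale: "v \<bullet> (G x *v v) = (v \<bullet> v) * ?f (x, v /\<^sub>R norm v)" if "v \<noteq> 0" for v x
  proof -
    have "(norm v)\<^sup>2 = v \<bullet> v" by (rule power2_norm_eq_inner)
    then show ?thesis using that by (simp add: matrix_vector_mult_scaleR field_simps power2_eq_square)
  qed
  show ?thesis
  proof (rule that[of "?f z0" "?f z1"])
    fix x v assume x: "x \<in> K"
    show "?f z0 * (v \<bullet> v) \<le> v \<bullet> (G x *v v)"
    proof (cases "v = 0")
      case False
      then have "(x, v /\<^sub>R norm v) \<in> ?S" using x by simp
      from z0(2)[OF this] show ?thesis
        unfolding scale[OF False, of x] mult.commute[of "v \<bullet> v"] by (rule mult_right_mono) simp
    qed simp
    show "v \<bullet> (G x *v v) \<le> ?f z1 * (v \<bullet> v)"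
    proof (cases "v = 0")
      case False
      then have "(x, v /\<^sub>R norm v) \<in> ?S" using x by simp
      from z1(2)[OF this] show ?thesis
        unfolding scale[OF False, of x] mult.commute[of "v \<bullet> v"] by (rule mult_right_mono) simp
    qed simp
  qed (use pos z0 z1 in auto)
qed

lemma borel_measurable_times_indicator:
  fixes f :: "'x::topological_space \<Rightarrow> ennreal"
  assumes "f \<in> borel_measurable (restrict_space borel S)" "S \<in> sets borel"
  shows "(\<lambda>x. f x * indicator S x) \<in> borel_measurable borel"
proof -
  have "S \<inter> space borel \<in> sets borel" using assms(2) by simp
  from iffD1[OF borel_measurable_restrict_space_iff_ennreal[OF this] assms(1)] show ?thesis .
qed

lemma chart_push_measurable:
  fixes c :: "('a::topological_space, 'n::finite) chart" and f :: "real^'n \<Rightarrow> ennreal"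
  assumes c: "is_chart c" and K: "K \<subseteq> fst c" "K \<in> sets borel" and f: "f \<in> borel_measurable borel"
  shows "(\<lambda>p. f (snd c p) * indicator K p) \<in> borel_measurable borel"
proof -
  have "snd c \<in> borel_measurable (restrict_space borel K)"
    using continuous_on_subset[OF chart_continuous(1)[OF c] K(1)] by (rule borel_measurable_continuous_on_restrict)
  from measurable_compose[OF this f] show ?thesis
    using K(2) by (subst (asm) borel_measurable_restrict_space_iff_ennreal) auto
qed

lemma chart_pull_measurable:
  fixes c :: "('a::topological_space, 'n::finite) chart"
  assumes c: "is_chart c" and K: "K \<subseteq> fst c"
    and f: "f \<in> borel_measurable (restrict_space borel K)"
  shows "(\<lambda>x. f (chart_inv c x)) \<in> borel_measurable (restrict_space borel (snd c ` K))"
proof (rule measurable_compose[OF _ f], rule measurable_restrict_space2)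
  show "chart_inv c \<in> space (restrict_space borel (snd c ` K)) \<rightarrow> K"
    using chart_inv_left[OF c] K by (auto simp: space_restrict_space)
  have "continuous_on (snd c ` K) (chart_inv c)"
    using K by (intro continuous_on_subset[OF chart_continuous(2)[OF c]]) auto
  then show "chart_inv c \<in> borel_measurable (restrict_space borel (snd c ` K))"
    by (rule borel_measurable_continuous_on_restrict)
qed

lemma chart_compact:
  fixes c :: "('a::t2_space, 'n::finite) chart"
  assumes c: "is_chart c" and D: "compact D" "D \<subseteq> snd c ` fst c"
  shows "compact (chart_inv c ` D)" "chart_inv c ` D \<subseteq> fst c" "chart_inv c ` D \<in> sets borel"
    "snd c ` chart_inv c ` D = D"
proof -
  show 1: "compact (chart_inv c ` D)"
    by (rule compact_continuous_image[OF continuous_on_subset[OF chart_continuous(2)[OF c] D(2)] D(1)])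
  then show "chart_inv c ` D \<in> sets borel" by (simp add: compact_imp_closed)
  show "chart_inv c ` D \<subseteq> fst c" using chart_inv_mem[OF c] D(2) by auto
  show "snd c ` chart_inv c ` D = D" by (rule chart_image_inv[OF c D(2)])
qed

section \<open>The local estimate\<close>

locale poincare_data = riemannian_bundle A T E ip g \<Gamma>
  for A :: "('a::{second_countable_topology, t2_space}, 'n::finite) chart set"
    and T :: "('a, 'k::finite, 'e::real_vector) triv set"
    and E :: "'a \<Rightarrow> 'e set"
    and ip :: "'a \<Rightarrow> 'e \<Rightarrow> 'e \<Rightarrow> real"
    and g :: "('a, 'n) chart \<Rightarrow> 'a \<Rightarrow> real^'n^'n"
    and \<Gamma> :: "('a, 'n, 'k, 'e) conn" +
  fixes vol :: "'a measure"
  assumes dim: "3 \<le> CARD('n)"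
    and vol: "riemannian_measure A g vol"
    and local_integrability: "connection_in_Lp_loc (real CARD('n)) vol A T \<Gamma>"
begin

lemma dim': "3 \<le> DIM(real^'n)"
  using dim by simp

lemma sets_vol [measurable_cong]: "sets vol = sets borel"
  using vol by (simp add: riemannian_measure_def)

abbreviation len_sq :: "('a \<Rightarrow> 'e) \<Rightarrow> 'a \<Rightarrow> real" where
  "len_sq u p \<equiv> ip p (u p) (u p)"

lemma len_sq_nonneg:
  assumes "C1_section A T E u"
  shows "0 \<le> len_sq u p"
proof -
  have "u p \<in> E p" using assms unfolding C1_section_def by blast
  then show ?thesis by (rule norm_sq_nonneg[of u p])
qed

lemma len_sq_has_deriv:
  assumes u: "C1_section A T E u" and c: "c \<in> A" "p \<in> fst c"
  shows "has_chart_deriv c (len_sq u) p (chart_deriv c (len_sq u) p)"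
  by (rule has_chart_deriv_chart_deriv[OF chart[OF c(1)] c(2) norm_sq_deriv[OF u c triv_at]])

lemma len_sq_continuous:
  assumes u: "C1_section A T E u"
  shows "continuous_on UNIV (len_sq u)"
proof -
  have "continuous_on (fst c) (len_sq u)" if c: "c \<in> A" for c
  proof -
    note cc = chart[OF c]
    have "continuous_on (snd c ` fst c) (\<lambda>x. len_sq u (chart_inv c x))"
    proof (rule has_derivative_continuous_on)
      fix x assume x: "x \<in> snd c ` fst c"
      show "((\<lambda>x. len_sq u (chart_inv c x)) has_derivative chart_deriv c (len_sq u) (chart_inv c x)) (at x within snd c ` fst c)"
        using len_sq_has_deriv[OF u c chart_inv_mem[OF cc x]]
        unfolding has_chart_deriv_def chart_inv_right[OF cc x] .
    qed
    from continuous_on_compose2[OF this chart_continuous(1)[OF cc] order_refl]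
    have "continuous_on (fst c) (\<lambda>p. len_sq u (chart_inv c (snd c p)))" .
    then show ?thesis
      by (rule continuous_on_cong[THEN iffD1, rotated 2, OF _ refl]) (simp add: chart_inv_left[OF cc])
  qed
  then have "continuous_on (\<Union>c\<in>A. fst c) (len_sq u)"
    using chart_open[OF chart] by (intro continuous_on_open_UN) auto
  moreover have "(\<Union>c\<in>A. fst c) = UNIV" using manifold unfolding smooth_structure_def by blast
  ultimately show ?thesis by simp
qed

lemma len_sq_measurable:
  "C1_section A T E u \<Longrightarrow> len_sq u \<in> borel_measurable borel"
  using len_sq_continuous by (rule borel_measurable_continuous_onI)

text \<open>
  The sets on which sections are controlled by their energy. The aim is to show that every point has a
  neighbourhood of this kind.
\<close>

definition energy_bounded :: "'a set \<Rightarrow> bool" where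
  "energy_bounded S \<longleftrightarrow> (\<exists>C::real. 0 \<le> C \<and> (\<forall>u. C1c_section A T E u \<longrightarrow>
     (\<integral>\<^sup>+p\<in>S. ennreal (len_sq u p) \<partial>vol) \<le> ennreal C * (\<integral>\<^sup>+p. ennreal (nabla_sq u p) \<partial>vol)))"

lemma energy_boundedE:
  assumes "energy_bounded S"
  obtains C where "0 \<le> C" "\<And>u. C1c_section A T E u \<Longrightarrow>
     (\<integral>\<^sup>+p\<in>S. ennreal (len_sq u p) \<partial>vol) \<le> ennreal C * (\<integral>\<^sup>+p. ennreal (nabla_sq u p) \<partial>vol)"
  using assms unfolding energy_bounded_def by blast

lemma energy_bounded_subset:
  assumes "energy_bounded S" "S' \<subseteq> S"
  shows "energy_bounded S'"
proof -
  have "(\<integral>\<^sup>+p\<in>S'. ennreal (len_sq u p) \<partial>vol) \<le> (\<integral>\<^sup>+p\<in>S. ennreal (len_sq u p) \<partial>vol)" for u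
    using assms(2) by (intro nn_integral_mono) (auto simp: indicator_def)
  then show ?thesis using assms(1) unfolding energy_bounded_def by (meson order_trans)
qed

lemma density_bounds:
  assumes c: "c \<in> A" and D: "compact D" "D \<subseteq> snd c ` fst c"
  obtains a b where "0 < a" "0 < b"
    "\<And>x. x \<in> D \<Longrightarrow> a \<le> sqrt (det (g c (chart_inv c x)))"
    "\<And>x. x \<in> D \<Longrightarrow> sqrt (det (g c (chart_inv c x))) \<le> b"
proof (cases "D = {}")
  case True
  then show ?thesis using that[of 1 1] by simp
next
  case False
  let ?J = "\<lambda>x. sqrt (det (g c (chart_inv c x)))"
  have cJ: "continuous_on D ?J"
    by (rule continuous_on_subset[OF metric_matrix_continuous(2)[OF manifold metric c] D(2)])
  have pos: "0 < ?J x" if "x \<in> D" for x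
    using metric_matrix_continuous(3)[OF manifold metric c, of x] that D(2) by auto
  obtain x0 where x0: "x0 \<in> D" "\<And>x. x \<in> D \<Longrightarrow> ?J x0 \<le> ?J x"
    using continuous_attains_inf[OF D(1) False cJ] by blast
  obtain x1 where x1: "x1 \<in> D" "\<And>x. x \<in> D \<Longrightarrow> ?J x \<le> ?J x1"
    using continuous_attains_sup[OF D(1) False cJ] by blast
  show ?thesis by (rule that[OF pos[OF x0(1)] pos[OF x1(1)] x0(2) x1(2)])
qed

lemma corner_cube_compact: "compact (corner_cube x m r)"
  by (simp add: corner_cube_def)

lemma vol_compact_finite:
  assumes "compact K"
  shows "emeasure vol K < top"
proof -
  have "\<forall>p. \<exists>Q. open Q \<and> p \<in> Q \<and> emeasure vol Q < top"
  proof
    fix p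
    obtain c m r0 where c: "c \<in> A" "p \<in> fst c" and fam: "cube_family c p m r0"
      by (rule cube_charts[OF manifold])
    define D where "D = corner_cube (snd c p) m r0"
    have D: "compact D" "D \<subseteq> snd c ` fst c" 
      using cube_familyD(2)[OF fam cube_family_pos[OF fam] order_refl] by (simp_all add: D_def corner_cube_compact)
    obtain Q where Q: "open Q" "p \<in> Q" "Q \<subseteq> fst c" "snd c ` Q \<subseteq> D"
      using cube_familyD(4)[OF fam cube_family_pos[OF fam] order_refl] unfolding D_def[symmetric] by (elim exE conjE) (rule that)
    obtain a b where b: "0 < b" "\<And>x. x \<in> D \<Longrightarrow> sqrt (det (g c (chart_inv c x))) \<le> b"
      by (rule density_bounds[OF c(1) D]) (rule that)
    note cc = chart[OF c(1)]
    have Qb: "Q \<in> sets borel" using Q(1) by simp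
    have "(\<integral>\<^sup>+p\<in>Q. 1 \<partial>vol) \<le> ennreal b * (\<integral>\<^sup>+x\<in>snd c ` Q. 1 \<partial>lborel)"
      by (rule nn_integral_chart_le[OF manifold metric vol c(1) _ Q(3) Qb]) (use Q(4) b in auto)
    also have "(\<integral>\<^sup>+x\<in>snd c ` Q. 1 \<partial>lborel) \<le> (\<integral>\<^sup>+x\<in>D. 1 \<partial>lborel)"
      using Q(4) by (intro nn_integral_mono) (auto simp: indicator_def)
    also have "\<dots> = emeasure lborel D" using D(1) by (simp add: compact_imp_closed)
    finally have "emeasure vol Q \<le> ennreal b * emeasure lborel D"
      using Qb by (simp add: sets_vol mult_left_mono)
    also have "\<dots> < top"
      using emeasure_compact_finite[OF D(1)] by (simp add: ennreal_mult_less_top)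
    finally show "\<exists>Q. open Q \<and> p \<in> Q \<and> emeasure vol Q < top" using Q by blast
  qed
  from choice[OF this] obtain Q where Q: "\<And>p. open (Q p)" "\<And>p. p \<in> Q p" "\<And>p. emeasure vol (Q p) < top" by blast
  have cov: "K \<subseteq> (\<Union>p\<in>UNIV. Q p)" using Q(2) by blast
  obtain F where F: "finite F" "K \<subseteq> (\<Union>p\<in>F. Q p)"
    by (rule compactE_image[OF assms _ cov], rule Q(1), rule that)
  have "emeasure vol K \<le> emeasure vol (\<Union>p\<in>F. Q p)"
    using F Q by (intro emeasure_mono) (auto simp: sets_vol intro!: borel_open open_UN)
  also have "\<dots> \<le> (\<Sum>p\<in>F. emeasure vol (Q p))"
    using F Q by (intro emeasure_subadditive_finite) (auto simp: sets_vol intro!: borel_open)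
  also have "\<dots> < top" using Q(3) F(1) by simp
  finally show ?thesis .
qed

definition local_kappa :: "('a, 'n) chart \<Rightarrow> ('a, 'k, 'e) triv \<Rightarrow> (real^'n) set \<Rightarrow> real^'n \<Rightarrow> real" where
  "local_kappa c t D x = indicator D x * norm (\<Gamma> c t (chart_inv c x))"

lemma local_kappa:
  assumes c: "c \<in> A" and t: "t \<in> T" and D: "compact D" "D \<subseteq> snd c ` fst c" "chart_inv c ` D \<subseteq> fst t"
  shows "local_kappa c t D \<in> borel_measurable borel"
    and "(\<integral>\<^sup>+x\<in>D. ennreal (local_kappa c t D x powr real CARD('n)) \<partial>lborel) < top"
proof -
  note cc = chart[OF c]
  define K where "K = chart_inv c ` D"
  have K: "compact K" "K \<subseteq> fst c" "K \<in> sets borel" "snd c ` K = D" "K \<subseteq> fst t"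
    using chart_compact[OF cc D(1,2)] D(3) by (simp_all add: K_def)
  have Db: "D \<in> sets borel" using D(1) by (simp add: compact_imp_closed)
  have Lp: "in_Lp (real CARD('n)) vol K (\<Gamma> c t)"
    using local_integrability c t K unfolding connection_in_Lp_loc_def by blast
  have rs: "sets (restrict_space vol K) = sets (restrict_space borel K)"
    using sets_vol by (rule sets_restrict_space_cong)
  have m: "\<Gamma> c t \<in> borel_measurable (restrict_space borel K)"
    using Lp unfolding in_Lp_def measurable_cong_sets[OF rs refl] by blast
  have "(\<lambda>x. norm (\<Gamma> c t (chart_inv c x))) \<in> borel_measurable (restrict_space borel D)"
    using measurable_compose[OF chart_pull_measurable[OF cc K(2) m] borel_measurable_norm] unfolding K(4) .
  then have "(\<lambda>x. indicator D x *\<^sub>R norm (\<Gamma> c t (chart_inv c x))) \<in> borel_measurable borel"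
    using Db by (subst (asm) borel_measurable_restrict_space_iff) auto
  then show "local_kappa c t D \<in> borel_measurable borel"
    by (simp add: local_kappa_def[abs_def])
  obtain a b where a: "0 < a" "\<And>x. x \<in> D \<Longrightarrow> a \<le> sqrt (det (g c (chart_inv c x)))"
    by (rule density_bounds[OF c D(1,2)]) (rule that)
  define h where "h p = ennreal (norm (\<Gamma> c t p) powr real CARD('n)) * indicator K p" for p
  have h: "h \<in> borel_measurable borel"
  proof -
    have "(\<lambda>p. ennreal (norm (\<Gamma> c t p) powr real CARD('n))) \<in> borel_measurable (restrict_space borel K)"
      using measurable_compose[OF m borel_measurable_norm] by measurable
    then show ?thesis unfolding h_def[abs_def] using K(3) by (subst (asm) borel_measurable_restrict_space_iff_ennreal) auto
  qed
  have "(\<integral>\<^sup>+x\<in>D. ennreal (local_kappa c t D x powr real CARD('n)) \<partial>lborel) = (\<integral>\<^sup>+x\<in>snd c ` K. h (chart_inv c x) \<partial>lborel)"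
    unfolding K(4) by (intro nn_integral_cong) (auto simp: local_kappa_def h_def K_def indicator_def)
  also have "\<dots> \<le> ennreal (1/a) * (\<integral>\<^sup>+p\<in>K. h p \<partial>vol)"
    by (rule nn_integral_chart_ge[OF manifold metric vol c h K(2,3) a(1)]) (use a(2) K(4) in auto)
  also have "(\<integral>\<^sup>+p\<in>K. h p \<partial>vol) = (\<integral>\<^sup>+p\<in>K. ennreal (norm (\<Gamma> c t p) powr real CARD('n)) \<partial>vol)"
    by (intro nn_integral_cong) (auto simp: h_def indicator_def)
  also have "ennreal (1/a) * \<dots> < top"
    using Lp by (simp add: in_Lp_def ennreal_mult_less_top)
  finally show "(\<integral>\<^sup>+x\<in>D. ennreal (local_kappa c t D x powr real CARD('n)) \<partial>lborel) < top" .
qed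

definition local_H :: "('a, 'n) chart \<Rightarrow> ('a, 'k, 'e) triv \<Rightarrow> ('a \<Rightarrow> 'e) \<Rightarrow> real^'n \<Rightarrow> real" where
  "local_H c t u x = (\<Sum>i\<in>UNIV. norm (cov_deriv c t u (chart_inv c x) (axis i 1)))"

text \<open>
  From \<open>\<partial>\<^sub>i U = \<nabla>\<^sub>i U + \<Gamma>\<^sub>i U\<close>. The Euclidean length of the components is used, and not the length of the
  section, because the local hypothesis is about the coefficients \<open>\<Gamma>\<close> in an arbitrary trivialization.
\<close>

lemma local_admissible:
  assumes u: "C1_section A T E u" and c: "c \<in> A" and t: "t \<in> T"
    and D0: "compact D0" "D0 \<subseteq> snd c ` fst c" "chart_inv c ` D0 \<subseteq> fst t"
    and D: "compact D" "D \<subseteq> D0"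
  defines "U \<equiv> \<lambda>x. components_in t u (chart_inv c x)"
  shows "admissible D (local_kappa c t D0) (\<lambda>x. U x \<bullet> U x)
     (\<lambda>x v. 2 * (U x \<bullet> chart_deriv c (components_in t u) (chart_inv c x) v)) (local_H c t u)"
proof -
  note cc = chart[OF c]
  let ?W = "fst c \<inter> fst t"
  have W: "open ?W" "?W \<subseteq> fst c" using c t chart_triv_open by auto
  have mem: "chart_inv c x \<in> ?W" if "x \<in> D0" for x
    using that D0 chart_inv_mem[OF cc, of x] by auto
  have DW: "D0 \<subseteq> snd c ` ?W"
  proof
    fix x assume x: "x \<in> D0"
    have "x \<in> snd c ` fst c" using D0(2) x by blast
    then show "x \<in> snd c ` ?W" using mem[OF x] unfolding chart_mem_image_iff[OF cc W(2)] by blast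
  qed
  note C = C1_in_chart(2,3)[OF cc W components_C1[OF u c t]]
  have cU: "continuous_on D U" unfolding U_def using continuous_on_subset[OF C(2)] D DW by blast
  have cdU: "continuous_on D (\<lambda>x. chart_deriv c (components_in t u) (chart_inv c x) v)" for v
    using continuous_on_subset[OF C(1)] D DW by blast
  have Db: "D \<in> sets borel" using D(1) by (simp add: compact_imp_closed)
  have dU: "(U has_derivative chart_deriv c (components_in t u) (chart_inv c x)) (at x within D)" if x: "x \<in> D" for x
  proof -
    have x': "x \<in> D0" "x \<in> snd c ` fst c" using x D D0 by blast+
    have "has_chart_deriv c (components_in t u) (chart_inv c x) (chart_deriv c (components_in t u) (chart_inv c x))"
      using components_deriv[OF u c t, of "chart_inv c x"] mem[OF x'(1)] by blast
    then have "(U has_derivative chart_deriv c (components_in t u) (chart_inv c x)) (at x within snd c ` fst c)"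
      unfolding has_chart_deriv_def chart_inv_right[OF cc x'(2)] U_def .
    then show ?thesis by (rule has_derivative_subset) (use D D0 in blast)
  qed
  have "((\<lambda>x. U x \<bullet> U x) has_derivative (\<lambda>v. 2 * (U x \<bullet> chart_deriv c (components_in t u) (chart_inv c x) v))) (at x within D)"
    if "x \<in> D" for x
    using has_derivative_inner[OF dU[OF that] dU[OF that]] by (simp add: inner_commute)
  moreover have "\<bar>2 * (U x \<bullet> chart_deriv c (components_in t u) (chart_inv c x) b)\<bar> \<le>
     2 * sqrt (U x \<bullet> U x) * (local_H c t u x + local_kappa c t D0 x * sqrt (U x \<bullet> U x))"
    if x: "x \<in> D" and b: "b \<in> Basis" for x b
  proof -
    let ?p = "chart_inv c x"
    obtain i where i: "b = axis i 1" using b by (auto simp: Basis_vec_def)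
    have conn_term_i: "conn_term c t ?p (axis i 1) v = \<Gamma> c t ?p $ i *v v" for v
      by (simp add: conn_term_def axis_def if_distrib[of "\<lambda>r. r *\<^sub>R _"] cong: if_cong)
    have "chart_deriv c (components_in t u) ?p b = cov_deriv c t u ?p b + conn_term c t ?p b (U x)"
      by (simp add: cov_deriv_def U_def)
    then have "norm (chart_deriv c (components_in t u) ?p b) \<le> norm (cov_deriv c t u ?p b) + norm (\<Gamma> c t ?p $ i *v U x)"
      unfolding i conn_term_i using norm_triangle_ineq by metis
    also have "norm (cov_deriv c t u ?p b) \<le> local_H c t u x"
      unfolding local_H_def i by (rule member_le_sum[where f="\<lambda>i. norm (cov_deriv c t u ?p (axis i 1))"]) auto
    also have "norm (\<Gamma> c t ?p $ i *v U x) \<le> norm (\<Gamma> c t ?p $ i) * norm (U x)" by (rule norm_matrix_vector_le)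
    also have "\<dots> \<le> norm (\<Gamma> c t ?p) * norm (U x)"
      by (intro mult_right_mono Finite_Cartesian_Product.norm_nth_le) simp
    finally have le: "norm (chart_deriv c (components_in t u) ?p b) \<le> local_H c t u x + norm (\<Gamma> c t ?p) * norm (U x)" by simp
    have "\<bar>U x \<bullet> chart_deriv c (components_in t u) ?p b\<bar> \<le> norm (U x) * norm (chart_deriv c (components_in t u) ?p b)"
      by (rule Cauchy_Schwarz_ineq2)
    also have "\<dots> \<le> norm (U x) * (local_H c t u x + norm (\<Gamma> c t ?p) * norm (U x))"
      by (intro mult_left_mono le) simp
    finally show ?thesis
      using x D by (auto simp: norm_eq_sqrt_inner[symmetric] local_kappa_def abs_mult subset_iff)
  qed
  moreover have "set_borel_measurable borel D (local_H c t u)"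
  proof -
    define \<Gamma>1 where "\<Gamma>1 x = indicator D0 x *\<^sub>R \<Gamma> c t (chart_inv c x)" for x
    have [measurable]: "\<Gamma>1 \<in> borel_measurable borel"
    proof -
      define K where "K = chart_inv c ` D0"
      have K: "compact K" "K \<subseteq> fst c" "snd c ` K = D0" "K \<subseteq> fst t"
        using chart_compact[OF cc D0(1,2)] D0(3) by (simp_all add: K_def)
      have Lp: "in_Lp (real CARD('n)) vol K (\<Gamma> c t)"
        using local_integrability c t K unfolding connection_in_Lp_loc_def by blast
      have rs: "sets (restrict_space vol K) = sets (restrict_space borel K)"
        using sets_vol by (rule sets_restrict_space_cong)
      have m: "\<Gamma> c t \<in> borel_measurable (restrict_space borel K)"
        using Lp unfolding in_Lp_def measurable_cong_sets[OF rs refl] by blast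
      have D0b: "D0 \<in> sets borel" using D0(1) by (simp add: compact_imp_closed)
      show ?thesis
        using chart_pull_measurable[OF cc K(2) m] D0b unfolding K(3) \<Gamma>1_def[abs_def]
        by (subst (asm) borel_measurable_restrict_space_iff) auto
    qed
    define V where "V i x = indicator D x *\<^sub>R chart_deriv c (components_in t u) (chart_inv c x) (axis i 1)" for i x
    define U1 where "U1 x = indicator D x *\<^sub>R U x" for x
    have [measurable]: "V i \<in> borel_measurable borel" for i
      unfolding V_def[abs_def] by (rule borel_measurable_continuous_on_indicator[OF Db cdU])
    have [measurable]: "U1 \<in> borel_measurable borel"
      unfolding U1_def[abs_def] by (rule borel_measurable_continuous_on_indicator[OF Db cU])
    have gm: "(\<lambda>x. \<Gamma>1 x $ i *v U1 x) \<in> borel_measurable borel" for i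
    proof -
      have "(\<lambda>z. fst z $ i *v snd z) \<in> borel_measurable (borel :: ((real^'k^'k^'n) \<times> (real^'k)) measure)"
      proof (rule borel_measurable_continuous_onI)
        have "continuous_on UNIV (\<lambda>z :: (real^'k^'k^'n) \<times> (real^'k). \<chi> a. \<Sum>b\<in>UNIV. fst z $ i $ a $ b * snd z $ b)"
          by (intro continuous_intros)
        then show "continuous_on UNIV (\<lambda>z :: (real^'k^'k^'n) \<times> (real^'k). fst z $ i *v snd z)"
          by (simp add: matrix_vector_mult_def)
      qed
      from measurable_compose[OF borel_measurable_Pair this, of \<Gamma>1 borel U1] show ?thesis by simp
    qed
    have "(\<lambda>x. \<Sum>i\<in>UNIV. norm (V i x - \<Gamma>1 x $ i *v U1 x)) \<in> borel_measurable borel"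
      using gm by measurable
    moreover have "(\<Sum>i\<in>UNIV. norm (V i x - \<Gamma>1 x $ i *v U1 x)) = indicator D x *\<^sub>R local_H c t u x" for x
    proof (cases "x \<in> D")
      case True
      have conn_term_i: "conn_term c t (chart_inv c x) (axis i 1) v = \<Gamma> c t (chart_inv c x) $ i *v v" for i v
        by (simp add: conn_term_def axis_def if_distrib[of "\<lambda>r. r *\<^sub>R _"] cong: if_cong)
      show ?thesis using True D by (auto simp: V_def \<Gamma>1_def U1_def local_H_def cov_deriv_def conn_term_i U_def subset_iff)
    qed (simp add: V_def U1_def)
    ultimately show ?thesis unfolding set_borel_measurable_def by simp
  qed
  moreover have "continuous_on D (\<lambda>x. 2 * (U x \<bullet> chart_deriv c (components_in t u) (chart_inv c x) b))" for b
    by (intro continuous_intros cU cdU)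
  moreover have "0 \<le> local_H c t u x" for x by (simp add: local_H_def sum_nonneg)
  ultimately show ?thesis unfolding admissible_def by (intro conjI ballI) auto
qed

lemma C1c_C1: "C1c_section A T E u \<Longrightarrow> C1_section A T E u"
  unfolding C1c_section_def by (rule conjunct1)

text \<open>
  The bound is divided by its constant so that the left-hand side, which is measurable, can be integrated
  first; only then is it compared with the integral of \<open>|\<nabla>u|\<^sup>2\<close>.
\<close>

lemma local_H_bound:
  assumes u: "C1_section A T E u" and c: "c \<in> A" and t: "t \<in> T"
    and p: "chart_inv c x \<in> fst c" "chart_inv c x \<in> fst t"
    and \<alpha>: "0 < \<alpha>" "\<And>v. \<alpha> * (v \<bullet> v) \<le> v \<bullet> (gram_matrix ip t (chart_inv c x) *v v)"
    and \<mu>: "0 < \<mu>" "\<And>v. v \<bullet> (g c (chart_inv c x) *v v) \<le> \<mu> * (v \<bullet> v)"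
  shows "(local_H c t u x)\<^sup>2 / ((real CARD('n))\<^sup>2 * (\<mu> / \<alpha>)) \<le> nabla_sq u (chart_inv c x)"
proof -
  let ?p = "chart_inv c x"
  have F0: "0 \<le> nabla_sq u ?p" by (rule nabla_norm_bound(1)[OF u])
  have le: "norm (cov_deriv c t u ?p (axis i 1)) \<le> sqrt (\<mu> / \<alpha> * nabla_sq u ?p)" for i
  proof -
    let ?v = "cov_deriv c t u ?p (axis i 1)"
    have "\<alpha> * (?v \<bullet> ?v) \<le> ?v \<bullet> (gram_matrix ip t ?p *v ?v)" by (rule \<alpha>(2))
    also have "\<dots> \<le> (axis i 1 \<bullet> (g c ?p *v axis i 1)) * nabla_sq u ?p" by (rule cov_deriv_bound[OF u c p(1) t p(2)])
    also have "\<dots> \<le> \<mu> * nabla_sq u ?p"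
      using \<mu>(2)[of "axis i 1"] F0 by (intro mult_right_mono) (simp_all add: inner_axis_axis)
    finally have "?v \<bullet> ?v \<le> \<mu> / \<alpha> * nabla_sq u ?p" using \<alpha>(1) by (simp add: field_simps)
    then show ?thesis unfolding norm_eq_sqrt_inner by (rule real_sqrt_le_mono)
  qed
  have "local_H c t u x \<le> (\<Sum>i\<in>(UNIV::'n set). sqrt (\<mu> / \<alpha> * nabla_sq u ?p))"
    unfolding local_H_def by (rule sum_mono) (rule le)
  also have "\<dots> = real CARD('n) * sqrt (\<mu> / \<alpha> * nabla_sq u ?p)" by simp
  finally have "(local_H c t u x)\<^sup>2 \<le> (real CARD('n) * sqrt (\<mu> / \<alpha> * nabla_sq u ?p))\<^sup>2"
    by (rule power_mono) (simp add: local_H_def sum_nonneg)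
  also have "\<dots> = (real CARD('n))\<^sup>2 * (\<mu> / \<alpha>) * nabla_sq u ?p"
    using F0 \<alpha>(1) \<mu>(1) by (simp add: power_mult_distrib)
  finally show ?thesis
    using \<alpha>(1) \<mu>(1) by (subst pos_divide_le_eq) (simp_all add: mult.commute)
qed

text \<open>
  The cubes at \<open>p\<close> shrink to one point, so the norm of \<open>\<Gamma>\<close> in \<open>L\<^sup>n\<close> over them tends to zero.
\<close>

lemma small_cube_exists:
  fixes p :: 'a
  obtains c t D0 z r Q where "c \<in> A" "t \<in> T" "compact D0" "D0 \<subseteq> snd c ` fst c" "chart_inv c ` D0 \<subseteq> fst t"
    "0 < r" "cbox z (z + r *\<^sub>R One) \<subseteq> D0" "small_on (cbox z (z + r *\<^sub>R One)) (local_kappa c t D0)"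
    "open Q" "p \<in> Q" "Q \<subseteq> fst c" "snd c ` Q \<subseteq> cbox z (z + r *\<^sub>R One)"
proof -
  obtain c m r0 where c: "c \<in> A" "p \<in> fst c" and fam: "cube_family c p m r0"
    by (rule cube_charts[OF manifold])
  note cc = chart[OF c(1)]
  define t where "t = triv_at T p"
  have t: "t \<in> T" "p \<in> fst t" using triv_at by (simp_all add: t_def)
  let ?x = "snd c p" and ?W = "fst c \<inter> fst t" and ?n = "real CARD('n)"
  have W: "open ?W" "?W \<subseteq> fst c" using c t chart_triv_open by auto
  obtain O' where O': "open O'" "snd c ` ?W = snd c ` fst c \<inter> O'"
    using chart_openin[OF cc W] unfolding openin_open by (elim exE conjE) (rule that)
  have "?x \<in> snd c ` ?W" using c(2) t(2) by (intro imageI) simp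
  then have xO: "?x \<in> O'" unfolding O'(2) by simp
  obtain \<rho> where \<rho>: "0 < \<rho>" "ball ?x \<rho> \<subseteq> O'" by (rule openE[OF O'(1) xO]) (rule that)
  have n0: "0 < ?n" by simp
  define r1 where "r1 = min r0 (\<rho> / (2 * ?n))"
  have r1: "0 < r1" "r1 \<le> r0" using cube_family_pos[OF fam] \<rho>(1) n0 by (auto simp: r1_def)
  define S where "S i = corner_cube ?x m (r1 / real (Suc i))" for i :: nat
  have ri: "0 < r1 / real (Suc i)" "r1 / real (Suc i) \<le> r1" for i using r1 by (auto simp: field_simps)
  have ri0: "r1 / real (Suc i) \<le> r0" for i using ri(2)[of i] r1(2) by linarith
  have Sc: "compact (S i)" for i unfolding S_def by (rule corner_cube_compact)
  have S0: "S 0 = corner_cube ?x m r1" by (simp add: S_def)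
  have SU: "S 0 \<subseteq> snd c ` fst c" unfolding S0 by (rule cube_familyD(2)[OF fam r1])
  have "S 0 \<subseteq> ball ?x \<rho>"
  proof -
    have "S 0 \<subseteq> cball ?x (r1 * ?n)" unfolding S0 by (rule cube_familyD(3)[OF fam r1])
    moreover have "r1 * ?n < \<rho>"
    proof -
      have "r1 * ?n \<le> \<rho> / (2 * ?n) * ?n" unfolding r1_def by (intro mult_right_mono) simp_all
      also have "\<dots> = \<rho> / 2" using n0 by simp
      finally show ?thesis using \<rho>(1) by simp
    qed
    ultimately show ?thesis by auto
  qed
  then have SW: "S 0 \<subseteq> snd c ` ?W" unfolding O'(2) using SU \<rho>(2) by blast
  have St: "chart_inv c ` S 0 \<subseteq> fst t"
  proof
    fix q assume "q \<in> chart_inv c ` S 0"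
    then obtain x where x: "x \<in> S 0" "q = chart_inv c x" by blast
    then have "x \<in> snd c ` ?W" using SW by blast
    then show "q \<in> fst t" unfolding chart_mem_image_iff[OF cc W(2)] x(2) by blast
  qed
  let ?\<kappa> = "local_kappa c t (S 0)"
  have dec: "decseq S"
  proof (rule decseq_SucI)
    fix i
    have "r1 / real (Suc (Suc i)) \<le> r1 / real (Suc i)" using r1 by (intro divide_left_mono) auto
    then show "S (Suc i) \<subseteq> S i" unfolding S_def by (rule cube_familyD(5)[OF fam ri(1) ri0 _ ri0])
  qed
  have null: "emeasure lborel (\<Inter>i. S i) = 0"
  proof -
    have "(\<Inter>i. S i) \<subseteq> {?x}"
    proof
      fix y assume y: "y \<in> (\<Inter>i. S i)"
      have "dist ?x y \<le> r1 * ?n / real (Suc i)" for i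
      proof -
        have "y \<in> S i" using y by blast
        then have "y \<in> cball ?x (r1 / real (Suc i) * ?n)" unfolding S_def using cube_familyD(3)[OF fam ri(1) ri0] by blast
        then show ?thesis by simp
      qed
      moreover have "(\<lambda>i. r1 * ?n / real (Suc i)) \<longlonglongrightarrow> 0" by (rule LIMSEQ_Suc[OF lim_const_over_n])
      ultimately have "dist ?x y \<le> 0" by (intro LIMSEQ_le_const) auto
      then show "y \<in> {?x}" by simp
    qed
    then have "emeasure lborel (\<Inter>i. S i) \<le> emeasure lborel {?x}" by (intro emeasure_mono) auto
    then show ?thesis by simp
  qed
  have "\<exists>i. small_on (S i) ?\<kappa>"
  proof (rule eventually_small_on[OF dim' _ dec _ null])
    show "?\<kappa> \<in> borel_measurable borel" by (rule local_kappa(1)[OF c(1) t(1) Sc SU St])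
    show "S i \<in> sets borel" for i using Sc[of i] by (simp add: compact_imp_closed)
    show "(\<integral>\<^sup>+x\<in>S 0. ennreal (?\<kappa> x powr real DIM(real^'n)) \<partial>lborel) < top"
      using local_kappa(2)[OF c(1) t(1) Sc SU St] by simp
  qed
  then obtain i where i: "small_on (S i) ?\<kappa>" by blast
  let ?r = "r1 / real (Suc i)"
  obtain Q where Q: "open Q" "p \<in> Q" "Q \<subseteq> fst c" "snd c ` Q \<subseteq> S i"
    using cube_familyD(4)[OF fam ri(1) ri0, of i] unfolding S_def[symmetric] by (elim exE conjE) (rule that)
  have cube: "S i = cbox (?x - ?r *\<^sub>R m) (?x - ?r *\<^sub>R m + ?r *\<^sub>R One)" by (simp add: S_def corner_cube_def)
  have "S i \<subseteq> S 0" using dec by (simp add: decseq_def)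
  then show thesis
    using that[OF c(1) t(1) Sc[of 0] SU St ri(1)[of i], of "?x - ?r *\<^sub>R m" Q] i Q unfolding cube by blast
qed

lemma combine_bounds:
  fixes X1 X2 Y Hh I :: ennreal
  assumes "X1 \<le> ennreal b * (ennreal \<beta> * X2)" "X2 \<le> ennreal C * (Y + Hh)"
    "Y \<le> ennreal k1 * I" "Hh \<le> ennreal k2 * I" "0 \<le> b" "0 \<le> \<beta>" "0 \<le> C" "0 \<le> k1" "0 \<le> k2"
  shows "X1 \<le> ennreal (b * \<beta> * C * (k1 + k2)) * I"
proof -
  have "X1 \<le> ennreal b * (ennreal \<beta> * (ennreal C * (ennreal k1 * I + ennreal k2 * I)))"
    using assms(1) by (rule order_trans) (intro mult_left_mono order_trans[OF assms(2)] add_mono assms(3,4); simp)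
  also have "\<dots> = ennreal (b * \<beta> * C * (k1 + k2)) * I"
    using assms(5-) by (simp add: ennreal_mult ennreal_plus algebra_simps)
  finally show ?thesis .
qed

text \<open>
  The neighbourhood \<open>Q\<close> corresponds to a part of a cube on which \<open>\<Gamma>\<close> is small. On the compact cube the metric,
  its density and the Gram matrix are comparable to the Euclidean ones, so the statement reduces to the
  propagation of bounds from an open part of the cube to all of it.
\<close>

lemma local_propagation:
  fixes p :: 'a
  obtains Q where "open Q" "p \<in> Q" "\<And>S. open S \<Longrightarrow> S \<noteq> {} \<Longrightarrow> S \<subseteq> Q \<Longrightarrow> energy_bounded S \<Longrightarrow> energy_bounded Q"
proof -
  obtain c t D0 z r Q where c: "c \<in> A" and t: "t \<in> T" and D0: "compact D0" "D0 \<subseteq> snd c ` fst c" "chart_inv c ` D0 \<subseteq> fst t"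
    and r: "0 < r" and DD0: "cbox z (z + r *\<^sub>R One) \<subseteq> D0" and small: "small_on (cbox z (z + r *\<^sub>R One)) (local_kappa c t D0)"
    and Q: "open Q" "p \<in> Q" "Q \<subseteq> fst c" "snd c ` Q \<subseteq> cbox z (z + r *\<^sub>R One)"
    by (rule small_cube_exists[of p])
  note cc = chart[OF c]
  let ?\<kappa> = "local_kappa c t D0"
  define D where "D = cbox z (z + r *\<^sub>R One)"
  have D: "compact D" "D \<subseteq> D0" "D \<subseteq> snd c ` fst c" using DD0 D0 by (auto simp: D_def)
  have Db: "D \<in> sets borel" using D(1) by (simp add: compact_imp_closed)
  note QD = Q(4)[folded D_def]
  let ?W = "fst c \<inter> fst t"
  have W: "open ?W" "?W \<subseteq> fst c" using c t chart_triv_open by auto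
  have pc: "chart_inv c x \<in> fst c" if "x \<in> D" for x
    using chart_inv_mem[OF cc, of x] D(3) that by blast
  have pt: "chart_inv c x \<in> fst t" if "x \<in> D" for x
    using D0(3) D(2) that by blast
  obtain a b where ab: "0 < a" "0 < b"
    "\<And>x. x \<in> D \<Longrightarrow> a \<le> sqrt (det (g c (chart_inv c x)))" "\<And>x. x \<in> D \<Longrightarrow> sqrt (det (g c (chart_inv c x))) \<le> b"
    by (rule density_bounds[OF c D(1,3)]) (rule that)
  have "continuous_on D (\<lambda>x. \<chi> a b. gram_matrix ip t (chart_inv c x) $ a $ b)"
  proof (intro continuous_on_vec_lambda)
    fix a b
    have "D \<subseteq> snd c ` ?W"
    proof
      fix x assume x: "x \<in> D"
      have "x \<in> snd c ` fst c" using D(3) x by blast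
      then show "x \<in> snd c ` ?W" unfolding chart_mem_image_iff[OF cc W(2), of x] using pc[OF x] pt[OF x] by blast
    qed
    then show "continuous_on D (\<lambda>x. gram_matrix ip t (chart_inv c x) $ a $ b)"
      by (rule continuous_on_subset[OF C1_in_chart(3)[OF cc W gram_C1[OF c t]]])
  qed
  then have cG: "continuous_on D (\<lambda>x. gram_matrix ip t (chart_inv c x))" by simp
  obtain \<alpha> \<beta> where \<alpha>\<beta>: "0 < \<alpha>" "0 < \<beta>"
    "\<And>x v. x \<in> D \<Longrightarrow> \<alpha> * (v \<bullet> v) \<le> v \<bullet> (gram_matrix ip t (chart_inv c x) *v v)"
    "\<And>x v. x \<in> D \<Longrightarrow> v \<bullet> (gram_matrix ip t (chart_inv c x) *v v) \<le> \<beta> * (v \<bullet> v)"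
    by (rule posdef_uniform[OF D(1) cG gram_posdef[OF t pt]]) (assumption, rule that)
  have cg: "continuous_on D (\<lambda>x. g c (chart_inv c x))"
    by (rule continuous_on_subset[OF metric_matrix_continuous(1)[OF manifold metric c] D(3)])
  obtain \<mu>0 \<mu> where \<mu>: "0 < \<mu>" "\<And>x v. x \<in> D \<Longrightarrow> v \<bullet> (g c (chart_inv c x) *v v) \<le> \<mu> * (v \<bullet> v)"
    by (rule posdef_uniform[OF D(1) cg metric_posdef[OF metric c pc]]) (assumption, rule that)
  define n where "n = real CARD('n)"
  have n0: "0 < n" by (simp add: n_def)
  define CH where "CH = n\<^sup>2 * (\<mu> / \<alpha>)"
  have CH: "0 < CH" using n0 \<mu>(1) \<alpha>\<beta>(1) by (simp add: CH_def)
  have "energy_bounded Q" if S: "open S" "S \<noteq> {}" "S \<subseteq> Q" "energy_bounded S" for S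
  proof -
    obtain CS where CS: "0 \<le> CS" "\<And>u. C1c_section A T E u \<Longrightarrow>
       (\<integral>\<^sup>+p\<in>S. ennreal (len_sq u p) \<partial>vol) \<le> ennreal CS * (\<integral>\<^sup>+p. ennreal (nabla_sq u p) \<partial>vol)"
      using S(4) by (rule energy_boundedE) (rule that)
    have Sc: "S \<subseteq> fst c" using S(3) Q(3) by (rule order_trans)
    have Sb: "S \<in> sets borel" "Q \<in> sets borel" using S(1) Q(1) by auto
    let ?B = "snd c ` S"
    have BD: "?B \<subseteq> D" using S(3) QD by blast
    obtain q where q: "q \<in> S" using S(2) by blast
    obtain O' where O': "open O'" "?B = snd c ` fst c \<inter> O'"
      using chart_openin[OF cc S(1) Sc] unfolding openin_open by (elim exE conjE) (rule that)
    have "snd c q \<in> ?B" using q by (rule imageI)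
    then have qO: "snd c q \<in> O'" "snd c q \<in> D" using BD unfolding O'(2) by blast+
    obtain \<rho> where \<rho>: "0 < \<rho>" "ball (snd c q) \<rho> \<subseteq> O'" by (rule openE[OF O'(1) qO(1)]) (rule that)
    have "controls D ?\<kappa> ?B D"
      unfolding D_def
    proof (rule cube_control[OF dim' _ _ small r _ \<rho>(1)])
      show "?\<kappa> \<in> borel_measurable borel" by (rule local_kappa(1)[OF c t D0])
      show "0 \<le> ?\<kappa> x" for x by (simp add: local_kappa_def)
      show "snd c q \<in> cbox z (z + r *\<^sub>R One)" using \<open>snd c q \<in> D\<close> by (simp add: D_def)
      show "ball (snd c q) \<rho> \<inter> cbox z (z + r *\<^sub>R One) \<subseteq> ?B"
        using \<rho>(2) D(3) unfolding O'(2) D_def by blast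
    qed
    then obtain C where C: "0 \<le> C" "\<And>s s' H. admissible D ?\<kappa> s s' H \<Longrightarrow>
       (\<integral>\<^sup>+x\<in>D. ennreal (s x) \<partial>lborel) \<le> ennreal C *
       ((\<integral>\<^sup>+x\<in>?B. ennreal (s x) \<partial>lborel) + (\<integral>\<^sup>+x\<in>D. ennreal ((H x)\<^sup>2) \<partial>lborel))"
      by (rule controlsE) (rule that)
    show "energy_bounded Q"
      unfolding energy_bounded_def
    proof (intro exI[of _ "b * \<beta> * C * (1/a * (1/\<alpha>) * CS + CH * (1/a))"] conjI allI impI)
      show "0 \<le> b * \<beta> * C * (1/a * (1/\<alpha>) * CS + CH * (1/a))"
        using ab \<alpha>\<beta> C(1) CS(1) CH by (intro mult_nonneg_nonneg add_nonneg_nonneg) auto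
      fix u assume uc: "C1c_section A T E u"
      note u = C1c_C1[OF uc]
      let ?I = "\<integral>\<^sup>+p. ennreal (nabla_sq u p) \<partial>vol"
      define U where "U x = components_in t u (chart_inv c x)" for x
      define H where "H = local_H c t u"
      have adm: "admissible D ?\<kappa> (\<lambda>x. U x \<bullet> U x) (\<lambda>x v. 2 * (U x \<bullet> chart_deriv c (components_in t u) (chart_inv c x) v)) H"
        unfolding U_def H_def by (rule local_admissible[OF u c t D0 D(1,2)])
      have us: "len_sq u (chart_inv c x) = U x \<bullet> (gram_matrix ip t (chart_inv c x) *v U x)" if "x \<in> D" for x
      proof -
        have "u (chart_inv c x) \<in> E (chart_inv c x)" using u unfolding C1_section_def by blast
        then show ?thesis unfolding U_def by (rule norm_sq_section[of t "chart_inv c x" u, OF t pt[OF that]])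
      qed
      have [measurable]: "len_sq u \<in> borel_measurable borel" by (rule len_sq_measurable[OF u])
      have X1: "(\<integral>\<^sup>+p\<in>Q. ennreal (len_sq u p) \<partial>vol) \<le> ennreal b * (ennreal \<beta> * (\<integral>\<^sup>+x\<in>D. ennreal (U x \<bullet> U x) \<partial>lborel))"
      proof -
        have "(\<integral>\<^sup>+p\<in>Q. ennreal (len_sq u p) \<partial>vol) \<le> ennreal b * (\<integral>\<^sup>+x\<in>snd c ` Q. ennreal (len_sq u (chart_inv c x)) \<partial>lborel)"
          by (rule nn_integral_chart_le[OF manifold metric vol c _ Q(3) Sb(2)]) (use QD ab(4) in auto)
        also have "(\<integral>\<^sup>+x\<in>snd c ` Q. ennreal (len_sq u (chart_inv c x)) \<partial>lborel) \<le> (\<integral>\<^sup>+x. ennreal \<beta> * (ennreal (U x \<bullet> U x) * indicator D x) \<partial>lborel)"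
        proof (rule nn_integral_mono)
          fix x
          show "ennreal (len_sq u (chart_inv c x)) * indicator (snd c ` Q) x \<le> ennreal \<beta> * (ennreal (U x \<bullet> U x) * indicator D x)"
          proof (cases "x \<in> snd c ` Q")
            case True
            then have x: "x \<in> D" using QD by blast
            have "len_sq u (chart_inv c x) \<le> \<beta> * (U x \<bullet> U x)" unfolding us[OF x] by (rule \<alpha>\<beta>(4)[OF x])
            then have "ennreal (len_sq u (chart_inv c x)) \<le> ennreal (\<beta> * (U x \<bullet> U x))" by (rule ennreal_leI)
            also have "\<dots> = ennreal \<beta> * ennreal (U x \<bullet> U x)" using \<alpha>\<beta>(2) by (intro ennreal_mult) auto
            finally show ?thesis using True x by simp
          qed simp
        qed
        also have "\<dots> = ennreal \<beta> * (\<integral>\<^sup>+x\<in>D. ennreal (U x \<bullet> U x) \<partial>lborel)"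
        proof (rule nn_integral_cmult)
          have "(\<lambda>x. indicator D x *\<^sub>R (U x \<bullet> U x)) \<in> borel_measurable borel"
            by (rule borel_measurable_continuous_on_indicator[OF Db admissible_continuous[OF adm]])
          then have "(\<lambda>x. ennreal (indicator D x *\<^sub>R (U x \<bullet> U x))) \<in> borel_measurable lborel" by measurable
          moreover have "ennreal (indicator D x *\<^sub>R (U x \<bullet> U x)) = ennreal (U x \<bullet> U x) * indicator D x" for x
            by (simp add: indicator_def)
          ultimately show "(\<lambda>x. ennreal (U x \<bullet> U x) * indicator D x) \<in> borel_measurable lborel" by (simp only:)
        qed
        finally show ?thesis by (simp add: mult_left_mono)
      qed
      note X2 = C(2)[OF adm]
      have Y: "(\<integral>\<^sup>+x\<in>?B. ennreal (U x \<bullet> U x) \<partial>lborel) \<le> ennreal (1/a * (1/\<alpha>) * CS) * ?I"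
      proof -
        have "(\<integral>\<^sup>+x\<in>?B. ennreal (U x \<bullet> U x) \<partial>lborel) \<le> (\<integral>\<^sup>+x\<in>?B. ennreal (1/\<alpha>) * ennreal (len_sq u (chart_inv c x)) \<partial>lborel)"
        proof (rule nn_integral_mono)
          fix x
          show "ennreal (U x \<bullet> U x) * indicator ?B x \<le> ennreal (1/\<alpha>) * ennreal (len_sq u (chart_inv c x)) * indicator ?B x"
          proof (cases "x \<in> ?B")
            case True
            then have x: "x \<in> D" using BD by blast
            have "\<alpha> * (U x \<bullet> U x) \<le> len_sq u (chart_inv c x)" unfolding us[OF x] by (rule \<alpha>\<beta>(3)[OF x])
            then have "U x \<bullet> U x \<le> 1/\<alpha> * len_sq u (chart_inv c x)" using \<alpha>\<beta>(1) by (simp add: field_simps)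
            then have "ennreal (U x \<bullet> U x) \<le> ennreal (1/\<alpha> * len_sq u (chart_inv c x))" by (rule ennreal_leI)
            also have "\<dots> = ennreal (1/\<alpha>) * ennreal (len_sq u (chart_inv c x))"
              using \<alpha>\<beta>(1) len_sq_nonneg[OF u] by (intro ennreal_mult) auto
            finally show ?thesis using True by simp
          qed simp
        qed
        also have "\<dots> \<le> ennreal (1/a) * (\<integral>\<^sup>+p\<in>S. ennreal (1/\<alpha>) * ennreal (len_sq u p) \<partial>vol)"
          by (rule nn_integral_chart_ge[OF manifold metric vol c _ Sc Sb(1) ab(1)]) (use BD ab(3) in auto)
        also have "(\<integral>\<^sup>+p\<in>S. ennreal (1/\<alpha>) * ennreal (len_sq u p) \<partial>vol) = (\<integral>\<^sup>+p. ennreal (1/\<alpha>) * (ennreal (len_sq u p) * indicator S p) \<partial>vol)"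
          by (simp add: mult.assoc)
        also have "\<dots> = ennreal (1/\<alpha>) * (\<integral>\<^sup>+p\<in>S. ennreal (len_sq u p) \<partial>vol)"
        proof (rule nn_integral_cmult)
          have [measurable]: "S \<in> sets borel" by (rule Sb(1))
          have "(\<lambda>p. ennreal (len_sq u p) * indicator S p) \<in> borel_measurable borel" by measurable
          then show "(\<lambda>p. ennreal (len_sq u p) * indicator S p) \<in> borel_measurable vol"
            unfolding measurable_cong_sets[OF sets_vol refl] .
        qed
        also have "\<dots> \<le> ennreal (1/\<alpha>) * (ennreal CS * ?I)" by (rule mult_left_mono[OF CS(2)[OF uc]]) simp
        finally have "(\<integral>\<^sup>+x\<in>?B. ennreal (U x \<bullet> U x) \<partial>lborel) \<le> ennreal (1/a) * (ennreal (1/\<alpha>) * (ennreal CS * ?I))"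
          by (simp add: mult_left_mono)
        also have "\<dots> = ennreal (1/a * (1/\<alpha>) * CS) * ?I"
        proof -
          have "0 \<le> 1/a" "0 \<le> 1/\<alpha>" using ab(1) \<alpha>\<beta>(1) by simp_all
          then show ?thesis using CS(1) by (simp only: ennreal_mult_collect mult_nonneg_nonneg mult.assoc)
        qed
        finally show ?thesis .
      qed
      have Hh: "(\<integral>\<^sup>+x\<in>D. ennreal ((H x)\<^sup>2) \<partial>lborel) \<le> ennreal (CH * (1/a)) * ?I"
      proof -
        define H1 where "H1 x = indicator D x *\<^sub>R H x" for x
        have [measurable]: "H1 \<in> borel_measurable borel"
          using adm unfolding admissible_def set_borel_measurable_def H1_def[abs_def] by blast
        define K where "K = chart_inv c ` D"
        have K: "K \<subseteq> fst c" "K \<in> sets borel" "snd c ` K = D"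
          using chart_compact[OF cc D(1,3)] by (simp_all add: K_def)
        define f where "f x = ennreal ((H1 x)\<^sup>2 / CH)" for x
        have [measurable]: "f \<in> borel_measurable borel" unfolding f_def by measurable
        have [measurable]: "D \<in> sets borel" by (rule Db)
        define h where "h p = f (snd c p) * indicator K p" for p
        have hm: "h \<in> borel_measurable borel"
          unfolding h_def[abs_def] by (rule chart_push_measurable[OF cc K(1,2)]) measurable
        have "(\<integral>\<^sup>+x\<in>D. ennreal ((H x)\<^sup>2) \<partial>lborel) = (\<integral>\<^sup>+x. ennreal CH * (f x * indicator D x) \<partial>lborel)"
          using CH by (intro nn_integral_cong) (auto simp: f_def H1_def indicator_def simp flip: ennreal_mult)
        also have "\<dots> = ennreal CH * (\<integral>\<^sup>+x\<in>D. f x \<partial>lborel)"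
          by (rule nn_integral_cmult) measurable
        also have "(\<integral>\<^sup>+x\<in>D. f x \<partial>lborel) = (\<integral>\<^sup>+x\<in>snd c ` K. h (chart_inv c x) \<partial>lborel)"
          unfolding K(3)
        proof (rule nn_integral_cong)
          fix x
          show "f x * indicator D x = h (chart_inv c x) * indicator D x"
          proof (cases "x \<in> D")
            case True
            then have "x \<in> snd c ` fst c" using D(3) by blast
            then show ?thesis using True chart_inv_right[OF cc, of x] by (simp add: h_def K_def)
          qed simp
        qed
        also have "\<dots> \<le> ennreal (1/a) * (\<integral>\<^sup>+p\<in>K. h p \<partial>vol)"
          by (rule nn_integral_chart_ge[OF manifold metric vol c hm K(1,2) ab(1)]) (use K(3) ab(3) in auto)
        also have "(\<integral>\<^sup>+p\<in>K. h p \<partial>vol) \<le> ?I"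
        proof (rule nn_integral_mono)
          fix p
          show "h p * indicator K p \<le> ennreal (nabla_sq u p)"
          proof (cases "p \<in> K")
            case True
            then obtain x where x: "x \<in> D" "p = chart_inv c x" unfolding K_def by blast
            have xU: "x \<in> snd c ` fst c" using D(3) x(1) by blast
            have "(H x)\<^sup>2 / CH \<le> nabla_sq u p"
              unfolding H_def CH_def n_def x(2)
              by (rule local_H_bound[OF u c t pc[OF x(1)] pt[OF x(1)] \<alpha>\<beta>(1) \<alpha>\<beta>(3)[OF x(1)] \<mu>(1) \<mu>(2)[OF x(1)]])
            then have "f x \<le> ennreal (nabla_sq u p)" unfolding f_def H1_def using x(1) by (intro ennreal_leI) simp
            then show ?thesis using True x chart_inv_right[OF cc xU] by (simp add: h_def)
          qed simp
        qed
        finally have "(\<integral>\<^sup>+x\<in>D. ennreal ((H x)\<^sup>2) \<partial>lborel) \<le> ennreal CH * (ennreal (1/a) * ?I)"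
          by (simp add: mult_left_mono)
        also have "\<dots> = ennreal (CH * (1/a)) * ?I"
          using CH ab(1) by (intro ennreal_mult_collect) simp_all
        finally show ?thesis .
      qed
      show "(\<integral>\<^sup>+p\<in>Q. ennreal (len_sq u p) \<partial>vol) \<le> ennreal (b * \<beta> * C * (1/a * (1/\<alpha>) * CS + CH * (1/a))) * ?I"
        by (rule combine_bounds[OF X1 X2 Y Hh]) (use ab \<alpha>\<beta> C(1) CS(1) CH in auto)
    qed
  qed
  then show thesis by (rule that[OF Q(1,2)])
qed

end

section \<open>The asymptotically flat end\<close>

text \<open>
  Let the rows of \<open>P\<close> form an orthonormal family. Its members have length at most \<open>1 / sqrt \<eta>\<close>, which
  bounds the determinant of \<open>P\<close> through the Leibniz formula, and \<open>det G = 1 / (det P)\<^sup>2\<close>.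
\<close>

lemma det_lower_bound:
  assumes "0 < \<eta>"
  obtains a where "0 < a"
    "\<And>G :: real^'n^'n. posdef G \<Longrightarrow> \<forall>\<xi>. \<eta> * (\<xi> \<bullet> \<xi>) \<le> \<xi> \<bullet> (G *v \<xi>) \<Longrightarrow> a \<le> sqrt (det G)"
proof -
  define B where "B = 1 / sqrt \<eta>"
  have B: "0 < B" using assms by (simp add: B_def)
  define N where "N = (\<Sum>p\<in>{p. p permutes (UNIV::'n set)}. \<Prod>i\<in>(UNIV::'n set). B)"
  have "id \<in> {p. p permutes (UNIV::'n set)}" by (simp add: permutes_id)
  then have "{p. p permutes (UNIV::'n set)} \<noteq> {}" by blast
  then have N: "0 < N" unfolding N_def using B
    by (intro sum_pos) (simp_all add: finite_permutations)
  have "1 / N \<le> sqrt (det G)" if G: "posdef G" and low: "\<forall>\<xi>. \<eta> * (\<xi> \<bullet> \<xi>) \<le> \<xi> \<bullet> (G *v \<xi>)" for G :: "real^'n^'n"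
  proof -
    obtain f :: "'n \<Rightarrow> real^'n" where f: "\<And>i j. f i \<bullet> (G *v f j) = (if i = j then 1 else 0)"
      using orthonormal_family_exists[OF G] by blast
    define P :: "real^'n^'n" where "P = (\<chi> i. f i)"
    have ent: "\<bar>P $ i $ j\<bar> \<le> B" for i j
    proof -
      have "\<eta> * (f i \<bullet> f i) \<le> 1" using spec[OF low, of "f i"] f[of i i] by simp
      then have "f i \<bullet> f i \<le> 1 / \<eta>" using assms by (simp add: field_simps)
      then have "norm (f i) \<le> B" unfolding norm_eq_sqrt_inner B_def using real_sqrt_le_mono[of "f i \<bullet> f i" "1/\<eta>"]
        by (simp add: real_sqrt_divide)
      moreover have "\<bar>f i $ j\<bar> \<le> norm (f i)" by (rule component_le_norm_cart)
      ultimately show ?thesis by (simp add: P_def)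
    qed
    have "\<bar>det P\<bar> \<le> N"
      unfolding det_def N_def
    proof (rule order_trans[OF sum_abs], rule sum_mono)
      fix p assume "p \<in> {p. p permutes (UNIV::'n set)}"
      have "\<bar>of_int (sign p) * (\<Prod>i\<in>UNIV. P $ i $ p i)\<bar> = \<bar>real_of_int (sign p)\<bar> * (\<Prod>i\<in>UNIV. \<bar>P $ i $ p i\<bar>)"
        by (simp add: abs_mult abs_prod)
      also have "\<dots> = (\<Prod>i\<in>UNIV. \<bar>P $ i $ p i\<bar>)" by (simp add: sign_def)
      also have "\<dots> \<le> (\<Prod>i\<in>(UNIV::'n set). B)" using ent by (intro prod_mono) auto
      finally show "\<bar>of_int (sign p) * (\<Prod>i\<in>UNIV. P $ i $ p i)\<bar> \<le> (\<Prod>i\<in>(UNIV::'n set). B)" .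
    qed
    have "P ** (G ** transpose P) = mat 1"
    proof -
      have "(P ** (G ** transpose P)) $ i $ j = f i \<bullet> (G *v f j)" for i j
      proof -
        have "(G ** transpose P) $ k $ j = (G *v f j) $ k" for k
          by (simp add: P_def matrix_matrix_mult_def matrix_vector_mult_def transpose_def)
        moreover have "(P ** (G ** transpose P)) $ i $ j = (\<Sum>k\<in>UNIV. P $ i $ k * (G ** transpose P) $ k $ j)"
          by (simp add: matrix_matrix_mult_def)
        ultimately show ?thesis by (simp add: P_def inner_vec_def)
      qed
      then show ?thesis by (simp add: f vec_eq_iff mat_def)
    qed
    then have "det P * (det G * det P) = 1"
      using arg_cong[of _ _ det] by (simp add: det_mul det_transpose) (metis det_I det_mul det_transpose)
    then have d: "det G * (det P)\<^sup>2 = 1" by (simp add: power2_eq_square algebra_simps)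
    then have "det P \<noteq> 0" by auto
    then have dG: "det G = (1 / \<bar>det P\<bar>)\<^sup>2" using d by (simp add: power_divide field_simps)
    have "1 / N \<le> 1 / \<bar>det P\<bar>" using \<open>\<bar>det P\<bar> \<le> N\<close> \<open>det P \<noteq> 0\<close> by (intro divide_left_mono) (auto simp: N)
    also have "\<dots> = sqrt (det G)" unfolding dG by simp
    finally show ?thesis .
  qed
  then show thesis using that[of "1 / N"] N by simp
qed

context poincare_data
begin

text \<open>
  Far out in the end, \<open>\<Gamma>\<^sup>S\<close> is small in \<open>L\<^sup>n\<close>, and the exterior estimate applies. The coordinates of the end need
  not be bounded on a compact subset of the manifold; but its volume is finite and the density of the
  volume is bounded below in the end, so its image has finite Lebesgue measure, which is enough.
\<close>

lemma energy_bounded_end: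
  assumes af: "weakly_af_end A g e" and decay: "in_Lp (real CARD('n)) vol (fst e) Gamma_S"
  obtains W where "open W" "W \<noteq> {}" "energy_bounded W"
proof -
  have e: "e \<in> A" and im: "snd e ` fst e = - cball 0 1" using af unfolding weakly_af_end_def by blast+
  obtain \<eta> where \<eta>: "0 < \<eta>"
    "\<And>p \<xi>. p \<in> fst e \<Longrightarrow> \<eta> * (\<xi> \<bullet> \<xi>) \<le> \<xi> \<bullet> (g e p *v \<xi>)"
    "\<And>p \<xi>. p \<in> fst e \<Longrightarrow> \<xi> \<bullet> (g e p *v \<xi>) \<le> inverse \<eta> * (\<xi> \<bullet> \<xi>)"
    using af unfolding weakly_af_end_def by blast
  note ec = chart[OF e]
  let ?\<phi> = "chart_inv e"
  let ?n = "real CARD('n)"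
  obtain a where a: "0 < a" "\<And>G :: real^'n^'n. posdef G \<Longrightarrow> \<forall>\<xi>. \<eta> * (\<xi> \<bullet> \<xi>) \<le> \<xi> \<bullet> (G *v \<xi>) \<Longrightarrow> a \<le> sqrt (det G)"
    by (rule det_lower_bound[OF \<eta>(1)]) (rule that)
  have low: "a \<le> sqrt (det (g e (?\<phi> x)))" if "x \<in> snd e ` fst e" for x
    by (rule a(2)[OF metric_posdef[OF metric e chart_inv_mem[OF ec that]]]) (intro allI \<eta>(2)[OF chart_inv_mem[OF ec that]])
  define \<epsilon> where "\<epsilon> = 1 / sqrt \<eta>"
  have \<epsilon>: "0 < \<epsilon>" using \<eta>(1) by (simp add: \<epsilon>_def)
  have gb: "sqrt (axis i 1 \<bullet> (g e p *v axis i 1)) \<le> \<epsilon>" if "p \<in> fst e" for p i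
    using real_sqrt_le_mono[OF \<eta>(3)[OF that, of "axis i 1"]] by (simp add: \<epsilon>_def inner_axis_axis real_sqrt_inverse inverse_eq_divide real_sqrt_divide)
  have ext: "(cube_exterior R :: (real^'n) set) \<subseteq> snd e ` fst e" if "1 \<le> R" for R
    unfolding im
  proof
    fix x :: "real^'n" assume "x \<in> cube_exterior R"
    then obtain b where b: "b \<in> Basis" "R < \<bar>x \<bullet> b\<bar>" unfolding cube_exterior_def by blast
    have "\<bar>x \<bullet> b\<bar> \<le> norm x" by (rule Basis_le_norm[OF b(1)])
    then show "x \<in> - cball 0 1" using b(2) that by simp
  qed
  define \<kappa> where "\<kappa> x = indicator (cube_exterior 1) x *\<^sub>R (\<epsilon> * Gamma_S (?\<phi> x))" for x
  have feb: "fst e \<in> sets borel" using chart_open[OF ec] by simp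
  have ceb: "(cube_exterior R :: (real^'n) set) \<in> sets borel" for R by (simp add: open_cube_exterior)
  have rs: "sets (restrict_space vol (fst e)) = sets (restrict_space borel (fst e))"
    using sets_vol by (rule sets_restrict_space_cong)
  have gm: "Gamma_S \<in> borel_measurable (restrict_space borel (fst e))"
    using decay unfolding in_Lp_def measurable_cong_sets[OF rs refl] by blast
  have \<kappa>m[measurable]: "\<kappa> \<in> borel_measurable borel"
  proof -
    have "(\<lambda>x. Gamma_S (?\<phi> x)) \<in> borel_measurable (restrict_space borel (snd e ` fst e))"
      by (rule chart_pull_measurable[OF ec order_refl gm])
    then have "(\<lambda>x. \<epsilon> * Gamma_S (?\<phi> x)) \<in> borel_measurable (restrict_space borel (cube_exterior 1))"
      by (intro borel_measurable_times borel_measurable_const measurable_restrict_mono[OF _ ext[OF order_refl]])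
    then show ?thesis unfolding \<kappa>_def[abs_def] using ceb by (subst (asm) borel_measurable_restrict_space_iff) auto
  qed
  have g0: "0 \<le> Gamma_S p" for p by (rule sym_form_bound(2))
  have \<kappa>0: "0 \<le> \<kappa> x" for x using \<epsilon> g0 by (simp add: \<kappa>_def)
  have \<kappa>fin: "(\<integral>\<^sup>+x\<in>cube_exterior 1. ennreal (\<kappa> x powr ?n) \<partial>lborel) < top"
  proof -
    define h where "h p = ennreal ((\<epsilon> powr ?n) * norm (Gamma_S p) powr ?n) * indicator (fst e) p" for p
    have hm: "h \<in> borel_measurable borel"
    proof -
      have "(\<lambda>p. ennreal ((\<epsilon> powr ?n) * norm (Gamma_S p) powr ?n)) \<in> borel_measurable (restrict_space borel (fst e))"
        using measurable_compose[OF gm borel_measurable_norm] by measurable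
      then show ?thesis unfolding h_def[abs_def] using feb by (rule borel_measurable_times_indicator)
    qed
    have "(\<integral>\<^sup>+x\<in>cube_exterior 1. ennreal (\<kappa> x powr ?n) \<partial>lborel) \<le> (\<integral>\<^sup>+x\<in>snd e ` fst e. h (?\<phi> x) \<partial>lborel)"
    proof (rule nn_integral_mono)
      fix x :: "real^'n"
      show "ennreal (\<kappa> x powr ?n) * indicator (cube_exterior 1) x \<le> h (?\<phi> x) * indicator (snd e ` fst e) x"
      proof (cases "x \<in> cube_exterior 1")
        case True
        then have x: "x \<in> snd e ` fst e" using ext[OF order_refl] by blast
        have "\<kappa> x powr ?n = (\<epsilon> powr ?n) * norm (Gamma_S (?\<phi> x)) powr ?n"
          using True \<epsilon> g0 by (simp add: \<kappa>_def powr_mult)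
        then show ?thesis using True x chart_inv_mem[OF ec x] by (simp add: h_def)
      qed simp
    qed
    also have "\<dots> \<le> ennreal (1/a) * (\<integral>\<^sup>+p\<in>fst e. h p \<partial>vol)"
      by (rule nn_integral_chart_ge[OF manifold metric vol e hm order_refl feb a(1) low])
    also have "(\<integral>\<^sup>+p\<in>fst e. h p \<partial>vol) = (\<integral>\<^sup>+p. ennreal (\<epsilon> powr ?n) * (ennreal (norm (Gamma_S p) powr ?n) * indicator (fst e) p) \<partial>vol)"
      by (intro nn_integral_cong) (auto simp: h_def indicator_def ennreal_mult)
    also have "\<dots> = ennreal (\<epsilon> powr ?n) * (\<integral>\<^sup>+p\<in>fst e. ennreal (norm (Gamma_S p) powr ?n) \<partial>vol)"
    proof (rule nn_integral_cmult)
      have "(\<lambda>p. ennreal (norm (Gamma_S p) powr ?n)) \<in> borel_measurable (restrict_space borel (fst e))"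
        using measurable_compose[OF gm borel_measurable_norm] by measurable
      then have "(\<lambda>p. ennreal (norm (Gamma_S p) powr ?n) * indicator (fst e) p) \<in> borel_measurable borel"
        using feb by (rule borel_measurable_times_indicator)
      then show "(\<lambda>p. ennreal (norm (Gamma_S p) powr ?n) * indicator (fst e) p) \<in> borel_measurable vol"
        unfolding measurable_cong_sets[OF sets_vol refl] .
    qed
    also have "ennreal (1/a) * (ennreal (\<epsilon> powr ?n) * (\<integral>\<^sup>+p\<in>fst e. ennreal (norm (Gamma_S p) powr ?n) \<partial>vol)) < top"
      using decay by (simp add: in_Lp_def ennreal_mult_less_top)
    finally show ?thesis by (simp add: mult_left_mono)
  qed
  have "\<exists>i. small_on (cube_exterior (1 + real i) :: (real^'n) set) \<kappa>"
  proof (rule eventually_small_on[OF dim' \<kappa>m])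
    show "decseq (\<lambda>i. cube_exterior (1 + real i) :: (real^'n) set)"
    proof (rule decseq_SucI)
      fix i
      have "1 + real i < r" if "1 + real (Suc i) < r" for r using that by simp
      then show "cube_exterior (1 + real (Suc i)) \<subseteq> (cube_exterior (1 + real i) :: (real^'n) set)"
        unfolding cube_exterior_def by blast
    qed
    have "(\<Inter>i. cube_exterior (1 + real i) :: (real^'n) set) = {}"
    proof (rule ccontr)
      assume "(\<Inter>i. cube_exterior (1 + real i) :: (real^'n) set) \<noteq> {}"
      then obtain x :: "real^'n" where x: "\<And>i::nat. x \<in> cube_exterior (1 + real i)" by blast
      obtain i :: nat where i: "norm x < real i" using reals_Archimedean2 by blast
      obtain b where "b \<in> Basis" "1 + real i < \<bar>x \<bullet> b\<bar>" using x[of i] unfolding cube_exterior_def by blast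
      then show False using Basis_le_norm[of b x] i by simp
    qed
    then show "emeasure lborel (\<Inter>i. cube_exterior (1 + real i) :: (real^'n) set) = 0" by simp
    show "(\<integral>\<^sup>+x\<in>cube_exterior (1 + real 0). ennreal (\<kappa> x powr real DIM(real^'n)) \<partial>lborel) < top"
      using \<kappa>fin by simp
  qed (rule ceb)
  then obtain i where small: "small_on (cube_exterior (1 + real i) :: (real^'n) set) \<kappa>" by blast
  define R where "R = 1 + real i"
  have R: "1 \<le> R" by (simp add: R_def)
  define S where "S = (cube_exterior R :: (real^'n) set)"
  have SU: "S \<subseteq> snd e ` fst e" unfolding S_def by (rule ext[OF R])
  have "1 < r" if "R < r" for r using R that by simp
  then have S1: "S \<subseteq> cube_exterior 1" unfolding S_def cube_exterior_def by blast
  have Sb: "S \<in> sets borel" unfolding S_def by (rule ceb)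
  have oS: "open S" unfolding S_def by (rule open_cube_exterior)
  note small = small[folded R_def S_def]
  obtain k :: 'n where True by simp
  define y :: "real^'n" where "y = (R + 2) *\<^sub>R axis k 1"
  define B where "B = ball y 1"
  have cbS: "cball y 1 \<subseteq> S"
  proof
    fix x assume "x \<in> cball y 1"
    then have "norm (x - y) \<le> 1" by (simp add: dist_norm norm_minus_commute)
    moreover have "\<bar>(x - y) $ k\<bar> \<le> norm (x - y)" by (rule component_le_norm_cart)
    ultimately have "R < \<bar>x $ k\<bar>" using R by (auto simp: y_def)
    then have "R < \<bar>x \<bullet> axis k 1\<bar>" by (simp add: inner_axis)
    then show "x \<in> S" unfolding S_def cube_exterior_def by (auto intro!: bexI[of _ "axis k 1"] simp: axis_in_Basis_iff)
  qed
  have BS: "B \<subseteq> S" using cbS by (auto simp: B_def)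
  define W where "W = fst e \<inter> snd e -` B"
  have W: "open W" unfolding W_def B_def
    using continuous_open_preimage[OF chart_continuous(1)[OF ec] chart_open[OF ec] open_ball] .
  have We: "W \<subseteq> fst e" by (simp add: W_def)
  have Wim: "snd e ` W = B"
  proof
    show "snd e ` W \<subseteq> B" by (auto simp: W_def)
    show "B \<subseteq> snd e ` W"
    proof
      fix x assume x: "x \<in> B"
      then have xU: "x \<in> snd e ` fst e" using BS SU by blast
      have "?\<phi> x \<in> W" using x chart_inv_mem[OF ec xU] chart_inv_right[OF ec xU] by (simp add: W_def)
      then show "x \<in> snd e ` W" unfolding chart_mem_image_iff[OF ec We] using xU by blast
    qed
  qed
  have "y \<in> B" by (simp add: B_def)
  then have Wne: "W \<noteq> {}" using Wim by blast
  obtain a' b where b: "0 < b" "\<And>x. x \<in> cball y 1 \<Longrightarrow> sqrt (det (g e (?\<phi> x))) \<le> b"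
    by (rule density_bounds[OF e compact_cball order_trans[OF cbS SU]]) (rule that)
  define K1 where "K1 = enn2real (epow (emeasure lborel B) (2 / ?n))"
  have K1: "epow (emeasure lborel B) (2 / ?n) = ennreal K1"
  proof -
    have "emeasure lborel B < top" using emeasure_bounded_finite[of B] by (simp add: B_def)
    then have "epow (emeasure lborel B) (2 / ?n) < top" by (cases "emeasure lborel B") (auto simp: epow_def)
    then show ?thesis by (simp add: K1_def)
  qed
  define K2 where "K2 = 24 * (sob_q TYPE(real^'n))\<^sup>2"
  define CH where "CH = (?n * \<epsilon>)\<^sup>2"
  have CH: "0 < CH" using \<epsilon> by (simp add: CH_def)
  have "energy_bounded W"
    unfolding energy_bounded_def
  proof (intro exI[of _ "b * (K1 * (K2 * (CH * (1/a))))"] conjI allI impI)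
    have K10: "0 \<le> K1" by (simp add: K1_def)
    show "0 \<le> b * (K1 * (K2 * (CH * (1/a))))" using b(1) K10 CH a(1) by (simp add: K2_def)
    fix u assume uc: "C1c_section A T E u"
    note u = C1c_C1[OF uc]
    let ?I = "\<integral>\<^sup>+p. ennreal (nabla_sq u p) \<partial>vol"
    define s where "s x = len_sq u (?\<phi> x)" for x
    define s' where "s' x = chart_deriv e (len_sq u) (?\<phi> x)" for x
    \<comment> \<open>\<open>|\<nabla>u|\<close> would serve as \<open>H\<close>, but is not known to be measurable; this is the smallest choice\<close>
    define H where "H x = (\<Sum>b\<in>Basis. max 0 (\<bar>s' x b\<bar> / (2 * sqrt (s x)) - \<kappa> x * sqrt (s x)))" for x
    have s0: "0 \<le> s x" for x unfolding s_def by (rule len_sq_nonneg[OF u])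
    have H0: "0 \<le> H x" for x unfolding H_def by (intro sum_nonneg) simp
    have \<phi>e: "?\<phi> x \<in> fst e" if "x \<in> S" for x by (rule chart_inv_mem[OF ec subsetD[OF SU that]])
    have F0: "0 \<le> nabla_sq u p" for p by (rule nabla_norm_bound(1)[OF u])
    have kato': "\<bar>s' x b\<bar> \<le> 2 * sqrt (s x) * (\<epsilon> * sqrt (nabla_sq u (?\<phi> x)) + \<kappa> x * sqrt (s x))"
      if x: "x \<in> S" and b: "b \<in> Basis" for x b
    proof -
      obtain i where i: "b = axis i 1" using b by (auto simp: Basis_vec_def)
      have "\<bar>s' x b\<bar> \<le> 2 * sqrt (s x) * sqrt (b \<bullet> (g e (?\<phi> x) *v b)) * (sqrt (nabla_sq u (?\<phi> x)) + Gamma_S (?\<phi> x) * sqrt (s x))"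
        unfolding s'_def s_def by (rule kato[OF u e \<phi>e[OF x]])
      also have "\<dots> \<le> 2 * sqrt (s x) * \<epsilon> * (sqrt (nabla_sq u (?\<phi> x)) + Gamma_S (?\<phi> x) * sqrt (s x))"
        unfolding i using gb[OF \<phi>e[OF x], of i] s0[of x] F0 g0
        by (intro mult_right_mono mult_left_mono add_nonneg_nonneg mult_nonneg_nonneg) auto
      also have "\<dots> = 2 * sqrt (s x) * (\<epsilon> * sqrt (nabla_sq u (?\<phi> x)) + \<kappa> x * sqrt (s x))"
        using x S1 by (simp add: \<kappa>_def subset_iff algebra_simps)
      finally show ?thesis .
    qed
    have adm: "admissible S \<kappa> s s' H"
      unfolding admissible_def
    proof (intro conjI ballI)
      fix x assume x: "x \<in> S"
      show "0 \<le> s x" by (rule s0)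
      show "0 \<le> H x" by (rule H0)
      have xU: "x \<in> snd e ` fst e" using SU x by blast
      have "(s has_derivative s' x) (at x within snd e ` fst e)"
        using len_sq_has_deriv[OF u e \<phi>e[OF x]] unfolding has_chart_deriv_def chart_inv_right[OF ec xU] s_def[abs_def] s'_def .
      then show "(s has_derivative s' x) (at x within S)" using SU by (rule has_derivative_subset)
      fix b :: "real^'n" assume b: "b \<in> Basis"
      show "\<bar>s' x b\<bar> \<le> 2 * sqrt (s x) * (H x + \<kappa> x * sqrt (s x))"
      proof (cases "s x = 0")
        case True
        then show ?thesis using kato'[OF x b] by simp
      next
        case False
        then have pos: "0 < sqrt (s x)" using s0[of x] by simp
        have "\<bar>s' x b\<bar> / (2 * sqrt (s x)) - \<kappa> x * sqrt (s x) \<le> max 0 (\<bar>s' x b\<bar> / (2 * sqrt (s x)) - \<kappa> x * sqrt (s x))" by simp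
        also have "\<dots> \<le> H x" unfolding H_def
          by (rule member_le_sum[where f="\<lambda>b. max 0 (\<bar>s' x b\<bar> / (2 * sqrt (s x)) - \<kappa> x * sqrt (s x))", OF b]) auto
        finally have "\<bar>s' x b\<bar> / (2 * sqrt (s x)) \<le> H x + \<kappa> x * sqrt (s x)" by simp
        then show ?thesis using pos by (simp add: pos_divide_le_eq mult.commute)
      qed
    next
      fix b :: "real^'n" assume "b \<in> Basis"
      show "continuous_on S (\<lambda>x. s' x b)" unfolding s'_def
        by (rule continuous_on_subset[OF norm_sq_continuous_deriv[OF u e] SU])
    next
      have cs: "continuous_on S s" unfolding s_def[abs_def]
        by (rule continuous_on_compose2[OF len_sq_continuous[OF u] continuous_on_subset[OF chart_continuous(2)[OF ec] SU]]) simp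
      define s1 where "s1 x = indicator S x *\<^sub>R s x" for x
      define d1 where "d1 b x = indicator S x *\<^sub>R s' x b" for b x
      have [measurable]: "s1 \<in> borel_measurable borel"
        unfolding s1_def[abs_def] by (rule borel_measurable_continuous_on_indicator[OF Sb cs])
      have [measurable]: "d1 b \<in> borel_measurable borel" for b
        unfolding d1_def[abs_def] s'_def
        by (rule borel_measurable_continuous_on_indicator[OF Sb continuous_on_subset[OF norm_sq_continuous_deriv[OF u e] SU]])
      have [measurable]: "S \<in> sets borel" by (rule Sb)
      have "(\<lambda>x. indicator S x *\<^sub>R (\<Sum>b\<in>Basis. max 0 (\<bar>d1 b x\<bar> / (2 * sqrt (s1 x)) - \<kappa> x * sqrt (s1 x)))) \<in> borel_measurable borel"
        by measurable
      moreover have "indicator S x *\<^sub>R (\<Sum>b\<in>Basis. max 0 (\<bar>d1 b x\<bar> / (2 * sqrt (s1 x)) - \<kappa> x * sqrt (s1 x))) = indicator S x *\<^sub>R H x" for x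
        by (cases "x \<in> S") (simp_all add: H_def d1_def s1_def)
      ultimately show "set_borel_measurable borel S H"
        unfolding set_borel_measurable_def by (simp only:)
    qed
    define Z where "Z = closure {p. u p \<noteq> 0}"
    have Z: "compact Z" using uc unfolding C1c_section_def Z_def by (rule conjunct2)
    have len_sq0: "len_sq u p = 0" if "p \<notin> Z" for p
    proof -
      have "u p = 0" using that closure_subset[of "{p. u p \<noteq> 0}"] unfolding Z_def by blast
      moreover have up: "u p \<in> E p" using u unfolding C1_section_def by blast
      moreover have "ip p (0 *\<^sub>R u p) (u p) = 0 * ip p (u p) (u p)" by (rule ip_rules(3)[OF up up])
      ultimately show ?thesis by simp
    qed
    have "bounded (len_sq u ` Z)"
      by (intro compact_imp_bounded compact_continuous_image Z continuous_on_subset[OF len_sq_continuous[OF u]]) simp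
    then obtain M where M: "\<And>p. p \<in> Z \<Longrightarrow> \<bar>len_sq u p\<bar> \<le> M" unfolding bounded_iff real_norm_def by blast
    have bdd: "s x \<le> max 0 M" for x
      using M[of "?\<phi> x"] len_sq0[of "?\<phi> x"] unfolding s_def by (cases "?\<phi> x \<in> Z") auto
    have supp: "emeasure lborel {x \<in> S. s x \<noteq> 0} < top"
    proof -
      have Zb: "Z \<in> sets borel" using Z by (simp add: compact_imp_closed)
      have "emeasure lborel {x \<in> S. s x \<noteq> 0} \<le> (\<integral>\<^sup>+x\<in>snd e ` fst e. indicator Z (?\<phi> x) \<partial>lborel)"
      proof -
        have oZ: "{x \<in> S. s x \<noteq> 0} \<in> sets borel"
        proof -
          have "continuous_on S s" by (rule admissible_continuous[OF adm])
          then have "open (S \<inter> s -` (- {0}))" by (rule continuous_open_preimage[OF _ oS]) auto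
          moreover have "S \<inter> s -` (- {0}) = {x \<in> S. s x \<noteq> 0}" by auto
          ultimately show ?thesis by simp
        qed
        then have "emeasure lborel {x \<in> S. s x \<noteq> 0} = (\<integral>\<^sup>+x. indicator {x \<in> S. s x \<noteq> 0} x \<partial>lborel)" by simp
        also have "\<dots> \<le> (\<integral>\<^sup>+x\<in>snd e ` fst e. indicator Z (?\<phi> x) \<partial>lborel)"
        proof (rule nn_integral_mono)
          fix x
          show "indicator {x \<in> S. s x \<noteq> 0} x \<le> (indicator Z (?\<phi> x) * indicator (snd e ` fst e) x :: ennreal)"
          proof (cases "x \<in> {x \<in> S. s x \<noteq> 0}")
            case True
            then have "?\<phi> x \<in> Z" "x \<in> snd e ` fst e" using len_sq0[of "?\<phi> x"] SU by (auto simp: s_def)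
            then show ?thesis by (simp add: indicator_def)
          qed simp
        qed
        finally show ?thesis .
      qed
      also have "\<dots> \<le> ennreal (1/a) * (\<integral>\<^sup>+p\<in>fst e. indicator Z p \<partial>vol)"
        by (rule nn_integral_chart_ge[OF manifold metric vol e _ order_refl feb a(1) low]) (use Zb in simp_all)
      also have "\<dots> \<le> ennreal (1/a) * (\<integral>\<^sup>+p. indicator Z p \<partial>vol)"
        by (intro mult_left_mono nn_integral_mono) (auto simp: indicator_def)
      also have "\<dots> = ennreal (1/a) * emeasure vol Z" using Zb by (simp add: sets_vol)
      also have "\<dots> < top" using vol_compact_finite[OF Z] by (simp add: ennreal_mult_less_top)
      finally show ?thesis .
    qed
    have est: "(\<integral>\<^sup>+x\<in>B. ennreal (s x) \<partial>lborel) \<le> ennreal K1 * (ennreal K2 * (\<integral>\<^sup>+x\<in>S. ennreal ((H x)\<^sup>2) \<partial>lborel))"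
      using exterior_estimate[OF dim' \<kappa>m \<kappa>0 small[unfolded S_def] adm[unfolded S_def] bdd supp[unfolded S_def] _ BS[unfolded S_def]] K1
      by (simp add: K2_def S_def B_def)
    have Hh: "(\<integral>\<^sup>+x\<in>S. ennreal ((H x)\<^sup>2) \<partial>lborel) \<le> ennreal (CH * (1/a)) * ?I"
    proof -
      have HF: "(H x)\<^sup>2 / CH \<le> nabla_sq u (?\<phi> x)" if x: "x \<in> S" for x
      proof -
        have "max 0 (\<bar>s' x b\<bar> / (2 * sqrt (s x)) - \<kappa> x * sqrt (s x)) \<le> \<epsilon> * sqrt (nabla_sq u (?\<phi> x))" if b: "b \<in> Basis" for b
        proof (cases "s x = 0")
          case True
          then show ?thesis using \<epsilon> F0 by simp
        next
          case False
          then have pos: "0 < 2 * sqrt (s x)" using s0[of x] by simp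
          have "\<bar>s' x b\<bar> / (2 * sqrt (s x)) \<le> \<epsilon> * sqrt (nabla_sq u (?\<phi> x)) + \<kappa> x * sqrt (s x)"
            using kato'[OF x b] unfolding pos_divide_le_eq[OF pos] by (simp add: mult.commute)
          then show ?thesis using \<epsilon> F0[of "?\<phi> x"] by simp
        qed
        then have "H x \<le> (\<Sum>b\<in>(Basis :: (real^'n) set). \<epsilon> * sqrt (nabla_sq u (?\<phi> x)))"
          unfolding H_def by (rule sum_mono)
        also have "\<dots> = ?n * \<epsilon> * sqrt (nabla_sq u (?\<phi> x))" by simp
        finally have "(H x)\<^sup>2 \<le> (?n * \<epsilon> * sqrt (nabla_sq u (?\<phi> x)))\<^sup>2" by (rule power_mono[OF _ H0])
        also have "\<dots> = CH * nabla_sq u (?\<phi> x)" using F0 by (simp add: CH_def power_mult_distrib)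
        finally show ?thesis using CH by (simp add: pos_divide_le_eq mult.commute)
      qed
      define H1 where "H1 x = indicator S x *\<^sub>R H x" for x
      have [measurable]: "H1 \<in> borel_measurable borel"
        using adm unfolding admissible_def set_borel_measurable_def H1_def[abs_def] by blast
      define f where "f x = ennreal ((H1 x)\<^sup>2 / CH)" for x
      have fm[measurable]: "f \<in> borel_measurable borel" unfolding f_def by measurable
      define h where "h p = f (snd e p) * indicator (fst e) p" for p
      have hm: "h \<in> borel_measurable borel"
        unfolding h_def[abs_def] by (rule chart_push_measurable[OF ec order_refl feb fm])
      have "(\<integral>\<^sup>+x\<in>S. ennreal ((H x)\<^sup>2) \<partial>lborel) = (\<integral>\<^sup>+x. ennreal CH * f x \<partial>lborel)"
        using CH by (intro nn_integral_cong) (auto simp: f_def H1_def indicator_def simp flip: ennreal_mult)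
      also have "\<dots> = ennreal CH * (\<integral>\<^sup>+x. f x \<partial>lborel)" by (rule nn_integral_cmult) measurable
      also have "(\<integral>\<^sup>+x. f x \<partial>lborel) = (\<integral>\<^sup>+x\<in>snd e ` fst e. h (?\<phi> x) \<partial>lborel)"
      proof (rule nn_integral_cong)
        fix x
        show "f x = h (?\<phi> x) * indicator (snd e ` fst e) x"
        proof (cases "x \<in> snd e ` fst e")
          case True
          then show ?thesis using chart_inv_right[OF ec True] chart_inv_mem[OF ec True] by (simp add: h_def)
        next
          case False
          then have "x \<notin> S" using SU by blast
          then show ?thesis using False by (simp add: f_def H1_def)
        qed
      qed
      also have "\<dots> \<le> ennreal (1/a) * (\<integral>\<^sup>+p\<in>fst e. h p \<partial>vol)"
        by (rule nn_integral_chart_ge[OF manifold metric vol e hm order_refl feb a(1) low])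
      also have "(\<integral>\<^sup>+p\<in>fst e. h p \<partial>vol) \<le> ?I"
      proof (rule nn_integral_mono)
        fix p
        show "h p * indicator (fst e) p \<le> ennreal (nabla_sq u p)"
        proof (cases "p \<in> fst e \<and> snd e p \<in> S")
          case True
          then have "f (snd e p) \<le> ennreal (nabla_sq u p)"
            using HF[of "snd e p"] chart_inv_left[OF ec] unfolding f_def H1_def by (intro ennreal_leI) simp
          then show ?thesis using True by (simp add: h_def)
        next
          case False
          then show ?thesis by (cases "p \<in> fst e") (simp_all add: h_def f_def H1_def)
        qed
      qed
      finally have "(\<integral>\<^sup>+x\<in>S. ennreal ((H x)\<^sup>2) \<partial>lborel) \<le> ennreal CH * (ennreal (1/a) * ?I)"
        by (simp add: mult_left_mono)
      also have "\<dots> = ennreal (CH * (1/a)) * ?I"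
        using CH a(1) by (intro ennreal_mult_collect) simp_all
      finally show ?thesis .
    qed
    have Wb: "W \<in> sets borel" using W by simp
    have um: "(\<lambda>p. ennreal (len_sq u p)) \<in> borel_measurable borel" using len_sq_measurable[OF u] by measurable
    have "(\<integral>\<^sup>+p\<in>W. ennreal (len_sq u p) \<partial>vol) \<le> ennreal b * (\<integral>\<^sup>+x\<in>B. ennreal (s x) \<partial>lborel)"
      using nn_integral_chart_le[OF manifold metric vol e um We Wb, of b] b(2) unfolding Wim s_def by (simp add: B_def)
    also have "\<dots> \<le> ennreal b * (ennreal K1 * (ennreal K2 * (ennreal (CH * (1/a)) * ?I)))"
      by (intro mult_left_mono order_trans[OF est] Hh) simp_all
    also have "\<dots> = ennreal (b * (K1 * (K2 * (CH * (1/a))))) * ?I"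
    proof -
      have "0 \<le> b" "0 \<le> K2" "0 \<le> CH * (1/a)" using b(1) CH a(1) by (simp_all add: K2_def)
      then show ?thesis using K10 by (simp only: ennreal_mult_collect mult_nonneg_nonneg)
    qed
    finally show "(\<integral>\<^sup>+p\<in>W. ennreal (len_sq u p) \<partial>vol) \<le> ennreal (b * (K1 * (K2 * (CH * (1/a))))) * ?I" .
  qed
  then show thesis by (rule that[OF W Wne])
qed

end

section \<open>The weighted inequality\<close>

context poincare_data
begin

text \<open>
  The points with such a neighbourhood form an open set, which is not empty because of the end. It is closed:
  if the neighbourhood \<open>Q\<close> of \<open>p\<close> given by local propagation meets it, then \<open>Q\<close> contains a controlled open set
  and is itself controlled.
\<close>

lemma energy_bounded_everywhere:
  assumes conn: "connected (UNIV :: 'a set)"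
    and af: "weakly_af_end A g e" and decay: "in_Lp (real CARD('n)) vol (fst e) Gamma_S"
  shows "\<exists>W. open W \<and> p \<in> W \<and> energy_bounded W"
proof -
  define G where "G = {p. \<exists>W. open W \<and> p \<in> W \<and> energy_bounded W}"
  have "open G"
  proof (subst open_subopen, intro ballI)
    fix p assume "p \<in> G"
    then obtain W where W: "open W" "p \<in> W" "energy_bounded W" unfolding G_def by blast
    then have "W \<subseteq> G" unfolding G_def by blast
    then show "\<exists>T. open T \<and> p \<in> T \<and> T \<subseteq> G" using W by blast
  qed
  moreover have "open (- G)"
  proof (subst open_subopen, intro ballI)
    fix p assume p: "p \<in> - G"
    obtain Q where Q: "open Q" "p \<in> Q" "\<And>S. open S \<Longrightarrow> S \<noteq> {} \<Longrightarrow> S \<subseteq> Q \<Longrightarrow> energy_bounded S \<Longrightarrow> energy_bounded Q"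
      by (rule local_propagation[of p]) (rule that)
    have "Q \<subseteq> - G"
    proof
      fix q assume q: "q \<in> Q"
      show "q \<in> - G"
      proof
        assume "q \<in> G"
        then obtain W where W: "open W" "q \<in> W" "energy_bounded W" unfolding G_def by blast
        have "energy_bounded (W \<inter> Q)" by (rule energy_bounded_subset[OF W(3)]) simp
        moreover have "open (W \<inter> Q)" using W(1) Q(1) by (rule open_Int)
        ultimately have "energy_bounded Q" using Q(3)[of "W \<inter> Q"] W(2) q by blast
        then have "p \<in> G" unfolding G_def using Q(1,2) by blast
        then show False using p by simp
      qed
    qed
    then show "\<exists>T. open T \<and> p \<in> T \<and> T \<subseteq> - G" using Q(1,2) by blast
  qed
  moreover have "G \<noteq> {}"
  proof -
    obtain W where W: "open W" "W \<noteq> {}" "energy_bounded W" by (rule energy_bounded_end[OF af decay])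
    then show ?thesis unfolding G_def by blast
  qed
  ultimately have "G = UNIV"
    using conn unfolding connected_clopen by (simp add: closed_def) blast
  then have "p \<in> G" by simp
  then show ?thesis unfolding G_def by (rule CollectD)
qed

text \<open>
  Countably many controlled open sets \<open>W\<^sub>i\<close> with constants \<open>C\<^sub>i\<close> cover the manifold. The weight is the sum of
  the multiples \<open>2\<^sup>-\<^sup>i\<^sup>-\<^sup>1 / C\<^sub>i\<close> of their indicator functions. It is at most one, and bounded below on every set
  that is covered by finitely many of them.
\<close>

lemma weighted_poincare:
  assumes cover: "\<And>p. \<exists>W. open W \<and> p \<in> W \<and> energy_bounded W"
  shows "\<exists>w :: 'a \<Rightarrow> real. in_L1_loc vol w \<and>
    (\<forall>\<Omega>. relatively_compact \<Omega> \<longrightarrow> 0 < ess_inf vol \<Omega> w) \<and>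
    (\<forall>u. C1c_section A T E u \<longrightarrow>
       (\<integral>\<^sup>+p. ennreal (len_sq u p * w p) \<partial>vol) \<le> (\<integral>\<^sup>+p. ennreal (nabla_sq u p) \<partial>vol))"
proof -
  define \<F> where "\<F> = {W. open W \<and> energy_bounded W}"
  obtain \<F>' where F': "\<F>' \<subseteq> \<F>" "countable \<F>'" "\<Union>\<F>' = \<Union>\<F>"
    by (rule Lindelof[of \<F>]) (simp add: \<F>_def, rule that)
  have UF: "\<Union>\<F> = UNIV" using cover unfolding \<F>_def by blast
  have ne: "\<F>' \<noteq> {}" using F'(3) UF by auto
  define W where "W = from_nat_into \<F>'"
  have W: "open (W i)" "energy_bounded (W i)" for i
    using from_nat_into[OF ne, of i] F'(1) unfolding W_def \<F>_def by blast+
  have WU: "(\<Union>i. W i) = UNIV"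
    using F'(2,3) UF range_from_nat_into[OF ne F'(2)] unfolding W_def by metis
  have "\<forall>i. \<exists>C::real. 1 \<le> C \<and> (\<forall>u. C1c_section A T E u \<longrightarrow>
     (\<integral>\<^sup>+p\<in>W i. ennreal (len_sq u p) \<partial>vol) \<le> ennreal C * (\<integral>\<^sup>+p. ennreal (nabla_sq u p) \<partial>vol))"
  proof
    fix i
    obtain C where C: "0 \<le> C" "\<And>u. C1c_section A T E u \<Longrightarrow>
     (\<integral>\<^sup>+p\<in>W i. ennreal (len_sq u p) \<partial>vol) \<le> ennreal C * (\<integral>\<^sup>+p. ennreal (nabla_sq u p) \<partial>vol)"
      by (rule energy_boundedE[OF W(2)]) (rule that)
    show "\<exists>C::real. 1 \<le> C \<and> (\<forall>u. C1c_section A T E u \<longrightarrow>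
     (\<integral>\<^sup>+p\<in>W i. ennreal (len_sq u p) \<partial>vol) \<le> ennreal C * (\<integral>\<^sup>+p. ennreal (nabla_sq u p) \<partial>vol))"
    proof (intro exI[of _ "max 1 C"] conjI allI impI)
      fix u assume uc: "C1c_section A T E u"
      have "ennreal C * (\<integral>\<^sup>+p. ennreal (nabla_sq u p) \<partial>vol) \<le> ennreal (max 1 C) * (\<integral>\<^sup>+p. ennreal (nabla_sq u p) \<partial>vol)"
        by (intro mult_right_mono ennreal_leI) auto
      then show "(\<integral>\<^sup>+p\<in>W i. ennreal (len_sq u p) \<partial>vol) \<le> ennreal (max 1 C) * (\<integral>\<^sup>+p. ennreal (nabla_sq u p) \<partial>vol)"
        by (rule order_trans[OF C(2)[OF uc]])
    qed simp
  qed
  from choice[OF this] obtain C :: "nat \<Rightarrow> real" where C: "\<And>i. 1 \<le> C i"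
    "\<And>i u. C1c_section A T E u \<Longrightarrow> (\<integral>\<^sup>+p\<in>W i. ennreal (len_sq u p) \<partial>vol) \<le> ennreal (C i) * (\<integral>\<^sup>+p. ennreal (nabla_sq u p) \<partial>vol)"
    by blast
  define c where "c i = (1/2) ^ Suc i / C i" for i
  have c0: "0 < c i" for i using C(1)[of i] by (simp add: c_def)
  have c1: "c i \<le> (1/2) ^ Suc i" for i
    using C(1)[of i] by (simp add: c_def divide_le_eq mult_le_cancel_left1)
  define w where "w p = (\<Sum>i. c i * indicator (W i) p)" for p
  have summ: "summable (\<lambda>i. c i * indicator (W i) p)" for p
  proof (rule summable_comparison_test'[OF sums_summable[OF power_half_series], of 0])
    fix i :: nat
    show "norm (c i * indicator (W i) p) \<le> (1/2) ^ Suc i" using c0[of i] c1[of i] by (simp add: indicator_def)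
  qed
  have w0: "0 \<le> w p" for p unfolding w_def using c0 by (intro suminf_nonneg summ) (simp add: less_imp_le)
  have w1: "w p \<le> 1" for p
  proof -
    have "w p \<le> (\<Sum>i. (1/2) ^ Suc i)" unfolding w_def
      using c0 c1 by (intro suminf_le summ sums_summable[OF power_half_series]) (auto simp: indicator_def)
    also have "\<dots> = 1" by (rule sums_unique[OF power_half_series, symmetric])
    finally show ?thesis .
  qed
  have Wb[measurable]: "W i \<in> sets borel" for i using W(1) by simp
  have wb: "w \<in> borel_measurable borel" unfolding w_def[abs_def] by measurable
  have wv: "w \<in> borel_measurable vol" unfolding measurable_cong_sets[OF sets_vol refl] by (rule wb)
  have "in_L1_loc vol w"
    unfolding in_L1_loc_def
  proof (intro conjI allI impI wv)
    fix K :: "'a set" assume K: "compact K"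
    then have Kb: "K \<in> sets borel" by (simp add: compact_imp_closed)
    show "set_integrable vol K w"
      unfolding set_integrable_def
    proof (rule integrableI_bounded)
      show "(\<lambda>p. indicator K p *\<^sub>R w p) \<in> borel_measurable vol"
        unfolding measurable_cong_sets[OF sets_vol refl] using wb Kb by measurable
      have "(\<integral>\<^sup>+p. ennreal (norm (indicator K p *\<^sub>R w p)) \<partial>vol) \<le> (\<integral>\<^sup>+p. indicator K p \<partial>vol)"
        using w0 w1 by (intro nn_integral_mono) (auto simp: indicator_def)
      also have "\<dots> = emeasure vol K" using Kb by (simp add: sets_vol)
      also have "\<dots> < \<infinity>" using vol_compact_finite[OF K] by simp
      finally show "(\<integral>\<^sup>+p. ennreal (norm (indicator K p *\<^sub>R w p)) \<partial>vol) < \<infinity>" .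
    qed
  qed
  moreover have "0 < ess_inf vol \<Omega> w" if \<Omega>: "relatively_compact \<Omega>" for \<Omega>
  proof -
    have comp: "compact (closure \<Omega>)" using \<Omega> by (simp add: relatively_compact_def)
    have cov: "closure \<Omega> \<subseteq> (\<Union>i\<in>UNIV. W i)" using WU by simp
    obtain I where I: "finite I" "closure \<Omega> \<subseteq> (\<Union>i\<in>I. W i)"
      by (rule compactE_image[OF comp _ cov], rule W(1), rule that)
    define a where "a = Min (insert 1 (c ` I))"
    have a0: "0 < a" unfolding a_def using I(1) c0 by (subst Min_gr_iff) auto
    have "a \<le> w p" if p: "p \<in> \<Omega>" for p
    proof -
      have "p \<in> closure \<Omega>" using p closure_subset by blast
      then obtain i where i: "i \<in> I" "p \<in> W i" using I(2) by blast
      have "a \<le> c i" unfolding a_def using I(1) i(1) by (intro Min_le) auto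
      also have "\<dots> = c i * indicator (W i) p" using i(2) by simp
      also have "\<dots> = (\<Sum>j\<in>{i}. c j * indicator (W j) p)" by (simp only: sum.insert sum.empty finite.emptyI empty_iff not_False_eq_True add_0_right)
      also have "\<dots> \<le> w p" unfolding w_def using c0 by (intro sum_le_suminf summ) (auto simp: less_imp_le)
      finally show ?thesis .
    qed
    then have "ereal a \<in> {a. AE p in vol. p \<in> \<Omega> \<longrightarrow> a \<le> ereal (w p)}" by simp
    then have "ereal a \<le> ess_inf vol \<Omega> w" unfolding ess_inf_def by (rule Sup_upper)
    then show ?thesis using a0 by (metis ereal_less(2) less_le_trans)
  qed
  moreover have "(\<integral>\<^sup>+p. ennreal (len_sq u p * w p) \<partial>vol) \<le> (\<integral>\<^sup>+p. ennreal (nabla_sq u p) \<partial>vol)" if uc: "C1c_section A T E u" for u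
  proof -
    note u = C1c_C1[OF uc]
    let ?I = "\<integral>\<^sup>+p. ennreal (nabla_sq u p) \<partial>vol"
    have um: "len_sq u \<in> borel_measurable borel" by (rule len_sq_measurable[OF u])
    have eq: "ennreal (len_sq u p * w p) = (\<Sum>i. ennreal (c i) * (ennreal (len_sq u p) * indicator (W i) p))" for p
    proof -
      have "len_sq u p * w p = (\<Sum>i. len_sq u p * (c i * indicator (W i) p))"
        unfolding w_def by (rule suminf_mult[OF summ, symmetric])
      moreover have "ennreal (\<Sum>i. len_sq u p * (c i * indicator (W i) p)) = (\<Sum>i. ennreal (len_sq u p * (c i * indicator (W i) p)))"
        using len_sq_nonneg[OF u, of p] c0 by (intro suminf_ennreal2[symmetric] summable_mult summ) (simp add: less_imp_le)
      moreover have "ennreal (len_sq u p * (c i * indicator (W i) p)) = ennreal (c i) * (ennreal (len_sq u p) * indicator (W i) p)" for i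
        using len_sq_nonneg[OF u, of p] c0[of i] by (cases "p \<in> W i") (simp_all add: ennreal_mult mult.commute less_imp_le)
      ultimately show ?thesis by simp
    qed
    have m: "(\<lambda>p. ennreal (len_sq u p) * indicator (W i) p) \<in> borel_measurable vol" for i
      unfolding measurable_cong_sets[OF sets_vol refl] using um by measurable
    have "(\<integral>\<^sup>+p. ennreal (len_sq u p * w p) \<partial>vol) = (\<Sum>i. \<integral>\<^sup>+p. ennreal (c i) * (ennreal (len_sq u p) * indicator (W i) p) \<partial>vol)"
      unfolding eq by (intro nn_integral_suminf borel_measurable_times_ennreal borel_measurable_const m)
    also have "\<dots> = (\<Sum>i. ennreal (c i) * (\<integral>\<^sup>+p\<in>W i. ennreal (len_sq u p) \<partial>vol))"
      by (simp add: nn_integral_cmult[OF m])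
    also have "\<dots> \<le> (\<Sum>i. ennreal ((1/2) ^ Suc i) * ?I)"
    proof (rule suminf_le)
      fix i
      have "ennreal (c i) * (\<integral>\<^sup>+p\<in>W i. ennreal (len_sq u p) \<partial>vol) \<le> ennreal (c i) * (ennreal (C i) * ?I)"
        by (rule mult_left_mono[OF C(2)[OF uc]]) simp
      also have "\<dots> = ennreal (c i * C i) * ?I"
        using c0[of i] C(1)[of i] by (intro ennreal_mult_collect) auto
      also have "c i * C i = (1/2) ^ Suc i" using C(1)[of i] by (simp add: c_def)
      finally show "ennreal (c i) * (\<integral>\<^sup>+p\<in>W i. ennreal (len_sq u p) \<partial>vol) \<le> ennreal ((1/2) ^ Suc i) * ?I" .
    qed (rule summableI)+
    also have "\<dots> = (\<Sum>i. ennreal ((1/2) ^ Suc i)) * ?I" by (rule ennreal_suminf_multc)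
    also have "(\<Sum>i. ennreal ((1/2) ^ Suc i)) = ennreal (\<Sum>i. (1/2) ^ Suc i)"
      by (intro suminf_ennreal2 sums_summable[OF power_half_series]) simp
    also have "(\<Sum>i. (1/2) ^ Suc i) = (1::real)" by (rule sums_unique[OF power_half_series, symmetric])
    finally show ?thesis by simp
  qed
  ultimately show ?thesis by blast
qed

end

theorem theorem9p5:
  fixes A :: "('a::{second_countable_topology, t2_space}, 'n::finite) chart set"
    and g :: "('a, 'n) chart \<Rightarrow> 'a \<Rightarrow> real^'n^'n"
    and vol :: "'a measure"
    and e :: "('a, 'n) chart"
    and T :: "('a, 'k::finite, 'e::real_vector) triv set"
    and E :: "'a \<Rightarrow> 'e set"
    and ip :: "'a \<Rightarrow> 'e \<Rightarrow> 'e \<Rightarrow> real"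
    and \<Gamma> :: "('a, 'n, 'k, 'e) conn"
  assumes dim: "CARD('n) \<ge> 3"
    and manifold: "smooth_structure A" "connected (UNIV :: 'a set)" "compact (manifold_boundary A)"
    and metric: "C0_riemannian_metric A g"
    and vol: "riemannian_measure A g vol"
    and af_end: "weakly_af_end A g e"
    and vbundle: "vector_bundle A T E" "bundle_inner_product A T E ip"
    and connection: "bundle_connection A T \<Gamma>"
    and local_integrability: "connection_in_Lp_loc (real CARD('n)) vol A T \<Gamma>"
    and decay:
      "in_Lp (real CARD('n) / 2) vol (fst e)
         (\<lambda>p. inverse (end_radius e p) * Gamma_sym_norm A g T ip \<Gamma> p)"
      "in_Lp (real CARD('n)) vol (fst e) (Gamma_sym_norm A g T ip \<Gamma>)"
  shows "\<exists>w :: 'a \<Rightarrow> real.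
    in_L1_loc vol w \<and>
    (\<forall>\<Omega>. relatively_compact \<Omega> \<longrightarrow> 0 < ess_inf vol \<Omega> w) \<and>
    (\<forall>u. C1c_section A T E u \<longrightarrow>
       (\<integral>\<^sup>+p. ennreal (ip p (u p) (u p) * w p) \<partial>vol)
       \<le> (\<integral>\<^sup>+p. ennreal (nabla_norm_sq A g T ip \<Gamma> u p) \<partial>vol))"
proof -
  note connected = manifold(2)
  interpret poincare_data A T E ip g \<Gamma> vol
    by unfold_locales (fact manifold(1) vbundle metric connection dim vol local_integrability)+
  show ?thesis
    by (rule weighted_poincare) (rule energy_bounded_everywhere[OF connected af_end decay(2)])
qed

end
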